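(* Let $F=\mathbb{R}$ or $\mathbb{C}$. For any irreducible Casselman–Wallach representation $\pi$ of $\mathrm{GL}_n(F)$, the kernel function $$k_{\pi,\psi}(x):=\lim_{\ell\to\infty}\int_{\det g=x}(\Phi_{\mathrm{GJ}}*\mathfrak{c}_\ell^\vee)(g)\,\varphi_{\widetilde\pi}(g)\,d_xg$$ is a smooth function on $F^\times$.
   Context: $|\cdot|_F$ is the normalized absolute value; $\psi$ is a fixed non-trivial additive character of $F$. $d^+g$ is the measure on $\mathrm{M}_n(F)$ induced by the self-dual Haar measure on $F$ for $\psi$, and $dg=|\det g|_F^{-n}d^+g$ on $\mathrm{GL}_n(F)$. For $x\in F^\times$, $d_xg$ is the $\mathrm{SL}_n(F)$-invariant measure on the $\mathrm{SL}_n(F)$-torsor $\{g\in\mathrm{GL}_n(F):\det g=x\}$ induced from the Haar measure of $\mathrm{SL}_n(F)$. Put $f^\vee(g)=f(g^{-1})$ and $(f_1*f_2)(g)=\int_{\mathrm{GL}_n(F)}f_1(h)f_2(h^{-1}g)\,dh$. $\Phi_{\mathrm{GJ}}(g)=\psi(\mathrm{tr}\,g)|\det g|_F^{n/2}$ on $\mathrm{GL}_n(F)$. $\varphi_{\widetilde\pi}$ is a fixed smooth matrix coefficient of the contragredient $\widetilde\pi$ with $\varphi_{\widetilde\pi}(\mathrm{I}_n)=1$. $\{\mathfrak{c}_\ell\}_{\ell\ge1}\subset\mathcal{C}_c^\infty(\mathrm{GL}_n(F))$ is a fixed sequence, all supported in a given compact neighborhood of $\mathrm{I}_n$, with $\lim_{\ell\to\infty}\int_{\mathrm{GL}_n(F)}\mathfrak{c}_\ell(g)h(g)\,dg=h(\mathrm{I}_n)$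 for every $h\in\mathcal{C}^\infty(\mathrm{GL}_n(F))$. *)

theory Defs
  imports "HOL-Analysis.Analysis"
begin

section \<open>Archimedean local fields\<close>

text \<open>
  The axiom says that the field is \<open>\<real>\<close>, or \<open>\<real> \<oplus> \<real> i\<close> with \<open>i\<^sup>2 = -1\<close> and with
  \<open>1, i\<close> orthonormal; together with the multiplicative norm of
  \<^class>\<open>real_normed_field\<close> this leaves exactly \<open>\<real>\<close> and \<open>\<complex>\<close> with their usual norms.
\<close>

class arch_local_field = real_normed_field + euclidean_space +
  assumes Basis_real_or_complex: "Basis = {1} \<or> (\<exists>i. i * i = - 1 \<and> Basis = {1, i})"

instance real :: arch_local_field
  by standard simp

instance complex :: arch_local_field
  by standard (auto simp: Basis_complex_def intro: exI[of _ \<i>])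

text \<open>The normalized absolute value is \<open>\<bar>x\<bar>\<close> on \<open>\<real>\<close> and \<open>\<bar>x\<bar>\<^sup>2\<close> on \<open>\<complex>\<close>.\<close>

definition absF :: "'f::arch_local_field \<Rightarrow> real" where
  "absF x = norm x ^ DIM('f)"

definition additive_character :: "('f::arch_local_field \<Rightarrow> complex) \<Rightarrow> bool" where
  "additive_character \<psi> \<longleftrightarrow>
     continuous_on UNIV \<psi> \<and> (\<forall>x. cmod (\<psi> x) = 1) \<and> (\<forall>x y. \<psi> (x + y) = \<psi> x * \<psi> y)"

definition nontrivial_additive_character :: "('f::arch_local_field \<Rightarrow> complex) \<Rightarrow> bool" where
  "nontrivial_additive_character \<psi> \<longleftrightarrow> additive_character \<psi> \<and> (\<exists>x. \<psi> x \<noteq> 1)"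

definition fourier ::
    "('f::arch_local_field \<Rightarrow> complex) \<Rightarrow> 'f measure \<Rightarrow> ('f \<Rightarrow> complex) \<Rightarrow> 'f \<Rightarrow> complex" where
  "fourier \<psi> \<mu> f y = (LINT x|\<mu>. f x * \<psi> (x * y))"

definition self_dual_haar :: "('f::arch_local_field \<Rightarrow> complex) \<Rightarrow> 'f measure \<Rightarrow> bool" where
  "self_dual_haar \<psi> \<mu> \<longleftrightarrow>
     (\<exists>c>0. \<mu> = scale_measure (ennreal c) lborel) \<and>
     (\<forall>f. continuous_on UNIV f \<and> integrable \<mu> f \<and> integrable \<mu> (fourier \<psi> \<mu> f) \<longrightarrow>
        (\<forall>x. fourier \<psi> \<mu> (fourier \<psi> \<mu> f) x = f (- x)))"


section \<open>Smooth functions between normed spaces\<close>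

text \<open>
  On an open subset of a finite-dimensional space this is the usual notion of a \<open>C\<^sup>k\<close> map;
  over \<open>\<complex>\<close> it is smoothness in the real sense.
\<close>

primrec Ck_on ::
    "nat \<Rightarrow> 'a::real_normed_vector set \<Rightarrow> ('a \<Rightarrow> 'b::real_normed_vector) \<Rightarrow> bool" where
  "Ck_on 0 S f \<longleftrightarrow> continuous_on S f"
| "Ck_on (Suc k) S f \<longleftrightarrow>
     (\<forall>x\<in>S. f differentiable (at x)) \<and> (\<forall>e. Ck_on k S (\<lambda>x. frechet_derivative f (at x) e))"

definition smooth_on :: "'a::real_normed_vector set \<Rightarrow> ('a \<Rightarrow> 'b::real_normed_vector) \<Rightarrow> bool" where
  "smooth_on S f \<longleftrightarrow> (\<forall>k. Ck_on k S f)"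


section \<open>The groups and their measures\<close>

definition GL :: "('f::arch_local_field^'n^'n) set" where
  "GL = {g. invertible g}"

definition SL :: "('f::arch_local_field^'n^'n) set" where
  "SL = {g. det g = 1}"

text \<open>
  The standard maximal compact subgroup: the linear isometries of \<open>F\<^sup>n\<close>, i.e. \<open>O(n)\<close> for
  \<open>F = \<real>\<close> and \<open>U(n)\<close> for \<open>F = \<complex>\<close>.
\<close>

definition maxK :: "('f::arch_local_field^'n^'n) set" where
  "maxK = {k. \<forall>x. norm (k *v x) = norm x}"

definition group_height :: "'f::arch_local_field^'n^'n \<Rightarrow> real" where
  "group_height g = norm g + norm (matrix_inv g)"

definition additive_matrix_measure ::
    "'f::arch_local_field measure \<Rightarrow> ('f^'n^'n) measure" where
  "additive_matrix_measure \<mu> =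
     distr (Pi\<^sub>M (UNIV :: ('n \<times> 'n) set) (\<lambda>_. \<mu>)) borel (\<lambda>x. \<chi> i j. x (i, j))"

definition GL_measure :: "'f::arch_local_field measure \<Rightarrow> ('f^'n^'n) measure" where
  "GL_measure \<mu> = density (additive_matrix_measure \<mu>)
     (\<lambda>g. indicator GL g * ennreal (inverse (absF (det g) ^ CARD('n))))"

text \<open>Haar measures of \<open>SL\<^sub>n(F)\<close>, as Borel measures on \<open>M\<^sub>n(F)\<close> concentrated on the closed set \<open>SL\<close>.\<close>

definition SL_haar :: "('f::arch_local_field^'n^'n) measure \<Rightarrow> bool" where
  "SL_haar \<nu> \<longleftrightarrow>
     sets \<nu> = sets borel \<and> emeasure \<nu> (- SL) = 0 \<and> emeasure \<nu> SL \<noteq> 0 \<and>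
     (\<forall>C. compact C \<longrightarrow> emeasure \<nu> C < \<infinity>) \<and>
     (\<forall>a\<in>SL. distr \<nu> borel (\<lambda>g. a ** g) = \<nu>)"

text \<open>
  A base point \<open>diag(1, \<dots>, x, \<dots>, 1)\<close> of the torsor \<open>{g. det g = x}\<close>. Since conjugation by
  \<open>GL\<^sub>n(F)\<close> preserves the Haar measures of \<open>SL\<^sub>n(F)\<close>, the measure transported to the torsor
  does not depend on the base point.
\<close>

definition torsor_point :: "'f::arch_local_field \<Rightarrow> 'f^'n^'n" where
  "torsor_point x = (\<chi> i j. if i = j then (if i = (SOME k. True) then x else 1) else 0)"

lemma det_torsor_point: "det (torsor_point x :: 'f::arch_local_field^'n^'n) = x"
proof -
  have "det (torsor_point x :: 'f^'n^'n) = (\<Prod>i\<in>UNIV. (torsor_point x :: 'f^'n^'n) $ i $ i)"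
    by (rule det_diagonal) (simp add: torsor_point_def)
  also have "\<dots> = (\<Prod>i\<in>(UNIV::'n set). if i = (SOME k. True) then x else 1)"
    by (simp add: torsor_point_def)
  also have "\<dots> = x"
    by simp
  finally show ?thesis .
qed

definition torsor_measure ::
    "('f::arch_local_field^'n^'n) measure \<Rightarrow> 'f \<Rightarrow> ('f^'n^'n) measure" where
  "torsor_measure \<nu> x = distr \<nu> borel (\<lambda>h. torsor_point x ** h)"


section \<open>Frechet spaces\<close>

locale frechet_space = vector_space scale
  for scale :: "complex \<Rightarrow> 'v::ab_group_add \<Rightarrow> 'v" +
  fixes p :: "nat \<Rightarrow> 'v \<Rightarrow> real"
  assumes p_triangle: "p k (u + v) \<le> p k u + p k v"
    and p_scale: "p k (scale a v) = cmod a * p k v"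
    and p_separates: "(\<And>k. p k v = 0) \<Longrightarrow> v = 0"
    and complete:
      "(\<And>k e. e > 0 \<Longrightarrow> \<exists>N. \<forall>i\<ge>N. \<forall>j\<ge>N. p k (x i - x j) < e) \<Longrightarrow>
       \<exists>v. \<forall>k. (\<lambda>i. p k (x i - v)) \<longlonglongrightarrow> 0"
begin

definition converges_to :: "(nat \<Rightarrow> 'v) \<Rightarrow> 'v \<Rightarrow> bool" where
  "converges_to u v \<longleftrightarrow> (\<forall>k. (\<lambda>i. p k (u i - v)) \<longlonglongrightarrow> 0)"

text \<open>The topology is metrizable, so closed means sequentially closed.\<close>

definition closed_subspace :: "'v set \<Rightarrow> bool" where
  "closed_subspace S \<longleftrightarrow>
     subspace S \<and> (\<forall>u v. (\<forall>i. u i \<in> S) \<and> converges_to u v \<longrightarrow> v \<in> S)"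

definition finite_dim :: "'v set \<Rightarrow> bool" where
  "finite_dim S \<longleftrightarrow> (\<exists>B. finite B \<and> S \<subseteq> span B)"

definition map_continuous_on :: "'x::real_normed_vector set \<Rightarrow> ('x \<Rightarrow> 'v) \<Rightarrow> bool" where
  "map_continuous_on S f \<longleftrightarrow>
     (\<forall>k. \<forall>x\<in>S. ((\<lambda>y. p k (f y - f x)) \<longlongrightarrow> 0) (at x within S))"

definition has_directional_derivative ::
    "('x::real_normed_vector \<Rightarrow> 'v) \<Rightarrow> 'v \<Rightarrow> 'x \<Rightarrow> 'x \<Rightarrow> bool" where
  "has_directional_derivative f d x e \<longleftrightarrow>
     (\<forall>k. ((\<lambda>t. p k (scale (of_real (inverse t)) (f (x + t *\<^sub>R e) - f x) - d)) \<longlongrightarrow> 0) (at (0::real)))"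

primrec map_Ck_on :: "nat \<Rightarrow> 'x::real_normed_vector set \<Rightarrow> ('x \<Rightarrow> 'v) \<Rightarrow> bool" where
  "map_Ck_on 0 S f \<longleftrightarrow> map_continuous_on S f"
| "map_Ck_on (Suc k) S f \<longleftrightarrow> map_continuous_on S f \<and>
     (\<forall>e. \<exists>f'. (\<forall>x\<in>S. has_directional_derivative f (f' x) x e) \<and> map_Ck_on k S f')"

definition map_smooth_on :: "'x::real_normed_vector set \<Rightarrow> ('x \<Rightarrow> 'v) \<Rightarrow> bool" where
  "map_smooth_on S f \<longleftrightarrow> (\<forall>k. map_Ck_on k S f)"

end


section \<open>Casselman--Wallach representations\<close>

text \<open>Only the values \<open>\<pi> g\<close> with \<open>g \<in> GL\<close> carry meaning.\<close>

locale frechet_representation = frechet_space scale p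
  for scale :: "complex \<Rightarrow> 'v::ab_group_add \<Rightarrow> 'v" and p :: "nat \<Rightarrow> 'v \<Rightarrow> real" +
  fixes \<pi> :: "'f::arch_local_field^'n^'n \<Rightarrow> 'v \<Rightarrow> 'v"
  assumes rep_add: "g \<in> GL \<Longrightarrow> \<pi> g (u + v) = \<pi> g u + \<pi> g v"
    and rep_scale: "g \<in> GL \<Longrightarrow> \<pi> g (scale a v) = scale a (\<pi> g v)"
    and rep_one: "\<pi> (mat 1) v = v"
    and rep_mult: "g \<in> GL \<Longrightarrow> h \<in> GL \<Longrightarrow> \<pi> (g ** h) v = \<pi> g (\<pi> h v)"
    and rep_continuous:
      "(\<And>i. X i \<in> GL) \<Longrightarrow> g \<in> GL \<Longrightarrow> X \<longlonglongrightarrow> g \<Longrightarrow> converges_to x v \<Longrightarrow>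
       converges_to (\<lambda>i. \<pi> (X i) (x i)) (\<pi> g v)"
begin

definition invariant_under :: "('f^'n^'n) set \<Rightarrow> 'v set \<Rightarrow> bool" where
  "invariant_under H S \<longleftrightarrow> (\<forall>h\<in>H. \<forall>v\<in>S. \<pi> h v \<in> S)"

definition closed_subrep :: "'v set \<Rightarrow> bool" where
  "closed_subrep S \<longleftrightarrow> closed_subspace S \<and> invariant_under GL S"

definition irreducible :: bool where
  "irreducible \<longleftrightarrow> (\<exists>v::'v. v \<noteq> 0) \<and> (\<forall>S. closed_subrep S \<longrightarrow> S = {0} \<or> S = UNIV)"

definition finite_length :: bool where
  "finite_length \<longleftrightarrow>
     (\<exists>N::nat. \<forall>\<C>. (\<forall>S\<in>\<C>. closed_subrep S) \<and> (\<forall>S\<in>\<C>. \<forall>T\<in>\<C>. S \<subseteq> T \<or> T \<subseteq> S) \<longrightarrow>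
        finite \<C> \<and> card \<C> \<le> N)"

definition K_finite :: "'v set" where
  "K_finite = {v. finite_dim ((\<lambda>k. \<pi> k v) ` maxK)}"

definition irreducible_K_type :: "'v set \<Rightarrow> bool" where
  "irreducible_K_type W \<longleftrightarrow>
     subspace W \<and> finite_dim W \<and> invariant_under maxK W \<and> W \<noteq> {0} \<and>
     (\<forall>S. subspace S \<and> S \<subseteq> W \<and> invariant_under maxK S \<longrightarrow> S = {0} \<or> S = W)"

definition K_embedding :: "'v set \<Rightarrow> ('v \<Rightarrow> 'v) \<Rightarrow> bool" where
  "K_embedding W T \<longleftrightarrow>
     inj_on T W \<and> (\<forall>u\<in>W. \<forall>v\<in>W. T (u + v) = T u + T v) \<and>
     (\<forall>a. \<forall>v\<in>W. T (scale a v) = scale a (T v)) \<and>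
     (\<forall>k\<in>maxK. \<forall>v\<in>W. T (\<pi> k v) = \<pi> k (T v))"

definition isotypic :: "'v set \<Rightarrow> 'v set" where
  "isotypic W = span (\<Union>{T ` W | T. K_embedding W T})"

text \<open>Every irreducible representation of \<open>K\<close> occurs with finite multiplicity.\<close>

definition admissible :: bool where
  "admissible \<longleftrightarrow> (\<forall>W. irreducible_K_type W \<longrightarrow> finite_dim (isotypic W))"

definition moderate_growth :: bool where
  "moderate_growth \<longleftrightarrow>
     (\<forall>k. \<exists>(N::nat) (m::nat) (C::real). \<forall>g\<in>GL. \<forall>v.
        p k (\<pi> g v) \<le> C * group_height g ^ N * (\<Sum>i\<le>m. p i v))"

end

locale casselman_wallach = frechet_representation scale p \<pi>
  for scale :: "complex \<Rightarrow> 'v::ab_group_add \<Rightarrow> 'v" and p :: "nat \<Rightarrow> 'v \<Rightarrow> real"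
    and \<pi> :: "'f::arch_local_field^'n^'n \<Rightarrow> 'v \<Rightarrow> 'v" +
  assumes smooth: "map_smooth_on GL (\<lambda>g. \<pi> g v)"
    and moderate_growth: moderate_growth
    and admissible: admissible
    and finite_length: finite_length
begin

text \<open>
  The \<open>K\<close>-finite vectors of the algebraic dual of the space of \<open>K\<close>-finite vectors; functionals are
  represented by functions on all of \<open>'v\<close> of which only the values on \<^term>\<open>K_finite\<close> matter.
\<close>

definition K_finite_functional :: "('v \<Rightarrow> complex) \<Rightarrow> bool" where
  "K_finite_functional \<xi> \<longleftrightarrow>
     (\<forall>u\<in>K_finite. \<forall>v\<in>K_finite. \<xi> (u + v) = \<xi> u + \<xi> v) \<and>
     (\<forall>a. \<forall>v\<in>K_finite. \<xi> (scale a v) = a * \<xi> v) \<and>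
     (\<exists>L. finite L \<and> (\<forall>k\<in>maxK. \<exists>c. \<forall>v\<in>K_finite.
        \<xi> (\<pi> (matrix_inv k) v) = (\<Sum>l\<in>L. c l * l v)))"

end

text \<open>
  The contragredient of \<open>\<pi>\<close> is the Casselman--Wallach representation whose space of
  \<open>K\<close>-finite vectors is the contragredient of that of \<open>\<pi>\<close>, that is, its \<open>K\<close>-finite dual. It is given
  here together with the canonical pairing. The smooth vectors of the strong dual of \<open>\<pi>\<close> would not do:
  every continuous functional on \<open>\<pi>\<close> has a smooth orbit there.
\<close>

locale contragredient =
  V: casselman_wallach scaleV p \<pi> + W: casselman_wallach scaleW q \<pi>'
  for scaleV :: "complex \<Rightarrow> 'v::ab_group_add \<Rightarrow> 'v" and p :: "nat \<Rightarrow> 'v \<Rightarrow> real"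
    and \<pi> :: "'f::arch_local_field^'n^'n \<Rightarrow> 'v \<Rightarrow> 'v"
    and scaleW :: "complex \<Rightarrow> 'w::ab_group_add \<Rightarrow> 'w" and q :: "nat \<Rightarrow> 'w \<Rightarrow> real"
    and \<pi>' :: "'f^'n^'n \<Rightarrow> 'w \<Rightarrow> 'w" +
  fixes B :: "'v \<Rightarrow> 'w \<Rightarrow> complex"
  assumes pairing_add_left: "B (u + v) w = B u w + B v w"
    and pairing_add_right: "B v (w + z) = B v w + B v z"
    and pairing_scale_left: "B (scaleV a v) w = a * B v w"
    and pairing_scale_right: "B v (scaleW a w) = a * B v w"
    and pairing_continuous:
      "V.converges_to x v \<Longrightarrow> W.converges_to y w \<Longrightarrow> (\<lambda>i. B (x i) (y i)) \<longlonglongrightarrow> B v w"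
    and pairing_invariant: "g \<in> GL \<Longrightarrow> B (\<pi> g v) (\<pi>' g w) = B v w"
    and K_finite_dual:
      "V.K_finite_functional \<xi> \<Longrightarrow> \<exists>!w. w \<in> W.K_finite \<and> (\<forall>v\<in>V.K_finite. \<xi> v = B v w)"

text \<open>All vectors of a Casselman--Wallach representation are smooth.\<close>

definition matrix_coefficient ::
    "('v \<Rightarrow> 'w \<Rightarrow> complex) \<Rightarrow> ('f::arch_local_field^'n^'n \<Rightarrow> 'w \<Rightarrow> 'w) \<Rightarrow> ('f^'n^'n \<Rightarrow> complex) \<Rightarrow> bool"
  where
  "matrix_coefficient B \<pi>' \<phi> \<longleftrightarrow> (\<exists>v w. \<forall>g\<in>GL. \<phi> g = B v (\<pi>' g w))"


section \<open>The kernel function\<close>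

definition test_function :: "('f::arch_local_field^'n^'n \<Rightarrow> complex) \<Rightarrow> bool" where
  "test_function f \<longleftrightarrow>
     smooth_on GL f \<and> (\<exists>C. compact C \<and> C \<subseteq> GL \<and> (\<forall>g\<in>GL - C. f g = 0))"

definition delta_sequence ::
    "'f::arch_local_field measure \<Rightarrow> (nat \<Rightarrow> 'f^'n^'n \<Rightarrow> complex) \<Rightarrow> bool" where
  "delta_sequence \<mu> \<cc> \<longleftrightarrow>
     (\<forall>l\<ge>1. test_function (\<cc> l)) \<and>
     (\<exists>C. compact C \<and> C \<subseteq> GL \<and> mat 1 \<in> interior C \<and> (\<forall>l\<ge>1. \<forall>g\<in>GL - C. \<cc> l g = 0)) \<and>
     (\<forall>h :: 'f^'n^'n \<Rightarrow> complex. smooth_on GL h \<longrightarrow>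
        (\<lambda>l. LINT g:GL|GL_measure \<mu>. \<cc> l g * h g) \<longlonglongrightarrow> h (mat 1))"

definition vee :: "('f::arch_local_field^'n^'n \<Rightarrow> complex) \<Rightarrow> 'f^'n^'n \<Rightarrow> complex" where
  "vee f g = f (matrix_inv g)"

definition GL_convolution ::
    "'f::arch_local_field measure \<Rightarrow> ('f^'n^'n \<Rightarrow> complex) \<Rightarrow> ('f^'n^'n \<Rightarrow> complex) \<Rightarrow>
     'f^'n^'n \<Rightarrow> complex" where
  "GL_convolution \<mu> f1 f2 g = (LINT h:GL|GL_measure \<mu>. f1 h * f2 (matrix_inv h ** g))"

definition Phi_GJ :: "('f::arch_local_field \<Rightarrow> complex) \<Rightarrow> 'f^'n^'n \<Rightarrow> complex" where
  "Phi_GJ \<psi> g = \<psi> (trace g) * of_real (absF (det g) powr (real CARD('n) / 2))"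

definition kernel_integral ::
    "('f::arch_local_field \<Rightarrow> complex) \<Rightarrow> 'f measure \<Rightarrow> ('f^'n^'n) measure \<Rightarrow>
     (nat \<Rightarrow> 'f^'n^'n \<Rightarrow> complex) \<Rightarrow> ('f^'n^'n \<Rightarrow> complex) \<Rightarrow> nat \<Rightarrow> 'f \<Rightarrow> complex" where
  "kernel_integral \<psi> \<mu> \<nu> \<cc> \<phi> l x =
     (LINT g:{g. det g = x}|torsor_measure \<nu> x.
        GL_convolution \<mu> (Phi_GJ \<psi>) (vee (\<cc> l)) g * \<phi> g)"

definition kernel_function ::
    "('f::arch_local_field \<Rightarrow> complex) \<Rightarrow> 'f measure \<Rightarrow> ('f^'n^'n) measure \<Rightarrow>
     (nat \<Rightarrow> 'f^'n^'n \<Rightarrow> complex) \<Rightarrow> ('f^'n^'n \<Rightarrow> complex) \<Rightarrow> 'f \<Rightarrow> complex" where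
  "kernel_function \<psi> \<mu> \<nu> \<cc> \<phi> x = lim (\<lambda>l. kernel_integral \<psi> \<mu> \<nu> \<cc> \<phi> l x)"

end

theory Submission
  imports Defs
begin

text \<open>
  Write the additive character as \<open>\<psi>(t) = exp(i l(t))\<close> with a real linear form \<open>l\<close>. After the
  substitution \<open>h = g u\<close> in the convolution, the integral that defines the kernel has, for a
  test function \<open>c\<close> in place of a member of the delta sequence, the form
  \<open>I(c, x) = \<integral> (\<integral> c(u) exp(i l(tr(g u))) F(u, g) du) dg\<close>, where \<open>g\<close> runs through the matrices
  of determinant \<open>x\<close> and \<open>F(u, g) = \<bar>det(g u)\<bar>\<^sup>n\<^sup>/\<^sup>2 \<phi>(g)\<close>. Repeated integration by parts in
  \<open>u\<close> makes the inner integral decay rapidly in \<open>g\<close>, whereas the volume of \<open>SL\<close> grows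
  polynomially, so \<open>I(c, x)\<close> exists. This decay depends on derivatives of \<open>c\<close>, however, and
  says nothing about the limit along the delta sequence. If the order of integration could be
  exchanged, then \<open>I(c, x) = \<integral> c(u) H(x, u) du\<close> with
  \<open>H(x, u) = \<integral> exp(i l(tr(g u))) F(u, g) dg\<close>, and the limit would be \<open>H(x, 1)\<close>. But \<open>F\<close> only
  has moderate growth in \<open>g\<close>, and the integral for \<open>H\<close> need not converge.

  The remedy is to use the oscillation along the torsor \<open>{g. det g = x}\<close>, which is preserved by
  the left translations \<open>g \<mapsto> (1 + s X) g\<close> with \<open>X\<close> of square zero, along which the phase has
  the derivative \<open>l(tr(X g u))\<close>. A matrix whose pairings with all such \<open>X\<close> vanish is scalar
  and hence determined up to finitely many choices by its determinant; quantitatively,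
  \<open>Q = 1 + \<Sum>\<^sub>X l(tr(X g u))\<^sup>2\<close> is at least of the size of \<open>(1 + norm g)\<^sup>2\<close> as long as \<open>u\<close> and
  \<open>det g\<close> stay in compact sets (lemma \<open>Q_lower_bound\<close>). Dividing by \<open>Q\<close>, one writes
  \<open>exp(i l) F = exp(i l) F' + \<Sum>\<^sub>X \<delta>\<^sub>X(exp(i l) G\<^sub>X)\<close>, where \<open>\<delta>\<^sub>X\<close> is the derivative along the
  translation and \<open>F'\<close> grows by one power of \<open>norm g\<close> less than \<open>F\<close> (lemma
  \<open>oscillatory_step\<close>). By invariance of the measure of the torsor the derivatives integrate to
  zero, so \<open>F\<close> may be replaced by \<open>F'\<close> in \<open>I(c, x)\<close>, and \<open>F'\<close> does not depend on \<open>c\<close> (lemma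
  \<open>oscillatory_reduction\<close>). After finitely many steps the amplitude is integrable, Fubini's
  theorem applies, and \<open>H\<close> is given by an absolutely convergent integral. Differentiating in
  \<open>x\<close> and \<open>u\<close> costs one power of \<open>norm g\<close> per derivative, which further steps make up for;
  hence \<open>H\<close> is smooth in both variables (lemma \<open>osc_integral_smooth\<close>). Smoothness in \<open>u\<close> lets
  the delta sequence return \<open>H(x, 1)\<close>, and smoothness in \<open>x\<close> is the claim.

  The amplitudes live in a class of symbols: functions of \<open>(u, g)\<close> whose derivatives along the
  motions above are all bounded by a fixed power of \<open>1 + norm g\<close>, locally uniformly in \<open>u\<close> and
  \<open>det g\<close>. A matrix coefficient \<open>B v (\<pi>' g w)\<close> belongs to it, because by invariance of the
  pairing its derivatives are coefficients of the same \<open>w\<close> with other vectors in place of \<open>v\<close>,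
  and moderate growth gives an exponent that does not depend on \<open>v\<close> (lemma
  \<open>coefficient_symbol\<close>).
\<close>


section \<open>Matrices over an archimedean local field\<close>

lemma GL_iff_det: "g \<in> GL \<longleftrightarrow> det g \<noteq> 0"
  by (simp add: GL_def invertible_det_nz)

lemma matrix_inv_GL:
  assumes "g \<in> GL"
  shows "g ** matrix_inv g = mat 1" "matrix_inv g ** g = mat 1"
proof -
  have "\<exists>h. g ** h = mat 1 \<and> h ** g = mat 1" using assms by (simp add: GL_def invertible_def)
  then have "g ** matrix_inv g = mat 1 \<and> matrix_inv g ** g = mat 1"
    unfolding matrix_inv_def by (rule someI_ex)
  then show "g ** matrix_inv g = mat 1" "matrix_inv g ** g = mat 1" by auto
qed

lemma matrix_inv_unique_GL:
  fixes g h :: "'f::arch_local_field^'n^'n"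
  assumes "g ** h = mat 1"
  shows "matrix_inv g = h"
proof -
  have "g \<in> GL" using assms matrix_left_right_inverse unfolding GL_def invertible_def by blast
  then have "matrix_inv g ** (g ** h) = h" by (simp add: matrix_mul_assoc matrix_inv_GL)
  then show ?thesis by (simp add: assms)
qed

lemma GL_mult [simp, intro]: "g \<in> GL \<Longrightarrow> h \<in> GL \<Longrightarrow> g ** h \<in> GL"
  by (simp add: GL_iff_det det_mul)

lemma one_GL [simp, intro]: "mat 1 \<in> GL" by (simp add: GL_iff_det)

lemma matrix_inv_in_GL [simp, intro]: "g \<in> GL \<Longrightarrow> matrix_inv g \<in> GL"
  using matrix_inv_GL unfolding GL_def invertible_def by blast

lemma det_matrix_inv: "g \<in> GL \<Longrightarrow> det (matrix_inv g) = inverse (det g)"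
  by (metis det_I det_mul inverse_unique matrix_inv_GL(1))

lemma matrix_inv_inv: "g \<in> GL \<Longrightarrow> matrix_inv (matrix_inv g) = g"
  by (rule matrix_inv_unique_GL) (simp add: matrix_inv_GL)

lemma matrix_inv_mult: "g \<in> GL \<Longrightarrow> h \<in> GL \<Longrightarrow> matrix_inv (g ** h) = matrix_inv h ** matrix_inv g"
  by (rule matrix_inv_unique_GL) (metis matrix_inv_GL(1) matrix_mul_assoc matrix_mul_rid)

lemma torsor_point_GL: "x \<noteq> 0 \<Longrightarrow> torsor_point x \<in> GL"
  by (simp add: GL_iff_det det_torsor_point)

lemma continuous_on_det [continuous_intros]:
  fixes f :: "'a::topological_space \<Rightarrow> 'f::arch_local_field^'n^'n"
  assumes "continuous_on S f"
  shows "continuous_on S (\<lambda>x. det (f x))"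
  unfolding det_def by (intro continuous_intros assms)

lemma open_GL: "open (GL :: ('f::arch_local_field^'n^'n) set)"
proof -
  have "GL = {g :: 'f^'n^'n. det g \<noteq> 0}" by (auto simp: GL_iff_det)
  moreover have "open {g :: 'f^'n^'n. det g \<noteq> 0}"
    by (intro open_Collect_neq continuous_intros)
  ultimately show ?thesis by simp
qed

lemma closed_SL: "closed (SL :: ('f::arch_local_field^'n^'n) set)"
  unfolding SL_def by (intro closed_Collect_eq continuous_intros)

lemma GL_borel [measurable]: "(GL :: ('f::arch_local_field^'n^'n) set) \<in> sets borel"
  by (rule borel_open[OF open_GL])

lemma scaleR_matrix_mult_left: "(r *\<^sub>R A) ** B = r *\<^sub>R (A ** B)"
  for A B :: "'f::arch_local_field^'n^'n"
  by (simp add: matrix_matrix_mult_def vec_eq_iff scaleR_sum_right)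

lemma scaleR_matrix_mult_right: "A ** (r *\<^sub>R B) = r *\<^sub>R (A ** B)"
  for A B :: "'f::arch_local_field^'n^'n"
  by (simp add: matrix_matrix_mult_def vec_eq_iff scaleR_sum_right)

lemma matrix_add_rdistrib: "(B + C) ** A = B ** A + C ** (A :: 'f::arch_local_field^'n^'n)"
  by (simp add: vec_eq_iff matrix_matrix_mult_def distrib_right sum.distrib)

lemma bounded_bilinear_matrix_mult:
  "bounded_bilinear ((**) :: 'f::arch_local_field^'n^'n \<Rightarrow> 'f^'n^'n \<Rightarrow> 'f^'n^'n)"
proof -
  have "bilinear ((**) :: 'f::arch_local_field^'n^'n \<Rightarrow> 'f^'n^'n \<Rightarrow> 'f^'n^'n)"
    unfolding bilinear_def
    by (auto intro!: linearI simp: matrix_add_ldistrib matrix_add_rdistrib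
        scaleR_matrix_mult_left scaleR_matrix_mult_right)
  then show ?thesis by (simp add: bilinear_conv_bounded_bilinear)
qed

lemmas continuous_on_matrix_mult [continuous_intros] =
  bounded_bilinear.continuous_on[OF bounded_bilinear_matrix_mult]

lemma norm_matrix_mult_le:
  "\<exists>C\<ge>1. \<forall>(A :: 'f::arch_local_field^'n^'n) (B :: 'f^'n^'n). norm (A ** B) \<le> C * norm A * norm B"
proof -
  obtain K where K: "K > 0" "\<forall>(A :: 'f^'n^'n) (B :: 'f^'n^'n). norm (A ** B) \<le> norm A * norm B * K"
    using bounded_bilinear.pos_bounded[OF bounded_bilinear_matrix_mult[where 'f='f and 'n='n]] by metis
  have "norm (A ** B) \<le> max K 1 * norm A * norm B" for A B :: "'f^'n^'n"
  proof -
    have "norm (A ** B) \<le> norm A * norm B * K" using K(2) by blast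
    also have "\<dots> \<le> norm A * norm B * max K 1" by (rule mult_left_mono) simp_all
    finally show ?thesis by (simp only: mult_ac)
  qed
  then show ?thesis by (meson max.cobounded2)
qed

lemma norm_vec_le_sum: "norm (x :: 'a::real_normed_vector^'n) \<le> (\<Sum>i\<in>UNIV. norm (x $ i))"
  unfolding norm_vec_def by (rule L2_set_le_sum) simp

lemma norm_matrix_le_sum:
  "norm (A :: 'a::real_normed_vector^'n^'m) \<le> (\<Sum>i\<in>UNIV. \<Sum>j\<in>UNIV. norm (A $ i $ j))"
  by (rule order_trans[OF norm_vec_le_sum]) (intro sum_mono norm_vec_le_sum)

lemma norm_entry_le: "norm (A $ i $ j) \<le> norm (A :: 'a::real_normed_vector^'n^'m)"
  using Finite_Cartesian_Product.norm_nth_le[of A i] Finite_Cartesian_Product.norm_nth_le[of "A $ i" j] by linarith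

lemma norm_det_le:
  "norm (det (A :: 'f::arch_local_field^'n^'n)) \<le> fact CARD('n) * norm A ^ CARD('n)"
proof -
  have "norm (det A) \<le> (\<Sum>p\<in>{p. p permutes (UNIV::'n set)}. norm A ^ CARD('n))"
    unfolding det_def
  proof (rule sum_norm_le)
    fix p :: "'n \<Rightarrow> 'n" assume "p \<in> {p. p permutes UNIV}"
    have "norm (of_int (sign p) :: 'f) = 1" by (simp add: sign_def)
    moreover have "norm (\<Prod>i\<in>(UNIV::'n set). A $ i $ p i) \<le> (\<Prod>i\<in>(UNIV::'n set). norm A)"
      unfolding prod_norm[symmetric] by (intro prod_mono) (auto simp: norm_entry_le)
    ultimately show "norm (of_int (sign p) * (\<Prod>i\<in>UNIV. A $ i $ p i)) \<le> norm A ^ CARD('n)"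
      by (simp add: norm_mult)
  qed
  also have "\<dots> = fact CARD('n) * norm A ^ CARD('n)"
    by (simp add: card_permutations)
  finally show ?thesis .
qed

text \<open>
  By Cramer's rule the entries of the inverse are quotients by \<open>det g\<close> of determinants of \<open>g\<close>
  with one column replaced by a unit vector, and those are bounded by the preceding estimate.
\<close>

lemma norm_matrix_inv_le:
  "\<exists>C\<ge>1. \<forall>g :: 'f::arch_local_field^'n^'n. det g \<noteq> 0 \<longrightarrow>
     norm (matrix_inv g) \<le> C * (1 + norm g) ^ CARD('n) / norm (det g)"
proof -
  let ?n = "CARD('n)"
  define C0 where "C0 = real ?n * real ?n"
  define C where "C = C0 * (fact ?n * C0 ^ ?n)"
  have n1: "real ?n \<ge> 1" by simp
  have C0: "C0 \<ge> 1" unfolding C0_def using n1 by (metis mult_mono' mult_1 zero_le_one)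
  have C: "C \<ge> 1" unfolding C_def
    using C0 by (metis fact_ge_1 mult_ge1_I one_le_power)
  have "norm (matrix_inv g) \<le> C * (1 + norm g) ^ ?n / norm (det g)"
    if nz: "det g \<noteq> 0" for g :: "'f^'n^'n"
  proof -
    have entry: "norm (matrix_inv g $ k $ j) \<le> fact ?n * C0 ^ ?n * (1 + norm g) ^ ?n / norm (det g)" for k j
    proof -
      let ?b = "axis j 1 :: 'f^'n"
      let ?M = "(\<chi> i l. if l = k then ?b $ i else g $ i $ l) :: 'f^'n^'n"
      have "g *v (matrix_inv g *v ?b) = ?b"
        using nz by (simp add: matrix_vector_mul_assoc matrix_inv_GL GL_iff_det)
      then have "matrix_inv g *v ?b = (\<chi> k. det ((\<chi> i l. if l = k then ?b $ i else g $ i $ l) :: 'f^'n^'n) / det g)"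
        using cramer[OF nz] by blast
      moreover have "(matrix_inv g *v ?b) $ k = matrix_inv g $ k $ j"
        by (simp add: matrix_vector_mult_def axis_def if_distrib cong: if_cong)
      ultimately have e: "matrix_inv g $ k $ j = det ?M / det g" by simp
      have "norm ?M \<le> (\<Sum>i\<in>(UNIV::'n set). \<Sum>l\<in>(UNIV::'n set). norm (?M $ i $ l))"
        by (rule norm_matrix_le_sum)
      also have "\<dots> \<le> (\<Sum>i\<in>(UNIV::'n set). \<Sum>l\<in>(UNIV::'n set). 1 + norm g)"
      proof (intro sum_mono)
        fix i l :: 'n
        show "norm (?M $ i $ l) \<le> 1 + norm g"
          using norm_entry_le[of g i l] by (auto simp: axis_def)
      qed
      also have "\<dots> = C0 * (1 + norm g)" by (simp add: C0_def)
      finally have "norm ?M ^ ?n \<le> (C0 * (1 + norm g)) ^ ?n" by (intro power_mono) auto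
      then have "norm (det ?M) \<le> fact ?n * (C0 * (1 + norm g)) ^ ?n"
        by (intro order_trans[OF norm_det_le] mult_left_mono) auto
      then show ?thesis unfolding e norm_divide
        by (intro divide_right_mono) (auto simp: power_mult_distrib mult_ac)
    qed
    have "norm (matrix_inv g) \<le> (\<Sum>k\<in>(UNIV::'n set). \<Sum>j\<in>(UNIV::'n set). norm (matrix_inv g $ k $ j))"
      by (rule norm_matrix_le_sum)
    also have "\<dots> \<le> (\<Sum>k\<in>(UNIV::'n set). \<Sum>j\<in>(UNIV::'n set). fact ?n * C0 ^ ?n * (1 + norm g) ^ ?n / norm (det g))"
      by (intro sum_mono entry)
    also have "\<dots> = C * (1 + norm g) ^ ?n / norm (det g)" by (simp add: C_def C0_def)
    finally show ?thesis .
  qed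
  then show ?thesis using C by blast
qed

definition elem :: "'n \<Rightarrow> 'n \<Rightarrow> 'f \<Rightarrow> 'f::arch_local_field^'n^'n" where
  "elem i j b = (\<chi> r c. if r = i \<and> c = j then b else 0)"

text \<open>
  For \<open>s = False\<close> and \<open>i \<noteq> j\<close> this is the conjugate of \<open>elem i j b\<close> by \<open>1 + elem j i 1\<close>. Under
  the trace pairing the matrices \<open>elem i j b\<close> with \<open>i \<noteq> j\<close> detect the off-diagonal entries of
  a matrix; their conjugates detect the differences of its diagonal entries.
\<close>

definition nilp :: "'n \<Rightarrow> 'n \<Rightarrow> 'f \<Rightarrow> bool \<Rightarrow> 'f::arch_local_field^'n^'n" where
  "nilp i j b s = (if s then elem i j b else elem i j b - elem i i b + elem j j b - elem j i b)"

lemma elem_mult_index: "(elem i j b ** M) $ r $ c = (if r = i then b * M $ j $ c else 0)"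
  by (simp add: matrix_matrix_mult_def elem_def if_distrib if_distribR cong: if_cong)

lemma trace_elem: "trace (elem i j b ** M) = b * M $ j $ i"
  by (simp add: trace_def elem_mult_index)

lemma elem_mult: "elem i j a ** elem k l b = (if j = k then elem i l (a * b) else 0)"
  by (simp add: vec_eq_iff elem_mult_index) (simp add: elem_def)

lemma det_elem:
  fixes c :: "'f::arch_local_field" and i j :: "'n::finite"
  assumes "i \<noteq> j" shows "det (mat 1 + elem i j c :: 'f^'n^'n) = 1"
proof -
  have "(mat 1 + elem i j c :: 'f^'n^'n) = (\<chi> k. if k = i then row i (mat 1) + c *s row j (mat 1) else row k (mat 1))"
    by (auto simp: vec_eq_iff elem_def row_def mat_def)
  then have "det (mat 1 + elem i j c :: 'f^'n^'n) = det (mat 1 :: 'f^'n^'n)"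
    using det_row_operation[OF assms, of "mat 1" c] by simp
  then show ?thesis by simp
qed

lemma matrix_sub_ldistrib: "A ** (B - C) = (A :: 'f::arch_local_field^'n^'n) ** B - A ** (C :: 'f::arch_local_field^'n^'n)"
  by (rule bounded_bilinear.diff_right[OF bounded_bilinear_matrix_mult])

lemma matrix_sub_rdistrib: "(B - (C :: 'f::arch_local_field^'n^'n)) ** A = B ** A - C ** (A :: 'f::arch_local_field^'n^'n)"
  by (rule bounded_bilinear.diff_left[OF bounded_bilinear_matrix_mult])

lemmas matrix_distribs = matrix_sub_ldistrib matrix_sub_rdistrib matrix_add_ldistrib matrix_add_rdistrib

lemma nilp_conj:
  assumes "i \<noteq> j"
  shows "nilp i j b False = (mat 1 + elem j i 1) ** elem i j b ** (mat 1 - elem j i 1)"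
    "(mat 1 + elem j i 1) ** (mat 1 - elem j i 1) = (mat 1 :: 'f::arch_local_field^'n^'n)"
    "(mat 1 - elem j i 1) ** (mat 1 + elem j i 1) = (mat 1 :: 'f::arch_local_field^'n^'n)"
  using assms by (simp_all add: nilp_def matrix_add_ldistrib matrix_add_rdistrib
      matrix_sub_ldistrib matrix_sub_rdistrib elem_mult)

lemma nilp_sq:
  assumes "i \<noteq> j"
  shows "nilp i j b s ** nilp i j b s = 0"
  using assms by (cases s) (simp_all add: nilp_def matrix_distribs elem_mult)

lemma scaleR_elem: "r *\<^sub>R elem i j b = elem i j (r *\<^sub>R b)"
  by (simp add: elem_def vec_eq_iff)

lemma scaleR_nilp: "r *\<^sub>R nilp i j b s = nilp i j (r *\<^sub>R b) s"
  by (simp add: nilp_def scaleR_elem scaleR_diff_right scaleR_add_right)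

lemma det_nilp:
  assumes "i \<noteq> j"
  shows "det (mat 1 + nilp i j b s :: 'f::arch_local_field^'n^'n) = 1"
proof (cases s)
  case True then show ?thesis using assms by (simp add: nilp_def det_elem)
next
  case False
  let ?P = "mat 1 + elem j i 1 :: 'f^'n^'n" and ?Q = "mat 1 - elem j i 1 :: 'f^'n^'n"
  have "mat 1 + nilp i j b False = ?P ** (mat 1 + elem i j b) ** ?Q"
    unfolding nilp_conj(1)[OF assms] using nilp_conj(2)[OF assms]
    by (simp add: matrix_add_ldistrib matrix_add_rdistrib)
  then have "det (mat 1 + nilp i j b False) = det (?P ** ?Q) * det (mat 1 + elem i j b)"
    by (simp add: det_mul)
  then show ?thesis using False assms by (simp add: det_elem nilp_conj(2))
qed

lemma trace_diff: "trace (A - B) = trace A - trace (B :: 'f::arch_local_field^'n^'n)"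
  by (simp add: trace_def sum_subtractf)

lemma trace_nilp:
  "trace (nilp i j b s ** M) = (if s then b * M $ j $ i else b * (M $ j $ i - M $ i $ i + M $ j $ j - M $ i $ j))"
  by (simp add: nilp_def matrix_distribs trace_diff trace_add trace_elem algebra_simps)

lemma trace_scaleR: "trace (r *\<^sub>R A) = r *\<^sub>R trace (A :: 'f::arch_local_field^'n^'n)"
  by (simp add: trace_def scaleR_sum_right)

lemma det_mat: "det (mat a :: 'f::arch_local_field^'n^'n) = a ^ CARD('n)"
  by (subst det_diagonal) (auto simp: mat_def)

lemma det_scaleR: "det (r *\<^sub>R A) = r ^ CARD('n) *\<^sub>R det (A :: 'f::arch_local_field^'n^'n)"
proof -
  have "r *\<^sub>R A = mat (of_real r :: 'f) ** A"
    by (simp add: vec_eq_iff matrix_matrix_mult_def mat_def if_distrib if_distribR scaleR_conv_of_real[where 'a='f] cong: if_cong)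
  then show ?thesis by (simp add: det_mul det_mat scaleR_conv_of_real)
qed

text \<open>
  Expanding \<open>w / z\<close> in the real basis and evaluating \<open>l\<close> at \<open>w = (w / z) * z\<close> expresses the
  nonzero number \<open>l w\<close> through the values \<open>l (b * z)\<close>, with coefficients of size at most
  \<open>norm w / norm z\<close>.
\<close>

lemma norm_le_Basis_pairings:
  fixes l :: "'f::arch_local_field \<Rightarrow> real"
  assumes "linear l" "l w \<noteq> 0"
  shows "norm z \<le> norm w / \<bar>l w\<bar> * (\<Sum>b\<in>Basis. \<bar>l (b * z)\<bar>)"
proof (cases "z = 0")
  case True then show ?thesis by (simp add: sum_nonneg)
next
  case False
  have "w = (\<Sum>b\<in>Basis. ((w / z) \<bullet> b) *\<^sub>R b) * z" using False by (simp add: euclidean_representation)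
  also have "\<dots> = (\<Sum>b\<in>Basis. ((w / z) \<bullet> b) *\<^sub>R (b * z))" by (simp add: sum_distrib_right)
  finally have "l w = l (\<Sum>b\<in>Basis. ((w / z) \<bullet> b) *\<^sub>R (b * z))" by simp
  also have "\<dots> = (\<Sum>b\<in>Basis. ((w / z) \<bullet> b) *\<^sub>R l (b * z))"
    by (simp add: linear_sum[OF assms(1)] linear_cmul[OF assms(1)])
  finally have "\<bar>l w\<bar> \<le> (\<Sum>b\<in>Basis. \<bar>((w / z) \<bullet> b) *\<^sub>R l (b * z)\<bar>)" by simp
  also have "\<dots> \<le> (\<Sum>b\<in>Basis. (norm w / norm z) * \<bar>l (b * z)\<bar>)"
    by (intro sum_mono) (auto simp: abs_mult norm_divide[symmetric] intro!: mult_right_mono Basis_le_norm)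
  also have "\<dots> = (norm w / norm z) * (\<Sum>b\<in>Basis. \<bar>l (b * z)\<bar>)" by (simp add: sum_distrib_left)
  finally show ?thesis using False assms(2) by (simp add: field_simps)
qed

lemma linear_functional_nondegenerate:
  fixes l :: "'f::arch_local_field \<Rightarrow> real"
  assumes "linear l" "l w \<noteq> 0" "\<And>b. b \<in> Basis \<Longrightarrow> l (b * z) = 0"
  shows "z = 0"
  using norm_le_Basis_pairings[OF assms(1,2), of z] assms(3) by simp

text \<open>
  The scalar runs through a real basis of the field, because the nilpotents are going to be
  paired with matrices by means of a form that is only real linear.
\<close>

definition nilp_index :: "('n \<times> 'n \<times> 'f::arch_local_field \<times> bool) set" where
  "nilp_index = {(i, j, b, s). i \<noteq> j \<and> b \<in> Basis}"

lemma finite_nilp_index [simp]: "finite (nilp_index :: ('n::finite \<times> 'n \<times> 'f::arch_local_field \<times> bool) set)"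
  by (rule finite_subset[of _ "UNIV \<times> UNIV \<times> Basis \<times> UNIV"]) (auto simp: nilp_index_def)

definition nilX :: "('n \<times> 'n \<times> 'f \<times> bool) \<Rightarrow> 'f::arch_local_field^'n^'n" where
  "nilX = (\<lambda>(i, j, b, s). nilp i j b s)"

lemma nilX_sq: "t \<in> nilp_index \<Longrightarrow> nilX t ** nilX t = 0"
  by (auto simp: nilp_index_def nilX_def nilp_sq)

lemma det_nilX: "t \<in> nilp_index \<Longrightarrow> det (mat 1 + r *\<^sub>R nilX t) = 1"
  by (auto simp: nilp_index_def nilX_def scaleR_nilp det_nilp)

text \<open>
  A matrix that pairs to zero with all the nilpotents is scalar, and a scalar matrix with
  determinant zero is zero. Hence the sum of the pairings and of \<open>norm (det A)\<close> is bounded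
  below on the unit sphere, by compactness. For a matrix of norm \<open>r \<ge> 1\<close>, passing to the unit
  sphere divides the pairings by \<open>r\<close> and the determinant by at least \<open>r\<close>, so that the bound
  becomes linear in the norm.
\<close>

lemma norm_le_nilX_pairings:
  fixes l :: "'f::arch_local_field \<Rightarrow> real"
  assumes l: "linear l" "l w \<noteq> 0"
  shows "\<exists>C>0. \<forall>(A :: 'f^'n^'n). norm A \<le> C * (1 + (\<Sum>t\<in>nilp_index. \<bar>l (trace (nilX t ** A))\<bar>) + norm (det A))"
proof -
  let ?S = "sphere 0 1 :: ('f^'n^'n) set"
  define h where "h A = (\<Sum>t\<in>nilp_index. \<bar>l (trace (nilX t ** A))\<bar>) + norm (det A)" for A :: "'f^'n^'n"
  have bl: "bounded_linear l" using l(1) linear_conv_bounded_linear by blast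
  have "continuous_on ?S h"
    unfolding h_def trace_def
    by (intro continuous_intros bounded_linear.continuous_on[OF bl])
  moreover have "?S \<noteq> {}" by simp
  ultimately obtain A0 where A0: "A0 \<in> ?S" "\<And>A. A \<in> ?S \<Longrightarrow> h A0 \<le> h A"
    using continuous_attains_inf[of ?S h] by (meson compact_sphere)
  have h0: "h A \<ge> 0" for A unfolding h_def by (intro add_nonneg_nonneg sum_nonneg) auto
  have pos: "h A0 > 0"
  proof (rule ccontr)
    assume "\<not> h A0 > 0"
    then have "h A0 = 0" using h0[of A0] by simp
    moreover have s0: "(\<Sum>t\<in>nilp_index. \<bar>l (trace (nilX t ** A0))\<bar>) \<ge> 0" by (intro sum_nonneg) auto
    ultimately have "(\<Sum>t\<in>nilp_index. \<bar>l (trace (nilX t ** A0))\<bar>) = 0" and d: "det A0 = 0"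
      unfolding h_def using norm_ge_zero[of "det A0"] by (linarith, metis add_nonneg_eq_0_iff norm_eq_zero norm_ge_zero)
    then have z: "l (trace (nilX t ** A0)) = 0" if "t \<in> nilp_index" for t
      using that by (subst (asm) sum_nonneg_eq_0_iff) auto
    have off: "A0 $ j $ i = 0" if "i \<noteq> j" for i j
      by (rule linear_functional_nondegenerate[OF l])
         (use z[of "(i, j, _, True)"] that in \<open>auto simp: nilp_index_def nilX_def trace_nilp\<close>)
    have diag: "A0 $ j $ j = A0 $ i $ i" for i j
    proof (cases "i = j")
      case False
      have "A0 $ j $ i - A0 $ i $ i + A0 $ j $ j - A0 $ i $ j = 0"
        by (rule linear_functional_nondegenerate[OF l])
           (use z[of "(i, j, _, False)"] False in \<open>auto simp: nilp_index_def nilX_def trace_nilp\<close>)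
      then show ?thesis using off[of i j] off[of j i] False by simp
    qed simp
    define a where "a = A0 $ (SOME i. True) $ (SOME i. True)"
    have "A0 = mat a"
      using off diag by (auto simp: vec_eq_iff mat_def a_def)
    moreover from this d have "a = 0" by (simp add: det_mat)
    ultimately have "A0 = 0" by simp
    then show False using A0(1) by simp
  qed
  define C where "C = 1 + 1 / h A0"
  have "norm A \<le> C * (1 + (\<Sum>t\<in>nilp_index. \<bar>l (trace (nilX t ** A))\<bar>) + norm (det A))" for A :: "'f^'n^'n"
  proof -
    define R where "R = (\<Sum>t\<in>nilp_index. \<bar>l (trace (nilX t ** A))\<bar>)"
    have R: "R \<ge> 0" unfolding R_def by (intro sum_nonneg) auto
    show ?thesis
    proof (cases "norm A \<le> 1")
      case True
      have "1 * 1 \<le> C * (1 + R + norm (det A))"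
        using R pos by (intro mult_mono) (auto simp: C_def)
      then show ?thesis using True by (simp add: R_def)
    next
      case False
      define r where "r = norm A"
      have r: "r > 1" using False by (simp add: r_def)
      define A1 where "A1 = (1 / r) *\<^sub>R A"
      have "norm A1 = 1" using r by (auto simp: A1_def r_def)
      then have le: "h A0 \<le> h A1" using A0(2) by simp
      have "(\<Sum>t\<in>nilp_index. \<bar>l (trace (nilX t ** A1))\<bar>) = R / r"
        unfolding R_def sum_divide_distrib
      proof (rule sum.cong[OF refl])
        fix t
        have "l (trace (nilX t ** A1)) = (1 / r) *\<^sub>R l (trace (nilX t ** A))"
          unfolding A1_def scaleR_matrix_mult_right trace_scaleR by (rule linear_cmul[OF l(1)])
        then show "\<bar>l (trace (nilX t ** A1))\<bar> = \<bar>l (trace (nilX t ** A))\<bar> / r"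
          using r by (simp add: abs_mult)
      qed
      moreover have "norm (det A1) \<le> norm (det A) / r"
      proof -
        have "norm (det A1) = (1 / r) ^ CARD('n) * norm (det A)"
          using r by (simp add: A1_def det_scaleR)
        also have "\<dots> \<le> (1 / r) ^ 1 * norm (det A)"
          using r by (intro mult_right_mono power_decreasing) (auto simp: Suc_leI)
        finally show ?thesis by simp
      qed
      ultimately have "h A0 \<le> (R + norm (det A)) / r" using le by (simp add: h_def add_divide_distrib)
      then have "r \<le> (1 / h A0) * (R + norm (det A))" using r pos by (simp add: field_simps)
      also have "\<dots> \<le> C * (1 + R + norm (det A))"
        using R pos by (intro mult_mono) (auto simp: C_def)
      finally show ?thesis by (simp add: r_def R_def)
    qed
  qed
  moreover have "C > 0" using pos by (simp add: C_def add_pos_pos)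
  ultimately show ?thesis by blast
qed


section \<open>Partial derivatives and parametric integrals\<close>

text \<open>
  Continuity of the iterated directional derivatives. The oscillatory integrals are
  differentiated one direction at a time, so this is what can be shown of them directly; on
  open sets it implies \<open>Ck_on\<close>.
\<close>

primrec partially_Ck :: "nat \<Rightarrow> 'a::real_normed_vector set \<Rightarrow> ('a \<Rightarrow> 'b::real_normed_vector) \<Rightarrow> bool" where
  "partially_Ck 0 S f \<longleftrightarrow> continuous_on S f"
| "partially_Ck (Suc k) S f \<longleftrightarrow> continuous_on S f \<and>
     (\<forall>e. \<exists>f'. (\<forall>x\<in>S. ((\<lambda>t. f (x + t *\<^sub>R e)) has_vector_derivative f' x) (at 0)) \<and> partially_Ck k S f')"

lemma norm_increment_le:
  fixes f :: "real \<Rightarrow> 'b::real_normed_vector"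
  assumes d: "\<And>s. s \<in> {a..b} \<Longrightarrow> (f has_vector_derivative f' s) (at s)"
    and bd: "\<And>s. s \<in> {a..b} \<Longrightarrow> norm (f' s) \<le> B" and "a \<le> b"
  shows "norm (f b - f a) \<le> B * (b - a)"
proof -
  have "norm (f b - f a) \<le> B * norm (b - a)"
  proof (rule differentiable_bound[of "{a..b}" f "\<lambda>s h. h *\<^sub>R f' s"])
    fix s assume s: "s \<in> {a..b}"
    show "(f has_derivative (\<lambda>h. h *\<^sub>R f' s)) (at s within {a..b})"
      using d[OF s] unfolding has_vector_derivative_def by (rule has_derivative_at_withinI)
    show "onorm (\<lambda>h. h *\<^sub>R f' s) \<le> B"
      using mult_left_mono[OF bd[OF s] abs_ge_zero] by (intro onorm_le) (simp add: mult.commute)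
  qed (use \<open>a \<le> b\<close> in auto)
  then show ?thesis using \<open>a \<le> b\<close> by simp
qed

lemma directional_derivative_line:
  fixes f :: "'a::real_normed_vector \<Rightarrow> 'b::real_normed_vector"
  assumes "((\<lambda>t. f (x + s *\<^sub>R e + t *\<^sub>R e)) has_vector_derivative D) (at 0)"
  shows "((\<lambda>t. f (x + t *\<^sub>R e)) has_vector_derivative D) (at s)"
proof -
  have "((\<lambda>t. t - s) has_vector_derivative 1) (at s)"
    by (auto intro!: derivative_eq_intros simp: has_vector_derivative_def)
  moreover have "((\<lambda>t. f (x + s *\<^sub>R e + t *\<^sub>R e)) has_vector_derivative D) (at (s - s))"
    using assms by simp
  ultimately have "(((\<lambda>t. f (x + s *\<^sub>R e + t *\<^sub>R e)) \<circ> (\<lambda>t. t - s)) has_vector_derivative 1 *\<^sub>R D) (at s)"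
    by (rule vector_diff_chain_at)
  moreover have "(\<lambda>t. f (x + s *\<^sub>R e + t *\<^sub>R e)) \<circ> (\<lambda>t. t - s) = (\<lambda>t. f (x + t *\<^sub>R e))"
    by (auto simp: fun_eq_iff algebra_simps)
  ultimately show ?thesis by simp
qed

text \<open>
  The way from \<open>x\<close> to \<open>y\<close> is travelled one coordinate at a time. On each leg the mean value
  inequality compares the increment of \<open>f\<close> with the derivative at \<open>x\<close> in that direction.
\<close>

lemma partials_imp_has_derivative:
  fixes f :: "'a::euclidean_space \<Rightarrow> 'b::real_normed_vector"
  assumes S: "open S" "x \<in> S"
    and d: "\<And>y e. y \<in> S \<Longrightarrow> ((\<lambda>t. f (y + t *\<^sub>R e)) has_vector_derivative D e y) (at 0)"
    and c: "\<And>e. continuous_on S (D e)"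
  shows "(f has_derivative (\<lambda>e. D e x)) (at x)"
proof -
  define L where "L e = (\<Sum>b\<in>Basis. (e \<bullet> b) *\<^sub>R D b x)" for e
  have L: "bounded_linear L"
    unfolding L_def by (intro bounded_linear_sum bounded_linear_intros)
  have "(f has_derivative L) (at x)"
    unfolding has_derivative_at_alt
  proof (intro conjI allI impI L)
    fix \<epsilon> :: real assume eps: "\<epsilon> > 0"
    define \<eta> where "\<eta> = \<epsilon> / DIM('a)"
    have eta: "\<eta> > 0" using eps by (simp add: \<eta>_def)
    obtain r where r: "r > 0" "ball x r \<subseteq> S" using S open_contains_ball by blast
    have "\<forall>b\<in>Basis. \<exists>\<delta>>0. \<forall>y\<in>S. dist y x < \<delta> \<longrightarrow> dist (D b y) (D b x) < \<eta>"
      using c S(2) eta unfolding continuous_on_iff by blast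
    then obtain \<delta> where \<delta>: "\<And>b. b \<in> Basis \<Longrightarrow> \<delta> b > 0 \<and> (\<forall>y\<in>S. dist y x < \<delta> b \<longrightarrow> dist (D b y) (D b x) < \<eta>)"
      by metis
    define d0 where "d0 = Min (insert r (\<delta> ` (Basis :: 'a set)))"
    have d0: "d0 > 0" unfolding d0_def using r \<delta> by (subst Min_gr_iff) auto
    have d0r: "d0 \<le> r" unfolding d0_def by (rule Min_le) auto
    have d0d: "d0 \<le> \<delta> b" if "b \<in> Basis" for b unfolding d0_def using that by (intro Min_le) auto
    show "\<exists>d>0. \<forall>y. norm (y - x) < d \<longrightarrow> norm (f y - f x - L (y - x)) \<le> \<epsilon> * norm (y - x)"
    proof (intro exI[of _ "d0"] conjI d0 allI impI)
      fix y assume y: "norm (y - x) < d0"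
      define v where "v = y - x"
      \<comment> \<open>the part of the way from \<open>x\<close> to \<open>y\<close> that is covered by the
         coordinates in \<open>A\<close>\<close>
      define vA where "vA A = (\<Sum>b\<in>A. (v \<bullet> b) *\<^sub>R b)" for A :: "'a set"
      have vA_norm: "norm (vA A + (t * (v \<bullet> b)) *\<^sub>R b) \<le> norm v"
        if "A \<subseteq> Basis" "b \<in> Basis" "b \<notin> A" "t \<in> {0..1}" for A b t
      proof (rule norm_le_componentwise)
        fix i :: 'a assume i: "i \<in> Basis"
        have fA: "finite A" by (rule finite_subset[OF that(1) finite_Basis])
        have 1: "vA A \<bullet> i = (if i \<in> A then v \<bullet> i else 0)"
        proof -
          have "vA A \<bullet> i = (\<Sum>b\<in>A. if b = i then v \<bullet> i else 0)"
            unfolding vA_def inner_sum_left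
            by (rule sum.cong[OF refl]) (use that(1) i in \<open>simp add: inner_Basis subset_iff\<close>)
          then show ?thesis using fA by simp
        qed
        have 2: "((t * (v \<bullet> b)) *\<^sub>R b) \<bullet> i = (if i = b then t * (v \<bullet> i) else 0)"
          using that(2) i by (simp add: inner_Basis)
        have "\<bar>t * (v \<bullet> i)\<bar> \<le> 1 * \<bar>v \<bullet> i\<bar>"
          unfolding abs_mult using that(4) by (intro mult_right_mono) auto
        then show "\<bar>(vA A + (t * (v \<bullet> b)) *\<^sub>R b) \<bullet> i\<bar> \<le> \<bar>v \<bullet> i\<bar>"
          unfolding inner_add_left 1 2 using that(3) by auto
      qed
      have "norm (f (x + vA A) - f x - (\<Sum>b\<in>A. (v \<bullet> b) *\<^sub>R D b x)) \<le> card A * (\<eta> * norm v)"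
        if "A \<subseteq> Basis" for A
      proof -
        have "finite A" by (rule finite_subset[OF that finite_Basis])
        then show ?thesis using that
        proof (induction A rule: finite_induct)
          case empty then show ?case by (simp add: vA_def)
        next
          case (insert b A)
          define p where "p = x + vA A"
          define e where "e = (v \<bullet> b) *\<^sub>R b"
          define q where "q t = f (p + t *\<^sub>R e) - t *\<^sub>R (v \<bullet> b) *\<^sub>R D b x" for t
          have seg: "p + t *\<^sub>R e \<in> S" "dist (p + t *\<^sub>R e) x < d0" if "t \<in> {0..1}" for t
          proof -
            have "norm (vA A + (t * (v \<bullet> b)) *\<^sub>R b) \<le> norm v" using insert that by (intro vA_norm) auto
            then show "dist (p + t *\<^sub>R e) x < d0" using y by (simp add: p_def e_def dist_norm v_def algebra_simps)
            then show "p + t *\<^sub>R e \<in> S" using d0r r(2) by (auto simp: dist_commute mem_ball subset_iff)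
          qed
          have b: "b \<in> Basis" using insert by auto
          have "norm (q 1 - q 0) \<le> (\<eta> * norm v) * (1 - 0)"
          proof (rule norm_increment_le)
            fix t :: real assume t: "t \<in> {0..1}"
            have D_e: "((\<lambda>s. f (z + s *\<^sub>R e)) has_vector_derivative (v \<bullet> b) *\<^sub>R D b z) (at 0)" if "z \<in> S" for z
            proof -
              have "((\<lambda>s. (v \<bullet> b) * s) has_vector_derivative (v \<bullet> b)) (at 0)"
                by (auto intro!: derivative_eq_intros simp: has_vector_derivative_def)
              moreover have "((\<lambda>t. f (z + t *\<^sub>R b)) has_vector_derivative D b z) (at ((v \<bullet> b) * 0))"
                using d[OF that] by simp
              ultimately have "((\<lambda>t. f (z + t *\<^sub>R b)) \<circ> (\<lambda>s. (v \<bullet> b) * s) has_vector_derivative (v \<bullet> b) *\<^sub>R D b z) (at 0)"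
                by (rule vector_diff_chain_at)
              then show ?thesis by (simp add: o_def e_def mult.commute)
            qed
            have "((\<lambda>t. f (p + t *\<^sub>R e)) has_vector_derivative (v \<bullet> b) *\<^sub>R D b (p + t *\<^sub>R e)) (at t)"
              by (rule directional_derivative_line) (rule D_e[OF seg(1)[OF t]])
            then show "(q has_vector_derivative ((v \<bullet> b) *\<^sub>R D b (p + t *\<^sub>R e) - (v \<bullet> b) *\<^sub>R D b x)) (at t)"
              unfolding q_def by (auto intro!: derivative_eq_intros)
            have "norm (D b (p + t *\<^sub>R e) - D b x) \<le> \<eta>"
              using \<delta>[OF b] seg[OF t] d0d[OF b] by (force simp: dist_norm)
            moreover have "\<bar>v \<bullet> b\<bar> \<le> norm v" using b by (rule Basis_le_norm)
            ultimately have "\<bar>v \<bullet> b\<bar> * norm (D b (p + t *\<^sub>R e) - D b x) \<le> norm v * \<eta>"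
              by (intro mult_mono) auto
            then show "norm ((v \<bullet> b) *\<^sub>R D b (p + t *\<^sub>R e) - (v \<bullet> b) *\<^sub>R D b x) \<le> \<eta> * norm v"
              by (simp flip: scaleR_diff_right add: mult.commute)
          qed simp
          moreover have "q 1 - q 0 = f (x + vA (insert b A)) - f (x + vA A) - (v \<bullet> b) *\<^sub>R D b x"
            using insert by (simp add: q_def p_def e_def vA_def algebra_simps)
          ultimately have "norm (f (x + vA (insert b A)) - f (x + vA A) - (v \<bullet> b) *\<^sub>R D b x) \<le> \<eta> * norm v"
            by simp
          moreover have "norm (f (x + vA A) - f x - (\<Sum>b\<in>A. (v \<bullet> b) *\<^sub>R D b x)) \<le> card A * (\<eta> * norm v)"
            using insert by auto
          moreover have "f (x + vA (insert b A)) - f x - (\<Sum>b\<in>insert b A. (v \<bullet> b) *\<^sub>R D b x)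
             = (f (x + vA (insert b A)) - f (x + vA A) - (v \<bullet> b) *\<^sub>R D b x)
               + (f (x + vA A) - f x - (\<Sum>b\<in>A. (v \<bullet> b) *\<^sub>R D b x))"
            using insert by simp
          ultimately have "norm (f (x + vA (insert b A)) - f x - (\<Sum>b\<in>insert b A. (v \<bullet> b) *\<^sub>R D b x))
            \<le> \<eta> * norm v + card A * (\<eta> * norm v)"
            by (simp only: norm_triangle_mono)
          then show ?case using insert.hyps by (simp add: distrib_right)
        qed
      qed
      from this[of Basis] have "norm (f (x + vA Basis) - f x - L v) \<le> DIM('a) * (\<eta> * norm v)"
        by (simp add: L_def)
      moreover have "vA Basis = v" by (simp add: vA_def euclidean_representation)
      ultimately show "norm (f y - f x - L (y - x)) \<le> \<epsilon> * norm (y - x)"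
        by (simp add: v_def \<eta>_def)
    qed
  qed
  moreover have "L e = D e x" for e
  proof -
    have "((\<lambda>t. x + t *\<^sub>R e) has_derivative (\<lambda>t. t *\<^sub>R e)) (at 0)"
      by (auto intro!: derivative_eq_intros)
    moreover have "(f has_derivative L) (at (x + 0 *\<^sub>R e))"
      using \<open>(f has_derivative L) (at x)\<close> by simp
    ultimately have "((\<lambda>t. f (x + t *\<^sub>R e)) has_derivative (\<lambda>t. L (t *\<^sub>R e))) (at 0)"
      by (rule has_derivative_compose)
    then have "((\<lambda>t. f (x + t *\<^sub>R e)) has_vector_derivative L e) (at 0)"
      by (simp add: has_vector_derivative_def linear_cmul[OF bounded_linear.linear[OF L]])
    then show ?thesis by (rule vector_derivative_unique_at[OF _ d[OF S(2)]])
  qed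
  then have "L = (\<lambda>e. D e x)" by (simp add: fun_eq_iff)
  ultimately show ?thesis by simp
qed

lemma Ck_on_cong:
  assumes "open S" "\<And>x. x \<in> S \<Longrightarrow> f x = g x" "Ck_on k S f"
  shows "Ck_on k S g"
  using assms(2,3)
proof (induction k arbitrary: f g)
  case 0 then show ?case by (simp cong: continuous_on_cong)
next
  case (Suc k)
  have eq: "(f has_derivative L) (at x) \<longleftrightarrow> (g has_derivative L) (at x)" if "x \<in> S" for x L

    using has_derivative_transform_within_open[OF _ assms(1) that, of f L UNIV g]
      has_derivative_transform_within_open[OF _ assms(1) that, of g L UNIV f] Suc.prems(1) by auto
  have fd: "frechet_derivative f (at x) = frechet_derivative g (at x)" if "x \<in> S" for x
    unfolding frechet_derivative_def eq[OF that] ..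
  have "Ck_on k S (\<lambda>x. frechet_derivative g (at x) e)" for e
  proof (rule Suc.IH)
    show "Ck_on k S (\<lambda>x. frechet_derivative f (at x) e)" using Suc.prems(2) by simp
    show "frechet_derivative f (at x) e = frechet_derivative g (at x) e" if "x \<in> S" for x
      by (simp only: fd[OF that])
  qed
  moreover have "g differentiable (at x)" if "x \<in> S" for x
  proof -
    have "f differentiable (at x)" using Suc.prems(2) that by simp
    then show ?thesis unfolding differentiable_def eq[OF that] .
  qed
  ultimately show ?case by simp
qed

lemma partially_Ck_imp_Ck_on:
  fixes f :: "'a::euclidean_space \<Rightarrow> 'b::real_normed_vector"
  assumes "open S" "partially_Ck k S f"
  shows "Ck_on k S f"
  using assms(2)
proof (induction k arbitrary: f)
  case 0 then show ?case by simp
next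
  case (Suc k)
  obtain D where D: "\<And>e x. x \<in> S \<Longrightarrow> ((\<lambda>t. f (x + t *\<^sub>R e)) has_vector_derivative D e x) (at 0)"
      "\<And>e. partially_Ck k S (D e)"
    using Suc.prems by (simp, metis)
  have "continuous_on S (D e)" for e using D(2)[of e] by (cases k) auto
  then have der: "(f has_derivative (\<lambda>e. D e x)) (at x)" if "x \<in> S" for x
    using partials_imp_has_derivative[OF assms(1) that D(1)] by blast
  have "Ck_on k S (\<lambda>x. frechet_derivative f (at x) e)" for e
    by (rule Ck_on_cong[OF assms(1) _ Suc.IH[OF D(2)[of e]]])
       (use frechet_derivative_at[OF der] in metis)
  then show ?case using der by (auto simp: differentiable_def)
qed

lemma has_vector_derivative_at_0_iff:
  "(f has_vector_derivative D) (at 0) \<longleftrightarrow> ((\<lambda>s. (f s - f 0) /\<^sub>R s) \<longlongrightarrow> D) (at 0)"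
proof -
  have "(f has_vector_derivative D) (at 0) \<longleftrightarrow> (\<lambda>h. norm (f h - f 0 - h *\<^sub>R D) / norm h) \<midarrow>0\<rightarrow> 0"
    by (simp add: has_vector_derivative_def has_derivative_at bounded_linear_scaleR_left)
  also have "\<dots> \<longleftrightarrow> (\<lambda>h. norm ((f h - f 0) /\<^sub>R h - D)) \<midarrow>0\<rightarrow> 0"
  proof (rule Lim_cong_within)
    fix h :: real assume "h \<noteq> 0"
    then have "(f h - f 0) /\<^sub>R h - D = (f h - f 0 - h *\<^sub>R D) /\<^sub>R h"
      by (simp add: scaleR_diff_right)
    then show "norm (f h - f 0 - h *\<^sub>R D) / norm h = norm ((f h - f 0) /\<^sub>R h - D)"
      by (simp add: divide_inverse mult.commute)
  qed auto
  also have "\<dots> \<longleftrightarrow> ((\<lambda>s. (f s - f 0) /\<^sub>R s) \<longlongrightarrow> D) (at 0)"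
    by (simp add: tendsto_norm_zero_iff Lim_null[symmetric])
  finally show ?thesis .
qed

text \<open>
  Dominated convergence for the difference quotients, which inherit the bound \<open>D\<close> from the
  derivatives through the mean value inequality.
\<close>

lemma has_vector_derivative_integral:
  fixes F :: "real \<Rightarrow> 'a \<Rightarrow> 'b::{banach, second_countable_topology}"
  assumes "\<delta> > 0"
    and meas: "\<And>s. \<bar>s\<bar> < \<delta> \<Longrightarrow> F s \<in> borel_measurable M"
    and int0: "integrable M (F 0)"
    and meas': "F' 0 \<in> borel_measurable M"
    and der: "AE x in M. \<forall>s. \<bar>s\<bar> < \<delta> \<longrightarrow>
      ((\<lambda>s. F s x) has_vector_derivative F' s x) (at s) \<and> norm (F' s x) \<le> D x"
    and D: "integrable M D"
  shows "((\<lambda>s. \<integral>x. F s x \<partial>M) has_vector_derivative (\<integral>x. F' 0 x \<partial>M)) (at 0)"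
proof -
  have incr: "AE x in M. \<forall>s. \<bar>s\<bar> < \<delta> \<longrightarrow> norm (F s x - F 0 x) \<le> D x * \<bar>s\<bar>"
    using der
  proof eventually_elim
    case (elim x)
    show ?case
    proof (intro allI impI)
      fix s assume s: "\<bar>s\<bar> < \<delta>"
      show "norm (F s x - F 0 x) \<le> D x * \<bar>s\<bar>"
      proof (cases "0 \<le> s")
        case True
        then show ?thesis using s
          norm_increment_le[of 0 s "\<lambda>s. F s x" "\<lambda>s. F' s x" "D x"] elim by auto
      next
        case False
        then show ?thesis using s
          norm_increment_le[of s 0 "\<lambda>s. F s x" "\<lambda>s. F' s x" "D x"] elim by (auto simp: norm_minus_commute)
      qed
    qed
  qed
  have intF: "integrable M (F s)" if s: "\<bar>s\<bar> < \<delta>" for s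
  proof -
    have "integrable M (\<lambda>x. F s x - F 0 x)"
    proof (rule Bochner_Integration.integrable_bound)
      show "integrable M (\<lambda>x. D x * \<bar>s\<bar>)" using D by simp
      show "(\<lambda>x. F s x - F 0 x) \<in> borel_measurable M" using meas[OF s] int0 by measurable
      show "AE x in M. norm (F s x - F 0 x) \<le> norm (D x * \<bar>s\<bar>)"
        using incr by eventually_elim (use s in \<open>force simp: abs_if\<close>)
    qed
    from Bochner_Integration.integrable_add[OF this int0] show ?thesis by simp
  qed
  have "((\<lambda>s. ((\<integral>x. F s x \<partial>M) - (\<integral>x. F 0 x \<partial>M)) /\<^sub>R s) \<longlongrightarrow> (\<integral>x. F' 0 x \<partial>M)) (at 0)"
    unfolding tendsto_at_iff_sequentially comp_def
  proof (intro allI impI)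
    fix X :: "nat \<Rightarrow> real" assume X: "\<forall>i. X i \<in> UNIV - {0}" "X \<longlonglongrightarrow> 0"
    obtain N where N: "\<And>n. n \<ge> N \<Longrightarrow> \<bar>X n\<bar> < \<delta>"
      using X(2) assms(1) unfolding LIMSEQ_iff by auto
    define Y where "Y n = X (n + N)" for n
    have Y: "Y n \<noteq> 0" "\<bar>Y n\<bar> < \<delta>" for n using X(1) N by (auto simp: Y_def)
    have Y0: "Y \<longlonglongrightarrow> 0" unfolding Y_def using X(2) by (rule LIMSEQ_ignore_initial_segment)
    have "(\<lambda>n. \<integral>x. (F (Y n) x - F 0 x) /\<^sub>R Y n \<partial>M) \<longlonglongrightarrow> (\<integral>x. F' 0 x \<partial>M)"
    proof (rule integral_dominated_convergence[OF meas' _ D])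
      show "(\<lambda>x. (F (Y n) x - F 0 x) /\<^sub>R Y n) \<in> borel_measurable M" for n
        using meas[OF Y(2)] int0 by measurable
      show "AE x in M. (\<lambda>n. (F (Y n) x - F 0 x) /\<^sub>R Y n) \<longlonglongrightarrow> F' 0 x"
        using der
      proof eventually_elim
        case (elim x)
        then have "((\<lambda>s. F s x) has_vector_derivative F' 0 x) (at 0)" using assms(1) by simp
        then have "((\<lambda>s. (F s x - F 0 x) /\<^sub>R s) \<longlongrightarrow> F' 0 x) (at 0)"
          by (simp add: has_vector_derivative_at_0_iff)
        then show ?case
          using Y Y0 unfolding tendsto_at_iff_sequentially comp_def by auto
      qed
      show "AE x in M. norm ((F (Y n) x - F 0 x) /\<^sub>R Y n) \<le> D x" for n
        using incr
      proof eventually_elim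
        case (elim x)
        then have "norm (F (Y n) x - F 0 x) \<le> D x * \<bar>Y n\<bar>" using Y by blast
        moreover have "norm ((F (Y n) x - F 0 x) /\<^sub>R Y n) = norm (F (Y n) x - F 0 x) / \<bar>Y n\<bar>"
          by (simp add: divide_inverse mult.commute)
        ultimately show ?case using Y(1)[of n] by (simp add: pos_divide_le_eq)
      qed
    qed
    moreover have "(\<integral>x. (F (Y n) x - F 0 x) /\<^sub>R Y n \<partial>M) = ((\<integral>x. F (Y n) x \<partial>M) - (\<integral>x. F 0 x \<partial>M)) /\<^sub>R Y n" for n
      using intF[OF Y(2)[of n]] int0 by simp
    ultimately have "(\<lambda>n. ((\<integral>x. F (Y n) x \<partial>M) - (\<integral>x. F 0 x \<partial>M)) /\<^sub>R Y n) \<longlonglongrightarrow> (\<integral>x. F' 0 x \<partial>M)" by (simp only:)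
    then show "(\<lambda>n. ((\<integral>x. F (X n) x \<partial>M) - (\<integral>x. F 0 x \<partial>M)) /\<^sub>R X n) \<longlonglongrightarrow> (\<integral>x. F' 0 x \<partial>M)"
      unfolding Y_def by (rule LIMSEQ_offset)
  qed
  then show ?thesis by (simp add: has_vector_derivative_at_0_iff)
qed

lemma integrable_indicator_compact:
  fixes K :: "'a::euclidean_space set" and c :: real
  assumes "compact K" shows "integrable lborel (\<lambda>u. c * indicator K u)"
  using assms emeasure_compact_finite[OF assms]
  by (intro integrable_mult_right integrable_real_indicator) (auto simp: borel_compact)

lemma lborel_integral_translate:
  fixes F :: "'a::euclidean_space \<Rightarrow> 'b::{banach, second_countable_topology}"
  assumes "F \<in> borel_measurable borel"
  shows "(\<integral>x. F (x + a) \<partial>lborel) = (\<integral>x. F x \<partial>lborel)"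
proof -
  have "(\<integral>x. F x \<partial>lborel) = (\<integral>x. F x \<partial>(distr lborel borel ((+) a)))"
    by (subst lborel_distr_plus) simp
  also have "\<dots> = (\<integral>x. F (a + x) \<partial>lborel)"
    by (rule integral_distr) (use assms in auto)
  finally show ?thesis by (simp add: add.commute)
qed

lemma continuous_on_zero_extension:
  fixes F :: "'a::euclidean_space \<Rightarrow> 'b::real_normed_vector"
  assumes "open U" "compact K" "continuous_on U F" "\<And>x. x \<in> U - K \<Longrightarrow> F x = 0" "K \<subseteq> U"
  shows "continuous_on UNIV (\<lambda>x. indicator U x *\<^sub>R F x)"
proof -
  have "continuous_on U (\<lambda>x. indicator U x *\<^sub>R F x)"
    using assms(3) by (rule continuous_on_eq) simp
  moreover have "continuous_on (- K) (\<lambda>x. indicator U x *\<^sub>R F x)"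
    by (rule continuous_on_eq[OF continuous_on_const[of _ 0]]) (use assms(4) in \<open>auto simp: indicator_def\<close>)
  ultimately have "continuous_on (U \<union> - K) (\<lambda>x. indicator U x *\<^sub>R F x)"
    using assms(1,2) by (intro continuous_on_open_Un) (auto simp: compact_imp_closed open_Compl)
  moreover have "U \<union> - K = UNIV" using assms(5) by auto
  ultimately show ?thesis by simp
qed

text \<open>
  Extended by zero, \<open>F\<close> has an integral that does not change under translation in the
  direction \<open>e\<close>; the claim is the derivative of this constancy.
\<close>

lemma integral_directional_derivative_zero:
  fixes F F' :: "'a::euclidean_space \<Rightarrow> complex"
  assumes U: "open U" "compact K" "K \<subseteq> U"
    and c: "continuous_on U F" "continuous_on U F'"
    and z: "\<And>x. x \<in> U - K \<Longrightarrow> F x = 0"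
    and der: "\<And>x. x \<in> U \<Longrightarrow> ((\<lambda>t. F (x + t *\<^sub>R e)) has_vector_derivative F' x) (at 0)"
  shows "(LINT x:U|lborel. F' x) = 0"
proof -
  have near: "\<forall>\<^sub>F t in nhds (0::real). x + t *\<^sub>R e \<in> V" if "open V" "x \<in> V" for x and V :: "'a set"
  proof -
    have "((\<lambda>t. x + t *\<^sub>R e) \<longlongrightarrow> x + 0 *\<^sub>R e) (nhds 0)"
      by (intro tendsto_intros filterlim_ident)
    then show ?thesis using that by (intro topological_tendstoD) auto
  qed
  have cK: "open (- K)" using U(2) by (simp add: compact_imp_closed open_Compl)
  have z': "F' x = 0" if "x \<in> U - K" for x
  proof -
    have "((\<lambda>t. F (x + t *\<^sub>R e)) has_vector_derivative 0) (at 0)"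
    proof (subst has_vector_derivative_cong_ev[where g = "\<lambda>t. 0"])
      show "\<forall>\<^sub>F t in nhds 0. t \<in> UNIV \<longrightarrow> F (x + t *\<^sub>R e) = 0"
        using near[of "U - K" x] that U(1) cK by (auto simp: Diff_eq open_Int elim!: eventually_mono intro: z)
    qed (use that z in auto)
    then show ?thesis using der[of x] that by (auto intro: vector_derivative_unique_at)
  qed
  define F0 where "F0 x = indicator U x *\<^sub>R F x" for x
  define F1 where "F1 x = indicator U x *\<^sub>R F' x" for x
  have cF0: "continuous_on UNIV F0" unfolding F0_def
    by (rule continuous_on_zero_extension[OF U(1,2) c(1) z U(3)])
  have cF1: "continuous_on UNIV F1" unfolding F1_def
    by (rule continuous_on_zero_extension[OF U(1,2) c(2) z' U(3)])
  have F0z: "F0 x = 0" and F1z: "F1 x = 0" if "x \<notin> K" for x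
    using that z z' by (auto simp: F0_def F1_def indicator_def)
  have der0: "((\<lambda>t. F0 (x + t *\<^sub>R e)) has_vector_derivative F1 x) (at 0)" for x
  proof (cases "x \<in> U")
    case True
    have "((\<lambda>t. F0 (x + t *\<^sub>R e)) has_vector_derivative F' x) (at 0)"
    proof (subst has_vector_derivative_cong_ev[where g = "\<lambda>t. F (x + t *\<^sub>R e)"])
      show "\<forall>\<^sub>F t in nhds 0. t \<in> UNIV \<longrightarrow> F0 (x + t *\<^sub>R e) = F (x + t *\<^sub>R e)"
        using near[OF U(1) True] by eventually_elim (simp add: F0_def)
    qed (use True der in \<open>auto simp: F0_def\<close>)
    then show ?thesis using True by (simp add: F1_def)
  next
    case False
    then have "x \<in> - K" using U(3) by auto
    have "((\<lambda>t. F0 (x + t *\<^sub>R e)) has_vector_derivative 0) (at 0)"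
    proof (subst has_vector_derivative_cong_ev[where g = "\<lambda>t. 0"])
      show "\<forall>\<^sub>F t in nhds 0. t \<in> UNIV \<longrightarrow> F0 (x + t *\<^sub>R e) = 0"
        using near[OF cK \<open>x \<in> - K\<close>] by eventually_elim (simp add: F0z)
    qed (use F0z \<open>x \<in> - K\<close> in auto)
    then show ?thesis using False by (simp add: F1_def)
  qed
  have derF: "((\<lambda>t. F0 (x + t *\<^sub>R e)) has_vector_derivative F1 (x + s *\<^sub>R e)) (at s)" for x s
    by (rule directional_derivative_line) (rule der0)
  have "bounded (F1 ` K)"
    by (rule compact_imp_bounded[OF compact_continuous_image]) (use cF1 U(2) continuous_on_subset in auto)
  then obtain B where B: "B > 0" "\<And>x. x \<in> K \<Longrightarrow> norm (F1 x) \<le> B"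
    using bounded_pos by (metis imageI)
  define K1 where "K1 = (\<lambda>(x, r). x - r *\<^sub>R e) ` (K \<times> {-1..1})"
  have K1: "compact K1" unfolding K1_def
    by (intro compact_continuous_image compact_Times U(2) compact_Icc)
       (auto intro!: continuous_intros simp: case_prod_beta)
  have bd: "norm (F1 (x + s *\<^sub>R e)) \<le> B * indicator K1 x" if "\<bar>s\<bar> < 1" for x s
  proof (cases "x + s *\<^sub>R e \<in> K")
    case True
    have "x \<in> K1" unfolding K1_def
      by (rule image_eqI[of _ _ "(x + s *\<^sub>R e, s)"]) (use True that in auto)
    then show ?thesis using B True by simp
  next
    case False then show ?thesis using F1z B(1) by simp
  qed
  have m0: "F0 \<in> borel_measurable borel" "F1 \<in> borel_measurable borel"
    using cF0 cF1 by (auto intro: borel_measurable_continuous_onI)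
  have int0: "integrable lborel F0"
  proof -
    have "integrable lborel (\<lambda>x. indicator K x *\<^sub>R F0 x)"
      by (rule borel_integrable_compact[OF U(2)]) (use cF0 continuous_on_subset in blast)
    moreover have "(\<lambda>x. indicator K x *\<^sub>R F0 x) = F0" using F0z by (auto simp: fun_eq_iff indicator_def)
    ultimately show ?thesis by simp
  qed
  have "((\<lambda>s. \<integral>x. F0 (x + s *\<^sub>R e) \<partial>lborel) has_vector_derivative (\<integral>x. F1 (x + 0 *\<^sub>R e) \<partial>lborel)) (at 0)"
  proof (rule has_vector_derivative_integral[where \<delta> = 1 and D = "\<lambda>x. B * indicator K1 x"])
    show "(\<lambda>x. F0 (x + s *\<^sub>R e)) \<in> borel_measurable lborel" for s using m0 by simp
    show "(\<lambda>x. F1 (x + 0 *\<^sub>R e)) \<in> borel_measurable lborel" using m0 by simp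
    show "integrable lborel (\<lambda>x. F0 (x + 0 *\<^sub>R e))" using int0 by simp
    show "integrable lborel (\<lambda>x. B * indicator K1 x)"
      by (rule integrable_indicator_compact[OF K1])
    show "AE x in lborel. \<forall>s. \<bar>s\<bar> < 1 \<longrightarrow>
        ((\<lambda>t. F0 (x + t *\<^sub>R e)) has_vector_derivative F1 (x + s *\<^sub>R e)) (at s) \<and>
        norm (F1 (x + s *\<^sub>R e)) \<le> B * indicator K1 x"
      using derF bd by (intro AE_I2) blast
  qed simp
  moreover have "(\<lambda>s. \<integral>x. F0 (x + s *\<^sub>R e) \<partial>lborel) = (\<lambda>s. \<integral>x. F0 x \<partial>lborel)"
    by (intro ext lborel_integral_translate m0)
  ultimately have "((\<lambda>s::real. \<integral>x. F0 x \<partial>lborel) has_vector_derivative (\<integral>x. F1 x \<partial>lborel)) (at 0)" by simp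
  then have "(\<integral>x. F1 x \<partial>lborel) = 0"
    by (rule vector_derivative_unique_at) (rule has_vector_derivative_const)
  then show ?thesis by (simp add: F1_def set_lebesgue_integral_def)
qed


section \<open>The invariant measure of the general linear group\<close>

lemma Basis_matrix:
  "(Basis :: ('f::euclidean_space^'n^'m) set) = (\<lambda>(i, j, b). axis i (axis j b)) ` (UNIV \<times> UNIV \<times> Basis)"
  unfolding Basis_vec_def by (auto simp: image_iff Bex_def) blast

lemma matrix_unit_Basis: "b \<in> Basis \<Longrightarrow> axis i (axis j b) \<in> Basis"
  unfolding Basis_matrix by (rule image_eqI[of _ _ "(i, j, b)"]) auto

lemma inner_matrix_unit: "A \<bullet> axis i (axis j b) = A $ i $ j \<bullet> b"
  for A :: "'f::euclidean_space^'n^'m"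
  by (simp add: inner_axis)

lemma prod_Basis_matrix:
  fixes h :: "'f::euclidean_space^'n^'m \<Rightarrow> 'c::comm_monoid_mult"
  shows "prod h Basis = (\<Prod>i\<in>UNIV. \<Prod>j\<in>UNIV. \<Prod>b\<in>Basis. h (axis i (axis j b)))"
proof -
  have inj: "inj_on (\<lambda>(i, j, b). axis i (axis j b)) (UNIV \<times> UNIV \<times> (Basis :: 'f set))"
    by (auto simp: inj_on_def axis_eq_axis)
  show ?thesis
    unfolding Basis_matrix prod.reindex[OF inj] prod.cartesian_product
    by (rule prod.cong) (simp_all add: case_prod_beta)
qed

lemma borel_measurable_matrix_of_family [measurable]:
  fixes \<mu> :: "'f::arch_local_field measure"
  assumes "sets \<mu> = sets borel"
  shows "(\<lambda>x. \<chi> i j. x (i, j)) \<in> Pi\<^sub>M (UNIV :: ('n::finite \<times> 'n) set) (\<lambda>_. \<mu>) \<rightarrow>\<^sub>M (borel :: ('f^'n^'n) measure)"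
proof (subst borel_measurable_euclidean_space, intro ballI)
  fix e :: "'f^'n^'n" assume "e \<in> Basis"
  then obtain i j b where e: "e = axis i (axis j b)" by (auto simp: Basis_matrix)
  have "(\<lambda>x. x (i, j)) \<in> Pi\<^sub>M (UNIV :: ('n \<times> 'n) set) (\<lambda>_. \<mu>) \<rightarrow>\<^sub>M \<mu>" by simp
  then have "(\<lambda>x. x (i, j)) \<in> borel_measurable (Pi\<^sub>M (UNIV :: ('n \<times> 'n) set) (\<lambda>_. \<mu>))"
    using measurable_cong_sets[OF refl assms] by blast
  then show "(\<lambda>x. (\<chi> i j. x (i, j)) \<bullet> e) \<in> borel_measurable (Pi\<^sub>M (UNIV :: ('n \<times> 'n) set) (\<lambda>_. \<mu>))"
    unfolding e inner_matrix_unit by simp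
qed

lemma emeasure_additive_matrix_measure:
  fixes \<mu> :: "'f::arch_local_field measure" and A :: "'n::finite \<Rightarrow> 'n \<Rightarrow> 'f set"
  assumes "sets \<mu> = sets borel" "sigma_finite_measure \<mu>" "\<And>i j. A i j \<in> sets borel"
    and S: "{x :: 'f^'n^'n. \<forall>i j. x $ i $ j \<in> A i j} \<in> sets borel"
  shows "emeasure (additive_matrix_measure \<mu>) {x. \<forall>i j. x $ i $ j \<in> A i j} = (\<Prod>i\<in>UNIV. \<Prod>j\<in>UNIV. emeasure \<mu> (A i j))"
proof -
  interpret product_sigma_finite "\<lambda>_ :: 'n \<times> 'n. \<mu>"
    using assms(2) by (simp add: product_sigma_finite_def)
  let ?P = "Pi\<^sub>M (UNIV :: ('n \<times> 'n) set) (\<lambda>_. \<mu>)"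
  have "(\<lambda>x. \<chi> i j. x (i, j)) -` {x. \<forall>i j. x $ i $ j \<in> A i j} \<inter> space ?P = Pi\<^sub>E UNIV (\<lambda>(i, j). A i j)"
    using assms(1) by (auto simp: space_PiM PiE_iff sets_eq_imp_space_eq[OF assms(1)])
  then have "emeasure (additive_matrix_measure \<mu>) {x. \<forall>i j. x $ i $ j \<in> A i j} = emeasure ?P (Pi\<^sub>E UNIV (\<lambda>(i, j). A i j))"
    unfolding additive_matrix_measure_def
    by (subst emeasure_distr[OF borel_measurable_matrix_of_family[OF assms(1)] S]) simp
  also have "\<dots> = (\<Prod>p\<in>UNIV. emeasure \<mu> (case p of (i, j) \<Rightarrow> A i j))"
    using assms by (intro emeasure_PiM) auto
  also have "\<dots> = (\<Prod>i\<in>UNIV. \<Prod>j\<in>UNIV. emeasure \<mu> (A i j))"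
    unfolding UNIV_Times_UNIV[symmetric] by (subst prod.cartesian_product) (simp add: case_prod_beta)
  finally show ?thesis .
qed

text \<open>
  Lebesgue measure is determined by its values on boxes, and the box of a matrix space is a
  product of boxes of the entries.
\<close>

lemma additive_matrix_measure_eq_lborel:
  fixes c :: real
  assumes "c > 0"
  shows "additive_matrix_measure (scale_measure (ennreal c) lborel) =
    scale_measure (ennreal (c ^ (CARD('n) * CARD('n)))) (lborel :: ('f::arch_local_field^'n^'n) measure)"
proof -
  let ?\<mu> = "scale_measure (ennreal c) (lborel :: 'f measure)"
  let ?C = "c ^ (CARD('n) * CARD('n))"
  define \<alpha> where "\<alpha> = (additive_matrix_measure ?\<mu> :: ('f^'n^'n) measure)"
  have sf: "sigma_finite_measure ?\<mu>"
  proof -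
    have "?\<mu> = density lborel (\<lambda>_. ennreal c)"
      by (rule measure_eqI) (simp_all add: emeasure_density_const)
    moreover have "sigma_finite_measure (density lborel (\<lambda>_. ennreal c) :: 'f measure)"
      by (subst sigma_finite_measure.sigma_finite_iff_density_finite[OF sigma_finite_lborel]) auto
    ultimately show ?thesis by simp
  qed
  have C: "?C > 0" using assms by simp
  have box: "emeasure \<alpha> (box l u) = ennreal ?C * ennreal (\<Prod>b\<in>Basis. (u - l) \<bullet> b)"
    if le: "\<And>b. b \<in> Basis \<Longrightarrow> l \<bullet> b \<le> u \<bullet> b" for l u :: "'f^'n^'n"
  proof -
    have le': "l $ i $ j \<bullet> b \<le> u $ i $ j \<bullet> b" if "b \<in> Basis" for i j b
      using le[of "axis i (axis j b)"] matrix_unit_Basis[OF that] by (simp add: inner_matrix_unit)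
    have eq: "box l u = {x. \<forall>i j. x $ i $ j \<in> box (l $ i $ j) (u $ i $ j)}"
      by (auto simp: mem_box Basis_matrix inner_matrix_unit)
    have "emeasure \<alpha> (box l u) = (\<Prod>i\<in>UNIV. \<Prod>j\<in>UNIV. emeasure ?\<mu> (box (l $ i $ j) (u $ i $ j)))"
      unfolding eq \<alpha>_def by (rule emeasure_additive_matrix_measure[OF _ sf]) (simp_all flip: eq)
    also have "\<dots> = (\<Prod>i\<in>UNIV. \<Prod>j\<in>UNIV. ennreal (c * (\<Prod>b\<in>Basis. (u $ i $ j - l $ i $ j) \<bullet> b)))"
      using assms le' by (intro prod.cong refl) (auto simp: emeasure_lborel_box ennreal_mult' prod_nonneg inner_diff_left)
    also have "\<dots> = ennreal (\<Prod>i\<in>(UNIV::'n set). \<Prod>j\<in>(UNIV::'n set). c * (\<Prod>b\<in>Basis. (u $ i $ j - l $ i $ j) \<bullet> b))"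
      using assms le' by (subst prod_ennreal, force intro!: mult_nonneg_nonneg prod_nonneg simp: inner_diff_left)+ simp
    also have "(\<Prod>i\<in>(UNIV::'n set). \<Prod>j\<in>(UNIV::'n set). c * (\<Prod>b\<in>Basis. (u $ i $ j - l $ i $ j) \<bullet> b))
       = ?C * (\<Prod>b\<in>Basis. (u - l) \<bullet> b)"
      by (simp add: prod_Basis_matrix inner_matrix_unit prod.distrib power_mult)
    finally show ?thesis using C by (simp add: ennreal_mult')
  qed
  have "lborel = scale_measure (ennreal (1 / ?C)) \<alpha>"
  proof (rule lborel_eqI)
    show "sets (scale_measure (ennreal (1 / ?C)) \<alpha>) = sets borel" by (simp add: \<alpha>_def additive_matrix_measure_def)
    fix l u :: "'f^'n^'n" assume le: "\<And>b. b \<in> Basis \<Longrightarrow> l \<bullet> b \<le> u \<bullet> b"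
    have "0 \<le> (\<Prod>b\<in>Basis. (u - l) \<bullet> b)" using le by (auto intro!: prod_nonneg simp: inner_diff_left)
    then show "emeasure (scale_measure (ennreal (1 / ?C)) \<alpha>) (box l u) = ennreal (\<Prod>b\<in>Basis. (u - l) \<bullet> b)"
      using C assms by (simp add: box[OF le] mult.assoc[symmetric] ennreal_mult'[symmetric])
  qed
  then have "scale_measure (ennreal ?C) (lborel :: ('f^'n^'n) measure) = scale_measure (ennreal ?C) (scale_measure (ennreal (1 / ?C)) \<alpha>)"
    by (rule arg_cong)
  also have "\<dots> = \<alpha>" using C assms by (simp add: scale_scale_measure ennreal_mult'[symmetric] del: ennreal_power)
  finally show ?thesis by (simp add: \<alpha>_def)
qed

text \<open>
  The uniqueness argument for Haar measures. With \<open>B\<close> the unit ball, the integral of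
  \<open>1\<^sub>B(y) 1\<^sub>A(x + y)\<close> over both variables is \<open>\<nu>(A)\<close> times the volume of \<open>B\<close> when \<open>x\<close> is
  integrated first; after the substitution \<open>y \<mapsto> y - x\<close> it is a constant times the volume of
  \<open>A\<close>.
\<close>

lemma translation_invariant_eq_lborel:
  fixes \<nu> :: "'a::euclidean_space measure"
  assumes s: "sets \<nu> = sets borel" and sf: "sigma_finite_measure \<nu>"
    and inv: "\<And>a. distr \<nu> borel ((+) a) = \<nu>"
  shows "\<exists>k. \<forall>A\<in>sets borel. emeasure \<nu> A = k * emeasure lborel A"
proof -
  interpret N: sigma_finite_measure \<nu> by fact
  interpret P: pair_sigma_finite \<nu> "lborel :: 'a measure" ..
  have [measurable_cong]: "sets \<nu> = sets borel" by fact
  define B where "B = ball (0::'a) 1"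
  define V where "V = emeasure lborel B"
  define k where "k = (\<integral>\<^sup>+x. indicator B (- x) \<partial>\<nu>)"
  have V: "V \<noteq> 0" "V \<noteq> \<infinity>"
  proof -
    show "V \<noteq> \<infinity>" using emeasure_lborel_ball_finite[of 0 1] by (simp add: V_def B_def less_top[symmetric])
    show "V \<noteq> 0" unfolding V_def B_def by (subst emeasure_ball) (auto simp: unit_ball_vol_pos less_imp_neq[symmetric])
  qed
  have inv_int: "(\<integral>\<^sup>+x. f (a + x) \<partial>\<nu>) = (\<integral>\<^sup>+x. f x \<partial>\<nu>)" if [measurable]: "f \<in> borel_measurable borel" for f a
  proof -
    have "(\<integral>\<^sup>+x. f x \<partial>\<nu>) = (\<integral>\<^sup>+x. f x \<partial>(distr \<nu> borel ((+) a)))" by (simp only: inv)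
    also have "\<dots> = (\<integral>\<^sup>+x. f (a + x) \<partial>\<nu>)" by (rule nn_integral_distr) measurable
    finally show ?thesis by simp
  qed
  have inv_l: "(\<integral>\<^sup>+x. f (a + x) \<partial>lborel) = (\<integral>\<^sup>+x. f x \<partial>(lborel :: 'a measure))" if [measurable]: "f \<in> borel_measurable borel" for f a
  proof -
    have "(\<integral>\<^sup>+x. f x \<partial>lborel) = (\<integral>\<^sup>+x. f x \<partial>(distr lborel borel ((+) a)))" by (subst lborel_distr_plus) simp
    also have "\<dots> = (\<integral>\<^sup>+x. f (a + x) \<partial>lborel)" by (rule nn_integral_distr) measurable
    finally show ?thesis by simp
  qed
  have [measurable]: "B \<in> sets borel" by (simp add: B_def)
  have "emeasure \<nu> A * V = k * emeasure lborel A" if [measurable]: "A \<in> sets borel" for A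
  proof -
    have "emeasure \<nu> A * V = (\<integral>\<^sup>+y. indicator B y * emeasure \<nu> A \<partial>lborel)"
      by (simp add: V_def nn_integral_multc mult.commute)
    also have "\<dots> = (\<integral>\<^sup>+y. indicator B y * (\<integral>\<^sup>+x. indicator A (y + x) \<partial>\<nu>) \<partial>lborel)"
      using inv_int[of "indicator A"] by (simp add: s)
    also have "\<dots> = (\<integral>\<^sup>+y. (\<integral>\<^sup>+x. indicator B y * indicator A (y + x) \<partial>\<nu>) \<partial>lborel)"
      by (intro nn_integral_cong nn_integral_cmult[symmetric]) measurable
    also have "\<dots> = (\<integral>\<^sup>+x. (\<integral>\<^sup>+y. indicator B y * indicator A (y + x) \<partial>lborel) \<partial>\<nu>)"
      by (rule P.Fubini') measurable
    also have "\<dots> = (\<integral>\<^sup>+x. (\<integral>\<^sup>+y. indicator B (y - x) * indicator A y \<partial>lborel) \<partial>\<nu>)"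
    proof (rule nn_integral_cong)
      fix x
      show "(\<integral>\<^sup>+y. indicator B y * indicator A (y + x) \<partial>lborel) = (\<integral>\<^sup>+y. indicator B (y - x) * indicator A y \<partial>lborel)"
        using inv_l[of "\<lambda>y. indicator B (y - x) * indicator A y" x] by (simp add: add.commute)
    qed
    also have "\<dots> = (\<integral>\<^sup>+y. (\<integral>\<^sup>+x. indicator B (y - x) * indicator A y \<partial>\<nu>) \<partial>lborel)"
      by (rule P.Fubini'[symmetric]) measurable
    also have "\<dots> = (\<integral>\<^sup>+y. (\<integral>\<^sup>+x. indicator B (y - x) \<partial>\<nu>) * indicator A y \<partial>lborel)"
      by (intro nn_integral_cong nn_integral_multc) measurable
    also have "\<dots> = (\<integral>\<^sup>+y. k * indicator A y \<partial>lborel)"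
    proof (intro nn_integral_cong arg_cong2[where f = "(*)"] refl)
      fix y :: 'a
      show "(\<integral>\<^sup>+x. indicator B (y - x) \<partial>\<nu>) = k"
        using inv_int[of "\<lambda>x. indicator B (y - x)" y] by (simp add: k_def)
    qed
    also have "\<dots> = k * emeasure lborel A" by (simp add: nn_integral_cmult)
    finally show ?thesis .
  qed
  note eq = this
  have "emeasure \<nu> A = (k / V) * emeasure lborel A" if "A \<in> sets borel" for A
  proof -
    have "emeasure \<nu> A = emeasure \<nu> A * V / V" using V by (simp add: mult_divide_eq_ennreal)
    also have "\<dots> = k * emeasure lborel A / V" by (simp only: eq[OF that])
    also have "\<dots> = (k / V) * emeasure lborel A" by (simp only: ennreal_divide_times ennreal_times_divide)
    finally show ?thesis .
  qed
  then show ?thesis by blast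
qed

text \<open>
  The unipotent factors of Gaussian elimination: \<open>col_unipotent k\<close> on the left adds multiples
  of row \<open>k\<close> to the other rows, \<open>row_unipotent k\<close> on the right adds multiples of column \<open>k\<close> to
  the other columns.
\<close>

definition col_unipotent :: "'n \<Rightarrow> ('n \<Rightarrow> 'f) \<Rightarrow> 'f::arch_local_field^'n^'n" where
  "col_unipotent k c = (\<chi> i j. (if i = j then 1 else 0) + (if j = k \<and> i \<noteq> k then c i else 0))"

definition row_unipotent :: "'n \<Rightarrow> ('n \<Rightarrow> 'f) \<Rightarrow> 'f::arch_local_field^'n^'n" where
  "row_unipotent k r = (\<chi> i j. (if i = j then 1 else 0) + (if i = k \<and> j \<noteq> k then r j else 0))"

definition row_scaling :: "'n \<Rightarrow> 'f \<Rightarrow> 'f::arch_local_field^'n^'n" where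
  "row_scaling k a = (\<chi> i j. if i = j then (if i = k then a else 1) else 0)"

lemma col_unipotent_mult_index:
  "(col_unipotent k c ** A) $ i $ j = A $ i $ j + (if i \<noteq> k then c i * A $ k $ j else 0)"
proof -
  have "(col_unipotent k c ** A) $ i $ j
      = (\<Sum>l\<in>UNIV. (if l = i then A $ i $ j else 0) + (if l = k then (if i \<noteq> k then c i * A $ k $ j else 0) else 0))"
    unfolding matrix_matrix_mult_def col_unipotent_def vec_lambda_beta
    by (rule sum.cong) (simp_all add: distrib_right)
  then show ?thesis by (simp add: sum.distrib)
qed

lemma mult_row_unipotent_index:
  "(A ** row_unipotent k r) $ i $ j = A $ i $ j + (if j \<noteq> k then A $ i $ k * r j else 0)"
proof -
  have "(A ** row_unipotent k r) $ i $ j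
      = (\<Sum>l\<in>UNIV. (if l = j then A $ i $ j else 0) + (if l = k then (if j \<noteq> k then A $ i $ k * r j else 0) else 0))"
    unfolding matrix_matrix_mult_def row_unipotent_def vec_lambda_beta
    by (rule sum.cong) (simp_all add: distrib_left)
  then show ?thesis by (simp add: sum.distrib)
qed

lemma row_scaling_mult_index:
  "(row_scaling k a ** A) $ i $ j = (if i = k then a * A $ i $ j else A $ i $ j)"
proof -
  have "(row_scaling k a ** A) $ i $ j = (\<Sum>l\<in>UNIV. if l = i then (if i = k then a * A $ i $ j else A $ i $ j) else 0)"
    unfolding matrix_matrix_mult_def row_scaling_def vec_lambda_beta
    by (rule sum.cong) simp_all
  then show ?thesis by simp
qed

lemma mult_row_scaling_index:
  "(A ** row_scaling k a) $ i $ j = (if j = k then A $ i $ j * a else A $ i $ j)"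
proof -
  have "(A ** row_scaling k a) $ i $ j = (\<Sum>l\<in>UNIV. if l = j then (if j = k then A $ i $ j * a else A $ i $ j) else 0)"
    unfolding matrix_matrix_mult_def row_scaling_def vec_lambda_beta
    by (rule sum.cong) simp_all
  then show ?thesis by simp
qed

text \<open>
  Doubling row and column \<open>k\<close> by a diagonal matrix conjugates \<open>col_unipotent k c\<close> to its
  square root and \<open>row_unipotent k c\<close> to its square. The character does not notice the
  conjugation, so it takes a nonzero value that is its own square, that is, 1. Gaussian
  elimination reduces every invertible matrix to a diagonal one by such factors.
\<close>

lemma GL_character_trivial:
  fixes \<omega> :: "'f::arch_local_field^'n^'n \<Rightarrow> real"
  assumes mult: "\<And>g h. g \<in> GL \<Longrightarrow> h \<in> GL \<Longrightarrow> \<omega> (g ** h) = \<omega> g * \<omega> h"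
    and nz: "\<And>g. g \<in> GL \<Longrightarrow> \<omega> g \<noteq> 0"
    and diag: "\<And>g. g \<in> GL \<Longrightarrow> (\<And>i j. i \<noteq> j \<Longrightarrow> g $ i $ j = 0) \<Longrightarrow> \<omega> g = 1"
    and "g \<in> GL"
  shows "\<omega> g = 1"
proof -
  have sc: "row_scaling k 2 \<in> GL" for k :: 'n
    by (simp add: GL_iff_det row_scaling_def det_diagonal)
  have col_GL: "col_unipotent k c \<in> (GL :: ('f^'n^'n) set)" for k c
  proof -
    have "col_unipotent k c ** col_unipotent k (\<lambda>i. - c i) = (mat 1 :: 'f^'n^'n)"
      by (auto simp: vec_eq_iff col_unipotent_mult_index) (auto simp: col_unipotent_def mat_def)
    then show ?thesis using matrix_left_right_inverse unfolding GL_def invertible_def by blast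
  qed
  have row_GL: "row_unipotent k c \<in> (GL :: ('f^'n^'n) set)" for k c
  proof -
    have "row_unipotent k c ** row_unipotent k (\<lambda>i. - c i) = (mat 1 :: 'f^'n^'n)"
      by (auto simp: vec_eq_iff mult_row_unipotent_index) (auto simp: row_unipotent_def mat_def)
    then show ?thesis using matrix_left_right_inverse unfolding GL_def invertible_def by blast
  qed
  have sc1: "\<omega> (row_scaling k 2) = 1" for k
    by (rule diag[OF sc]) (simp add: row_scaling_def)
  have col: "\<omega> (col_unipotent k c) = 1" for k c
  proof -
    define d where "d i = c i / 2" for i
    have "row_scaling k 2 ** col_unipotent k c = col_unipotent k d ** row_scaling k 2"
      by (auto simp: vec_eq_iff row_scaling_mult_index mult_row_scaling_index) (auto simp: col_unipotent_def d_def)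
    then have "\<omega> (col_unipotent k c) = \<omega> (col_unipotent k d)"
      using mult[OF sc col_GL, of k k c] mult[OF col_GL sc, of k d k] by (simp add: sc1)
    moreover have "col_unipotent k d ** col_unipotent k d = col_unipotent k c"
      by (auto simp: vec_eq_iff col_unipotent_mult_index) (auto simp: col_unipotent_def d_def)
    ultimately have "\<omega> (col_unipotent k d) = \<omega> (col_unipotent k d) * \<omega> (col_unipotent k d)"
      using mult[OF col_GL col_GL, of k d k d] by simp
    then show ?thesis using nz[OF col_GL, of k d] \<open>\<omega> (col_unipotent k c) = \<omega> (col_unipotent k d)\<close> by simp
  qed
  have row: "\<omega> (row_unipotent k c) = 1" for k c
  proof -
    define d where "d i = 2 * c i" for i
    have "row_scaling k 2 ** row_unipotent k c = row_unipotent k d ** row_scaling k 2"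
      by (auto simp: vec_eq_iff row_scaling_mult_index mult_row_scaling_index) (auto simp: row_unipotent_def d_def)
    then have "\<omega> (row_unipotent k c) = \<omega> (row_unipotent k d)"
      using mult[OF sc row_GL, of k k c] mult[OF row_GL sc, of k d k] by (simp add: sc1)
    moreover have "row_unipotent k c ** row_unipotent k c = row_unipotent k d"
      by (auto simp: vec_eq_iff mult_row_unipotent_index) (auto simp: row_unipotent_def d_def)
    ultimately have "\<omega> (row_unipotent k c) = \<omega> (row_unipotent k c) * \<omega> (row_unipotent k c)"
      using mult[OF row_GL row_GL, of k c k c] by simp
    then show ?thesis using nz[OF row_GL, of k c] by simp
  qed
  \<comment> \<open>Elimination, with \<open>K\<close> the set of indices whose row and column have already
     been cleared.\<close>
  have "\<omega> A = 1" if "A \<in> GL" "\<And>i j. i \<in> K \<Longrightarrow> j \<noteq> i \<Longrightarrow> A $ i $ j = 0 \<and> A $ j $ i = 0" for A K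
    using that
  proof (induction "card (- K)" arbitrary: A K)
    case 0
    then have "- K = {}" by simp
    then have "K = UNIV" by blast
    then show ?case using 0 by (intro diag) auto
  next
    case (Suc m)
    then obtain k where k: "k \<notin> K" by (metis Compl_iff card.empty equals0I nat.distinct(1))
    have "\<exists>j. A $ k $ j \<noteq> 0"
    proof (rule ccontr)
      assume "\<not> ?thesis"
      then have "row k A = 0" by (simp add: row_def vec_eq_iff)
      then have "det A = 0" by (rule det_zero_row(2))
      then show False using Suc.prems(1) by (simp add: GL_iff_det)
    qed
    then obtain j where j: "A $ k $ j \<noteq> 0" by blast
    have "\<exists>B. B \<in> GL \<and> \<omega> B = \<omega> A \<and> B $ k $ k \<noteq> 0 \<and> (\<forall>i j. i \<in> K \<longrightarrow> j \<noteq> i \<longrightarrow> B $ i $ j = 0 \<and> B $ j $ i = 0)"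
    proof (cases "A $ k $ k = 0")
      case False then show ?thesis using Suc.prems by blast
    next
      case True
      then have jk: "j \<noteq> k" using j by auto
      then have jK: "j \<notin> K" using Suc.prems(2)[of j k] j by auto
      \<comment> \<open>The pivot vanishes: column \<open>j\<close> is added to column \<open>k\<close>.\<close>
      define B where "B = A ** row_unipotent j (\<lambda>i. if i = k then 1 else 0)"
      have ind: "B $ a $ b = A $ a $ b + (if b = k then A $ a $ j else 0)" for a b
        using jk by (auto simp: B_def mult_row_unipotent_index)
      have "B \<in> GL" "\<omega> B = \<omega> A" using Suc.prems(1) by (auto simp: B_def row_GL mult row)
      moreover have "B $ k $ k \<noteq> 0" using j True by (simp add: ind)
      moreover have "B $ a $ b = 0 \<and> B $ b $ a = 0" if "a \<in> K" "b \<noteq> a" for a b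
        using Suc.prems(2)[OF that] Suc.prems(2)[OF that(1), of j] that k jK by (auto simp: ind)
      ultimately show ?thesis by blast
    qed
    then obtain B where B: "B \<in> GL" "\<omega> B = \<omega> A" "B $ k $ k \<noteq> 0"
      "\<And>i j. i \<in> K \<Longrightarrow> j \<noteq> i \<Longrightarrow> B $ i $ j = 0 \<and> B $ j $ i = 0" by blast
    define B' where "B' = col_unipotent k (\<lambda>i. - B $ i $ k / B $ k $ k) ** B"
    define C where "C = B' ** row_unipotent k (\<lambda>j. - B $ k $ j / B $ k $ k)"
    have B'i: "B' $ a $ b = B $ a $ b + (if a \<noteq> k then - B $ a $ k / B $ k $ k * B $ k $ b else 0)" for a b
      by (simp add: B'_def col_unipotent_mult_index)
    have Ci: "C $ a $ b = B' $ a $ b + (if b \<noteq> k then B' $ a $ k * (- B $ k $ b / B $ k $ k) else 0)" for a b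
      by (simp add: C_def mult_row_unipotent_index)
    have "B' \<in> GL" "\<omega> B' = \<omega> B" using B(1) by (auto simp: B'_def col_GL mult col)
    then have CGL: "C \<in> GL" and Cchi: "\<omega> C = \<omega> B" by (auto simp: C_def row_GL mult row)
    have Cz: "C $ a $ b = 0 \<and> C $ b $ a = 0" if "a \<in> insert k K" "b \<noteq> a" for a b
    proof (cases "a = k")
      case True
      then show ?thesis using that B(3) by (simp add: Ci B'i)
    next
      case False
      then have aK: "a \<in> K" using that by simp
      have "B $ a $ k = 0" "B $ k $ a = 0" using B(4)[OF aK, of k] False by auto
      then show ?thesis using B(4)[OF aK that(2)] False by (auto simp: Ci B'i)
    qed
    have "m = card (- insert k K)" using Suc.hyps(2) k
      by (metis Compl_insert Compl_iff card_Diff_singleton diff_Suc_1 finite)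
    then have "\<omega> C = 1" using Suc.hyps(1)[of "insert k K" C] CGL Cz by blast
    then show ?case using Cchi B(2) by simp
  qed
  from this[of g "{}"] assms(4) show ?thesis by simp
qed

lemma absF_mult: "absF (x * y) = absF x * absF y"
  by (simp add: absF_def norm_mult power_mult_distrib)

lemma absF_pos: "x \<noteq> 0 \<Longrightarrow> absF x > 0"
  by (simp add: absF_def)

lemma absF_prod: "absF (prod f A) = (\<Prod>i\<in>A. absF (f i))"
  by (simp add: absF_def prod_norm[symmetric] prod_power_distrib)

lemma measurable_left_mult [measurable]:
  fixes g :: "'f::arch_local_field^'n^'n"
  shows "(\<lambda>x. g ** x) \<in> borel \<rightarrow>\<^sub>M (borel :: ('f^'n^'n) measure)"
  by (intro borel_measurable_continuous_onI linear_continuous_on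
      bounded_bilinear.bounded_linear_right[OF bounded_bilinear_matrix_mult])

lemma GL_cancel_left: "g \<in> GL \<Longrightarrow> matrix_inv g ** (g ** x) = x" "g \<in> GL \<Longrightarrow> g ** (matrix_inv g ** x) = x"
  for g x :: "'f::arch_local_field^'n^'n"
  by (simp_all add: matrix_mul_assoc matrix_inv_GL)

lemma emeasure_polydisc:
  fixes r :: "'n::finite \<Rightarrow> real"
  assumes "\<And>i. r i > 0"
  shows "{x :: 'f::arch_local_field^'n^'n. \<forall>i j. x $ i $ j \<in> ball 0 (r i)} \<in> sets borel"
    "emeasure lborel {x :: 'f^'n^'n. \<forall>i j. x $ i $ j \<in> ball 0 (r i)}
      = ennreal (\<Prod>i\<in>(UNIV::'n set). (unit_ball_vol (real DIM('f)) * r i ^ DIM('f)) ^ CARD('n))"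
proof -
  have eq: "{x :: 'f^'n^'n. \<forall>i j. x $ i $ j \<in> ball 0 (r i)} = (\<Inter>i. \<Inter>j. {x. norm (x $ i $ j) < r i})"
    by auto
  show S: "{x :: 'f^'n^'n. \<forall>i j. x $ i $ j \<in> ball 0 (r i)} \<in> sets borel"
    unfolding eq by (intro borel_open open_INT finite_class.finite_UNIV ballI open_Collect_less continuous_intros)
  have "emeasure (additive_matrix_measure (lborel :: 'f measure)) {x :: 'f^'n^'n. \<forall>i j. x $ i $ j \<in> ball 0 (r i)}
    = (\<Prod>i\<in>(UNIV::'n set). \<Prod>j\<in>(UNIV::'n set). emeasure lborel (ball (0::'f) (r i)))"
    by (rule emeasure_additive_matrix_measure[OF _ sigma_finite_lborel _ S]) simp_all
  moreover have "additive_matrix_measure (lborel :: 'f measure) = (lborel :: ('f^'n^'n) measure)"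
    using additive_matrix_measure_eq_lborel[of 1, where 'f='f and 'n='n] by simp
  ultimately show "emeasure lborel {x :: 'f^'n^'n. \<forall>i j. x $ i $ j \<in> ball 0 (r i)}
      = ennreal (\<Prod>i\<in>(UNIV::'n set). (unit_ball_vol (real DIM('f)) * r i ^ DIM('f)) ^ CARD('n))"
    using assms
    by (simp add: emeasure_ball less_imp_le ennreal_power prod_ennreal)
qed

text \<open>
  The image measure is translation invariant, hence a multiple of Lebesgue measure, and the
  factor is multiplicative in \<open>g\<close>. Its product with \<open>absF (det g) ^ n\<close> is therefore a
  character, and on diagonal matrices this character is seen to be trivial from the volumes of
  polydiscs.
\<close>

lemma lborel_left_mult:
  fixes g :: "'f::arch_local_field^'n^'n"
  assumes g: "g \<in> GL"
  shows "distr lborel borel (\<lambda>x :: 'f^'n^'n. g ** x) = scale_measure (ennreal (inverse (absF (det g) ^ CARD('n)))) lborel"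
proof -
  let ?\<nu> = "\<lambda>g. distr lborel borel (\<lambda>x :: 'f^'n^'n. g ** x)"
  let ?V = "unit_ball_vol (real DIM('f))"
  have "\<exists>k. \<forall>A\<in>sets borel. emeasure (?\<nu> g) A = k * emeasure lborel A" if g: "g \<in> GL" for g
  proof (rule translation_invariant_eq_lborel)
    have "distr (?\<nu> g) borel (\<lambda>x. matrix_inv g ** x) = distr lborel borel (\<lambda>x. x)"
      by (subst distr_distr) (simp_all add: o_def GL_cancel_left[OF g])
    also have "\<dots> = lborel" by (rule distr_id2) simp
    finally have "sigma_finite_measure (distr (?\<nu> g) borel (\<lambda>x. matrix_inv g ** x))"
      using sigma_finite_lborel by simp
    then show "sigma_finite_measure (?\<nu> g)" by (rule sigma_finite_measure_distr) simp
    fix a :: "'f^'n^'n"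
    have "distr (?\<nu> g) borel ((+) a) = distr lborel borel (\<lambda>x. a + g ** x)"
      by (subst distr_distr) (simp_all add: o_def)
    also have "\<dots> = distr lborel borel (\<lambda>x. g ** (matrix_inv g ** a + x))"
      by (simp add: matrix_add_ldistrib GL_cancel_left[OF g])
    also have "\<dots> = distr (distr lborel borel ((+) (matrix_inv g ** a))) borel (\<lambda>x. g ** x)"
      by (subst distr_distr) (simp_all add: o_def)
    also have "\<dots> = ?\<nu> g" by (subst lborel_distr_plus) simp
    finally show "distr (?\<nu> g) borel ((+) a) = ?\<nu> g" .
  qed simp
  then obtain k where k: "\<And>g A. g \<in> GL \<Longrightarrow> A \<in> sets borel \<Longrightarrow> emeasure (?\<nu> g) A = k g * emeasure lborel A"
    by metis
  define P where "P = {x :: 'f^'n^'n. \<forall>i j. x $ i $ j \<in> ball 0 ((\<lambda>_. 1) i)}"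
  have Vp: "?V > 0" by (simp add: unit_ball_vol_pos)
  have P: "P \<in> sets borel" "emeasure lborel P = ennreal (?V ^ (CARD('n) * CARD('n)))"
    using emeasure_polydisc[of "\<lambda>_ :: 'n. 1", where 'f='f] by (simp_all add: P_def power_mult)
  have P0: "emeasure lborel P \<noteq> 0" "emeasure lborel P \<noteq> top" using less_imp_neq[OF Vp] by (simp_all add: P(2))
  have cancel: "a = b" if "a * emeasure lborel P = b * emeasure lborel P" for a b
    using that mult_divide_eq_ennreal[OF P0] by metis
  have kmult: "k (g ** h) = k g * k h" if "g \<in> GL" "h \<in> GL" for g h
  proof (rule cancel)
    have S: "(\<lambda>x. g ** x) -` P \<in> sets borel" using measurable_sets[OF measurable_left_mult P(1)] by simp
    have "emeasure (?\<nu> (g ** h)) P = emeasure (?\<nu> h) ((\<lambda>x. g ** x) -` P)"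
      using P(1) S by (simp add: emeasure_distr vimage_def matrix_mul_assoc)
    also have "\<dots> = k h * emeasure (?\<nu> g) P"
      using P(1) k[OF that(2) S] by (simp add: emeasure_distr)
    finally show "k (g ** h) * emeasure lborel P = k g * k h * emeasure lborel P"
      using k[OF _ P(1)] that by (simp add: mult_ac)
  qed
  have k1: "k (mat 1) = 1"
  proof (rule cancel)
    show "k (mat 1) * emeasure lborel P = 1 * emeasure lborel P"
      using k[OF one_GL P(1)] P(1) by (simp add: emeasure_distr)
  qed
  have kinv: "k g * k (matrix_inv g) = 1" if "g \<in> GL" for g
    using kmult[OF that matrix_inv_in_GL[OF that]] k1 by (simp add: matrix_inv_GL[OF that])
  have kfin: "k g \<noteq> 0 \<and> k g \<noteq> top" if "g \<in> GL" for g
    using kinv[OF that] by (auto simp: ennreal_top_mult split: if_splits)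
  have "enn2real (k g) * absF (det g) ^ CARD('n) = 1"
  proof (rule GL_character_trivial[OF _ _ _ g])
    fix g h :: "'f^'n^'n" assume "g \<in> GL" "h \<in> GL"
    then show "enn2real (k (g ** h)) * absF (det (g ** h)) ^ CARD('n) =
      enn2real (k g) * absF (det g) ^ CARD('n) * (enn2real (k h) * absF (det h) ^ CARD('n))"
      by (simp add: kmult enn2real_mult det_mul absF_mult power_mult_distrib)
  next
    fix g :: "'f^'n^'n" assume "g \<in> GL"
    then show "enn2real (k g) * absF (det g) ^ CARD('n) \<noteq> 0"
      using kfin[of g] absF_pos[of "det g"] by (auto simp: enn2real_eq_0_iff GL_iff_det)
  next
    fix D :: "'f^'n^'n" assume D: "D \<in> GL" "\<And>i j. i \<noteq> j \<Longrightarrow> D $ i $ j = 0"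
    have det: "det D = (\<Prod>i\<in>UNIV. D $ i $ i)" by (rule det_diagonal) (use D in auto)
    then have nz: "D $ i $ i \<noteq> 0" for i using D(1) by (auto simp: GL_iff_det)
    have ind: "(D ** x) $ i $ j = D $ i $ i * x $ i $ j" for x i j
    proof -
      have "(D ** x) $ i $ j = (\<Sum>l\<in>UNIV. if l = i then D $ i $ i * x $ i $ j else 0)"
        unfolding matrix_matrix_mult_def vec_lambda_beta by (rule sum.cong) (use D(2) in auto)
      then show ?thesis by simp
    qed
    define Pi where "Pi = (\<Prod>i\<in>(UNIV::'n set). norm (D $ i $ i) ^ DIM('f)) ^ CARD('n)"
    have absd: "absF (det D) ^ CARD('n) = Pi" by (simp add: det absF_prod Pi_def) (simp add: absF_def)
    have Pi0: "Pi > 0" using nz by (simp add: Pi_def prod_pos)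
    have "k D * emeasure lborel P = emeasure lborel ((\<lambda>x. D ** x) -` P)"
      using k[OF D(1) P(1)] P(1) by (simp add: emeasure_distr)
    also have "(\<lambda>x. D ** x) -` P = {x. \<forall>i j. x $ i $ j \<in> ball 0 (1 / norm (D $ i $ i))}"
      using nz by (auto simp: P_def ind norm_mult pos_less_divide_eq mult.commute)
    also have "emeasure lborel \<dots> = ennreal (\<Prod>i\<in>(UNIV::'n set). (?V * (1 / norm (D $ i $ i)) ^ DIM('f)) ^ CARD('n))"
      by (rule emeasure_polydisc(2)) (use nz in simp)
    also have "(\<Prod>i\<in>(UNIV::'n set). (?V * (1 / norm (D $ i $ i)) ^ DIM('f)) ^ CARD('n)) = ?V ^ (CARD('n) * CARD('n)) / Pi"
    proof -
      have "(?V * (1 / norm (D $ i $ i)) ^ DIM('f)) ^ CARD('n) = ?V ^ CARD('n) / (norm (D $ i $ i) ^ DIM('f)) ^ CARD('n)" for i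
        by (simp add: power_divide)
      then show ?thesis by (simp add: prod_dividef Pi_def power_mult prod_power_distrib)
    qed
    also have "ennreal \<dots> = ennreal (1 / Pi) * emeasure lborel P"
      using Pi0 Vp by (simp add: P(2) ennreal_mult'[symmetric])
    finally have "k D = ennreal (1 / Pi)" by (rule cancel)
    then show "enn2real (k D) * absF (det D) ^ CARD('n) = 1" using Pi0 by (simp add: absd)
  qed
  then have "enn2real (k g) = inverse (absF (det g) ^ CARD('n))"
    by (metis inverse_unique mult.commute)
  then have kg: "k g = ennreal (inverse (absF (det g) ^ CARD('n)))"
    using kfin[OF g] by (metis ennreal_enn2real less_top)
  show ?thesis
    by (rule measure_eqI) (use k[OF g] kg in auto)
qed

lemma measurable_absF_det [measurable]:
  "(\<lambda>g. absF (det g)) \<in> borel_measurable (borel :: ('f::arch_local_field^'n^'n) measure)"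
  unfolding absF_def by (intro borel_measurable_continuous_onI continuous_intros)

lemma GL_measure_left_mult:
  fixes \<mu> :: "'f::arch_local_field measure" and g :: "'f^'n^'n"
  assumes \<mu>: "\<mu> = scale_measure (ennreal c) lborel" "c > 0" and g: "g \<in> GL"
  shows "distr (GL_measure \<mu>) borel (\<lambda>h. g ** h) = (GL_measure \<mu> :: ('f^'n^'n) measure)"
proof (rule measure_eqI)
  define w where "w h = indicator GL h * ennreal (inverse (absF (det h) ^ CARD('n)))" for h :: "'f^'n^'n"
  have wm [measurable]: "w \<in> borel_measurable borel"
    unfolding w_def by measurable
  define C where "C = ennreal (c ^ (CARD('n) * CARD('n)))"
  have GLm: "GL_measure \<mu> = density (scale_measure C lborel) w"
    unfolding GL_measure_def w_def C_def \<mu>(1) additive_matrix_measure_eq_lborel[OF \<mu>(2)] ..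
  show "sets (distr (GL_measure \<mu>) borel (\<lambda>h. g ** h)) = sets (GL_measure \<mu> :: ('f^'n^'n) measure)"
    by (simp add: GLm)
  fix A assume "A \<in> sets (distr (GL_measure \<mu>) borel (\<lambda>h. g ** h))"
  then have A [measurable]: "A \<in> sets borel" by simp
  have S [measurable]: "(\<lambda>x. g ** x) -` A \<in> sets borel" using measurable_sets[OF measurable_left_mult A] by simp
  have gi: "matrix_inv g \<in> GL" using g by simp
  have winv: "w (matrix_inv g ** h) = ennreal (absF (det g) ^ CARD('n)) * w h" for h
  proof (cases "h \<in> GL")
    case True
    then show ?thesis using g
      by (simp add: w_def det_mul det_matrix_inv absF_mult power_mult_distrib ennreal_mult'[symmetric])
         (simp add: absF_def norm_inverse power_inverse GL_iff_det ennreal_mult)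
  next
    case False
    then have "matrix_inv g ** h \<notin> GL" using g by (auto simp: GL_iff_det det_mul)
    then show ?thesis using False by (simp add: w_def)
  qed
  have "emeasure (distr (GL_measure \<mu>) borel (\<lambda>h. g ** h)) A = C * (\<integral>\<^sup>+h. w h * indicator A (g ** h) \<partial>lborel)"
    using A S by (simp add: GLm emeasure_distr emeasure_density nn_integral_scale_measure indicator_vimage[symmetric] o_def)
  also have "(\<integral>\<^sup>+h. w h * indicator A (g ** h) \<partial>lborel) = (\<integral>\<^sup>+h. w (matrix_inv g ** (g ** h)) * indicator A (g ** h) \<partial>lborel)"
    by (simp add: GL_cancel_left[OF g])
  also have "\<dots> = (\<integral>\<^sup>+h. w (matrix_inv g ** h) * indicator A h \<partial>(distr lborel borel (\<lambda>x. g ** x)))"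
    by (subst nn_integral_distr) simp_all
  also have "\<dots> = (\<integral>\<^sup>+h. ennreal (absF (det g) ^ CARD('n)) * (w h * indicator A h) \<partial>(distr lborel borel (\<lambda>x. g ** x)))"
    by (simp add: winv mult.assoc)
  also have "\<dots> = ennreal (absF (det g) ^ CARD('n)) * ennreal (inverse (absF (det g) ^ CARD('n))) * (\<integral>\<^sup>+h. w h * indicator A h \<partial>lborel)"
    unfolding lborel_left_mult[OF g] by (simp add: nn_integral_scale_measure nn_integral_cmult mult.assoc)
  also have "ennreal (absF (det g) ^ CARD('n)) * ennreal (inverse (absF (det g) ^ CARD('n))) = 1"
    using absF_pos[of "det g"] g by (simp add: ennreal_mult'[symmetric] GL_iff_det)
  also have "C * (1 * (\<integral>\<^sup>+h. w h * indicator A h \<partial>lborel)) = emeasure (GL_measure \<mu>) A"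
    using A by (simp add: GLm emeasure_density nn_integral_scale_measure)
  finally show "emeasure (distr (GL_measure \<mu>) borel (\<lambda>h. g ** h)) A = emeasure (GL_measure \<mu>) A" .
qed

lemma GL_integral_left_mult:
  fixes \<mu> :: "'f::arch_local_field measure" and g :: "'f^'n^'n" and F :: "'f^'n^'n \<Rightarrow> complex"
  assumes \<mu>: "\<mu> = scale_measure (ennreal c) lborel" "c > 0" and g: "g \<in> GL"
    and F: "(\<lambda>h. indicator GL h *\<^sub>R F h) \<in> borel_measurable borel"
  shows "(LINT h:GL|GL_measure \<mu>. F h) = (LINT h:GL|GL_measure \<mu>. F (g ** h))"
proof -
  have "(\<integral>h. indicator GL h *\<^sub>R F h \<partial>GL_measure \<mu>) = (\<integral>h. indicator GL h *\<^sub>R F h \<partial>(distr (GL_measure \<mu>) borel (\<lambda>h. g ** h)))"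
    by (simp only: GL_measure_left_mult[OF \<mu> g])
  also have "\<dots> = (\<integral>h. indicator GL (g ** h) *\<^sub>R F (g ** h) \<partial>GL_measure \<mu>)"
    by (rule integral_distr[OF _ F]) (simp add: GL_measure_def additive_matrix_measure_def)
  also have "(\<lambda>h. indicator GL (g ** h) *\<^sub>R F (g ** h)) = (\<lambda>h. indicator GL h *\<^sub>R F (g ** h))"
    using g by (auto simp: fun_eq_iff indicator_def GL_iff_det det_mul)
  finally show ?thesis by (simp add: set_lebesgue_integral_def)
qed

lemma GL_integral_lborel:
  fixes \<mu> :: "'f::arch_local_field measure" and F :: "'f^'n^'n \<Rightarrow> complex"
  assumes \<mu>: "\<mu> = scale_measure (ennreal c) lborel" "c > 0"
    and F: "(\<lambda>h. indicator GL h *\<^sub>R F h) \<in> borel_measurable borel"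
  shows "(LINT h:GL|GL_measure \<mu>. F h) =
    (LINT h:GL|lborel. (c ^ (CARD('n) * CARD('n)) / absF (det h) ^ CARD('n)) *\<^sub>R F h)"
proof -
  let ?C = "c ^ (CARD('n) * CARD('n))"
  define w where "w h = ?C * (indicator GL h * inverse (absF (det h) ^ CARD('n)))" for h :: "'f^'n^'n"
  have wm [measurable]: "w \<in> borel_measurable borel"
    unfolding w_def by measurable
  have w0: "w h \<ge> 0" for h using \<mu>(2) by (auto simp: w_def absF_def)
  have "GL_measure \<mu> = density (density lborel (\<lambda>_. ennreal ?C)) (\<lambda>g :: 'f^'n^'n. indicator GL g * ennreal (inverse (absF (det g) ^ CARD('n))))"
  proof -
    have "scale_measure (ennreal ?C) lborel = density (lborel :: ('f^'n^'n) measure) (\<lambda>_. ennreal ?C)"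
      by (rule measure_eqI) (simp_all add: emeasure_density_const)
    then show ?thesis
      unfolding GL_measure_def \<mu>(1) additive_matrix_measure_eq_lborel[OF \<mu>(2)] by simp
  qed
  also have "\<dots> = density lborel (\<lambda>h. ennreal (w h))"
  proof (subst density_density_eq)
    show "(\<lambda>g :: 'f^'n^'n. indicator GL g * ennreal (inverse (absF (det g) ^ CARD('n)))) \<in> borel_measurable lborel"
      by measurable
    show "density lborel (\<lambda>x. ennreal ?C * (indicator GL x * ennreal (inverse (absF (det x) ^ CARD('n))))) = density lborel (\<lambda>h. ennreal (w h))"
      using \<mu>(2) by (intro arg_cong[where f = "density lborel"] ext) (simp add: w_def indicator_def ennreal_mult'[symmetric])
  qed simp
  finally have "(LINT h:GL|GL_measure \<mu>. F h) = (\<integral>h. w h *\<^sub>R (indicator GL h *\<^sub>R F h) \<partial>lborel)"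
    unfolding set_lebesgue_integral_def using F w0 by (subst integral_density[symmetric]) simp_all
  also have "\<dots> = (LINT h:GL|lborel. (?C / absF (det h) ^ CARD('n)) *\<^sub>R F h)"
    unfolding set_lebesgue_integral_def by (intro Bochner_Integration.integral_cong) (auto simp: w_def indicator_def divide_inverse)
  finally show ?thesis .
qed


section \<open>Haar measures of the special linear group\<close>

lemma SL_subset_GL: "SL \<subseteq> GL" by (auto simp: SL_def GL_iff_det)

lemma SL_haarD:
  fixes \<nu> :: "('f::arch_local_field^'n^'n) measure"
  assumes "SL_haar \<nu>"
  shows "sets \<nu> = sets borel" "AE h in \<nu>. h \<in> SL" "\<And>C. compact C \<Longrightarrow> emeasure \<nu> C < \<infinity>"
    "\<And>a. a \<in> SL \<Longrightarrow> distr \<nu> borel (\<lambda>g. a ** g) = \<nu>" "sigma_finite_measure \<nu>"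
proof -
  show s: "sets \<nu> = sets borel" and c: "\<And>C. compact C \<Longrightarrow> emeasure \<nu> C < \<infinity>"
    and "\<And>a. a \<in> SL \<Longrightarrow> distr \<nu> borel (\<lambda>g. a ** g) = \<nu>"
    using assms by (auto simp: SL_haar_def)
  have "- SL \<in> sets \<nu>" unfolding s by (intro borel_open open_Compl closed_SL)
  then show "AE h in \<nu>. h \<in> SL"
    using assms by (intro AE_I'[where N = "- SL"]) (auto simp: SL_haar_def null_sets_def)
  show "sigma_finite_measure \<nu>"
  proof
    show "\<exists>A. countable A \<and> A \<subseteq> sets \<nu> \<and> \<Union>A = space \<nu> \<and> (\<forall>a\<in>A. emeasure \<nu> a \<noteq> \<infinity>)"
    proof (intro exI[of _ "range (\<lambda>k::nat. cball 0 (real k))"] conjI)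
      show "\<Union> (range (\<lambda>k::nat. cball 0 (real k))) = space \<nu>"
        using real_arch_simple sets_eq_imp_space_eq[OF s] by (auto simp: mem_cball)
      show "\<forall>a\<in>range (\<lambda>k::nat. cball 0 (real k)). emeasure \<nu> a \<noteq> \<infinity>"
        using c[OF compact_cball] by (auto simp: less_top[symmetric])
    qed (auto simp: s)
  qed
qed

text \<open>
  The ball of radius \<open>R\<close> is cut into the cells of a cubical grid whose side is a small
  multiple of \<open>(1 + R) powr (- n)\<close>. Inverses of elements of \<open>SL\<close> in the ball are at most of
  size \<open>(1 + R) ^ n\<close>, so two elements \<open>h\<close>, \<open>h'\<close> in the same cell satisfy
  \<open>norm (matrix_inv h ** h' - mat 1) \<le> 1\<close>. Every cell is thus contained in a left translate of
  one compact set, and translates have equal measure; the number of cells is polynomial in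
  \<open>R\<close>.
\<close>

lemma SL_haar_growth:
  fixes \<nu> :: "('f::arch_local_field^'n^'n) measure"
  assumes "SL_haar \<nu>"
  shows "\<exists>C>0. \<exists>N. \<forall>R\<ge>1. emeasure \<nu> (cball 0 R) \<le> ennreal (C * (1 + R) ^ N)"
proof -
  note H = SL_haarD[OF assms]
  let ?n = "CARD('n)" and ?D = "DIM('f^'n^'n)"
  obtain K where K: "K \<ge> 1" "\<And>(A :: 'f^'n^'n) (B :: 'f^'n^'n). norm (A ** B) \<le> K * norm A * norm B"
    using norm_matrix_mult_le by metis
  obtain CI where CI: "CI \<ge> 1" "\<And>g :: 'f^'n^'n. det g \<noteq> 0 \<Longrightarrow> norm (matrix_inv g) \<le> CI * (1 + norm g) ^ ?n / norm (det g)"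
    using norm_matrix_inv_le by metis
  define U where "U = (cball (mat 1) 1 :: ('f^'n^'n) set)"
  define m where "m = measure \<nu> U"
  have mU: "emeasure \<nu> U = ennreal m" unfolding m_def
    by (rule emeasure_eq_ennreal_measure) (use H(3)[OF compact_cball, of "mat 1" 1] in \<open>simp add: U_def\<close>)
  have m0: "m \<ge> 0" by (simp add: m_def)
  define A where "A = 2 * (real ?D * K * CI) + 3"
  have D1: "real ?D \<ge> 1" using DIM_positive[where 'a="'f^'n^'n"] by linarith
  have DKC: "real ?D * K * CI \<ge> 1" using D1 K(1) CI(1) by (intro mult_ge1_I) auto
  have "emeasure \<nu> (cball 0 R) \<le> ennreal ((A ^ ?D * (m + 1)) * (1 + R) ^ ((?n + 1) * ?D))" if R: "R \<ge> 1" for R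
  proof -
    define s where "s = 1 / (real ?D * K * CI * (1 + R) ^ ?n)"
    have R1: "(1 + R) ^ ?n \<ge> 1" using R by (intro one_le_power) simp
    have sp: "s > 0" unfolding s_def using D1 K(1) CI(1) R1 by (intro divide_pos_pos mult_pos_pos) linarith+
    \<comment> \<open>\<open>\<gamma> h\<close> is the cell of \<open>h\<close> in the grid of side
       \<open>s\<close>.\<close>
    define \<gamma> where "\<gamma> h = (\<lambda>b\<in>Basis. \<lfloor>(h \<bullet> b) / s\<rfloor>)" for h :: "'f^'n^'n"
    have near: "norm (matrix_inv h ** h' - mat 1) \<le> 1"
      if h: "h \<in> SL" "norm h \<le> R" and "\<gamma> h = \<gamma> h'" for h h'
    proof -
      have "\<bar>(h' - h) \<bullet> b\<bar> \<le> s" if b: "b \<in> Basis" for b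
      proof -
        have "\<gamma> h b = \<gamma> h' b" by (simp only: \<open>\<gamma> h = \<gamma> h'\<close>)
        then have "\<lfloor>(h \<bullet> b) / s\<rfloor> = \<lfloor>(h' \<bullet> b) / s\<rfloor>" using b by (simp add: \<gamma>_def)
        then have "\<bar>(h' \<bullet> b) / s - (h \<bullet> b) / s\<bar> \<le> 1" by linarith
        then have "\<bar>(h' - h) \<bullet> b\<bar> / s \<le> 1" using sp by (simp add: inner_diff_left diff_divide_distrib[symmetric])
        then show ?thesis using sp by simp
      qed
      then have "norm (h' - h) \<le> (\<Sum>b\<in>(Basis :: ('f^'n^'n) set). s)"
        by (intro order_trans[OF norm_le_l1] sum_mono) auto
      then have d: "norm (h' - h) \<le> ?D * s" by simp
      have hG: "h \<in> GL" using h SL_subset_GL by blast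
      have "matrix_inv h ** h' - mat 1 = matrix_inv h ** (h' - h)"
        by (simp add: matrix_sub_ldistrib matrix_inv_GL[OF hG])
      then have "norm (matrix_inv h ** h' - mat 1) \<le> K * norm (matrix_inv h) * norm (h' - h)"
        using K(2) by simp
      also have "\<dots> \<le> K * (CI * (1 + R) ^ ?n) * (?D * s)"
      proof (intro mult_mono order_refl d)
        have "norm (matrix_inv h) \<le> CI * (1 + norm h) ^ ?n" using CI(2)[of h] h by (simp add: SL_def)
        also have "\<dots> \<le> CI * (1 + R) ^ ?n" using h CI(1) by (intro mult_left_mono power_mono) auto
        finally show "norm (matrix_inv h) \<le> CI * (1 + R) ^ ?n" .
      qed (use K CI R sp in auto)
      also have "\<dots> = 1"
        using sp DKC R1 K(1) CI(1) R by (simp add: s_def field_simps)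
      finally show ?thesis .
    qed
    define B where "B = SL \<inter> cball (0 :: 'f^'n^'n) R"
    define Z where "Z = Pi\<^sub>E (Basis :: ('f^'n^'n) set) (\<lambda>_. {\<lfloor>- R / s\<rfloor>..\<lfloor>R / s\<rfloor>})"
    have Zf: "finite Z" unfolding Z_def by (intro finite_PiE) auto
    have sub: "\<gamma> ` B \<subseteq> Z"
    proof
      fix z assume "z \<in> \<gamma> ` B"
      then obtain h where h: "norm h \<le> R" "z = \<gamma> h" by (auto simp: B_def)
      have "- R / s \<le> (h \<bullet> b) / s" "(h \<bullet> b) / s \<le> R / s" if "b \<in> Basis" for b
        using Basis_le_norm[OF that, of h] h(1) sp by (intro divide_right_mono; linarith)+
      then show "z \<in> Z" unfolding Z_def h(2) \<gamma>_def by (auto intro!: floor_mono)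
    qed
    then have fin: "finite (\<gamma> ` B)" using Zf by (rule finite_subset)
    have "real (card Z) \<le> (A * (1 + R) ^ (?n + 1)) ^ ?D"
    proof -
      have "real (card Z) = real (nat (\<lfloor>R / s\<rfloor> - \<lfloor>- R / s\<rfloor> + 1)) ^ ?D"
        unfolding Z_def by (subst card_PiE) auto
      also have "\<dots> \<le> (A * (1 + R) ^ (?n + 1)) ^ ?D"
      proof (rule power_mono)
        have "R / s \<ge> 0" using R sp by simp
        then have "real (nat (\<lfloor>R / s\<rfloor> - \<lfloor>- R / s\<rfloor> + 1)) \<le> 2 * (R / s) + 3" by linarith
        also have "2 * (R / s) + 3 = 2 * (real ?D * K * CI * (R * (1 + R) ^ ?n)) + 3" by (simp add: s_def mult_ac)
        also have "\<dots> \<le> 2 * (real ?D * K * CI * (1 + R) ^ (?n + 1)) + 3 * (1 + R) ^ (?n + 1)"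
        proof (intro add_mono mult_left_mono)
          show "R * (1 + R) ^ ?n \<le> (1 + R) ^ (?n + 1)" using R R1 by (simp add: algebra_simps)
          have "(1 + R) ^ (?n + 1) \<ge> 1" using R by (intro one_le_power) simp
          then show "3 \<le> 3 * (1 + R) ^ (?n + 1)" by simp
        qed (use DKC in auto)
        also have "\<dots> = A * (1 + R) ^ (?n + 1)" by (simp add: A_def algebra_simps)
        finally show "real (nat (\<lfloor>R / s\<rfloor> - \<lfloor>- R / s\<rfloor> + 1)) \<le> A * (1 + R) ^ (?n + 1)" .
      qed simp
      finally show ?thesis .
    qed
    moreover have "card (\<gamma> ` B) \<le> card Z" by (rule card_mono[OF Zf sub])
    ultimately have cardG: "real (card (\<gamma> ` B)) \<le> (A * (1 + R) ^ (?n + 1)) ^ ?D" by linarith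
    define \<sigma> where "\<sigma> z = (SOME h. h \<in> B \<and> \<gamma> h = z)" for z
    have \<sigma>: "\<sigma> z \<in> B \<and> \<gamma> (\<sigma> z) = z" if "z \<in> \<gamma> ` B" for z
      unfolding \<sigma>_def by (rule someI_ex) (use that in auto)
    define T where "T z = (\<lambda>x. matrix_inv (\<sigma> z) ** x) -` U" for z
    have Tm: "T z \<in> sets \<nu>" for z
      using measurable_sets[OF measurable_left_mult, of U] by (simp add: T_def U_def H(1))
    have "matrix_inv (\<sigma> z) \<in> SL" if "z \<in> \<gamma> ` B" for z
    proof -
      have "\<sigma> z \<in> SL" using \<sigma>[OF that] by (simp add: B_def)
      then show ?thesis using SL_subset_GL by (auto simp: SL_def det_matrix_inv GL_iff_det)
    qed
    then have T: "emeasure \<nu> (T z) = ennreal m" if "z \<in> \<gamma> ` B" for z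
    proof -
      have "emeasure \<nu> U = emeasure (distr \<nu> borel (\<lambda>x. matrix_inv (\<sigma> z) ** x)) U"
        using H(4)[OF \<open>z \<in> \<gamma> ` B \<Longrightarrow> matrix_inv (\<sigma> z) \<in> SL\<close>[OF that]] by simp
      also have "\<dots> = emeasure \<nu> (T z)"
        unfolding T_def using H(1) sets_eq_imp_space_eq[OF H(1)]
        by (subst emeasure_distr) (auto simp: U_def measurable_cong_sets[OF H(1) refl])
      finally show ?thesis by (simp add: mU)
    qed
    have "emeasure \<nu> (cball 0 R) \<le> emeasure \<nu> (\<Union>z\<in>\<gamma> ` B. T z)"
    proof (rule emeasure_mono_AE)
      show "AE h in \<nu>. h \<in> cball 0 R \<longrightarrow> h \<in> (\<Union>z\<in>\<gamma> ` B. T z)"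
        using H(2)
      proof eventually_elim
        case (elim h)
        show ?case
        proof
          assume "h \<in> cball 0 R"
          then have hB: "h \<in> B" using elim by (simp add: B_def)
          let ?z = "\<gamma> h"
          have z: "?z \<in> \<gamma> ` B" using hB by simp
          have "norm (matrix_inv (\<sigma> ?z) ** h - mat 1) \<le> 1"
            using \<sigma>[OF z] by (intro near) (auto simp: B_def)
          then have "h \<in> T ?z" by (simp add: T_def U_def dist_norm norm_minus_commute)
          then show "h \<in> (\<Union>z\<in>\<gamma> ` B. T z)" using z by blast
        qed
      qed
      show "(\<Union>z\<in>\<gamma> ` B. T z) \<in> sets \<nu>" using fin Tm by (intro sets.finite_UN) auto
    qed
    also have "\<dots> \<le> (\<Sum>z\<in>\<gamma> ` B. emeasure \<nu> (T z))"
      using fin Tm by (intro emeasure_subadditive_finite) auto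
    also have "\<dots> = ennreal (card (\<gamma> ` B) * m)"
      using m0 by (simp add: T ennreal_mult ennreal_of_nat_eq_real_of_nat)
    also have "\<dots> \<le> ennreal ((A ^ ?D * (m + 1)) * (1 + R) ^ ((?n + 1) * ?D))"
    proof (rule ennreal_leI)
      have "real (card (\<gamma> ` B)) * m \<le> (A * (1 + R) ^ (?n + 1)) ^ ?D * (m + 1)"
        using cardG m0 by (intro mult_mono) auto
      also have "\<dots> = (A ^ ?D * (m + 1)) * (1 + R) ^ ((?n + 1) * ?D)"
        by (simp only: power_mult_distrib power_mult[symmetric] mult_ac)
      finally show "real (card (\<gamma> ` B)) * m \<le> (A ^ ?D * (m + 1)) * (1 + R) ^ ((?n + 1) * ?D)" .
    qed
    finally show ?thesis .
  qed
  moreover have "A ^ ?D * (m + 1) > 0" using DKC m0 by (intro mult_pos_pos zero_less_power) (auto simp: A_def)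
  ultimately show ?thesis by blast
qed

text \<open>
  If balls have volume \<open>O((1 + R) ^ N)\<close>, the exponent \<open>N + 2\<close> leaves the convergent sum of the
  inverse squares of the radii.
\<close>

lemma SL_haar_integrable:
  fixes \<nu> :: "('f::arch_local_field^'n^'n) measure"
  assumes "SL_haar \<nu>"
  shows "\<exists>N0>0. \<forall>r\<le>- N0. integrable \<nu> (\<lambda>h. (1 + norm h) powr r)"
proof -
  note H = SL_haarD[OF assms]
  obtain C N where C: "C > 0" "\<And>R. R \<ge> 1 \<Longrightarrow> emeasure \<nu> (cball 0 R) \<le> ennreal (C * (1 + R) ^ N)"
    using SL_haar_growth[OF assms] by blast
  define M where "M = N + 2"
  have [measurable_cong]: "sets \<nu> = sets borel" by (rule H)
  have main: "integrable \<nu> (\<lambda>h. (1 + norm h) powr (- real M))"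
  proof (rule integrableI_nonneg)
    define a where "a k = (1 + real k) powr (- real M)" for k :: nat
    have "(\<integral>\<^sup>+h. ennreal ((1 + norm h) powr (- real M)) \<partial>\<nu>)
      \<le> (\<integral>\<^sup>+h. (\<Sum>k. ennreal (a k) * indicator (cball 0 (real k + 1)) h) \<partial>\<nu>)"
    proof (rule nn_integral_mono)
      fix h :: "'f^'n^'n"
      define k where "k = nat \<lfloor>norm h\<rfloor>"
      have "real k = of_int \<lfloor>norm h\<rfloor>" by (simp add: k_def)
      then have k: "real k \<le> norm h" "norm h \<le> real k + 1" by linarith+
      have "(1 + norm h) powr (- real M) \<le> a k" unfolding a_def using k by (intro powr_mono2') auto
      then have "ennreal ((1 + norm h) powr (- real M)) \<le> ennreal (a k) * indicator (cball 0 (real k + 1)) h"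
        using k by (simp add: ennreal_leI)
      also have "\<dots> \<le> (\<Sum>k. ennreal (a k) * indicator (cball 0 (real k + 1)) h)"
      proof -
        define f where "f k = ennreal (a k) * indicator (cball 0 (real k + 1)) h" for k
        have "f k \<le> suminf f" using sum_le_suminf[of f "{k}"] by (simp add: summableI)
        then show ?thesis by (simp only: f_def[abs_def])
      qed
      finally show "ennreal ((1 + norm h) powr (- real M)) \<le> (\<Sum>k. ennreal (a k) * indicator (cball 0 (real k + 1)) h)" .
    qed
    also have "\<dots> = (\<Sum>k. \<integral>\<^sup>+h. ennreal (a k) * indicator (cball 0 (real k + 1)) h \<partial>\<nu>)"
      by (intro nn_integral_suminf borel_measurable_times_ennreal borel_measurable_indicator borel_measurable_const)
        (simp add: H(1))
    also have "\<dots> = (\<Sum>k. ennreal (a k) * emeasure \<nu> (cball 0 (real k + 1)))"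
      by (simp add: nn_integral_cmult_indicator H(1))
    also have "\<dots> \<le> (\<Sum>k. ennreal (C * 2 ^ N * inverse ((1 + real k) ^ 2)))"
    proof (rule suminf_le)
      fix k :: nat
      have "ennreal (a k) * emeasure \<nu> (cball 0 (real k + 1)) \<le> ennreal (a k) * ennreal (C * (1 + (real k + 1)) ^ N)"
        by (intro mult_left_mono C(2)) auto
      also have "\<dots> = ennreal (a k * (C * (1 + (real k + 1)) ^ N))" by (rule ennreal_mult'[symmetric]) (simp add: a_def)
      also have "\<dots> \<le> ennreal (C * 2 ^ N * inverse ((1 + real k) ^ 2))"
      proof (rule ennreal_leI)
        have "a k * (C * (1 + (real k + 1)) ^ N) \<le> a k * (C * (2 * (1 + real k)) ^ N)"
          using C(1) by (intro mult_left_mono power_mono) (auto simp: a_def)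
        also have "\<dots> = C * 2 ^ N * (a k * (1 + real k) ^ N)" by (simp only: power_mult_distrib mult_ac)
        also have "a k * (1 + real k) ^ N = inverse ((1 + real k) ^ 2)"
        proof -
          have "a k = inverse ((1 + real k) ^ M)" by (simp add: a_def powr_minus powr_realpow)
          then show ?thesis by (simp add: M_def power_add del: power_Suc add_2_eq_Suc')
        qed
        finally show "a k * (C * (1 + (real k + 1)) ^ N) \<le> C * 2 ^ N * inverse ((1 + real k) ^ 2)" .
      qed
      finally show "ennreal (a k) * emeasure \<nu> (cball 0 (real k + 1)) \<le> ennreal (C * 2 ^ N * inverse ((1 + real k) ^ 2))" .
    qed (auto simp: summableI)
    also have "\<dots> < \<infinity>"
    proof -
      have "summable (\<lambda>k. inverse (real (Suc k) ^ 2))"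
        by (subst summable_Suc_iff) (rule inverse_power_summable, simp)
      then have "summable (\<lambda>k. C * 2 ^ N * inverse ((1 + real k) ^ 2))"
        by (intro summable_mult) (simp add: add.commute)
      then show ?thesis using C(1) by (subst suminf_ennreal2) auto
    qed
    finally show "(\<integral>\<^sup>+h. ennreal ((1 + norm h) powr (- real M)) \<partial>\<nu>) < \<infinity>" .
    show "(\<lambda>h. (1 + norm h) powr (- real M)) \<in> borel_measurable \<nu>" by measurable
    show "AE h in \<nu>. 0 \<le> (1 + norm h) powr (- real M)" by simp
  qed
  have "integrable \<nu> (\<lambda>h. (1 + norm h) powr r)" if "r \<le> - real M" for r
  proof (rule Bochner_Integration.integrable_bound[OF main])
    show "AE h in \<nu>. norm ((1 + norm h) powr r) \<le> norm ((1 + norm h) powr - real M)"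
      using that by (intro AE_I2) (auto intro!: powr_mono)
  qed measurable
  then show ?thesis by (intro exI[of _ "real M"]) (auto simp: M_def)
qed

text \<open>
  For the invariance, left translation by \<open>a\<close> corresponds under the base point \<open>t\<close> to left
  translation of \<open>SL\<close> by the conjugate of \<open>a\<close> with \<open>t\<close>.
\<close>

lemma torsor_measureD:
  fixes \<nu> :: "('f::arch_local_field^'n^'n) measure"
  assumes "SL_haar \<nu>" "x \<noteq> 0"
  shows "sets (torsor_measure \<nu> x) = sets borel" "AE g in torsor_measure \<nu> x. det g = x"
    "\<And>a. a \<in> SL \<Longrightarrow> distr (torsor_measure \<nu> x) borel (\<lambda>g. a ** g) = torsor_measure \<nu> x"
proof -
  note H = SL_haarD[OF assms(1)]
  have [measurable_cong]: "sets \<nu> = sets borel" by (rule H)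
  show "sets (torsor_measure \<nu> x) = sets borel" by (simp add: torsor_measure_def)
  show "AE g in torsor_measure \<nu> x. det g = x"
    unfolding torsor_measure_def
  proof (subst AE_distr_iff)
    show "AE h in \<nu>. det (torsor_point x ** h) = x"
      using H(2) by eventually_elim (simp add: det_mul det_torsor_point SL_def)
    show "{g \<in> space borel. det g = x} \<in> sets borel"
      by (simp, intro borel_closed closed_Collect_eq continuous_intros)
  qed measurable
  fix a :: "'f^'n^'n" assume a: "a \<in> SL"
  let ?t = "torsor_point x :: 'f^'n^'n"
  have t: "?t \<in> GL" using assms(2) by (rule torsor_point_GL)
  define b where "b = matrix_inv ?t ** a ** ?t"
  have b: "b \<in> SL" using a t by (simp add: b_def SL_def det_mul det_matrix_inv GL_iff_det)
  have tb: "?t ** b = a ** ?t" by (simp add: b_def matrix_mul_assoc matrix_inv_GL[OF t])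
  have "distr (torsor_measure \<nu> x) borel (\<lambda>g. a ** g) = distr \<nu> borel (\<lambda>h. ?t ** (b ** h))"
    unfolding torsor_measure_def by (subst distr_distr) (simp_all add: o_def matrix_mul_assoc tb)
  also have "\<dots> = distr (distr \<nu> borel (\<lambda>h. b ** h)) borel (\<lambda>h. ?t ** h)"
    by (subst distr_distr) (simp_all add: o_def)
  also have "\<dots> = torsor_measure \<nu> x" unfolding H(4)[OF b] torsor_measure_def ..
  finally show "distr (torsor_measure \<nu> x) borel (\<lambda>g. a ** g) = torsor_measure \<nu> x" .
qed

lemma sigma_finite_torsor_measure:
  fixes \<nu> :: "('f::arch_local_field^'n^'n) measure"
  assumes "SL_haar \<nu>" "x \<noteq> 0"
  shows "sigma_finite_measure (torsor_measure \<nu> x)"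
proof -
  note H = SL_haarD[OF assms(1)]
  have [measurable_cong]: "sets \<nu> = sets borel" by (rule H)
  have t: "(torsor_point x :: 'f^'n^'n) \<in> GL" using assms(2) by (rule torsor_point_GL)
  have "distr (torsor_measure \<nu> x) borel (\<lambda>g. matrix_inv (torsor_point x) ** g) = distr \<nu> borel (\<lambda>h. h)"
    unfolding torsor_measure_def by (subst distr_distr) (simp_all add: o_def GL_cancel_left[OF t])
  also have "\<dots> = \<nu>" by (rule distr_id2) (simp add: H(1))
  finally have "sigma_finite_measure (distr (torsor_measure \<nu> x) borel (\<lambda>g. matrix_inv (torsor_point x) ** g))"
    using H(5) by simp
  then show ?thesis by (rule sigma_finite_measure_distr) (simp add: torsor_measure_def)
qed

lemma one_plus_powr_comparable:
  fixes a b L r :: real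
  assumes "0 \<le> a" "0 \<le> b" "L \<ge> 1" "a \<le> L * b" "r \<le> 0"
  shows "(1 + b) powr r \<le> L powr (- r) * (1 + a) powr r"
proof -
  have "1 + a \<le> L * (1 + b)" using assms by (simp add: distrib_left)
  then have "(L * (1 + b)) powr r \<le> (1 + a) powr r"
    using assms by (intro powr_mono2') auto
  then have "L powr r * (1 + b) powr r \<le> (1 + a) powr r" using assms by (simp add: powr_mult)
  then have "L powr (- r) * (L powr r * (1 + b) powr r) \<le> L powr (- r) * (1 + a) powr r"
    by (rule mult_left_mono) simp
  moreover have "L powr (- r) * L powr r = 1" using assms by (simp add: powr_add[symmetric])
  ultimately show ?thesis by (simp add: mult.assoc[symmetric])
qed

text \<open>
  How far the order of a symbol has to be lowered for its integral over \<open>SL\<close> to converge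
  absolutely.
\<close>

definition growth_exponent :: "('f::arch_local_field^'n^'n) measure \<Rightarrow> real" where
  "growth_exponent \<nu> = (SOME N0. N0 > 0 \<and> (\<forall>r\<le>- N0. integrable \<nu> (\<lambda>h. (1 + norm h) powr r)))"

lemma growth_exponent:
  fixes \<nu> :: "('f::arch_local_field^'n^'n) measure"
  assumes "SL_haar \<nu>"
  shows "growth_exponent \<nu> > 0" "r \<le> - growth_exponent \<nu> \<Longrightarrow> integrable \<nu> (\<lambda>h. (1 + norm h) powr r)"
proof -
  have "growth_exponent \<nu> > 0 \<and> (\<forall>r\<le>- growth_exponent \<nu>. integrable \<nu> (\<lambda>h. (1 + norm h) powr r))"
    unfolding growth_exponent_def using SL_haar_integrable[OF assms] by (rule someI_ex)
  then show "growth_exponent \<nu> > 0" "r \<le> - growth_exponent \<nu> \<Longrightarrow> integrable \<nu> (\<lambda>h. (1 + norm h) powr r)"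
    by auto
qed

lemma torsor_integrable_powr:
  fixes \<nu> :: "('f::arch_local_field^'n^'n) measure"
  assumes "SL_haar \<nu>" "x \<noteq> 0" "r \<le> - growth_exponent \<nu>"
  shows "integrable (torsor_measure \<nu> x) (\<lambda>g. (1 + norm g) powr r)"
proof -
  note H = SL_haarD[OF assms(1)]
  have [measurable_cong]: "sets \<nu> = sets borel" by (rule H)
  let ?t = "torsor_point x :: 'f^'n^'n"
  have t: "?t \<in> GL" using assms(2) by (rule torsor_point_GL)
  obtain K where K: "K \<ge> 1" "\<And>(A :: 'f^'n^'n) (B :: 'f^'n^'n). norm (A ** B) \<le> K * norm A * norm B"
    using norm_matrix_mult_le by metis
  define L where "L = 1 + K * norm (matrix_inv ?t)"
  have L: "L \<ge> 1" using K(1) by (simp add: L_def)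
  have r: "r \<le> 0" using assms(3) growth_exponent(1)[OF assms(1)] by linarith
  have "norm h \<le> L * norm (?t ** h)" for h :: "'f^'n^'n"
  proof -
    have "norm h = norm (matrix_inv ?t ** (?t ** h))" by (simp add: GL_cancel_left[OF t])
    also have "\<dots> \<le> K * norm (matrix_inv ?t) * norm (?t ** h)" by (rule K(2))
    also have "\<dots> \<le> L * norm (?t ** h)" unfolding L_def by (intro mult_right_mono) auto
    finally show ?thesis .
  qed
  then have bd: "(1 + norm (?t ** h)) powr r \<le> L powr (- r) * (1 + norm h) powr r" for h :: "'f^'n^'n"
    using L r by (intro one_plus_powr_comparable) auto
  have "integrable \<nu> (\<lambda>h. (1 + norm (?t ** h)) powr r)"
  proof (rule Bochner_Integration.integrable_bound)
    show "integrable \<nu> (\<lambda>h. L powr (- r) * (1 + norm h) powr r)"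
      by (intro integrable_mult_right growth_exponent(2)[OF assms(1,3)])
    show "AE h in \<nu>. norm ((1 + norm (?t ** h)) powr r) \<le> norm (L powr (- r) * (1 + norm h) powr r)"
      using bd by (intro AE_I2) (simp add: abs_mult)
  qed measurable
  then show ?thesis unfolding torsor_measure_def by (subst integrable_distr_eq) simp_all
qed

lemma torsor_integrable_bound:
  fixes \<nu> :: "('f::arch_local_field^'n^'n) measure" and F :: "'f^'n^'n \<Rightarrow> complex"
  assumes \<nu>: "SL_haar \<nu>" "x \<noteq> 0" and r: "r \<le> - growth_exponent \<nu>"
    and m: "(\<lambda>g. indicator GL g *\<^sub>R F g) \<in> borel_measurable borel"
    and b: "\<And>g. det g = x \<Longrightarrow> norm (F g) \<le> C * (1 + norm g) powr r"
  shows "set_integrable (torsor_measure \<nu> x) GL F"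
  unfolding set_integrable_def
proof (rule Bochner_Integration.integrable_bound)
  have [measurable_cong]: "sets (torsor_measure \<nu> x) = sets borel" by (rule torsor_measureD[OF \<nu>])
  show "integrable (torsor_measure \<nu> x) (\<lambda>g. C * (1 + norm g) powr r)"
    by (intro integrable_mult_right torsor_integrable_powr[OF \<nu> r])
  show "(\<lambda>g. indicator GL g *\<^sub>R F g) \<in> borel_measurable (torsor_measure \<nu> x)" using m by measurable
  show "AE g in torsor_measure \<nu> x. norm (indicator GL g *\<^sub>R F g) \<le> norm (C * (1 + norm g) powr r)"
    using torsor_measureD(2)[OF \<nu>]
  proof eventually_elim
    case (elim g)
    show ?case using b[OF elim] elim \<nu>(2) by (simp add: GL_iff_det indicator_def)
  qed
qed

text \<open>
  The integral of \<open>F\<close> over the torsor does not change when \<open>g\<close> is replaced by \<open>(1 + s X) g\<close>;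
  the claim is the derivative of this constancy at \<open>s = 0\<close>. Since \<open>X\<close> has square zero, the
  matrices \<open>1 + s X\<close> form a one-parameter group, so that the derivative given at \<open>s = 0\<close>
  determines the derivatives at the other points of the line.
\<close>

lemma torsor_integral_derivative_zero:
  fixes \<nu> :: "('f::arch_local_field^'n^'n) measure" and F F' :: "'f^'n^'n \<Rightarrow> complex"
  assumes \<nu>: "SL_haar \<nu>" "x \<noteq> 0" and r: "r \<le> - growth_exponent \<nu>"
    and X: "X ** X = 0" "\<And>s. det (mat 1 + s *\<^sub>R X) = 1"
    and m: "(\<lambda>g. indicator GL g *\<^sub>R F g) \<in> borel_measurable borel" "(\<lambda>g. indicator GL g *\<^sub>R F' g) \<in> borel_measurable borel"
    and b: "\<And>g. det g = x \<Longrightarrow> norm (F g) \<le> C * (1 + norm g) powr r"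
           "\<And>g. det g = x \<Longrightarrow> norm (F' g) \<le> C * (1 + norm g) powr r"
    and der: "\<And>g. det g = x \<Longrightarrow> ((\<lambda>s. F (g + s *\<^sub>R (X ** g))) has_vector_derivative F' g) (at 0)"
  shows "(LINT g:GL|torsor_measure \<nu> x. F' g) = 0"
proof -
  let ?M = "torsor_measure \<nu> x"
  have [measurable_cong]: "sets ?M = sets borel" by (rule torsor_measureD[OF \<nu>])
  obtain K where K: "K \<ge> 1" "\<And>(A :: 'f^'n^'n) (B :: 'f^'n^'n). norm (A ** B) \<le> K * norm A * norm B"
    using norm_matrix_mult_le by metis
  define a where "a s = mat 1 + s *\<^sub>R X" for s
  have aS: "a s \<in> SL" for s using X(2) by (simp add: a_def SL_def)
  have det_a: "det (a s ** g) = det g" for s g using aS by (simp add: det_mul SL_def)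
  have a_ind: "indicator GL (a s ** g) = (indicator GL g :: real)" for s g
    by (simp add: indicator_def GL_iff_det det_a)
  have a_inv: "a (- s) ** a s = mat 1" for s
    using X(1) by (simp add: a_def matrix_add_ldistrib matrix_add_rdistrib matrix_sub_rdistrib scaleR_matrix_mult_left scaleR_matrix_mult_right)
  have ag: "a s ** g = g + s *\<^sub>R (X ** g)" for s and g :: "'f^'n^'n"
    by (simp add: a_def matrix_add_rdistrib scaleR_matrix_mult_left)
  have Xa: "X ** (a s ** g) = X ** g" for s and g :: "'f^'n^'n"
    using X(1) by (simp add: ag matrix_add_ldistrib scaleR_matrix_mult_right matrix_mul_assoc)
  have derF: "((\<lambda>s. F (a s ** g)) has_vector_derivative F' (a s ** g)) (at s)" if "det g = x" for s g
  proof -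
    have "((\<lambda>t. F (a s ** g + t *\<^sub>R (X ** (a s ** g)))) has_vector_derivative F' (a s ** g)) (at 0)"
      by (rule der) (use that det_a in simp)
    then have "((\<lambda>t. F (g + s *\<^sub>R (X ** g) + t *\<^sub>R (X ** g))) has_vector_derivative F' (a s ** g)) (at 0)"
      unfolding Xa unfolding ag .
    then show ?thesis unfolding ag by (rule directional_derivative_line)
  qed
  have C0: "0 \<le> C"
  proof -
    have "0 \<le> C * (1 + norm (torsor_point x :: 'f^'n^'n)) powr r"
      using b(1)[of "torsor_point x"] norm_ge_zero order_trans by (metis det_torsor_point)
    moreover have "(1 + norm (torsor_point x :: 'f^'n^'n)) powr r > 0"
      by (simp add: add_pos_nonneg less_imp_neq[symmetric])
    ultimately show ?thesis by (simp add: zero_le_mult_iff)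
  qed
  define L where "L = 1 + K * (norm (mat 1 :: 'f^'n^'n) + norm X)"
  have L: "L \<ge> 1" using K(1) by (simp add: L_def)
  have r0: "r \<le> 0" using r growth_exponent(1)[OF \<nu>(1)] by linarith
  have bd: "norm (F' (a s ** g)) \<le> C * (L powr (- r) * (1 + norm g) powr r)" if "det g = x" "\<bar>s\<bar> < 1" for s g
  proof -
    have "norm g = norm (a (- s) ** (a s ** g))" by (simp add: matrix_mul_assoc a_inv)
    also have "\<dots> \<le> K * norm (a (- s)) * norm (a s ** g)" by (rule K(2))
    also have "\<dots> \<le> L * norm (a s ** g)"
    proof (rule mult_right_mono)
      have "norm (a (- s)) \<le> norm (mat 1 :: 'f^'n^'n) + norm (s *\<^sub>R X)"
        unfolding a_def using norm_triangle_ineq4[of "mat 1" "s *\<^sub>R X"] by simp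
      also have "norm (s *\<^sub>R X) \<le> norm X" using that(2) by (simp add: mult_left_le_one_le)
      finally have "K * norm (a (- s)) \<le> K * (norm (mat 1 :: 'f^'n^'n) + norm X)"
        using K(1) by (intro mult_left_mono) auto
      then show "K * norm (a (- s)) \<le> L" by (simp add: L_def)
    qed simp
    finally have "(1 + norm (a s ** g)) powr r \<le> L powr (- r) * (1 + norm g) powr r"
      using L r0 by (intro one_plus_powr_comparable) auto
    moreover have "norm (F' (a s ** g)) \<le> C * (1 + norm (a s ** g)) powr r"
      by (rule b(2)) (use that det_a in simp)
    ultimately show ?thesis using C0 by (meson mult_left_mono order_trans)
  qed
  have mF: "(\<lambda>g. indicator GL g *\<^sub>R F (a s ** g)) \<in> borel_measurable borel"
    and mF': "(\<lambda>g. indicator GL g *\<^sub>R F' (a s ** g)) \<in> borel_measurable borel" for s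
    using measurable_compose[OF measurable_left_mult m(1), of "a s"]
      measurable_compose[OF measurable_left_mult m(2), of "a s"] by (simp_all add: a_ind)
  have a0: "a 0 = mat 1" by (simp add: a_def)
  have intF: "integrable ?M (\<lambda>g. indicator GL g *\<^sub>R F g)"
    using torsor_integrable_bound[OF \<nu> r m(1) b(1)] by (simp add: set_integrable_def)
  have "((\<lambda>s. \<integral>g. indicator GL g *\<^sub>R F (a s ** g) \<partial>?M) has_vector_derivative
      (\<integral>g. indicator GL g *\<^sub>R F' (a 0 ** g) \<partial>?M)) (at 0)"
  proof (rule has_vector_derivative_integral[where \<delta> = 1 and D = "\<lambda>g. C * (L powr (- r) * (1 + norm g) powr r)"])
    show "(\<lambda>g. indicator GL g *\<^sub>R F (a s ** g)) \<in> borel_measurable ?M" for s using mF by measurable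
    show "(\<lambda>g. indicator GL g *\<^sub>R F' (a 0 ** g)) \<in> borel_measurable ?M" using mF' by measurable
    show "integrable ?M (\<lambda>g. indicator GL g *\<^sub>R F (a 0 ** g))" using intF by (simp add: a0)
    show "integrable ?M (\<lambda>g. C * (L powr (- r) * (1 + norm g) powr r))"
      by (intro integrable_mult_right torsor_integrable_powr[OF \<nu> r])
    show "AE g in ?M. \<forall>s. \<bar>s\<bar> < 1 \<longrightarrow>
       ((\<lambda>s. indicator GL g *\<^sub>R F (a s ** g)) has_vector_derivative indicator GL g *\<^sub>R F' (a s ** g)) (at s) \<and>
       norm (indicator GL g *\<^sub>R F' (a s ** g)) \<le> C * (L powr (- r) * (1 + norm g) powr r)"
      using torsor_measureD(2)[OF \<nu>]
    proof eventually_elim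
      case (elim g)
      then have "g \<in> GL" using \<nu>(2) by (simp add: GL_iff_det)
      then show ?case using derF[OF elim] bd[OF elim] by simp
    qed
  qed simp
  moreover have "(\<integral>g. indicator GL g *\<^sub>R F (a s ** g) \<partial>?M) = (\<integral>g. indicator GL g *\<^sub>R F g \<partial>?M)" for s
  proof -
    have "(\<integral>g. indicator GL g *\<^sub>R F g \<partial>?M) = (\<integral>g. indicator GL g *\<^sub>R F g \<partial>(distr ?M borel (\<lambda>g. a s ** g)))"
      by (simp only: torsor_measureD(3)[OF \<nu> aS])
    also have "\<dots> = (\<integral>g. indicator GL (a s ** g) *\<^sub>R F (a s ** g) \<partial>?M)"
      by (rule integral_distr[OF _ m(1)]) measurable
    finally show ?thesis by (simp add: a_ind)
  qed
  ultimately have "((\<lambda>s::real. \<integral>g. indicator GL g *\<^sub>R F g \<partial>?M) has_vector_derivative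
      (\<integral>g. indicator GL g *\<^sub>R F' g \<partial>?M)) (at 0)" by (simp add: a0)
  then have "(\<integral>g. indicator GL g *\<^sub>R F' g \<partial>?M) = 0"
    by (rule vector_derivative_unique_at) (rule has_vector_derivative_const)
  then show ?thesis by (simp add: set_lebesgue_integral_def)
qed


section \<open>Additive characters\<close>

text \<open>
  A primitive \<open>G\<close> of \<open>g\<close> satisfies \<open>G (x + a) - G x = g x * G a\<close>. For some \<open>a\<close> the factor
  \<open>G a\<close> is nonzero, so \<open>g\<close> is differentiable and solves \<open>g' = d g\<close>; since its values lie on
  the unit circle, \<open>d\<close> is imaginary. The primitive starts at 0, which yields the formula for
  positive arguments first; multiplicativity extends it.
\<close>

lemma unitary_character_of_real:
  fixes g :: "real \<Rightarrow> complex"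
  assumes c: "continuous_on UNIV g" and u: "\<And>t. cmod (g t) = 1" and m: "\<And>s t. g (s + t) = g s * g t"
  shows "\<exists>a. \<forall>t. g t = exp (\<i> * of_real (a * t))"
proof -
  have g0: "g 0 = 1" using m[of 0 0] u[of 0] by auto
  define G where "G x = integral {0..x} g" for x
  have derG: "(G has_vector_derivative g x) (at x within {0..b})" if "x \<in> {0..b}" for x b
    unfolding G_def by (rule integral_has_vector_derivative[OF continuous_on_subset[OF c] that]) auto
  have "\<exists>a>0. G a \<noteq> 0"
  proof (rule ccontr)
    assume "\<not> ?thesis"
    then have z: "G a = 0" if "a \<in> {0..1}" for a using that by (cases "a = 0") (auto simp: G_def)
    have "(G has_vector_derivative g 0) (at 0 within {0..1})" by (rule derG) simp
    moreover have "(G has_vector_derivative 0) (at 0 within {0..1})"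
      by (rule has_vector_derivative_transform[where f = "\<lambda>_. 0"]) (use z in auto)
    ultimately have "g 0 = 0"
      by (rule vector_derivative_unique_within[rotated]) (simp add: trivial_limit_within islimpt_Icc)
    then show False using g0 by simp
  qed
  then obtain a where a: "a > 0" "G a \<noteq> 0" by blast
  define d where "d = (g a - 1) / G a"
  have fac: "G (x + a) - G x = g x * G a" if "x \<ge> 0" for x
  proof -
    have "integral {0..x} g + integral {x..x + a} g = integral {0..x + a} g"
      using that a by (intro Henstock_Kurzweil_Integration.integral_combine integrable_continuous_interval continuous_on_subset[OF c]) auto
    moreover have "integral {x..x + a} g = integral {0..a} (\<lambda>t. g (t + x))"
      using integral_shift_Icc_real[of 0 a g x] by (simp add: add.commute o_def)
    moreover have "\<dots> = integral {0..a} (\<lambda>t. g x * g t)" by (simp add: m mult.commute)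
    moreover have "\<dots> = g x * integral {0..a} g" by (rule integral_mult_right)
    ultimately show ?thesis by (simp add: G_def algebra_simps)
  qed
  have derg: "(g has_vector_derivative d * g x) (at x)" if x: "x > 0" for x
  proof -
    have G: "(G has_vector_derivative g y) (at y)" if "y > 0" for y
    proof -
      have "at y within {0..y+1} = at y" using that by (intro at_within_interior) auto
      then show ?thesis using derG[of y "y + 1"] that by simp
    qed
    have "((\<lambda>t. G (t + a)) has_vector_derivative g (x + a)) (at x)"
    proof -
      have "((\<lambda>t. t + a) has_vector_derivative 1) (at x)"
        by (auto intro!: derivative_eq_intros simp: has_vector_derivative_def)
      from vector_diff_chain_at[OF this, of G "g (x + a)"] G[of "x + a"] x a(1)
      show ?thesis by (simp add: o_def)
    qed
    then have "((\<lambda>t. (G (t + a) - G t) / G a) has_vector_derivative (g (x + a) - g x) / G a) (at x)"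
      using G[OF x] by (auto intro!: derivative_eq_intros)
    moreover have "(g (x + a) - g x) / G a = d * g x" using m[of x a] by (simp add: d_def algebra_simps diff_divide_distrib)
    ultimately have "((\<lambda>t. (G (t + a) - G t) / G a) has_vector_derivative d * g x) (at x)" by simp
    then show ?thesis
    proof (rule has_vector_derivative_transform_within_open[where S = "{0<..}"])
      show "(G (t + a) - G t) / G a = g t" if "t \<in> {0<..}" for t using fac[of t] that a by simp
    qed (use x in auto)
  qed
  have pos: "g x = exp (d * (of_real x - 1)) * g 1" if "x > 0" for x
  proof -
    define q where "q t = exp (- d * of_real t) * g t" for t :: real
    have q': "(q has_vector_derivative 0) (at t)" if "t > 0" for t
    proof -
      have "((\<lambda>t. exp (- d * of_real t)) has_vector_derivative exp (- d * of_real t) * (- d)) (at t)"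
        by (auto intro!: derivative_eq_intros has_vector_derivative_real_field)
      then have "(q has_vector_derivative exp (- d * of_real t) * (d * g t) + exp (- d * of_real t) * (- d) * g t) (at t)"
        unfolding q_def using derg[OF that] by (rule has_vector_derivative_mult)
      then show ?thesis by (simp add: algebra_simps)
    qed
    obtain k where "\<And>t. t \<in> {0<..} \<Longrightarrow> q t = k"
    proof (rule has_vector_derivative_zero_constant[of "{0<..}" q])
      show "(q has_vector_derivative 0) (at t within {0<..})" if "t \<in> {0<..}" for t
        using q' that by (auto intro: has_vector_derivative_at_within)
    qed (rule convex_real_interval, blast)
    then have "q x = q 1" using \<open>x > 0\<close> by simp
    then have "exp (d * of_real x) * (exp (- d * of_real x) * g x) = exp (d * of_real x) * (exp (- d) * g 1)"
      by (simp add: q_def)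
    moreover have "exp (d * of_real x) * exp (- d * of_real x) = 1"
      by (simp only: exp_add[symmetric]) simp
    moreover have "exp (d * of_real x) * exp (- d) = exp (d * (of_real x - 1))"
      by (simp add: exp_add[symmetric] right_diff_distrib)
    ultimately show ?thesis by (simp only: mult.assoc[symmetric] mult_1)
  qed
  have all: "g x = exp (d * of_real x)" for x
  proof -
    define y where "y = \<bar>x\<bar> + 1"
    have y: "y > 0" "x + y > 0" by (auto simp: y_def)
    have "g x * g y = g (x + y)" by (simp add: m)
    then have "g x * (exp (d * (of_real y - 1)) * g 1) = exp (d * (of_real (x + y) - 1)) * g 1"
      using pos[OF y(1)] pos[OF y(2)] by simp
    moreover have "g 1 \<noteq> 0" using u[of 1] by auto
    ultimately have "g x * exp (d * (of_real y - 1)) = exp (d * (of_real (x + y) - 1))" by simp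
    also have "\<dots> = exp (d * of_real x) * exp (d * (of_real y - 1))"
      by (simp add: exp_add[symmetric] algebra_simps)
    finally show ?thesis by simp
  qed
  have "cmod (exp d) = 1" using u[of 1] all[of 1] by simp
  then have "Re d = 0" by simp
  then have "d = \<i> * of_real (Im d)" by (simp add: complex_eq_iff)
  then have "g t = exp (\<i> * of_real (Im d * t))" for t using all[of t] by (metis mult.assoc of_real_mult)
  then show ?thesis by blast
qed

lemma additive_character_exp:
  fixes \<psi> :: "'f::arch_local_field \<Rightarrow> complex"
  assumes "nontrivial_additive_character \<psi>"
  shows "\<exists>l w. linear l \<and> l w \<noteq> 0 \<and> (\<forall>x. \<psi> x = exp (\<i> * of_real (l x :: real)))"
proof -
  have c: "continuous_on UNIV \<psi>" and u: "\<And>x. cmod (\<psi> x) = 1" and m: "\<And>x y. \<psi> (x + y) = \<psi> x * \<psi> y"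
    and nt: "\<exists>x. \<psi> x \<noteq> 1"
    using assms by (auto simp: nontrivial_additive_character_def additive_character_def)
  have "\<exists>a. \<forall>t. \<psi> (t *\<^sub>R b) = exp (\<i> * of_real (a * t))" for b
    by (rule unitary_character_of_real)
       (auto simp: u m scaleR_add_left intro!: continuous_on_compose2[OF c] continuous_intros)
  then obtain a where a: "\<And>b t. \<psi> (t *\<^sub>R b) = exp (\<i> * of_real (a b * t))" by metis
  define l where "l x = (\<Sum>b\<in>Basis. a b * (x \<bullet> b))" for x :: 'f
  have l: "linear l" unfolding l_def by (auto intro!: linearI simp: inner_add_left algebra_simps sum.distrib sum_distrib_left)
  have z: "\<psi> 0 = 1" using m[of 0 0] u[of 0] by auto
  have "\<psi> (\<Sum>b\<in>B. (x \<bullet> b) *\<^sub>R b) = exp (\<i> * of_real (\<Sum>b\<in>B. a b * (x \<bullet> b)))" if "finite B" for B and x :: 'f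
    using that by (induction B rule: finite_induct) (auto simp: z m a exp_add distrib_left)
  from this[of Basis] have e: "\<psi> x = exp (\<i> * of_real (l x))" for x
    by (simp add: l_def euclidean_representation)
  obtain w where "\<psi> w \<noteq> 1" using nt by blast
  then have "l w \<noteq> 0" using e[of w] by auto
  then show ?thesis using l e by blast
qed


section \<open>Symbols\<close>

text \<open>
  The velocity of \<open>g\<close> when the distinguished row of \<open>torsor_point\<close> is scaled in such a way
  that \<open>det g\<close> moves with velocity \<open>c\<close>. This is how \<open>torsor_point x ** h\<close>, with \<open>h\<close> in \<open>SL\<close>,
  moves when \<open>x\<close> moves with velocity \<open>c\<close>.
\<close>

definition row_motion :: "'f \<Rightarrow> 'f^'n^'n \<Rightarrow> 'f::arch_local_field^'n^'n" where
  "row_motion c g = (\<chi> i j. if i = (SOME k. True) then c / det g * g $ i $ j else 0)"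

lemma torsor_point_mult_index:
  "(torsor_point x ** g) $ i $ j = (if i = (SOME k. True) then x * g $ i $ j else g $ i $ j)"
proof -
  have "(torsor_point x ** g) $ i $ j = (\<Sum>l\<in>UNIV. if l = i then (if i = (SOME k. True) then x * g $ i $ j else g $ i $ j) else 0)"
    unfolding matrix_matrix_mult_def torsor_point_def vec_lambda_beta by (rule sum.cong) simp_all
  then show ?thesis by simp
qed

lemma add_row_motion:
  fixes g :: "'f::arch_local_field^'n^'n"
  assumes "det g \<noteq> 0"
  shows "g + s *\<^sub>R row_motion c g = torsor_point (1 + s *\<^sub>R c / det g) ** g"
  by (simp add: vec_eq_iff torsor_point_mult_index row_motion_def distrib_right scaleR_conv_of_real[where 'a='f])

lemma det_add_row_motion:
  fixes g :: "'f::arch_local_field^'n^'n"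
  assumes "det g \<noteq> 0"
  shows "det (g + s *\<^sub>R row_motion c g) = det g + s *\<^sub>R c"
  using assms by (simp add: add_row_motion det_mul det_torsor_point distrib_right scaleR_conv_of_real[where 'a='f])

lemma torsor_point_line:
  fixes h :: "'f::arch_local_field^'n^'n"
  assumes "det h = 1" "x \<noteq> 0"
  shows "torsor_point (x + s *\<^sub>R c) ** h = torsor_point x ** h + s *\<^sub>R row_motion c (torsor_point x ** h)"
  using assms
  by (simp add: vec_eq_iff torsor_point_mult_index row_motion_def det_mul det_torsor_point distrib_right scaleR_conv_of_real[where 'a='f])

text \<open>
  In a pair \<open>(u, g)\<close> the matrix \<open>u\<close> is the variable of the test function, and \<open>g\<close> runs through
  the torsors \<open>{g. det g = x}\<close>.
\<close>

type_synonym ('f, 'n) mpair = "('f^'n^'n) \<times> ('f^'n^'n)"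

definition GL2 :: "('f::arch_local_field, 'n::finite) mpair set" where "GL2 = GL \<times> GL"

lemma open_GL2: "open (GL2 :: ('f::arch_local_field, 'n::finite) mpair set)"
  unfolding GL2_def by (intro open_Times open_GL)

text \<open>
  The velocity of \<open>(u, torsor_point x ** h)\<close> when the parameters \<open>u\<close> and \<open>x\<close> move with
  velocities \<open>e\<close> and \<open>c\<close>.
\<close>

definition param_field :: "'f^'n^'n \<Rightarrow> 'f \<Rightarrow> ('f::arch_local_field, 'n::finite) mpair \<Rightarrow> ('f, 'n) mpair" where
  "param_field e c p = (e, row_motion c (snd p))"

text \<open>
  Left translation of \<open>g\<close> by \<open>1 + s X\<close> with \<open>X\<close> nilpotent; it does not leave the torsor of
  \<open>g\<close>.
\<close>

definition nil_field :: "('n \<times> 'n \<times> 'f \<times> bool) \<Rightarrow> ('f::arch_local_field, 'n::finite) mpair \<Rightarrow> ('f, 'n) mpair" where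
  "nil_field t p = (0, nilX t ** snd p)"

definition fields :: "(('f::arch_local_field, 'n::finite) mpair \<Rightarrow> ('f, 'n) mpair) set" where
  "fields = range (\<lambda>(e, c). param_field e c) \<union> nil_field ` nilp_index"

lemma fields_cases:
  assumes "\<xi> \<in> fields"
  obtains e c where "\<xi> = param_field e c" | t where "t \<in> nilp_index" "\<xi> = nil_field t"
  using assms unfolding fields_def by auto

lemma param_field_fields [simp]: "param_field e c \<in> fields"
  unfolding fields_def by auto

lemma nil_field_fields [simp]: "t \<in> nilp_index \<Longrightarrow> nil_field t \<in> fields"
  unfolding fields_def by auto

text \<open>
  The derivative of \<open>F\<close> along the vector field \<open>\<xi>\<close> is taken on the straight line with velocity
  \<open>\<xi> p\<close>. For the fields above these lines are the integral curves.
\<close>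

definition derives :: "(('f::arch_local_field, 'n::finite) mpair \<Rightarrow> 'c::real_normed_vector) \<Rightarrow>
    (('f, 'n) mpair \<Rightarrow> ('f, 'n) mpair) \<Rightarrow> (('f, 'n) mpair \<Rightarrow> 'c) \<Rightarrow> bool" where
  "derives F \<xi> F' \<longleftrightarrow> (\<forall>p\<in>GL2. ((\<lambda>s. F (p + s *\<^sub>R \<xi> p)) has_vector_derivative F' p) (at 0))"

text \<open>
  Here \<open>u\<close> is confined to a compact part of \<open>GL\<close> and \<open>det g\<close> to a compact part of the
  multiplicative group, while \<open>g\<close> may be large.
\<close>

definition bdd_region :: "real \<Rightarrow> ('f::arch_local_field, 'n::finite) mpair set" where
  "bdd_region R = {p. norm (fst p) \<le> R \<and> 1 / R \<le> norm (det (fst p)) \<and>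
     1 / R \<le> norm (det (snd p)) \<and> norm (det (snd p)) \<le> R}"

definition of_order :: "real \<Rightarrow> (('f::arch_local_field, 'n::finite) mpair \<Rightarrow> 'c::real_normed_vector) \<Rightarrow> bool" where
  "of_order m F \<longleftrightarrow> continuous_on GL2 F \<and>
     (\<forall>R>0. \<exists>C. \<forall>p\<in>bdd_region R. norm (F p) \<le> C * (1 + norm (snd p)) powr m)"

text \<open>
  Symbols of order \<open>m\<close>, with control of \<open>k\<close> derivatives. Differentiation preserves the order
  instead of lowering it, since the vector fields themselves grow linearly in \<open>g\<close>.
\<close>

primrec symb :: "nat \<Rightarrow> real \<Rightarrow> (('f::arch_local_field, 'n::finite) mpair \<Rightarrow> 'c::real_normed_vector) \<Rightarrow> bool" where
  "symb 0 m F \<longleftrightarrow> of_order m F"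
| "symb (Suc k) m F \<longleftrightarrow> of_order m F \<and> (\<forall>\<xi>\<in>fields. \<exists>F'. derives F \<xi> F' \<and> symb k m F')"

lemma bdd_region_GL2: "R > 0 \<Longrightarrow> bdd_region R \<subseteq> GL2"
proof
  fix p :: "('a, 'b) mpair" assume "R > 0" "p \<in> bdd_region R"
  moreover from this have "0 < 1 / R" by simp
  ultimately have "norm (det (fst p)) > 0" "norm (det (snd p)) > 0"
    unfolding bdd_region_def by (auto intro: less_le_trans)
  then show "p \<in> GL2" by (cases p) (simp add: GL2_def GL_iff_det)
qed

lemma of_orderI:
  assumes "continuous_on GL2 F" "\<And>R. R > 0 \<Longrightarrow> \<exists>C. \<forall>p\<in>bdd_region R. norm (F p) \<le> C * (1 + norm (snd p)) powr m"
  shows "of_order m F"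
  using assms unfolding of_order_def by blast

lemma of_orderD:
  assumes "of_order m F" "R > 0"
  obtains C where "C \<ge> 0" "\<And>p. p \<in> bdd_region R \<Longrightarrow> norm (F p) \<le> C * (1 + norm (snd p)) powr m"
proof -
  obtain C where C: "\<And>p. p \<in> bdd_region R \<Longrightarrow> norm (F p) \<le> C * (1 + norm (snd p)) powr m"
    using assms unfolding of_order_def by blast
  have "norm (F p) \<le> max C 0 * (1 + norm (snd p)) powr m" if "p \<in> bdd_region R" for p
    using C[OF that] mult_right_mono[of C "max C 0" "(1 + norm (snd p)) powr m"] by fastforce
  then show thesis using that[of "max C 0"] by simp
qed

lemma symb_of_order: "symb k m F \<Longrightarrow> of_order m F"
  by (cases k) auto

lemma symb_Suc_imp: "symb (Suc k) m F \<Longrightarrow> symb k m F"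
proof (induction k arbitrary: F)
  case 0 then show ?case by simp
next
  case (Suc k)
  show ?case
    unfolding symb.simps(2)
  proof (intro conjI ballI)
    show "of_order m F" using Suc.prems by simp
    fix \<xi> :: "('a, 'b) mpair \<Rightarrow> ('a, 'b) mpair" assume "\<xi> \<in> fields"
    then obtain F' where "derives F \<xi> F'" "symb (Suc k) m F'" using Suc.prems unfolding symb.simps(2)[of "Suc k"] by blast
    then show "\<exists>F'. derives F \<xi> F' \<and> symb k m F'" using Suc.IH by blast
  qed
qed

lemma symb_SucI:
  assumes "of_order m F" "\<And>\<xi>. \<xi> \<in> fields \<Longrightarrow> \<exists>F'. derives F \<xi> F' \<and> symb k m F'"
  shows "symb (Suc k) m F"
  using assms by simp

lemma symb_SucD:
  assumes "symb (Suc k) m F" "\<xi> \<in> fields"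
  obtains F' where "derives F \<xi> F'" "symb k m F'"
  using assms by auto

lemma of_order_weaken: "of_order m F \<Longrightarrow> m \<le> m' \<Longrightarrow> of_order m' F"
proof (rule of_orderI)
  assume F: "of_order m F" "m \<le> m'"
  show "continuous_on GL2 F" using F by (simp add: of_order_def)
  fix R :: real assume "R > 0"
  then obtain C where C: "C \<ge> 0" "\<And>p. p \<in> bdd_region R \<Longrightarrow> norm (F p) \<le> C * (1 + norm (snd p)) powr m"
    using of_orderD[OF F(1)] by blast
  have "norm (F p) \<le> C * (1 + norm (snd p)) powr m'" if "p \<in> bdd_region R" for p
  proof -
    have "C * (1 + norm (snd p)) powr m \<le> C * (1 + norm (snd p)) powr m'"
      using F(2) C(1) by (intro mult_left_mono powr_mono) auto
    then show ?thesis using C(2)[OF that] by linarith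
  qed
  then show "\<exists>C. \<forall>p\<in>bdd_region R. norm (F p) \<le> C * (1 + norm (snd p)) powr m'" by blast
qed

lemma symb_weaken: "symb k m F \<Longrightarrow> m \<le> m' \<Longrightarrow> symb k m' F"
proof (induction k arbitrary: F)
  case 0 then show ?case by (simp add: of_order_weaken)
next
  case (Suc k)
  show ?case
  proof (rule symb_SucI)
    show "of_order m' F" using Suc.prems by (auto intro: of_order_weaken)
    fix \<xi> :: "('a, 'b) mpair \<Rightarrow> ('a, 'b) mpair" assume "\<xi> \<in> fields"
    then obtain F' where "derives F \<xi> F'" "symb k m F'" using symb_SucD[OF Suc.prems(1)] by blast
    then show "\<exists>F'. derives F \<xi> F' \<and> symb k m' F'" using Suc.IH Suc.prems(2) by blast
  qed
qed

lemma eventually_line_in_open: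
  fixes p v :: "'a::real_normed_vector"
  assumes "open V" "p \<in> V"
  shows "\<forall>\<^sub>F s in nhds (0::real). p + s *\<^sub>R v \<in> V"
proof -
  have "((\<lambda>s. p + s *\<^sub>R v) \<longlongrightarrow> p + 0 *\<^sub>R v) (nhds 0)"
    by (intro tendsto_intros filterlim_ident)
  then show ?thesis using assms by (intro topological_tendstoD) auto
qed

lemma derives_cong:
  assumes "derives F \<xi> F'" "\<And>p. p \<in> GL2 \<Longrightarrow> F p = G p" "\<And>p. p \<in> GL2 \<Longrightarrow> F' p = G' p"
  shows "derives G \<xi> G'"
  unfolding derives_def
proof
  fix p :: "('a, 'b) mpair" assume p: "p \<in> GL2"
  have "((\<lambda>s. F (p + s *\<^sub>R \<xi> p)) has_vector_derivative G' p) (at 0)"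
    using assms(1,3) p unfolding derives_def by metis
  moreover have "\<forall>\<^sub>F s in nhds 0. s \<in> UNIV \<longrightarrow> G (p + s *\<^sub>R \<xi> p) = F (p + s *\<^sub>R \<xi> p)"
    using eventually_line_in_open[OF open_GL2 p, of "\<xi> p"] by eventually_elim (simp add: assms(2))
  ultimately show "((\<lambda>s. G (p + s *\<^sub>R \<xi> p)) has_vector_derivative G' p) (at 0)"
    using assms(2)[OF p] by (subst has_vector_derivative_cong_ev) auto
qed

lemma of_order_cong:
  assumes "of_order m F" "\<And>p. p \<in> GL2 \<Longrightarrow> F p = G p"
  shows "of_order m G"
proof (rule of_orderI)
  show "continuous_on GL2 G" using assms by (auto simp: of_order_def cong: continuous_on_cong)
  fix R :: real assume R: "R > 0"
  then obtain C where "C \<ge> 0" "\<And>p. p \<in> bdd_region R \<Longrightarrow> norm (F p) \<le> C * (1 + norm (snd p)) powr m"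
    using of_orderD[OF assms(1)] by blast
  then show "\<exists>C. \<forall>p\<in>bdd_region R. norm (G p) \<le> C * (1 + norm (snd p)) powr m"
    using bdd_region_GL2[OF R] assms(2) by (metis subsetD)
qed

lemma symb_cong:
  assumes "symb k m F" "\<And>p. p \<in> GL2 \<Longrightarrow> F p = G p"
  shows "symb k m G"
proof (cases k)
  case 0 then show ?thesis using assms by (auto intro: of_order_cong)
next
  case (Suc j)
  have "symb (Suc j) m G"
  proof (rule symb_SucI)
    show "of_order m G" using of_order_cong[OF symb_of_order[OF assms(1)] assms(2)] .
    fix \<xi> :: "('a, 'b) mpair \<Rightarrow> ('a, 'b) mpair" assume "\<xi> \<in> fields"
    then obtain F' where "derives F \<xi> F'" "symb j m F'" using symb_SucD[OF assms(1)[unfolded Suc]] by blast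
    then show "\<exists>F'. derives G \<xi> F' \<and> symb j m F'" using derives_cong[of F \<xi> F' G F'] assms(2) by blast
  qed
  then show ?thesis by (simp add: Suc)
qed

lemma of_order_const: "of_order 0 (\<lambda>_. c)"
  by (rule of_orderI) (auto intro!: exI[of _ "norm c"] simp: powr_zero_eq_one add_nonneg_eq_0_iff)

lemma derives_const: "derives (\<lambda>_. c) \<xi> (\<lambda>_. 0)"
  by (simp add: derives_def has_vector_derivative_const)

lemma symb_const: "symb k 0 (\<lambda>_. c)"
proof (induction k arbitrary: c)
  case 0 then show ?case by (simp add: of_order_const)
next
  case (Suc k)
  show ?case by (rule symb_SucI[OF of_order_const]) (use derives_const Suc in blast)
qed

lemma symb_zero: "symb k m (\<lambda>_. 0)"
proof (induction k)
  have o: "of_order m (\<lambda>_. 0)" by (rule of_orderI) (auto intro!: exI[of _ 0])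
  { case 0 then show ?case using o by simp
  next
    case (Suc k) then show ?case using o derives_const[of 0] by auto }
qed

lemma of_order_add:
  assumes "of_order m F" "of_order m G" shows "of_order m (\<lambda>p. F p + G p)"
proof (rule of_orderI)
  show "continuous_on GL2 (\<lambda>p. F p + G p)" using assms by (auto simp: of_order_def intro: continuous_on_add)
  fix R :: real assume R: "R > 0"
  obtain C where C: "\<And>p. p \<in> bdd_region R \<Longrightarrow> norm (F p) \<le> C * (1 + norm (snd p)) powr m"
    using of_orderD[OF assms(1) R] by blast
  obtain D where D: "\<And>p. p \<in> bdd_region R \<Longrightarrow> norm (G p) \<le> D * (1 + norm (snd p)) powr m"
    using of_orderD[OF assms(2) R] by blast
  have "norm (F p + G p) \<le> (C + D) * (1 + norm (snd p)) powr m" if "p \<in> bdd_region R" for p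
    using C[OF that] D[OF that] norm_triangle_ineq[of "F p" "G p"] by (simp add: distrib_right)
  then show "\<exists>C. \<forall>p\<in>bdd_region R. norm (F p + G p) \<le> C * (1 + norm (snd p)) powr m" by blast
qed

lemma derives_add: "derives F \<xi> F' \<Longrightarrow> derives G \<xi> G' \<Longrightarrow> derives (\<lambda>p. F p + G p) \<xi> (\<lambda>p. F' p + G' p)"
  unfolding derives_def by (auto intro: has_vector_derivative_add)

lemma symb_add: "symb k m F \<Longrightarrow> symb k m G \<Longrightarrow> symb k m (\<lambda>p. F p + G p)"
proof (induction k arbitrary: F G)
  case 0 then show ?case by (simp add: of_order_add)
next
  case (Suc k)
  show ?case
  proof (rule symb_SucI)
    show "of_order m (\<lambda>p. F p + G p)" using Suc.prems[THEN symb_of_order] by (rule of_order_add)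
    fix \<xi> :: "('a, 'b) mpair \<Rightarrow> ('a, 'b) mpair" assume x: "\<xi> \<in> fields"
    obtain F' where "derives F \<xi> F'" "symb k m F'" using symb_SucD[OF Suc.prems(1) x] by blast
    moreover obtain G' where "derives G \<xi> G'" "symb k m G'" using symb_SucD[OF Suc.prems(2) x] by blast
    ultimately show "\<exists>F'. derives (\<lambda>p. F p + G p) \<xi> F' \<and> symb k m F'"
      using derives_add Suc.IH by blast
  qed
qed

lemma symb_sum:
  assumes "\<And>i. i \<in> I \<Longrightarrow> symb k m (F i)" shows "symb k m (\<lambda>p. \<Sum>i\<in>I. F i p)"
  using assms by (induction I rule: infinite_finite_induct) (auto intro: symb_zero symb_add)

lemma of_order_mult:
  fixes F G :: "('f::arch_local_field, 'n::finite) mpair \<Rightarrow> 'c::real_normed_algebra"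
  assumes "of_order m F" "of_order m' G" shows "of_order (m + m') (\<lambda>p. F p * G p)"
proof (rule of_orderI)
  show "continuous_on GL2 (\<lambda>p. F p * G p)" using assms by (auto simp: of_order_def intro: continuous_on_mult)
  fix R :: real assume R: "R > 0"
  obtain C where C: "C \<ge> 0" "\<And>p. p \<in> bdd_region R \<Longrightarrow> norm (F p) \<le> C * (1 + norm (snd p)) powr m"
    using of_orderD[OF assms(1) R] by blast
  obtain D where D: "D \<ge> 0" "\<And>p. p \<in> bdd_region R \<Longrightarrow> norm (G p) \<le> D * (1 + norm (snd p)) powr m'"
    using of_orderD[OF assms(2) R] by blast
  have "norm (F p * G p) \<le> (C * D) * (1 + norm (snd p)) powr (m + m')" if "p \<in> bdd_region R" for p
  proof -
    have "norm (F p * G p) \<le> norm (F p) * norm (G p)" by (rule norm_mult_ineq)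
    also have "\<dots> \<le> (C * (1 + norm (snd p)) powr m) * (D * (1 + norm (snd p)) powr m')"
      using C D that by (intro mult_mono) auto
    also have "\<dots> = (C * D) * (1 + norm (snd p)) powr (m + m')" by (simp add: powr_add mult_ac)
    finally show ?thesis .
  qed
  then show "\<exists>C. \<forall>p\<in>bdd_region R. norm (F p * G p) \<le> C * (1 + norm (snd p)) powr (m + m')" by blast
qed

lemma derives_mult:
  fixes F G :: "('f::arch_local_field, 'n::finite) mpair \<Rightarrow> 'c::real_normed_algebra"
  shows "derives F \<xi> F' \<Longrightarrow> derives G \<xi> G' \<Longrightarrow> derives (\<lambda>p. F p * G p) \<xi> (\<lambda>p. F p * G' p + F' p * G p)"
  unfolding derives_def using has_vector_derivative_mult by fastforce

lemma symb_mult: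
  fixes F G :: "('f::arch_local_field, 'n::finite) mpair \<Rightarrow> 'c::real_normed_algebra"
  shows "symb k m F \<Longrightarrow> symb k m' G \<Longrightarrow> symb k (m + m') (\<lambda>p. F p * G p)"
proof (induction k arbitrary: F G)
  case 0 then show ?case by (simp add: of_order_mult)
next
  case (Suc k)
  show ?case
  proof (rule symb_SucI)
    show "of_order (m + m') (\<lambda>p. F p * G p)" using Suc.prems[THEN symb_of_order] by (rule of_order_mult)
    fix \<xi> :: "('f, 'n) mpair \<Rightarrow> ('f, 'n) mpair" assume x: "\<xi> \<in> fields"
    obtain F' where F': "derives F \<xi> F'" "symb k m F'" using symb_SucD[OF Suc.prems(1) x] by blast
    obtain G' where G': "derives G \<xi> G'" "symb k m' G'" using symb_SucD[OF Suc.prems(2) x] by blast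
    have "symb k (m + m') (\<lambda>p. F p * G' p + F' p * G p)"
      by (intro symb_add Suc.IH F' G' Suc.prems[THEN symb_Suc_imp])
    then show "\<exists>F'. derives (\<lambda>p. F p * G p) \<xi> F' \<and> symb k (m + m') F'"
      using derives_mult[OF F'(1) G'(1)] by blast
  qed
qed

lemma symb_prod:
  fixes F :: "'i \<Rightarrow> ('f::arch_local_field, 'n::finite) mpair \<Rightarrow> 'c::{real_normed_algebra_1, comm_ring_1}"
  assumes "\<And>i. i \<in> I \<Longrightarrow> symb k 0 (F i)" shows "symb k 0 (\<lambda>p. \<Prod>i\<in>I. F i p)"
  using assms
proof (induction I rule: infinite_finite_induct)
  case (insert i I)
  then have "symb k (0 + 0) (\<lambda>p. F i p * (\<Prod>i\<in>I. F i p))" by (intro symb_mult) auto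
  then show ?case using insert by simp
qed (auto intro: symb_const)

lemma derives_bounded_linear:
  assumes "bounded_linear T" "derives F \<xi> F'" shows "derives (\<lambda>p. T (F p)) \<xi> (\<lambda>p. T (F' p))"
  using assms unfolding derives_def by (auto intro: bounded_linear.has_vector_derivative)

lemma symb_bounded_linear:
  assumes T: "bounded_linear T" shows "symb k m F \<Longrightarrow> symb k m (\<lambda>p. T (F p))"
proof (induction k arbitrary: F)
  have o: "of_order m (\<lambda>p. T (F p))" if F: "of_order m F" for F
  proof (rule of_orderI)
    show "continuous_on GL2 (\<lambda>p. T (F p))" using F by (auto simp: of_order_def intro: bounded_linear.continuous_on[OF T])
    fix R :: real assume R: "R > 0"
    obtain C where C: "\<And>p. p \<in> bdd_region R \<Longrightarrow> norm (F p) \<le> C * (1 + norm (snd p)) powr m"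
      using of_orderD[OF F R] by blast
    obtain K where K: "K > 0" "\<And>x. norm (T x) \<le> norm x * K" using bounded_linear.pos_bounded[OF T] by blast
    have "norm (T (F p)) \<le> (K * C) * (1 + norm (snd p)) powr m" if "p \<in> bdd_region R" for p
    proof -
      have "norm (T (F p)) \<le> K * norm (F p)" using K(2) by (simp add: mult.commute)
      also have "\<dots> \<le> K * (C * (1 + norm (snd p)) powr m)" using C[OF that] K(1) by (intro mult_left_mono) auto
      finally show ?thesis by (simp add: mult.assoc)
    qed
    then show "\<exists>C. \<forall>p\<in>bdd_region R. norm (T (F p)) \<le> C * (1 + norm (snd p)) powr m" by blast
  qed
  { case 0 then show ?case using o by simp
  next
    case (Suc k)
    show ?case
    proof (rule symb_SucI)
      show "of_order m (\<lambda>p. T (F p))" using o[OF symb_of_order[OF Suc.prems]] .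
      fix \<xi> :: "('c, 'd) mpair \<Rightarrow> ('c, 'd) mpair" assume x: "\<xi> \<in> fields"
      obtain F' where "derives F \<xi> F'" "symb k m F'" using symb_SucD[OF Suc.prems(1) x] by blast
      then show "\<exists>F'. derives (\<lambda>p. T (F p)) \<xi> F' \<and> symb k m F'"
        using derives_bounded_linear[OF T] Suc.IH by blast
    qed }
qed


section \<open>Algebra of symbols\<close>

lemma has_vector_derivative_affine: "((\<lambda>s. a + s *\<^sub>R b) has_vector_derivative b) (at x)"
  by (auto intro!: derivative_eq_intros simp: has_vector_derivative_def)

lemma derives_fst_entry: "derives (\<lambda>p. fst p $ i $ j) \<xi> (\<lambda>p. fst (\<xi> p) $ i $ j)"
  by (simp add: derives_def has_vector_derivative_affine)

lemma derives_snd_entry: "derives (\<lambda>p. snd p $ i $ j) \<xi> (\<lambda>p. snd (\<xi> p) $ i $ j)"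
  by (simp add: derives_def has_vector_derivative_affine)

lemma of_order_0I:
  fixes F :: "('f::arch_local_field, 'n::finite) mpair \<Rightarrow> 'c::real_normed_vector"
  assumes "continuous_on GL2 F" "\<And>R. R > 0 \<Longrightarrow> \<exists>C. \<forall>p\<in>bdd_region R. norm (F p) \<le> C"
  shows "of_order 0 F"
proof (rule of_orderI[OF assms(1)])
  fix R :: real assume "R > 0"
  then obtain C where "\<And>p. p \<in> bdd_region R \<Longrightarrow> norm (F p) \<le> C" using assms(2) by blast
  moreover have "(1 + norm (snd p)) powr 0 = 1" for p :: "('f, 'n) mpair"
    using norm_ge_zero[of "snd p"] by (simp add: add_nonneg_eq_0_iff)
  ultimately have "norm (F p) \<le> C * (1 + norm (snd p)) powr 0" if "p \<in> bdd_region R" for p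
    using that by (simp only: mult_1_right)
  then show "\<exists>C. \<forall>p\<in>bdd_region R. norm (F p) \<le> C * (1 + norm (snd p)) powr 0" by blast
qed

text \<open>
  Matrix-valued symbols, understood entrywise: traces, products and determinants are then sums
  and products of scalar symbols.
\<close>

definition msymb :: "nat \<Rightarrow> real \<Rightarrow> (('f::arch_local_field, 'n::finite) mpair \<Rightarrow> 'f^'n^'n) \<Rightarrow> bool" where
  "msymb k m A \<longleftrightarrow> (\<forall>i j. symb k m (\<lambda>p. A p $ i $ j))"

lemma symb_fst_entry: "symb k 0 (\<lambda>p :: ('f::arch_local_field, 'n::finite) mpair. fst p $ i $ j)"
proof -
  have o: "of_order 0 (\<lambda>p :: ('f, 'n) mpair. fst p $ i $ j)"
  proof (rule of_order_0I)
    show "continuous_on GL2 (\<lambda>p :: ('f, 'n) mpair. fst p $ i $ j)" by (intro continuous_intros)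
    show "\<exists>C. \<forall>p\<in>bdd_region R. norm (fst (p :: ('f, 'n) mpair) $ i $ j) \<le> C" for R
      by (intro exI[of _ R] ballI) (auto simp: bdd_region_def intro: order_trans[OF norm_entry_le])
  qed
  show ?thesis
  proof (cases k)
    case (Suc k')
    have "symb (Suc k') 0 (\<lambda>p :: ('f, 'n) mpair. fst p $ i $ j)"
    proof (rule symb_SucI[OF o])
      fix \<xi> :: "('f, 'n) mpair \<Rightarrow> ('f, 'n) mpair" assume "\<xi> \<in> fields"
      then show "\<exists>F'. derives (\<lambda>p. fst p $ i $ j) \<xi> F' \<and> symb k' 0 F'"
      proof (cases rule: fields_cases)
        case (1 e c)
        then show ?thesis using derives_fst_entry[of i j \<xi>] symb_const[of k' "e $ i $ j"] by (auto simp: param_field_def)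
      next
        case (2 t)
        then show ?thesis using derives_fst_entry[of i j \<xi>] symb_const[of k' 0] by (auto simp: nil_field_def)
      qed
    qed
    then show ?thesis by (simp add: Suc)
  qed (use o in simp)
qed

lemma derives_det_snd_param:
  "derives (\<lambda>p :: ('f::arch_local_field, 'n::finite) mpair. det (snd p)) (param_field e c) (\<lambda>_. c)"
  unfolding derives_def
proof
  fix p :: "('f, 'n) mpair" assume "p \<in> GL2"
  then have "det (snd p) \<noteq> 0" by (auto simp: GL2_def GL_iff_det)
  then have "(\<lambda>s. det (snd (p + s *\<^sub>R param_field e c p))) = (\<lambda>s. det (snd p) + s *\<^sub>R c)"
    by (simp add: param_field_def det_add_row_motion)
  then show "((\<lambda>s. det (snd (p + s *\<^sub>R param_field e c p))) has_vector_derivative c) (at 0)"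
    by (simp add: has_vector_derivative_affine)
qed

lemma add_nil_motion: "g + s *\<^sub>R (X ** g) = (mat 1 + s *\<^sub>R X) ** (g :: 'f::arch_local_field^'n^'n)"
  by (simp add: matrix_add_rdistrib scaleR_matrix_mult_left)

lemma derives_det_snd_nil:
  assumes "t \<in> nilp_index"
  shows "derives (\<lambda>p :: ('f::arch_local_field, 'n::finite) mpair. det (snd p)) (nil_field t) (\<lambda>_. 0)"
  unfolding derives_def nil_field_def
  using assms by (simp add: add_nil_motion det_mul det_nilX has_vector_derivative_const)

lemma derives_inverse:
  fixes F :: "('f::arch_local_field, 'n::finite) mpair \<Rightarrow> 'c::real_normed_div_algebra"
  assumes "derives F \<xi> F'" "\<And>p. p \<in> GL2 \<Longrightarrow> F p \<noteq> 0"
  shows "derives (\<lambda>p. inverse (F p)) \<xi> (\<lambda>p. - (inverse (F p) * F' p * inverse (F p)))"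
  unfolding derives_def
proof
  fix p :: "('f, 'n) mpair" assume p: "p \<in> GL2"
  have "((\<lambda>s. F (p + s *\<^sub>R \<xi> p)) has_derivative (\<lambda>h. h *\<^sub>R F' p)) (at 0)"
    using assms(1) p unfolding derives_def has_vector_derivative_def by blast
  then have "((\<lambda>s. inverse (F (p + s *\<^sub>R \<xi> p))) has_derivative
     (\<lambda>h. - (inverse (F (p + 0 *\<^sub>R \<xi> p)) * (h *\<^sub>R F' p) * inverse (F (p + 0 *\<^sub>R \<xi> p))))) (at 0)"
    using assms(2)[OF p] by (intro Deriv.has_derivative_inverse) auto
  then show "((\<lambda>s. inverse (F (p + s *\<^sub>R \<xi> p))) has_vector_derivative - (inverse (F p) * F' p * inverse (F p))) (at 0)"
    by (simp add: has_vector_derivative_def)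
qed

lemma GL2_det: "p \<in> GL2 \<Longrightarrow> det (fst p) \<noteq> 0" "p \<in> GL2 \<Longrightarrow> det (snd p) \<noteq> 0"
  by (auto simp: GL2_def GL_iff_det)

text \<open>
  Along each of the fields the determinant of \<open>g\<close> moves with constant velocity, which is 0 for
  the nilpotent ones.
\<close>

lemma symb_det_snd:
  "symb k 0 (\<lambda>p :: ('f::arch_local_field, 'n::finite) mpair. det (snd p))"
  "symb k 0 (\<lambda>p :: ('f::arch_local_field, 'n::finite) mpair. inverse (det (snd p)))"
proof -
  have o1: "of_order 0 (\<lambda>p :: ('f, 'n) mpair. det (snd p))"
    by (rule of_order_0I) (auto simp: bdd_region_def intro!: continuous_intros)
  have o2: "of_order 0 (\<lambda>p :: ('f, 'n) mpair. inverse (det (snd p)))"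
  proof (rule of_order_0I)
    show "continuous_on GL2 (\<lambda>p :: ('f, 'n) mpair. inverse (det (snd p)))"
      by (intro continuous_intros) (simp add: GL2_det)
    fix R :: real assume "R > 0"
    then have "norm (inverse (det (snd p))) \<le> R" if "p \<in> bdd_region R" for p :: "('f, 'n) mpair"
      using that le_imp_inverse_le[of "1 / R" "norm (det (snd p))"] by (simp add: bdd_region_def norm_inverse)
    then show "\<exists>C. \<forall>p\<in>bdd_region R. norm (inverse (det (snd (p :: ('f, 'n) mpair)))) \<le> C" by blast
  qed
  show "symb k 0 (\<lambda>p :: ('f, 'n) mpair. det (snd p))"
  proof (cases k)
    case (Suc k')
    have "symb (Suc k') 0 (\<lambda>p :: ('f, 'n) mpair. det (snd p))"
    proof (rule symb_SucI[OF o1])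
      fix \<xi> :: "('f, 'n) mpair \<Rightarrow> ('f, 'n) mpair" assume "\<xi> \<in> fields"
      then show "\<exists>F'. derives (\<lambda>p. det (snd p)) \<xi> F' \<and> symb k' 0 F'"
        using derives_det_snd_param derives_det_snd_nil symb_const
        by (cases rule: fields_cases) blast+
    qed
    then show ?thesis by (simp add: Suc)
  qed (use o1 in simp)
  show "symb k 0 (\<lambda>p :: ('f, 'n) mpair. inverse (det (snd p)))"
  proof (induction k)
    case 0 then show ?case using o2 by simp
  next
    case (Suc k)
    show ?case
    proof (rule symb_SucI[OF o2])
      fix \<xi> :: "('f, 'n) mpair \<Rightarrow> ('f, 'n) mpair" assume "\<xi> \<in> fields"
      then obtain c where "derives (\<lambda>p. det (snd p)) \<xi> (\<lambda>_. c)"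
        using derives_det_snd_param derives_det_snd_nil by (cases rule: fields_cases) blast+
      then have "derives (\<lambda>p. inverse (det (snd p))) \<xi> (\<lambda>p. - (inverse (det (snd p)) * c * inverse (det (snd p))))"
        by (rule derives_inverse) (simp add: GL2_det)
      moreover have "symb k (0 + 0 + 0) (\<lambda>p :: ('f, 'n) mpair. inverse (det (snd p)) * c * inverse (det (snd p)))"
        by (intro symb_mult Suc symb_const)
      then have "symb k 0 (\<lambda>p :: ('f, 'n) mpair. - (inverse (det (snd p)) * c * inverse (det (snd p))))"
        using symb_bounded_linear[OF bounded_linear_minus[OF bounded_linear_ident]] by simp
      ultimately show "\<exists>F'. derives (\<lambda>p. inverse (det (snd p))) \<xi> F' \<and> symb k 0 F'" by blast
    qed
  qed
qed

lemma symb_mult0: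
  fixes F G :: "('f::arch_local_field, 'n::finite) mpair \<Rightarrow> 'c::real_normed_algebra"
  shows "symb k 0 F \<Longrightarrow> symb k m G \<Longrightarrow> symb k m (\<lambda>p. F p * G p)"
  using symb_mult[of k 0 F m G] by simp

lemma symb_snd_entry: "symb k 1 (\<lambda>p :: ('f::arch_local_field, 'n::finite) mpair. snd p $ i $ j)"
proof (induction k arbitrary: i j)
  have o: "of_order 1 (\<lambda>p :: ('f, 'n) mpair. snd p $ i $ j)" for i j
  proof (rule of_orderI)
    show "continuous_on GL2 (\<lambda>p :: ('f, 'n) mpair. snd p $ i $ j)" by (intro continuous_intros)
    have "norm (snd p $ i $ j) \<le> 1 * (1 + norm (snd p)) powr 1" for p :: "('f, 'n) mpair"
      using norm_entry_le[of "snd p" i j] norm_ge_zero[of "snd p"] by simp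
    then show "\<exists>C. \<forall>p\<in>bdd_region R. norm (snd (p :: ('f, 'n) mpair) $ i $ j) \<le> C * (1 + norm (snd p)) powr 1" for R by blast
  qed
  { case 0 then show ?case using o by simp
  next
    case (Suc k)
    show ?case
    proof (rule symb_SucI[OF o])
      fix \<xi> :: "('f, 'n) mpair \<Rightarrow> ('f, 'n) mpair" assume "\<xi> \<in> fields"
      then have "symb k 1 (\<lambda>p. snd (\<xi> p) $ i $ j)"
      proof (cases rule: fields_cases)
        case (1 e c)
        show ?thesis
        proof (cases "i = (SOME k. True)")
          case True
          have "symb k 1 (\<lambda>p :: ('f, 'n) mpair. c * inverse (det (snd p)) * snd p $ i $ j)"
            by (intro symb_mult0 symb_const symb_det_snd Suc)
          then show ?thesis using 1 True by (simp add: param_field_def row_motion_def divide_inverse)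
        next
          case False
          then show ?thesis using 1 by (simp add: param_field_def row_motion_def symb_zero)
        qed
      next
        case (2 t)
        have "symb k 1 (\<lambda>p :: ('f, 'n) mpair. \<Sum>l\<in>UNIV. nilX t $ i $ l * snd p $ l $ j)"
          by (intro symb_sum symb_mult0 symb_const Suc)
        then show ?thesis using 2 by (simp add: nil_field_def matrix_matrix_mult_def)
      qed
      then show "\<exists>F'. derives (\<lambda>p. snd p $ i $ j) \<xi> F' \<and> symb k 1 F'"
        using derives_snd_entry by blast
    qed }
qed

lemma msymb_fst: "msymb k 0 fst" and msymb_snd: "msymb k 1 snd"
  by (simp_all add: msymb_def symb_fst_entry symb_snd_entry)

lemma msymb_const: "msymb k 0 (\<lambda>_. A)"
  by (simp_all add: msymb_def symb_const symb_zero)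

lemma msymb_mult: "msymb k m A \<Longrightarrow> msymb k m' A' \<Longrightarrow> msymb k (m + m') (\<lambda>p. A p ** A' p)"
  unfolding msymb_def matrix_matrix_mult_def vec_lambda_beta by (intro allI symb_sum symb_mult) auto

lemma symb_trace: "msymb k m A \<Longrightarrow> symb k m (\<lambda>p. trace (A p))"
  unfolding msymb_def trace_def by (intro symb_sum) auto

lemma symb_det: "msymb k 0 A \<Longrightarrow> symb k 0 (\<lambda>p. det (A p))"
  unfolding msymb_def det_def by (intro symb_sum symb_mult0 symb_const symb_prod) auto

lemma msymb_fields:
  assumes "\<xi> \<in> (fields :: (('f::arch_local_field, 'n::finite) mpair \<Rightarrow> ('f, 'n) mpair) set)"
  shows "msymb k 0 (\<lambda>p. fst (\<xi> p))" "msymb k 1 (\<lambda>p. snd (\<xi> p))"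
proof -
  show "msymb k 0 (\<lambda>p. fst (\<xi> p))"
    using assms by (cases rule: fields_cases) (simp_all add: param_field_def nil_field_def msymb_const)
  show "msymb k 1 (\<lambda>p. snd (\<xi> p))"
    unfolding msymb_def
  proof (intro allI)
    fix i j
    obtain F' where F': "derives (\<lambda>p :: ('f, 'n) mpair. snd p $ i $ j) \<xi> F'" "symb k 1 F'"
      using symb_SucD[OF symb_snd_entry[of "Suc k" i j] assms] by blast
    show "symb k 1 (\<lambda>p. snd (\<xi> p) $ i $ j)"
    proof (rule symb_cong[OF F'(2)])
      fix p :: "('f, 'n) mpair" assume p: "p \<in> GL2"
      show "F' p = snd (\<xi> p) $ i $ j"
        by (rule vector_derivative_unique_at[OF bspec[OF F'(1)[unfolded derives_def] p]
              bspec[OF derives_snd_entry[of i j \<xi>, unfolded derives_def] p]])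
    qed
  qed
qed

lemma derives_powr:
  fixes F :: "('f::arch_local_field, 'n::finite) mpair \<Rightarrow> real"
  assumes "derives F \<xi> F'" "\<And>p. p \<in> GL2 \<Longrightarrow> F p > 0"
  shows "derives (\<lambda>p. F p powr r) \<xi> (\<lambda>p. r * (F' p * F p powr (r - 1)))"
  unfolding derives_def
proof
  fix p :: "('f, 'n) mpair" assume p: "p \<in> GL2"
  have "((\<lambda>s. F (p + s *\<^sub>R \<xi> p)) has_vector_derivative F' p) (at 0)"
    using assms(1) p unfolding derives_def by blast
  moreover have "((\<lambda>z. z powr r) has_field_derivative r * F p powr (r - 1)) (at (F (p + 0 *\<^sub>R \<xi> p)))"
    using has_real_derivative_powr[of "F p" r] assms(2)[OF p] by simp
  ultimately have "((\<lambda>z. z powr r) \<circ> (\<lambda>s. F (p + s *\<^sub>R \<xi> p)) has_vector_derivative F' p * (r * F p powr (r - 1))) (at 0)"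
    by (rule field_vector_diff_chain_at)
  then show "((\<lambda>s. F (p + s *\<^sub>R \<xi> p) powr r) has_vector_derivative r * (F' p * F p powr (r - 1))) (at 0)"
    by (simp add: o_def mult_ac)
qed

text \<open>
  With matching upper and lower bounds for \<open>F\<close>, powers of both signs have the expected order.
  The derivative involves the exponent \<open>r - 1\<close>, so the induction on \<open>k\<close> covers all exponents
  at once.
\<close>

lemma symb_powr:
  fixes F :: "('f::arch_local_field, 'n::finite) mpair \<Rightarrow> real"
  assumes "\<And>k. symb k m F" and pos: "\<And>p. p \<in> GL2 \<Longrightarrow> F p > 0"
    and low: "\<And>R. R > 0 \<Longrightarrow> \<exists>c>0. \<forall>p\<in>bdd_region R. c * (1 + norm (snd p)) powr m \<le> F p"
  shows "symb k (m * r) (\<lambda>p. F p powr r)"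
proof (induction k arbitrary: r)
  have o: "of_order (m * r) (\<lambda>p. F p powr r)" for r
  proof (rule of_orderI)
    have "continuous_on GL2 F" using assms(1)[of 0] by (simp add: of_order_def)
    then show "continuous_on GL2 (\<lambda>p. F p powr r)"
      using pos by (intro continuous_intros) (auto simp: less_imp_neq[symmetric])
    fix R :: real assume R: "R > 0"
    obtain C where C: "C \<ge> 0" "\<And>p. p \<in> bdd_region R \<Longrightarrow> norm (F p) \<le> C * (1 + norm (snd p)) powr m"
      using of_orderD[OF assms(1)[of 0, simplified] R] by blast
    obtain c where c: "c > 0" "\<And>p. p \<in> bdd_region R \<Longrightarrow> c * (1 + norm (snd p)) powr m \<le> F p"
      using low[OF R] by blast
    have "norm (F p powr r) \<le> (C powr r + c powr r) * (1 + norm (snd p)) powr (m * r)" if p: "p \<in> bdd_region R" for p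
    proof (cases "r \<ge> 0")
      case True
      have "F p \<le> C * (1 + norm (snd p)) powr m" using C(2)[OF p] by simp
      then have "F p powr r \<le> (C * (1 + norm (snd p)) powr m) powr r"
        using True pos[of p] p bdd_region_GL2[OF R] by (intro powr_mono2) (auto intro: less_imp_le)
      also have "\<dots> = C powr r * (1 + norm (snd p)) powr (m * r)" using C(1) by (simp add: powr_mult powr_powr)
      also have "\<dots> \<le> (C powr r + c powr r) * (1 + norm (snd p)) powr (m * r)" by (intro mult_right_mono) auto
      finally show ?thesis by simp
    next
      case False
      have "F p powr r \<le> (c * (1 + norm (snd p)) powr m) powr r"
        using False c p by (intro powr_mono2') (auto intro!: mult_pos_pos simp: add_pos_nonneg less_imp_neq[symmetric] add_nonneg_eq_0_iff)
      also have "\<dots> = c powr r * (1 + norm (snd p)) powr (m * r)" using c(1) by (simp add: powr_mult powr_powr)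
      also have "\<dots> \<le> (C powr r + c powr r) * (1 + norm (snd p)) powr (m * r)" by (intro mult_right_mono) auto
      finally show ?thesis by simp
    qed
    then show "\<exists>C. \<forall>p\<in>bdd_region R. norm (F p powr r) \<le> C * (1 + norm (snd p)) powr (m * r)" by blast
  qed
  { case 0 then show ?case using o by simp
  next
    case (Suc k)
    show ?case
    proof (rule symb_SucI[OF o])
      fix \<xi> :: "('f, 'n) mpair \<Rightarrow> ('f, 'n) mpair" assume x: "\<xi> \<in> fields"
      obtain F' where F': "derives F \<xi> F'" "symb k m F'" using symb_SucD[OF assms(1)[of "Suc k"] x] by blast
      have "symb k (m + m * (r - 1)) (\<lambda>p. F' p * F p powr (r - 1))" by (intro symb_mult F' Suc)
      then have "symb k (m * r) (\<lambda>p. F' p * F p powr (r - 1))" by (simp add: algebra_simps)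
      then have "symb k (m * r) (\<lambda>p. r * (F' p * F p powr (r - 1)))" by (rule symb_mult0[OF symb_const])
      then show "\<exists>F'. derives (\<lambda>p. F p powr r) \<xi> F' \<and> symb k (m * r) F'"
        using derives_powr[OF F'(1) pos] by blast
    qed }
qed

lemma compact_GL_region:
  "compact {u :: 'f::arch_local_field^'n^'n. norm u \<le> R \<and> 1 / R \<le> norm (det u)}"
proof -
  have "{u :: 'f^'n^'n. norm u \<le> R \<and> 1 / R \<le> norm (det u)} = cball 0 R \<inter> {u. 1 / R \<le> norm (det u)}" by auto
  moreover have "closed {u :: 'f^'n^'n. 1 / R \<le> norm (det u)}" by (intro closed_Collect_le continuous_intros)
  ultimately show ?thesis by (simp add: compact_Int_closed)
qed

lemma symb_test:
  fixes c :: "'f::arch_local_field^'n^'n \<Rightarrow> complex"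
  assumes "Ck_on k GL c"
  shows "symb k 0 (\<lambda>p :: ('f, 'n) mpair. c (fst p))"
  using assms
proof (induction k arbitrary: c)
  have o: "of_order 0 (\<lambda>p :: ('f, 'n) mpair. c (fst p))" if c: "continuous_on GL c" for c :: "'f^'n^'n \<Rightarrow> complex"
  proof (rule of_order_0I)
    show "continuous_on GL2 (\<lambda>p :: ('f, 'n) mpair. c (fst p))"
      by (rule continuous_on_compose2[OF c]) (auto simp: GL2_def intro: continuous_intros)
    fix R :: real assume R: "R > 0"
    have "{u :: 'f^'n^'n. norm u \<le> R \<and> 1 / R \<le> norm (det u)} \<subseteq> GL"
    proof
      fix u :: "'f^'n^'n" assume "u \<in> {u. norm u \<le> R \<and> 1 / R \<le> norm (det u)}"
      moreover have "0 < 1 / R" using R by simp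
      ultimately have "0 < norm (det u)" by (auto intro: less_le_trans)
      then show "u \<in> GL" by (simp add: GL_iff_det)
    qed
    then have "compact (c ` {u. norm u \<le> R \<and> 1 / R \<le> norm (det u)})"
      by (intro compact_continuous_image compact_GL_region continuous_on_subset[OF c])
    then have "bounded (c ` {u. norm u \<le> R \<and> 1 / R \<le> norm (det u)})" by (rule compact_imp_bounded)
    then obtain B where "\<forall>z\<in>c ` {u. norm u \<le> R \<and> 1 / R \<le> norm (det u)}. norm z \<le> B"
      unfolding bounded_iff ..
    then have B: "norm (c u) \<le> B" if "norm u \<le> R" "1 / R \<le> norm (det u)" for u using that by simp
    have "norm (c (fst p)) \<le> B" if "p \<in> bdd_region R" for p :: "('f, 'n) mpair"
      using that by (intro B) (simp_all add: bdd_region_def)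
    then show "\<exists>C. \<forall>p\<in>bdd_region R. norm (c (fst (p :: ('f, 'n) mpair))) \<le> C" by blast
  qed
  { case 0 then show ?case using o by simp
  next
    case (Suc k)
    have d: "(c has_derivative frechet_derivative c (at u)) (at u)" if "u \<in> GL" for u
      using Suc.prems that by (simp add: frechet_derivative_works[symmetric])
    have cont: "continuous_on GL c"
      by (rule continuous_at_imp_continuous_on) (use d has_derivative_continuous in fast)
    show ?case
    proof (rule symb_SucI[OF o[OF cont]])
      fix \<xi> :: "('f, 'n) mpair \<Rightarrow> ('f, 'n) mpair" assume "\<xi> \<in> fields"
      then show "\<exists>F'. derives (\<lambda>p. c (fst p)) \<xi> F' \<and> symb k 0 F'"
      proof (cases rule: fields_cases)
        case (1 e b)
        have "derives (\<lambda>p. c (fst p)) \<xi> (\<lambda>p. frechet_derivative c (at (fst p)) e)"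
          unfolding derives_def
        proof
          fix p :: "('f, 'n) mpair" assume p: "p \<in> GL2"
          have "((\<lambda>s. fst p + s *\<^sub>R e) has_derivative (\<lambda>s. s *\<^sub>R e)) (at 0)"
            by (auto intro!: derivative_eq_intros)
          moreover have "(c has_derivative frechet_derivative c (at (fst p))) (at (fst p + 0 *\<^sub>R e))"
            using d[of "fst p"] p by (auto simp: GL2_def)
          ultimately have "((\<lambda>s. c (fst p + s *\<^sub>R e)) has_derivative (\<lambda>s. frechet_derivative c (at (fst p)) (s *\<^sub>R e))) (at 0)"
            by (rule has_derivative_compose)
          moreover have "linear (frechet_derivative c (at (fst p)))"
            using d[of "fst p"] p by (auto simp: GL2_def intro: has_derivative_linear)
          ultimately show "((\<lambda>s. c (fst (p + s *\<^sub>R \<xi> p))) has_vector_derivative frechet_derivative c (at (fst p)) e) (at 0)"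
            by (simp add: has_vector_derivative_def 1 param_field_def linear_cmul)
        qed
        moreover have "Ck_on k GL (\<lambda>u. frechet_derivative c (at u) e)" using Suc.prems by simp
        ultimately show ?thesis using Suc.IH by blast
      next
        case (2 t)
        have "derives (\<lambda>p. c (fst p)) \<xi> (\<lambda>_. 0)"
          by (simp add: derives_def 2 nil_field_def has_vector_derivative_const)
        then show ?thesis using symb_zero by blast
      qed
    qed }
qed


section \<open>The phase and the gain of one order\<close>

definition symbol :: "real \<Rightarrow> (('f::arch_local_field, 'n::finite) mpair \<Rightarrow> 'c::real_normed_vector) \<Rightarrow> bool" where
  "symbol m F \<longleftrightarrow> (\<forall>k. symb k m F)"

lemma symbol_of_order: "symbol m F \<Longrightarrow> of_order m F"
  by (auto simp: symbol_def intro: symb_of_order)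

lemma symbol_continuous: "symbol m F \<Longrightarrow> continuous_on GL2 F"
  using symbol_of_order by (auto simp: of_order_def)

lemma derives_unique:
  assumes "derives F \<xi> F1" "derives F \<xi> F2" "p \<in> GL2" shows "F1 p = F2 p"
  using assms unfolding derives_def by (meson vector_derivative_unique_at)

text \<open>
  Derivatives along a field are unique, so one function serves for all orders of
  differentiability.
\<close>

lemma symbol_derives:
  fixes F :: "('f::arch_local_field, 'n::finite) mpair \<Rightarrow> 'c::real_normed_vector"
  assumes "symbol m F" "\<xi> \<in> fields"
  obtains F' where "derives F \<xi> F'" "symbol m F'"
proof -
  obtain F0 where F0: "derives F \<xi> F0" using assms symb_SucD unfolding symbol_def by metis
  have "symb k m F0" for k
  proof -
    obtain F1 where F1: "derives F \<xi> F1" "symb k m F1"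
      using symb_SucD[OF _ assms(2), of k m F] assms(1) unfolding symbol_def by blast
    show ?thesis by (rule symb_cong[OF F1(2)]) (rule derives_unique[OF F1(1) F0])
  qed
  then show thesis using that F0 by (simp add: symbol_def)
qed

lemma symbol_weaken: "symbol m F \<Longrightarrow> m \<le> m' \<Longrightarrow> symbol m' F"
  by (auto simp: symbol_def intro: symb_weaken)

lemma symbol_mult:
  fixes F G :: "('f::arch_local_field, 'n::finite) mpair \<Rightarrow> 'c::real_normed_algebra"
  shows "symbol m F \<Longrightarrow> symbol m' G \<Longrightarrow> symbol (m + m') (\<lambda>p. F p * G p)"
  by (simp add: symbol_def symb_mult)

lemma symbol_mult0:
  fixes F G :: "('f::arch_local_field, 'n::finite) mpair \<Rightarrow> 'c::real_normed_algebra"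
  shows "symbol 0 F \<Longrightarrow> symbol m G \<Longrightarrow> symbol m (\<lambda>p. F p * G p)"
  by (simp add: symbol_def symb_mult0)

lemma symbol_const: "symbol 0 (\<lambda>_. c)" and symbol_add: "symbol m F \<Longrightarrow> symbol m G \<Longrightarrow> symbol m (\<lambda>p. F p + G p)"
  by (simp_all add: symbol_def symb_const symb_add)

lemma symbol_sum: "(\<And>i. i \<in> I \<Longrightarrow> symbol m (H i)) \<Longrightarrow> symbol m (\<lambda>p. \<Sum>i\<in>I. H i p)"
  by (simp add: symbol_def symb_sum)

lemma symbol_minus: "symbol m F \<Longrightarrow> symbol m (\<lambda>p. - F p)"
  unfolding symbol_def using symb_bounded_linear[OF bounded_linear_minus[OF bounded_linear_ident]] by blast

lemma symbol_bounded_linear: "bounded_linear T \<Longrightarrow> symbol m F \<Longrightarrow> symbol m (\<lambda>p. T (F p))"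
  by (simp add: symbol_def symb_bounded_linear)

lemma compact_GL_bounds:
  fixes K :: "('f::arch_local_field^'n^'n) set"
  assumes "compact K" "K \<subseteq> GL"
  obtains R where "R > 0" "\<And>u. u \<in> K \<Longrightarrow> norm u \<le> R \<and> 1 / R \<le> norm (det u)"
proof -
  have "bounded K" using assms(1) by (rule compact_imp_bounded)
  then obtain A where A: "\<forall>u\<in>K. norm u \<le> A" unfolding bounded_iff ..
  have "continuous_on K (\<lambda>u. inverse (det u))"
    using assms(2) by (intro continuous_intros) (auto simp: GL_iff_det)
  then have "bounded ((\<lambda>u. inverse (det u)) ` K)"
    by (intro compact_imp_bounded compact_continuous_image assms(1))
  then obtain D where D: "\<forall>z\<in>(\<lambda>u. inverse (det u)) ` K. norm z \<le> D" unfolding bounded_iff ..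
  define R where "R = max 1 (max A D)"
  have "norm u \<le> R \<and> 1 / R \<le> norm (det u)" if u: "u \<in> K" for u
  proof
    show "norm u \<le> R" using A u by (force simp: R_def)
    have "det u \<noteq> 0" using assms(2) u by (auto simp: GL_iff_det)
    moreover have "inverse (norm (det u)) \<le> R" using D u by (force simp: R_def norm_inverse)
    ultimately show "1 / R \<le> norm (det u)"
      by (simp add: R_def field_simps)
  qed
  then show thesis using that[of R] by (simp add: R_def)
qed

text \<open>
  The additive character is \<open>\<psi> x = exp (\<i> * l x)\<close>, and \<open>w\<close> witnesses that it is nontrivial.
\<close>

locale phase =
  fixes l :: "'f::arch_local_field \<Rightarrow> real" and w :: 'f
  assumes lin: "linear l" and lw: "l w \<noteq> 0"
begin

lemma blin: "bounded_linear l"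
  using lin linear_conv_bounded_linear by blast

text \<open>
  The oscillating factor \<open>\<psi> (trace (g u))\<close> at \<open>(u, g)\<close>.
\<close>

definition E :: "('f, 'n::finite) mpair \<Rightarrow> complex" where
  "E p = exp (\<i> * of_real (l (trace (snd p ** fst p))))"

lemma norm_E [simp]: "norm (E p) = 1"
  by (simp add: E_def)

lemma continuous_on_E: "continuous_on S E"
  unfolding E_def trace_def by (intro continuous_intros bounded_linear.continuous_on[OF blin])

definition phase_derivative :: "(('f, 'n::finite) mpair \<Rightarrow> ('f, 'n) mpair) \<Rightarrow> ('f, 'n) mpair \<Rightarrow> real" where
  "phase_derivative \<xi> p = l (trace (snd (\<xi> p) ** fst p + snd p ** fst (\<xi> p)))"

lemma derives_E:
  fixes \<xi> :: "('f, 'n::finite) mpair \<Rightarrow> ('f, 'n) mpair"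
  shows "derives E \<xi> (\<lambda>p. \<i> * of_real (phase_derivative \<xi> p) * E p)"
  unfolding derives_def
proof
  fix p :: "('f, 'n) mpair"
  define a where "a = l (trace (snd p ** fst p))"
  define c where "c = l (trace (snd (\<xi> p) ** fst (\<xi> p)))"
  have "l (trace (snd (p + s *\<^sub>R \<xi> p) ** fst (p + s *\<^sub>R \<xi> p))) = a + s * phase_derivative \<xi> p + s * s * c" for s
    by (simp add: phase_derivative_def a_def c_def matrix_add_ldistrib matrix_add_rdistrib scaleR_matrix_mult_left
        scaleR_matrix_mult_right trace_add trace_scaleR linear_add[OF lin] linear_cmul[OF lin] algebra_simps)
  then have eq: "(\<lambda>s. E (p + s *\<^sub>R \<xi> p)) = exp \<circ> (\<lambda>s. \<i> * of_real (a + s * phase_derivative \<xi> p + s * s * c))"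
    by (simp add: E_def o_def fun_eq_iff)
  have "((\<lambda>s. \<i> * complex_of_real (a + s * phase_derivative \<xi> p + s * s * c)) has_vector_derivative \<i> * of_real (phase_derivative \<xi> p)) (at 0)"
    by (auto intro!: derivative_eq_intros simp: has_vector_derivative_def scaleR_conv_of_real)
  then have "(exp \<circ> (\<lambda>s. \<i> * of_real (a + s * phase_derivative \<xi> p + s * s * c)) has_vector_derivative
     \<i> * of_real (phase_derivative \<xi> p) * exp (\<i> * of_real a)) (at 0)"
    by (rule field_vector_diff_chain_at) (auto intro!: derivative_eq_intros)
  then show "((\<lambda>s. E (p + s *\<^sub>R \<xi> p)) has_vector_derivative \<i> * of_real (phase_derivative \<xi> p) * E p) (at 0)"
    by (simp add: eq) (simp add: E_def a_def)
qed

lemma symbol_phase_derivative: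
  assumes "\<xi> \<in> (fields :: (('f, 'n::finite) mpair \<Rightarrow> ('f, 'n) mpair) set)"
  shows "symbol 1 (\<lambda>p. phase_derivative \<xi> p)"
  unfolding symbol_def
proof
  fix k
  have "symb k (1 + 0) (\<lambda>p. trace (snd (\<xi> p) ** fst p))"
    by (rule symb_trace[OF msymb_mult[OF msymb_fields(2)[OF assms] msymb_fst]])
  moreover have "symb k (1 + 0) (\<lambda>p. trace (snd p ** fst (\<xi> p)))"
    by (rule symb_trace[OF msymb_mult[OF msymb_snd msymb_fields(1)[OF assms]]])
  ultimately have "symb k 1 (\<lambda>p. trace (snd (\<xi> p) ** fst p) + trace (snd p ** fst (\<xi> p)))"
    by (intro symb_add) auto
  then show "symb k 1 (\<lambda>p. phase_derivative \<xi> p)"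
    unfolding phase_derivative_def trace_add[symmetric] by (rule symb_bounded_linear[OF blin])
qed

lemma symbol_of_real: "symbol m (\<lambda>p. f p :: real) \<Longrightarrow> symbol m (\<lambda>p. complex_of_real (f p))"
  by (rule symbol_bounded_linear[OF bounded_linear_of_real])

text \<open>
  The sum of the squares of the derivatives of the phase along the torsor; the summand 1 makes
  it invertible.
\<close>

definition Q :: "('f, 'n::finite) mpair \<Rightarrow> real" where
  "Q p = 1 + (\<Sum>t\<in>nilp_index. phase_derivative (nil_field t) p * phase_derivative (nil_field t) p)"

lemma phase_derivative_nil: "phase_derivative (nil_field t) p = l (trace (nilX t ** (snd p ** fst p)))"
  by (simp add: phase_derivative_def nil_field_def matrix_mul_assoc)

lemma Q_ge_1: "Q p \<ge> 1"
  unfolding Q_def by (simp add: sum_nonneg)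

lemma symbol_Q: "symbol 2 Q"
proof -
  have "symbol (1 + 1) (\<lambda>p. \<Sum>t\<in>nilp_index. phase_derivative (nil_field t) p * phase_derivative (nil_field t) p)"
    by (intro symbol_sum symbol_mult symbol_phase_derivative nil_field_fields)
  moreover have "symbol 2 (\<lambda>_. 1 :: real)" by (rule symbol_weaken[OF symbol_const]) simp
  ultimately have "symbol 2 (\<lambda>p. 1 + (\<Sum>t\<in>nilp_index. phase_derivative (nil_field t) p * phase_derivative (nil_field t) p))"
    by (intro symbol_add) simp_all
  then show ?thesis by (simp add: Q_def[abs_def])
qed

text \<open>
  The derivatives of the phase are the pairings of \<open>g u\<close> with the nilpotents. Since the
  determinant of \<open>g u\<close> is bounded on the region, they control the norm of \<open>g u\<close>, and as the
  inverse of \<open>u\<close> is bounded there, also that of \<open>g\<close>.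
\<close>

lemma Q_lower_bound:
  assumes R: "R > 0"
  shows "\<exists>c>0. \<forall>p\<in>bdd_region R. c * (1 + norm (snd p)) powr 2 \<le> Q (p :: ('f, 'n::finite) mpair)"
proof -
  let ?T = "nilp_index :: ('n \<times> 'n \<times> 'f \<times> bool) set"
  obtain C where C: "C > 0" "\<And>A :: 'f^'n^'n. norm A \<le> C * (1 + (\<Sum>t\<in>nilp_index. \<bar>l (trace (nilX t ** A))\<bar>) + norm (det A))"
    using norm_le_nilX_pairings[OF lin lw] by blast
  obtain K where K: "K \<ge> 1" "\<And>(A :: 'f^'n^'n) (B :: 'f^'n^'n). norm (A ** B) \<le> K * norm A * norm B"
    using norm_matrix_mult_le by metis
  obtain CI where CI: "CI \<ge> 1" "\<And>g :: 'f^'n^'n. det g \<noteq> 0 \<Longrightarrow> norm (matrix_inv g) \<le> CI * (1 + norm g) ^ CARD('n) / norm (det g)"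
    using norm_matrix_inv_le by metis
  define V where "V = CI * (1 + R) ^ CARD('n) * R"
  have V: "V > 0" using CI(1) R by (simp add: V_def)
  define D where "D = R * (fact CARD('n) * R ^ CARD('n))"
  have D: "D > 0" using R by (simp add: D_def)
  define T where "T = real (card ?T)"
  define M where "M = 1 + K * (C * (1 + T + D)) * V"
  have M: "M > 0" using K(1) C(1) V D by (simp add: M_def T_def add_pos_nonneg)
  have main: "1 + norm (snd p) \<le> M * sqrt (Q p)" if p: "p \<in> bdd_region R" for p :: "('f, 'n) mpair"
  proof -
    obtain u g where pe: "p = (u, g)" by (cases p)
    have "p \<in> GL2" using bdd_region_GL2[OF R] p by blast
    then have uG: "u \<in> GL" and gG: "g \<in> GL" by (auto simp: pe GL2_def)
    have b: "norm u \<le> R" "1 / R \<le> norm (det u)" "norm (det g) \<le> R"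
      using p by (auto simp: pe bdd_region_def)
    have inv: "norm (matrix_inv u) \<le> V"
    proof -
      have "norm (matrix_inv u) \<le> CI * (1 + norm u) ^ CARD('n) / norm (det u)" using CI(2)[of u] uG by (simp add: GL_iff_det)
      also have "\<dots> \<le> CI * (1 + R) ^ CARD('n) / (1 / R)"
        using b R CI(1) by (intro frac_le mult_left_mono power_mono) auto
      finally show ?thesis by (simp add: V_def)
    qed
    have s: "\<bar>l (trace (nilX t ** (g ** u)))\<bar> \<le> sqrt (Q p)" if "t \<in> ?T" for t
    proof (rule real_le_rsqrt)
      have "phase_derivative (nil_field t) p * phase_derivative (nil_field t) p \<le> (\<Sum>t\<in>?T. phase_derivative (nil_field t) p * phase_derivative (nil_field t) p)"
        by (rule member_le_sum[OF that]) auto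
      then show "\<bar>l (trace (nilX t ** (g ** u)))\<bar>\<^sup>2 \<le> Q p"
        by (simp add: Q_def phase_derivative_nil pe power2_eq_square)
    qed
    have q1: "1 \<le> sqrt (Q p)" using Q_ge_1[of p] by simp
    have "norm (det (g ** u)) \<le> D"
    proof -
      have "norm (det u) \<le> fact CARD('n) * norm u ^ CARD('n)" by (rule norm_det_le)
      also have "\<dots> \<le> fact CARD('n) * R ^ CARD('n)" using b(1) by (intro mult_left_mono power_mono) auto
      finally have "norm (det g) * norm (det u) \<le> R * (fact CARD('n) * R ^ CARD('n))"
        using b(3) R by (intro mult_mono) auto
      then show ?thesis by (simp add: det_mul norm_mult D_def)
    qed
    moreover have "(\<Sum>t\<in>?T. \<bar>l (trace (nilX t ** (g ** u)))\<bar>) \<le> T * sqrt (Q p)"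
      using sum_bounded_above[of ?T "\<lambda>t. \<bar>l (trace (nilX t ** (g ** u)))\<bar>" "sqrt (Q p)"] s by (simp add: T_def)
    ultimately have "1 + (\<Sum>t\<in>?T. \<bar>l (trace (nilX t ** (g ** u)))\<bar>) + norm (det (g ** u)) \<le> sqrt (Q p) + T * sqrt (Q p) + D * sqrt (Q p)"
      using q1 D mult_left_mono[of 1 "sqrt (Q p)" D] by linarith
    then have "C * (1 + (\<Sum>t\<in>?T. \<bar>l (trace (nilX t ** (g ** u)))\<bar>) + norm (det (g ** u)))
        \<le> C * (sqrt (Q p) + T * sqrt (Q p) + D * sqrt (Q p))"
      using C(1) by (intro mult_left_mono) auto
    then have "norm (g ** u) \<le> C * (sqrt (Q p) + T * sqrt (Q p) + D * sqrt (Q p))"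
      by (rule order_trans[OF C(2)])
    then have gu: "norm (g ** u) \<le> C * (1 + T + D) * sqrt (Q p)"
      by (simp add: algebra_simps)
    have "norm g \<le> K * norm (g ** u) * norm (matrix_inv u)"
      using K(2)[of "g ** u" "matrix_inv u"] uG by (simp add: matrix_mul_assoc[symmetric] matrix_inv_GL)
    also have "\<dots> \<le> K * (C * (1 + T + D) * sqrt (Q p)) * V"
    proof (intro mult_mono order_refl gu inv)
      show "0 \<le> K * (C * (1 + T + D) * sqrt (Q p))"
        using K(1) order_trans[OF norm_ge_zero gu] by (intro mult_nonneg_nonneg[of K]) linarith+
    qed (use K(1) in auto)
    finally have "norm g \<le> K * (C * (1 + T + D) * sqrt (Q p)) * V" .
    then have "1 + norm g \<le> sqrt (Q p) + K * (C * (1 + T + D) * sqrt (Q p)) * V" using q1 by linarith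
    also have "\<dots> = M * sqrt (Q p)" by (simp add: M_def algebra_simps)
    finally show ?thesis by (simp add: pe)
  qed
  have "(1 / M\<^sup>2) * (1 + norm (snd p)) powr 2 \<le> Q p" if p: "p \<in> bdd_region R" for p :: "('f, 'n) mpair"
  proof -
    have "(1 + norm (snd p))\<^sup>2 \<le> (M * sqrt (Q p))\<^sup>2" using main[OF p] by (intro power_mono) auto
    also have "\<dots> = M\<^sup>2 * Q p" using Q_ge_1[of p] by (simp add: power_mult_distrib)
    finally have "(1 + norm (snd p))\<^sup>2 / M\<^sup>2 \<le> Q p" using M by (simp add: divide_le_eq mult.commute)
    moreover have "(1 + norm (snd p)) powr 2 = (1 + norm (snd p))\<^sup>2"
      by (rule powr_numeral) (simp add: add_pos_nonneg)
    ultimately show ?thesis by simp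
  qed
  then show ?thesis using M by (intro exI[of _ "1 / M\<^sup>2"]) simp
qed

text \<open>
  The reciprocal of \<open>Q\<close>, written as a power in order to be a symbol by \<open>symb_powr\<close>.
\<close>

definition iQ :: "('f, 'n::finite) mpair \<Rightarrow> complex" where
  "iQ p = of_real (Q p powr (- 1))"

lemma symbol_iQ: "symbol (- 2) (iQ :: ('f, 'n::finite) mpair \<Rightarrow> complex)"
proof -
  have *: "symb k (2 * (- 1)) (\<lambda>p :: ('f, 'n) mpair. Q p powr (- 1))" for k
    using symbol_Q Q_ge_1 Q_lower_bound
    by (intro symb_powr) (auto simp: symbol_def intro: less_le_trans[OF zero_less_one])
  have "symbol (- 2) (\<lambda>p :: ('f, 'n) mpair. Q p powr (- 1))"
    unfolding symbol_def using *[simplified mult_minus_right mult_1_right] by (rule allI)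
  then show ?thesis unfolding iQ_def[abs_def] by (rule symbol_of_real)
qed

lemma Q_iQ: "of_real (Q p) * iQ p = 1"
  using Q_ge_1[of p] by (simp add: iQ_def powr_minus flip: of_real_mult)

text \<open>
  Integration by parts at the level of integrands. Let \<open>\<delta>\<^sub>t\<close> be the derivative along
  \<open>nil_field t\<close> and \<open>s\<^sub>t\<close> the corresponding derivative of the phase, so that
  \<open>\<delta>\<^sub>t E = \<i> s\<^sub>t E\<close>. From \<open>1 = (1 + \<Sum> s\<^sub>t\<^sup>2) / Q\<close> one gets \<open>E F = E F / Q + \<Sum> E s\<^sub>t\<^sup>2 F / Q\<close>,
  and with \<open>G\<^sub>t = - \<i> s\<^sub>t F / Q\<close> the terms of the sum are \<open>\<delta>\<^sub>t (E G\<^sub>t) - E \<delta>\<^sub>t G\<^sub>t\<close>. Here \<open>Q\<close>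
  has order 2 and \<open>s\<^sub>t\<close> order 1, so \<open>F / Q\<close> has order \<open>m - 2\<close>, and \<open>G\<^sub>t\<close> together with its
  derivative has order \<open>m - 1\<close>.
\<close>

lemma oscillatory_step:
  fixes F :: "('f, 'n::finite) mpair \<Rightarrow> complex"
  assumes F: "symbol m F"
  obtains F' G G' where "symbol (m - 1) F'"
    "\<And>t. t \<in> nilp_index \<Longrightarrow> symbol (m - 1) (G t)" "\<And>t. t \<in> nilp_index \<Longrightarrow> symbol m (G' t)"
    "\<And>t. t \<in> nilp_index \<Longrightarrow> derives (\<lambda>p. E p * G t p) (nil_field t) (\<lambda>p. E p * G' t p)"
    "\<And>p. F p = F' p + (\<Sum>t\<in>nilp_index. G' t p)"
proof -
  let ?T = "nilp_index :: ('n \<times> 'n \<times> 'f \<times> bool) set"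
  define G where "G t p = - \<i> * (of_real (phase_derivative (nil_field t) p) * (iQ p * F p))" for t p
  have G: "symbol (m - 1) (G t)" if "t \<in> ?T" for t
  proof -
    have "symbol (1 + (- 2 + m)) (\<lambda>p. of_real (phase_derivative (nil_field t) p) * (iQ p * F p))"
      by (intro symbol_mult symbol_of_real symbol_phase_derivative nil_field_fields that symbol_iQ F)
    then have "symbol (m - 1) (\<lambda>p. of_real (phase_derivative (nil_field t) p) * (iQ p * F p))" by simp
    then show ?thesis unfolding G_def by (rule symbol_mult0[OF symbol_const])
  qed
  have "\<forall>t\<in>?T. \<exists>dG. derives (G t) (nil_field t) dG \<and> symbol (m - 1) dG"
    using symbol_derives[OF G nil_field_fields] by metis
  then obtain dG where dG: "\<And>t. t \<in> ?T \<Longrightarrow> derives (G t) (nil_field t) (dG t)"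
      "\<And>t. t \<in> ?T \<Longrightarrow> symbol (m - 1) (dG t)"
    by (metis (no_types))
  define G' where "G' t p = \<i> * (of_real (phase_derivative (nil_field t) p) * G t p) + dG t p" for t p
  have G': "symbol m (G' t)" if "t \<in> ?T" for t
  proof -
    have "symbol (1 + (m - 1)) (\<lambda>p. of_real (phase_derivative (nil_field t) p) * G t p)"
      by (intro symbol_mult symbol_of_real symbol_phase_derivative nil_field_fields that G)
    then have "symbol m (\<lambda>p. of_real (phase_derivative (nil_field t) p) * G t p)" by simp
    moreover have "symbol m (dG t)" by (rule symbol_weaken[OF dG(2)[OF that]]) simp
    ultimately show ?thesis unfolding G'_def by (intro symbol_add symbol_mult0[OF symbol_const])
  qed
  define F' where "F' p = iQ p * F p + - (\<Sum>t\<in>?T. dG t p)" for p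
  show thesis
  proof (rule that[of F' G G'])
    have "symbol (- 2 + m) (\<lambda>p. iQ p * F p)" by (intro symbol_mult symbol_iQ F)
    then have "symbol (m - 1) (\<lambda>p. iQ p * F p)" by (rule symbol_weaken) simp
    then show "symbol (m - 1) F'" unfolding F'_def by (intro symbol_add symbol_minus symbol_sum dG(2))
    fix t assume t: "t \<in> ?T"
    show "symbol (m - 1) (G t)" "symbol m (G' t)" using G[OF t] G'[OF t] .
    show "derives (\<lambda>p. E p * G t p) (nil_field t) (\<lambda>p. E p * G' t p)"
      by (rule derives_cong[OF derives_mult[OF derives_E dG(1)[OF t]]]) (simp_all add: G'_def algebra_simps)
  next
    fix p
    have i2: "\<i> * (a * (- \<i> * (a * y))) = a * a * y" for a y :: complex
      by (simp add: algebra_simps)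
    have "G' t p = of_real (phase_derivative (nil_field t) p * phase_derivative (nil_field t) p) * (iQ p * F p) + dG t p" for t
      unfolding G'_def G_def i2 of_real_mult ..
    then have "(\<Sum>t\<in>?T. G' t p) = (\<Sum>t\<in>?T. of_real (phase_derivative (nil_field t) p * phase_derivative (nil_field t) p) * (iQ p * F p)) + (\<Sum>t\<in>?T. dG t p)"
      by (simp only: sum.distrib)
    also have "(\<Sum>t\<in>?T. of_real (phase_derivative (nil_field t) p * phase_derivative (nil_field t) p) * (iQ p * F p)) = (of_real (Q p) - 1) * (iQ p * F p)"
      by (simp add: Q_def sum_distrib_right)
    also have "\<dots> = F p - iQ p * F p" using Q_iQ[of p] by (simp add: left_diff_distrib mult.assoc[symmetric])
    finally show "F p = F' p + (\<Sum>t\<in>?T. G' t p)" by (simp add: F'_def)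
  qed
qed

end


section \<open>Rapid decay after testing\<close>

lemma measurable_GL2:
  fixes F :: "('f::arch_local_field, 'n::finite) mpair \<Rightarrow> complex"
  assumes "continuous_on GL2 F"
  shows "(\<lambda>p. indicator GL2 p *\<^sub>R F p) \<in> borel_measurable borel"
  by (rule borel_measurable_continuous_on_indicator[OF borel_open[OF open_GL2] assms])

lemma measurable_swap_borel:
  "(\<lambda>(g, u). (u, g)) \<in> borel \<Otimes>\<^sub>M borel \<rightarrow>\<^sub>M (borel :: ('a::second_countable_topology \<times> 'b::second_countable_topology) measure)"
  unfolding borel_prod by (intro borel_measurable_continuous_onI) (auto intro!: continuous_intros simp: case_prod_beta)

context phase
begin

definition u_integral :: "(('f, 'n::finite) mpair \<Rightarrow> complex) \<Rightarrow> 'f^'n^'n \<Rightarrow> complex" where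
  "u_integral F g = (LINT u:GL|lborel. E (u, g) * F (u, g))"

definition supported :: "('f^'n^'n) set \<Rightarrow> (('f, 'n::finite) mpair \<Rightarrow> complex) \<Rightarrow> bool" where
  "supported K F \<longleftrightarrow> (\<forall>p\<in>GL2. fst p \<notin> K \<longrightarrow> F p = 0)"

lemma continuous_on_slice:
  assumes "continuous_on GL2 F" "g \<in> GL"
  shows "continuous_on GL (\<lambda>u. E (u, g) * F (u, g))"
proof -
  have "continuous_on GL (\<lambda>u. F (u, g))"
    by (rule continuous_on_compose2[OF assms(1)]) (use assms(2) in \<open>auto simp: GL2_def intro!: continuous_intros\<close>)
  moreover have "continuous_on GL (\<lambda>u. E (u, g))"
    by (rule continuous_on_compose2[OF continuous_on_E[of UNIV]]) (auto intro!: continuous_intros)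
  ultimately show ?thesis by (intro continuous_on_mult)
qed

lemma u_integrable:
  assumes "continuous_on GL2 F" "g \<in> GL" "compact K" "K \<subseteq> GL" "supported K F"
  shows "set_integrable lborel GL (\<lambda>u. E (u, g) * F (u, g))"
proof -
  have "integrable lborel (\<lambda>u. indicator K u *\<^sub>R (E (u, g) * F (u, g)))"
    by (rule borel_integrable_compact[OF assms(3) continuous_on_subset[OF continuous_on_slice[OF assms(1,2)] assms(4)]])
  moreover have "(\<lambda>u. indicator K u *\<^sub>R (E (u, g) * F (u, g))) = (\<lambda>u. indicator GL u *\<^sub>R (E (u, g) * F (u, g)))"
    using assms(2,4,5) by (auto simp: fun_eq_iff indicator_def supported_def GL2_def)
  ultimately show ?thesis by (simp add: set_integrable_def)
qed

lemma u_integral_bound: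
  assumes F: "of_order m F" and K: "compact K" "K \<subseteq> GL" "supported K F" and R: "R > 0"
  shows "\<exists>C\<ge>0. \<forall>g. 1 / R \<le> norm (det g) \<and> norm (det g) \<le> R \<longrightarrow> norm (u_integral F g) \<le> C * (1 + norm g) powr m"
proof -
  obtain R0 where R0: "R0 > 0" "\<And>u. u \<in> K \<Longrightarrow> norm u \<le> R0 \<and> 1 / R0 \<le> norm (det u)"
    using compact_GL_bounds[OF K(1,2)] by metis
  define R1 where "R1 = max R R0"
  have R1: "R1 > 0" "R \<le> R1" "R0 \<le> R1" using R by (auto simp: R1_def)
  obtain C where C: "C \<ge> 0" "\<And>p. p \<in> bdd_region R1 \<Longrightarrow> norm (F p) \<le> C * (1 + norm (snd p)) powr m"
    using of_orderD[OF F R1(1)] by metis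
  have "norm (u_integral F g) \<le> (C * measure lborel K) * (1 + norm g) powr m"
    if g: "1 / R \<le> norm (det g)" "norm (det g) \<le> R" for g
  proof -
    have "0 < 1 / R" using R by simp
    then have "0 < norm (det g)" using g(1) by linarith
    then have gG: "g \<in> GL" by (simp add: GL_iff_det)
    have region: "(u, g) \<in> bdd_region R1" if "u \<in> K" for u
    proof -
      have "1 / R1 \<le> 1 / R" "1 / R1 \<le> 1 / R0" using R R0(1) R1 by (auto intro: divide_left_mono)
      then show ?thesis using R0(2)[OF that] g R1 by (auto simp: bdd_region_def)
    qed
    have i: "integrable lborel (\<lambda>u. indicator GL u *\<^sub>R (E (u, g) * F (u, g)))"
      using u_integrable[OF _ gG K] F by (simp add: of_order_def set_integrable_def)
    have "norm (\<integral>u. indicator GL u *\<^sub>R (E (u, g) * F (u, g)) \<partial>lborel) \<le> (\<integral>u. (C * (1 + norm g) powr m) * indicator K u \<partial>lborel)"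
    proof (rule Bochner_Integration.integral_norm_bound_integral[OF i])
      show "integrable lborel (\<lambda>u. (C * (1 + norm g) powr m) * indicator K u)"
        by (rule integrable_indicator_compact[OF K(1)])
      fix u
      show "norm (indicator GL u *\<^sub>R (E (u, g) * F (u, g))) \<le> (C * (1 + norm g) powr m) * indicator K u"
      proof (cases "u \<in> K")
        case True then show ?thesis using C(2)[OF region[OF True]] K(2) by (auto simp: norm_mult)
      next
        case False then show ?thesis using K(3) gG by (auto simp: supported_def GL2_def indicator_def)
      qed
    qed
    also have "\<dots> = (C * (1 + norm g) powr m) * measure lborel K"
      using K(1) by (simp add: borel_compact)
    finally show ?thesis by (simp add: u_integral_def set_lebesgue_integral_def mult_ac)
  qed
  then show ?thesis using C(1) by (intro exI[of _ "C * measure lborel K"]) auto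
qed

lemma supported_derives:
  fixes F :: "('f, 'n::finite) mpair \<Rightarrow> complex"
  assumes "supported K F" "compact K" "derives F \<xi> F'"
  shows "supported K F'"
  unfolding supported_def
proof (intro ballI impI)
  fix p :: "('f, 'n) mpair" assume p: "p \<in> GL2" "fst p \<notin> K"
  have o: "open (GL2 \<inter> (fst -` (- K)))"
    using assms(2) by (intro open_Int open_GL2 open_vimage_fst) (simp add: compact_imp_closed open_Compl)
  have "((\<lambda>s. F (p + s *\<^sub>R \<xi> p)) has_vector_derivative 0) (at 0)"
  proof (subst has_vector_derivative_cong_ev[where g = "\<lambda>s. 0"])
    show "\<forall>\<^sub>F s in nhds 0. s \<in> UNIV \<longrightarrow> F (p + s *\<^sub>R \<xi> p) = 0"
      using eventually_line_in_open[OF o, of p "\<xi> p"] p assms(1)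
      by (auto elim!: eventually_mono simp: supported_def)
  qed (use p assms(1) in \<open>auto simp: supported_def\<close>)
  moreover have "((\<lambda>s. F (p + s *\<^sub>R \<xi> p)) has_vector_derivative F' p) (at 0)"
    using assms(3) p by (simp add: derives_def)
  ultimately show "F' p = 0" by (metis vector_derivative_unique_at)
qed

lemma row_motion_0 [simp]: "row_motion 0 g = 0"
  by (simp add: row_motion_def vec_eq_iff)

text \<open>
  When \<open>u\<close> moves in the direction \<open>e\<close>, the phase \<open>l (trace (g ** u))\<close> changes at the rate
  \<open>l (trace (g ** e))\<close>, which is constant in \<open>u\<close>.
\<close>

lemma u_integral_by_parts:
  fixes F :: "('f, 'n::finite) mpair \<Rightarrow> complex"
  assumes cF: "continuous_on GL2 F" "continuous_on GL2 dF" and K: "compact K" "K \<subseteq> GL" "supported K F" "supported K dF"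
    and d: "derives F (param_field e 0) dF" and g: "g \<in> GL"
  shows "\<i> * of_real (l (trace (g ** e))) * u_integral F g = - u_integral dF g"
proof -
  let ?c = "\<i> * of_real (l (trace (g ** e)))"
  have "(LINT u:GL|lborel. E (u, g) * dF (u, g) + ?c * (E (u, g) * F (u, g))) = 0"
  proof (rule integral_directional_derivative_zero[OF open_GL K(1,2)])
    show "continuous_on GL (\<lambda>u. E (u, g) * F (u, g))" by (rule continuous_on_slice[OF cF(1) g])
    show "continuous_on GL (\<lambda>u. E (u, g) * dF (u, g) + ?c * (E (u, g) * F (u, g)))"
      by (intro continuous_on_add continuous_on_mult_left continuous_on_slice cF g)
    show "E (u, g) * F (u, g) = 0" if "u \<in> GL - K" for u using that K(3) g by (auto simp: supported_def GL2_def)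
    fix u :: "'f^'n^'n" assume u: "u \<in> GL"
    then have p: "(u, g) \<in> GL2" using g by (simp add: GL2_def)
    have "derives (\<lambda>p. E p * F p) (param_field e 0)
       (\<lambda>p. E p * dF p + \<i> * of_real (phase_derivative (param_field e 0) p) * E p * F p)"
      by (rule derives_mult[OF derives_E d])
    from bspec[OF this[unfolded derives_def] p]
    show "((\<lambda>t. E (u + t *\<^sub>R e, g) * F (u + t *\<^sub>R e, g)) has_vector_derivative
        E (u, g) * dF (u, g) + ?c * (E (u, g) * F (u, g))) (at 0)"
      by (simp add: param_field_def phase_derivative_def mult_ac)
  qed
  moreover have i1: "set_integrable lborel GL (\<lambda>u. E (u, g) * dF (u, g))" and i2: "set_integrable lborel GL (\<lambda>u. E (u, g) * F (u, g))"
    using u_integrable[OF cF(2) g K(1,2,4)] u_integrable[OF cF(1) g K(1,2,3)] .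
  ultimately have "u_integral dF g + ?c * u_integral F g = 0"
    unfolding u_integral_def by (subst (asm) set_integral_add) (auto intro: set_integrable_mult_right)
  then show ?thesis by (simp add: add_eq_0_iff)
qed

lemma norm_le_trace_pairings:
  "\<exists>C>0. \<forall>g :: 'f^'n::finite^'n. norm g \<le> C * (\<Sum>(i, j, b)\<in>UNIV \<times> UNIV \<times> Basis. \<bar>l (trace (g ** elem i j b))\<bar>)"
proof -
  define c where "c = norm w / \<bar>l w\<bar>"
  have w: "w \<noteq> 0" using lw linear_0[OF lin] by auto
  have c: "c > 0" using w lw by (simp add: c_def)
  have z: "norm z \<le> c * (\<Sum>b\<in>Basis. \<bar>l (b * z)\<bar>)" for z :: 'f
    unfolding c_def by (rule norm_le_Basis_pairings[OF lin lw])
  have "norm g \<le> c * (\<Sum>(i, j, b)\<in>UNIV \<times> UNIV \<times> Basis. \<bar>l (trace (g ** elem i j b))\<bar>)" for g :: "'f^'n^'n"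
  proof -
    have "norm g \<le> (\<Sum>j\<in>(UNIV::'n set). \<Sum>i\<in>(UNIV::'n set). norm (g $ j $ i))" by (rule norm_matrix_le_sum)
    also have "\<dots> \<le> (\<Sum>j\<in>(UNIV::'n set). \<Sum>i\<in>(UNIV::'n set). c * (\<Sum>b\<in>Basis. \<bar>l (b * g $ j $ i)\<bar>))"
      by (intro sum_mono z)
    also have "\<dots> = c * (\<Sum>i\<in>UNIV. \<Sum>j\<in>UNIV. \<Sum>b\<in>Basis. \<bar>l (trace (g ** elem i j b))\<bar>)"
      unfolding sum_distrib_left by (subst sum.swap) (simp add: trace_mul_sym[of g] trace_elem)
    also have "\<dots> = c * (\<Sum>(i, j, b)\<in>UNIV \<times> UNIV \<times> Basis. \<bar>l (trace (g ** elem i j b))\<bar>)"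
      by (simp add: sum.cartesian_product)
    finally show ?thesis .
  qed
  then show ?thesis using c by blast
qed

text \<open>
  Each integration by parts in \<open>u\<close> divides by \<open>l (trace (g ** e))\<close> and preserves the order of
  the amplitude; for \<open>e\<close> among the multiples of matrix units by basis elements these numbers
  control the norm of \<open>g\<close>.
\<close>

lemma u_integral_rapid_decay:
  fixes F :: "('f, 'n::finite) mpair \<Rightarrow> complex"
  assumes "symbol m F" and K: "compact K" "K \<subseteq> GL" and "supported K F" and R: "R > 0"
  shows "\<exists>C\<ge>0. \<forall>g. 1 / R \<le> norm (det g) \<and> norm (det g) \<le> R \<longrightarrow> norm (u_integral F g) \<le> C * (1 + norm g) powr (m - real k)"
  using assms(1,4)
proof (induction k arbitrary: F)
  case 0
  then show ?case using u_integral_bound[OF symbol_of_order K _ R] by simp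
next
  case (Suc k)
  let ?T = "(UNIV :: 'n set) \<times> (UNIV :: 'n set) \<times> (Basis :: 'f set)"
  let ?e = "\<lambda>(i, j, b). elem i j b :: 'f^'n^'n"
  obtain C1 where C1: "C1 > 0" "\<And>g :: 'f^'n^'n. norm g \<le> C1 * (\<Sum>(i, j, b)\<in>?T. \<bar>l (trace (g ** elem i j b))\<bar>)"
    using norm_le_trace_pairings by blast
  have "\<forall>t. \<exists>dF. derives F (param_field (?e t) 0) dF \<and> symbol m dF"
    using symbol_derives[OF Suc.prems(1) param_field_fields] by metis
  then obtain dF where dF: "\<And>t. derives F (param_field (?e t) 0) (dF t)" "\<And>t. symbol m (dF t)" by metis
  have sd: "supported K (dF t)" for t
    by (rule supported_derives[OF Suc.prems(2) K(1) dF(1)])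
  obtain C0 where C0: "C0 \<ge> 0" "\<And>g. 1 / R \<le> norm (det g) \<and> norm (det g) \<le> R \<Longrightarrow> norm (u_integral F g) \<le> C0 * (1 + norm g) powr (m - real k)"
    using Suc.IH[OF Suc.prems] by blast
  have "\<forall>t. \<exists>C\<ge>0. \<forall>g. 1 / R \<le> norm (det g) \<and> norm (det g) \<le> R \<longrightarrow> norm (u_integral (dF t) g) \<le> C * (1 + norm g) powr (m - real k)"
    using Suc.IH[OF dF(2) sd] by blast
  then obtain Ct where Ct: "\<And>t. Ct t \<ge> 0" "\<And>t g. 1 / R \<le> norm (det g) \<and> norm (det g) \<le> R \<Longrightarrow> norm (u_integral (dF t) g) \<le> Ct t * (1 + norm g) powr (m - real k)"
    by metis
  define C where "C = C0 + C1 * (\<Sum>t\<in>?T. Ct t)"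
  have C: "C \<ge> 0" using C0(1) C1(1) Ct(1) by (simp add: C_def sum_nonneg)
  have "norm (u_integral F g) \<le> C * (1 + norm g) powr (m - real (Suc k))"
    if g: "1 / R \<le> norm (det g) \<and> norm (det g) \<le> R" for g
  proof -
    let ?P = "(1 + norm g) powr (m - real k)"
    have "0 < 1 / R" using R by simp
    then have "0 < norm (det g)" using g by linarith
    then have gG: "g \<in> GL" by (simp add: GL_iff_det)
    have bp: "\<bar>l (trace (g ** ?e t))\<bar> * norm (u_integral F g) \<le> Ct t * ?P" for t
    proof -
      have "\<i> * of_real (l (trace (g ** ?e t))) * u_integral F g = - u_integral (dF t) g"
        by (rule u_integral_by_parts[OF symbol_continuous[OF Suc.prems(1)] symbol_continuous[OF dF(2)] K Suc.prems(2) sd dF(1) gG])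
      then have "norm (\<i> * of_real (l (trace (g ** ?e t))) * u_integral F g) = norm (u_integral (dF t) g)" by simp
      then have "\<bar>l (trace (g ** ?e t))\<bar> * norm (u_integral F g) = norm (u_integral (dF t) g)" by (simp add: norm_mult)
      then show ?thesis using Ct(2)[OF g, of t] by simp
    qed
    have "norm g * norm (u_integral F g) \<le> C1 * (\<Sum>t\<in>?T. \<bar>l (trace (g ** ?e t))\<bar>) * norm (u_integral F g)"
      using C1(2)[of g] by (intro mult_right_mono) (auto simp: case_prod_beta)
    also have "\<dots> = C1 * (\<Sum>t\<in>?T. \<bar>l (trace (g ** ?e t))\<bar> * norm (u_integral F g))"
      by (simp add: sum_distrib_right mult.assoc)
    also have "\<dots> \<le> C1 * (\<Sum>t\<in>?T. Ct t * ?P)" using C1(1) bp by (intro mult_left_mono sum_mono) auto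
    also have "\<dots> = C1 * (\<Sum>t\<in>?T. Ct t) * ?P" by (simp add: sum_distrib_right)
    finally have "(1 + norm g) * norm (u_integral F g) \<le> C * ?P"
      using C0(2)[OF g] by (simp add: C_def distrib_right)
    also have "?P = (1 + norm g) * (1 + norm g) powr (m - real (Suc k))"
    proof -
      have "m - real k = 1 + (m - real (Suc k))" by simp
      then show ?thesis by (simp only: powr_add) simp
    qed
    finally have "(1 + norm g) * norm (u_integral F g) \<le> (1 + norm g) * (C * (1 + norm g) powr (m - real (Suc k)))"
      by (simp add: mult_ac)
    moreover have "1 + norm g > 0" by (simp add: add_pos_nonneg)
    ultimately show ?thesis by (simp only: mult_le_cancel_left_pos)
  qed
  then show ?case using C by blast
qed

lemma measurable_u_integral:
  fixes F :: "('f, 'n::finite) mpair \<Rightarrow> complex"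
  assumes "continuous_on GL2 F"
  shows "(\<lambda>g. indicator GL g *\<^sub>R u_integral F g) \<in> borel_measurable borel"
proof -
  have "continuous_on GL2 (\<lambda>p. E p * F p)" by (intro continuous_on_mult continuous_on_E assms)
  from measurable_compose[OF measurable_swap_borel measurable_GL2[OF this]]
  have "(\<lambda>(g, u). indicator GL2 (u, g) *\<^sub>R (E (u, g) * F (u, g))) \<in> borel_measurable (borel \<Otimes>\<^sub>M lborel)"
    by (simp add: case_prod_beta cong: measurable_cong_sets)
  then have "(\<lambda>g. \<integral>u. indicator GL2 (u, g) *\<^sub>R (E (u, g) * F (u, g)) \<partial>lborel) \<in> borel_measurable borel"
    by (rule lborel.borel_measurable_lebesgue_integral)
  moreover have "(\<integral>u. indicator GL2 (u, g) *\<^sub>R (E (u, g) * F (u, g)) \<partial>lborel) = indicator GL g *\<^sub>R u_integral F g" for g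
    by (cases "g \<in> GL") (simp_all add: u_integral_def set_lebesgue_integral_def GL2_def indicator_def)
  ultimately show ?thesis by simp
qed

lemma u_integral_derivative:
  fixes G :: "('f, 'n::finite) mpair \<Rightarrow> complex"
  assumes cG: "continuous_on GL2 G" "continuous_on GL2 G'" and K: "compact K" "K \<subseteq> GL" "supported K G" "supported K G'"
    and t: "t \<in> nilp_index" and d: "derives (\<lambda>p. E p * G p) (nil_field t) (\<lambda>p. E p * G' p)" and g: "g \<in> GL"
  shows "((\<lambda>s. u_integral G (g + s *\<^sub>R (nilX t ** g))) has_vector_derivative u_integral G' g) (at 0)"
proof -
  define gs where "gs s = g + s *\<^sub>R (nilX t ** g)" for s
  have det: "det (gs s) = det g" for s using t by (simp add: gs_def add_nil_motion det_mul det_nilX)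
  have gsG: "gs s \<in> GL" for s using g by (simp add: GL_iff_det det)
  have Xgs: "nilX t ** gs s = nilX t ** g" for s
    using nilX_sq[OF t] by (simp add: gs_def matrix_add_ldistrib scaleR_matrix_mult_right matrix_mul_assoc)
  have cont: "continuous_on (K \<times> {-1..1}) (\<lambda>(u, s). G' (u, gs s))"
    unfolding case_prod_beta
    by (rule continuous_on_compose2[OF cG(2)])
       (use K(2) gsG in \<open>auto simp: GL2_def gs_def intro!: continuous_intros\<close>)
  have "bounded ((\<lambda>(u, s). G' (u, gs s)) ` (K \<times> {-1..1}))"
    by (intro compact_imp_bounded compact_continuous_image[OF cont] compact_Times K(1) compact_Icc)
  then obtain D where D: "\<forall>z\<in>(\<lambda>(u, s). G' (u, gs s)) ` (K \<times> {-1..1}). norm z \<le> D" unfolding bounded_iff ..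
  have bd: "norm (indicator GL u *\<^sub>R (E (u, gs s) * G' (u, gs s))) \<le> D * indicator K u" if "\<bar>s\<bar> < 1" for s u
  proof (cases "u \<in> K")
    case True
    then have "norm (G' (u, gs s)) \<le> D" using D that by force
    then show ?thesis using True K(2) by (auto simp: norm_mult)
  next
    case False
    then show ?thesis using K(4) gsG by (auto simp: supported_def GL2_def indicator_def)
  qed
  have m: "(\<lambda>u. indicator GL u *\<^sub>R (E (u, gs s) * H (u, gs s))) \<in> borel_measurable lborel"
    if "continuous_on GL2 H" for H s
    using borel_measurable_continuous_on_indicator[OF GL_borel continuous_on_slice[OF that gsG]] by simp
  have "((\<lambda>s. \<integral>u. indicator GL u *\<^sub>R (E (u, gs s) * G (u, gs s)) \<partial>lborel) has_vector_derivative
      (\<integral>u. indicator GL u *\<^sub>R (E (u, gs 0) * G' (u, gs 0)) \<partial>lborel)) (at 0)"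
  proof (rule has_vector_derivative_integral[where \<delta> = 1 and D = "\<lambda>u. D * indicator K u"])
    show "integrable lborel (\<lambda>u. indicator GL u *\<^sub>R (E (u, gs 0) * G (u, gs 0)))"
      using u_integrable[OF cG(1) gsG K(1-3)] by (simp add: set_integrable_def)
    show "integrable lborel (\<lambda>u. D * indicator K u)"
      by (rule integrable_indicator_compact[OF K(1)])
    have "((\<lambda>s. indicator GL u *\<^sub>R (E (u, gs s) * G (u, gs s))) has_vector_derivative
        indicator GL u *\<^sub>R (E (u, gs s) * G' (u, gs s))) (at s)" for s u
    proof (cases "u \<in> GL")
      case True
      have "((\<lambda>r. E ((u, gs s) + r *\<^sub>R nil_field t (u, gs s)) * G ((u, gs s) + r *\<^sub>R nil_field t (u, gs s)))
         has_vector_derivative E (u, gs s) * G' (u, gs s)) (at 0)"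
        using d True gsG unfolding derives_def by (auto simp: GL2_def)
      moreover have "nil_field t (u, gs s) = (0, nilX t ** g)" by (simp add: nil_field_def Xgs)
      ultimately have "((\<lambda>r. E ((u, g) + s *\<^sub>R (0, nilX t ** g) + r *\<^sub>R (0, nilX t ** g)) * G ((u, g) + s *\<^sub>R (0, nilX t ** g) + r *\<^sub>R (0, nilX t ** g)))
         has_vector_derivative E (u, gs s) * G' (u, gs s)) (at 0)"
        by (simp add: gs_def)
      from directional_derivative_line[OF this] show ?thesis using True by (simp add: gs_def)
    qed simp
    then show "AE u in lborel. \<forall>s. \<bar>s\<bar> < 1 \<longrightarrow>
       ((\<lambda>s. indicator GL u *\<^sub>R (E (u, gs s) * G (u, gs s))) has_vector_derivative indicator GL u *\<^sub>R (E (u, gs s) * G' (u, gs s))) (at s) \<and>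
       norm (indicator GL u *\<^sub>R (E (u, gs s) * G' (u, gs s))) \<le> D * indicator K u"
      using bd by (intro AE_I2) blast
  qed (use m cG in auto)
  then show ?thesis by (simp add: u_integral_def set_lebesgue_integral_def gs_def)
qed

end


section \<open>Lowering the order under the test integral\<close>

context phase
begin

lemma symbol_test:
  fixes c :: "'f^'n::finite^'n \<Rightarrow> complex"
  assumes "smooth_on GL c" shows "symbol 0 (\<lambda>p :: ('f, 'n) mpair. c (fst p))"
  using assms symb_test by (auto simp: symbol_def smooth_on_def)

lemma torsor_region:
  assumes "x \<noteq> 0"
  obtains R where "R > 0" "1 / R \<le> norm x" "norm x \<le> R"
proof
  show "max (norm x) (1 / norm x) > 0" using assms by (simp add: less_max_iff_disj)
  have "1 / max (norm x) (1 / norm x) \<le> 1 / (1 / norm x)" using assms by (intro divide_left_mono) (auto simp: less_max_iff_disj)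
  then show "1 / max (norm x) (1 / norm x) \<le> norm x" by simp
qed simp

lemma u_integral_torsor_integrable:
  fixes F :: "('f, 'n::finite) mpair \<Rightarrow> complex" and \<nu> :: "('f^'n^'n) measure"
  assumes \<nu>: "SL_haar \<nu>" "x \<noteq> 0" and F: "symbol m F" and K: "compact K" "K \<subseteq> GL" "supported K F"
  shows "\<exists>C r. r \<le> - growth_exponent \<nu> \<and> (\<forall>g. det g = x \<longrightarrow> norm (u_integral F g) \<le> C * (1 + norm g) powr r)"
    "set_integrable (torsor_measure \<nu> x) GL (u_integral F)"
proof -
  obtain R where R: "R > 0" "1 / R \<le> norm x" "norm x \<le> R" using torsor_region[OF \<nu>(2)] .
  obtain k :: nat where k: "m + growth_exponent \<nu> \<le> real k" using real_arch_simple by blast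
  obtain C where C: "\<And>g. 1 / R \<le> norm (det g) \<and> norm (det g) \<le> R \<Longrightarrow> norm (u_integral F g) \<le> C * (1 + norm g) powr (m - real k)"
    using u_integral_rapid_decay[OF F K R(1), of k] by blast
  have r: "m - real k \<le> - growth_exponent \<nu>" using k by simp
  have b: "norm (u_integral F g) \<le> C * (1 + norm g) powr (m - real k)" if "det g = x" for g
    using C[of g] R that by simp
  show "\<exists>C r. r \<le> - growth_exponent \<nu> \<and> (\<forall>g. det g = x \<longrightarrow> norm (u_integral F g) \<le> C * (1 + norm g) powr r)"
    using r b by blast
  show "set_integrable (torsor_measure \<nu> x) GL (u_integral F)"
    by (rule torsor_integrable_bound[OF \<nu> r measurable_u_integral[OF symbol_continuous[OF F]] b])
qed

lemma set_integral_sum':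
  fixes f :: "'i \<Rightarrow> 'a \<Rightarrow> complex"
  assumes "finite I" "\<And>i. i \<in> I \<Longrightarrow> set_integrable M A (f i)"
  shows "(LINT x:A|M. (\<Sum>i\<in>I. f i x)) = (\<Sum>i\<in>I. LINT x:A|M. f i x)" "set_integrable M A (\<lambda>x. \<Sum>i\<in>I. f i x)"
proof -
  have i: "integrable M (\<lambda>x. indicator A x *\<^sub>R f i x)" if "i \<in> I" for i
    using assms(2)[OF that] by (simp add: set_integrable_def)
  show "(LINT x:A|M. (\<Sum>i\<in>I. f i x)) = (\<Sum>i\<in>I. LINT x:A|M. f i x)"
    unfolding set_lebesgue_integral_def scaleR_sum_right by (rule Bochner_Integration.integral_sum[OF i])
  show "set_integrable M A (\<lambda>x. \<Sum>i\<in>I. f i x)"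
    unfolding set_integrable_def scaleR_sum_right by (rule Bochner_Integration.integrable_sum[OF i])
qed

lemma u_integral_decompose:
  fixes F :: "('f, 'n::finite) mpair \<Rightarrow> complex"
  assumes "g \<in> GL" "compact K" "K \<subseteq> GL" "continuous_on GL2 F'" "supported K F'"
    and "finite I" "\<And>t. t \<in> I \<Longrightarrow> continuous_on GL2 (H t)" "\<And>t. t \<in> I \<Longrightarrow> supported K (H t)"
    and eq: "\<And>p. F p = F' p + (\<Sum>t\<in>I. H t p)"
  shows "u_integral F g = u_integral F' g + (\<Sum>t\<in>I. u_integral (H t) g)"
proof -
  have i: "set_integrable lborel GL (\<lambda>u. E (u, g) * H t (u, g))" if "t \<in> I" for t
    by (rule u_integrable[OF assms(7)[OF that] assms(1,2,3) assms(8)[OF that]])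
  have "u_integral F g = (LINT u:GL|lborel. E (u, g) * F' (u, g) + (\<Sum>t\<in>I. E (u, g) * H t (u, g)))"
    by (simp add: u_integral_def eq distrib_left sum_distrib_left)
  also have "\<dots> = u_integral F' g + (LINT u:GL|lborel. (\<Sum>t\<in>I. E (u, g) * H t (u, g)))"
    unfolding u_integral_def by (rule set_integral_add(2)[OF u_integrable[OF assms(4,1,2,3,5)] set_integral_sum'(2)[OF assms(6) i]])
  also have "(LINT u:GL|lborel. (\<Sum>t\<in>I. E (u, g) * H t (u, g))) = (\<Sum>t\<in>I. u_integral (H t) g)"
    unfolding u_integral_def by (rule set_integral_sum'(1)[OF assms(6) i])
  finally show ?thesis .
qed

lemma measurable_slice:
  fixes F :: "('f, 'n::finite) mpair \<Rightarrow> complex"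
  assumes "continuous_on GL2 F" "u \<in> GL"
  shows "(\<lambda>g. indicator GL g *\<^sub>R (E (u, g) * F (u, g))) \<in> borel_measurable borel"
proof -
  have "continuous_on GL (\<lambda>g. F (u, g))"
    by (rule continuous_on_compose2[OF assms(1)]) (use assms(2) in \<open>auto simp: GL2_def intro!: continuous_intros\<close>)
  moreover have "continuous_on GL (\<lambda>g. E (u, g))"
    by (rule continuous_on_compose2[OF continuous_on_E[of UNIV]]) (auto intro!: continuous_intros)
  ultimately have "continuous_on GL (\<lambda>g. E (u, g) * F (u, g))" by (intro continuous_on_mult)
  then show ?thesis by (rule borel_measurable_continuous_on_indicator[OF GL_borel])
qed

text \<open>
  The integral over the torsor for a fixed \<open>u\<close>. It converges absolutely if the order of \<open>F\<close> is
  at most the negative of the growth exponent.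
\<close>

definition osc_integral :: "('f^'n::finite^'n) measure \<Rightarrow> (('f, 'n) mpair \<Rightarrow> complex) \<Rightarrow> 'f \<times> ('f^'n^'n) \<Rightarrow> complex" where
  "osc_integral \<nu> F z = (LINT g:GL|torsor_measure \<nu> (fst z). E (snd z, g) * F (snd z, g))"

lemma slice_bound:
  fixes F :: "('f, 'n::finite) mpair \<Rightarrow> complex"
  assumes F: "of_order m F" and "x \<noteq> 0" "u \<in> GL"
  shows "\<exists>C\<ge>0. \<forall>g. det g = x \<longrightarrow> norm (E (u, g) * F (u, g)) \<le> C * (1 + norm g) powr m"
proof -
  obtain R where R: "R > 0" "1 / R \<le> norm x" "norm x \<le> R" using torsor_region[OF assms(2)] .
  obtain R' where R': "R' > 0" "\<And>v. v \<in> {u} \<Longrightarrow> norm v \<le> R' \<and> 1 / R' \<le> norm (det v)"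
    using compact_GL_bounds[of "{u}"] assms(3) by auto
  define R1 where "R1 = max R R'"
  have R1: "R1 > 0" "1 / R1 \<le> 1 / R" "1 / R1 \<le> 1 / R'" "R \<le> R1" "R' \<le> R1"
    using R(1) R'(1) by (auto simp: R1_def intro!: divide_left_mono)
  obtain C where C: "C \<ge> 0" "\<And>p. p \<in> bdd_region R1 \<Longrightarrow> norm (F p) \<le> C * (1 + norm (snd p)) powr m"
    using of_orderD[OF F R1(1)] by metis
  have "(u, g) \<in> bdd_region R1" if "det g = x" for g
    using R R1 R'(2)[of u] that by (auto simp: bdd_region_def)
  then have "norm (E (u, g) * F (u, g)) \<le> C * (1 + norm g) powr m" if "det g = x" for g
    using C(2)[of "(u, g)"] that by (simp add: norm_mult)
  then show ?thesis using C(1) by blast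
qed

definition cutoff :: "('f^'n::finite^'n) set \<Rightarrow> ('f^'n^'n \<Rightarrow> complex) \<Rightarrow> bool" where
  "cutoff K c \<longleftrightarrow> symbol 0 (\<lambda>p :: ('f, 'n) mpair. c (fst p)) \<and> compact K \<and> K \<subseteq> GL \<and> (\<forall>u\<in>GL - K. c u = 0)"

text \<open>
  The integral over the torsor after integration against \<open>c\<close> in \<open>u\<close>. By the rapid decay of the
  inner integral it converges for symbols \<open>F\<close> of any order.
\<close>

definition tested_integral :: "('f^'n::finite^'n) measure \<Rightarrow> 'f \<Rightarrow> ('f^'n^'n \<Rightarrow> complex) \<Rightarrow>
    (('f, 'n) mpair \<Rightarrow> complex) \<Rightarrow> complex" where
  "tested_integral \<nu> x c F = (LINT g:GL|torsor_measure \<nu> x. u_integral (\<lambda>p. c (fst p) * F p) g)"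

text \<open>
  The terms \<open>\<delta>\<^sub>t (E G\<^sub>t)\<close> produced by \<open>oscillatory_step\<close> integrate to zero over the torsor,
  because of the rapid decay when they have been tested and because of absolute convergence
  otherwise. The derivatives do not touch functions of \<open>u\<close>, so the same \<open>F'\<close> serves for all
  cutoffs \<open>c\<close>; this is what survives the passage to the limit in \<open>c\<close>.
\<close>

lemma oscillatory_reduction:
  fixes F :: "('f, 'n::finite) mpair \<Rightarrow> complex"
  assumes F: "symbol m F"
  shows "\<exists>F'. symbol (m - 1) F' \<and>
    (\<forall>(\<nu> :: ('f^'n^'n) measure) x c K. SL_haar \<nu> \<longrightarrow> x \<noteq> 0 \<longrightarrow> cutoff K c \<longrightarrow>
       tested_integral \<nu> x c F = tested_integral \<nu> x c F') \<and>
    (\<forall>(\<nu> :: ('f^'n^'n) measure) x u. SL_haar \<nu> \<longrightarrow> x \<noteq> 0 \<longrightarrow> u \<in> GL \<longrightarrow> m \<le> - growth_exponent \<nu> \<longrightarrow>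
       osc_integral \<nu> F (x, u) = osc_integral \<nu> F' (x, u))"
proof -
  let ?T = "nilp_index :: ('n \<times> 'n \<times> 'f \<times> bool) set"
  obtain F' G G' where F': "symbol (m - 1) F'"
    and G: "\<And>t. t \<in> ?T \<Longrightarrow> symbol (m - 1) (G t)" and G': "\<And>t. t \<in> ?T \<Longrightarrow> symbol m (G' t)"
    and dG: "\<And>t. t \<in> ?T \<Longrightarrow> derives (\<lambda>p. E p * G t p) (nil_field t) (\<lambda>p. E p * G' t p)"
    and eq: "\<And>p. F p = F' p + (\<Sum>t\<in>?T. G' t p)"
    using oscillatory_step[OF F] by blast
  have A: "tested_integral \<nu> x c F = tested_integral \<nu> x c F'"
    if \<nu>: "SL_haar \<nu>" "x \<noteq> 0" and "cutoff K c" for \<nu> :: "('f^'n^'n) measure" and x c K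
  proof -
    have c: "symbol 0 (\<lambda>p :: ('f, 'n) mpair. c (fst p))" "\<forall>u\<in>GL - K. c u = 0" and K: "compact K" "K \<subseteq> GL"
      using \<open>cutoff K c\<close> by (simp_all add: cutoff_def)
    have sup: "supported K (\<lambda>p. c (fst p) * H p)" for H :: "('f, 'n) mpair \<Rightarrow> complex"
      using c(2) by (auto simp: supported_def GL2_def)
    have sy: "symbol k (\<lambda>p. c (fst p) * H p)" if "symbol k H" for k and H :: "('f, 'n) mpair \<Rightarrow> complex"
      by (rule symbol_mult0[OF c(1) that])
    note co = symbol_continuous[OF sy]
    have zero: "(LINT g:GL|torsor_measure \<nu> x. u_integral (\<lambda>p. c (fst p) * G' t p) g) = 0" if t: "t \<in> ?T" for t
    proof -
      obtain C1 r1 where b1: "r1 \<le> - growth_exponent \<nu>"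
        "\<forall>g. det g = x \<longrightarrow> norm (u_integral (\<lambda>p. c (fst p) * G t p) g) \<le> C1 * (1 + norm g) powr r1"
        using u_integral_torsor_integrable(1)[OF \<nu> sy[OF G[OF t]] K sup] by (elim exE conjE)
      obtain C2 r2 where b2: "r2 \<le> - growth_exponent \<nu>"
        "\<forall>g. det g = x \<longrightarrow> norm (u_integral (\<lambda>p. c (fst p) * G' t p) g) \<le> C2 * (1 + norm g) powr r2"
        using u_integral_torsor_integrable(1)[OF \<nu> sy[OF G'[OF t]] K sup] by (elim exE conjE)
      define C where "C = max 0 (max C1 C2)"
      define r where "r = max r1 r2"
      have up: "C1 * (1 + norm g) powr r1 \<le> C * (1 + norm g) powr r" "C2 * (1 + norm g) powr r2 \<le> C * (1 + norm g) powr r"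
        for g :: "'f^'n^'n"
        by (auto simp: C_def r_def intro!: mult_mono powr_mono)
      have d0: "derives (\<lambda>p. E p * (c (fst p) * G t p)) (nil_field t) (\<lambda>p. E p * (c (fst p) * G' t p))"
      proof -
        have "derives (\<lambda>p. c (fst p)) (nil_field t) (\<lambda>_. 0)"
          by (simp add: derives_def nil_field_def has_vector_derivative_const)
        from derives_mult[OF this dG[OF t]] show ?thesis
          by (rule derives_cong) (simp_all add: mult_ac)
      qed
      show ?thesis
      proof (rule torsor_integral_derivative_zero[OF \<nu>, where r = r and X = "nilX t"])
        show "r \<le> - growth_exponent \<nu>" using b1 b2 by (simp add: r_def)
        show "nilX t ** nilX t = 0" "\<And>s. det (mat 1 + s *\<^sub>R nilX t) = 1" using nilX_sq[OF t] det_nilX[OF t] by auto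
        show "(\<lambda>g. indicator GL g *\<^sub>R u_integral (\<lambda>p. c (fst p) * G t p) g) \<in> borel_measurable borel"
          by (rule measurable_u_integral[OF co[OF G[OF t]]])
        show "(\<lambda>g. indicator GL g *\<^sub>R u_integral (\<lambda>p. c (fst p) * G' t p) g) \<in> borel_measurable borel"
          by (rule measurable_u_integral[OF co[OF G'[OF t]]])
        fix g :: "'f^'n^'n" assume g: "det g = x"
        show "norm (u_integral (\<lambda>p. c (fst p) * G t p) g) \<le> C * (1 + norm g) powr r" using b1(2)[rule_format, OF g] up(1)[of g] by linarith
        show "norm (u_integral (\<lambda>p. c (fst p) * G' t p) g) \<le> C * (1 + norm g) powr r" using b2(2)[rule_format, OF g] up(2)[of g] by linarith
        show "((\<lambda>s. u_integral (\<lambda>p. c (fst p) * G t p) (g + s *\<^sub>R (nilX t ** g))) has_vector_derivative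
            u_integral (\<lambda>p. c (fst p) * G' t p) g) (at 0)"
          by (rule u_integral_derivative[OF co[OF G[OF t]] co[OF G'[OF t]] K sup sup t d0])
             (use g \<nu>(2) in \<open>simp add: GL_iff_det\<close>)
      qed
    qed
    have "u_integral (\<lambda>p. c (fst p) * F p) g = u_integral (\<lambda>p. c (fst p) * F' p) g + (\<Sum>t\<in>?T. u_integral (\<lambda>p. c (fst p) * G' t p) g)"
      if "g \<in> GL" for g
      by (rule u_integral_decompose[OF that K co[OF F'] sup finite_nilp_index co[OF G'] sup])
         (simp_all add: eq distrib_left sum_distrib_left)
    then have "(LINT g:GL|torsor_measure \<nu> x. u_integral (\<lambda>p. c (fst p) * F p) g)
       = (LINT g:GL|torsor_measure \<nu> x. u_integral (\<lambda>p. c (fst p) * F' p) g + (\<Sum>t\<in>?T. u_integral (\<lambda>p. c (fst p) * G' t p) g))"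
      unfolding set_lebesgue_integral_def by (intro Bochner_Integration.integral_cong) (auto simp: indicator_def)
    also have "\<dots> = (LINT g:GL|torsor_measure \<nu> x. u_integral (\<lambda>p. c (fst p) * F' p) g)
        + (LINT g:GL|torsor_measure \<nu> x. (\<Sum>t\<in>?T. u_integral (\<lambda>p. c (fst p) * G' t p) g))"
      by (rule set_integral_add(2)[OF u_integral_torsor_integrable(2)[OF \<nu> sy[OF F'] K sup]
            set_integral_sum'(2)[OF finite_nilp_index u_integral_torsor_integrable(2)[OF \<nu> sy[OF G'] K sup]]])
    also have "(LINT g:GL|torsor_measure \<nu> x. (\<Sum>t\<in>?T. u_integral (\<lambda>p. c (fst p) * G' t p) g)) = 0"
      by (subst set_integral_sum'(1)[OF finite_nilp_index u_integral_torsor_integrable(2)[OF \<nu> sy[OF G'] K sup]])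
         (simp_all add: zero)
    finally show ?thesis by (simp add: tested_integral_def)
  qed
  have B: "osc_integral \<nu> F (x, u) = osc_integral \<nu> F' (x, u)"
    if \<nu>: "SL_haar \<nu>" "x \<noteq> 0" and u: "u \<in> GL" and m: "m \<le> - growth_exponent \<nu>"
    for \<nu> :: "('f^'n^'n) measure" and x u
  proof -
    have int: "set_integrable (torsor_measure \<nu> x) GL (\<lambda>g. E (u, g) * H (u, g))" if H: "symbol m H" for H
    proof -
      obtain C where C: "\<forall>g. det g = x \<longrightarrow> norm (E (u, g) * H (u, g)) \<le> C * (1 + norm g) powr m"
        using slice_bound[OF symbol_of_order[OF H] \<nu>(2) u] by (elim exE conjE)
      show ?thesis using C[rule_format]
        by (rule torsor_integrable_bound[OF \<nu> m measurable_slice[OF symbol_continuous[OF H] u]])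
    qed
    have F'm: "symbol m F'" by (rule symbol_weaken[OF F']) simp
    have zero: "(LINT g:GL|torsor_measure \<nu> x. E (u, g) * G' t (u, g)) = 0" if t: "t \<in> ?T" for t
    proof -
      have Gm: "symbol m (G t)" by (rule symbol_weaken[OF G[OF t]]) simp
      obtain C1 where C1: "C1 \<ge> 0" "\<forall>g. det g = x \<longrightarrow> norm (E (u, g) * G t (u, g)) \<le> C1 * (1 + norm g) powr m"
        using slice_bound[OF symbol_of_order[OF Gm] \<nu>(2) u] by (elim exE conjE)
      obtain C2 where C2: "C2 \<ge> 0" "\<forall>g. det g = x \<longrightarrow> norm (E (u, g) * G' t (u, g)) \<le> C2 * (1 + norm g) powr m"
        using slice_bound[OF symbol_of_order[OF G'[OF t]] \<nu>(2) u] by (elim exE conjE)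
      show ?thesis
      proof (rule torsor_integral_derivative_zero[OF \<nu> m, where X = "nilX t" and C = "C1 + C2"])
        show "nilX t ** nilX t = 0" "\<And>s. det (mat 1 + s *\<^sub>R nilX t) = 1" using nilX_sq[OF t] det_nilX[OF t] by auto
        show "(\<lambda>g. indicator GL g *\<^sub>R (E (u, g) * G t (u, g))) \<in> borel_measurable borel"
          by (rule measurable_slice[OF symbol_continuous[OF Gm] u])
        show "(\<lambda>g. indicator GL g *\<^sub>R (E (u, g) * G' t (u, g))) \<in> borel_measurable borel"
          by (rule measurable_slice[OF symbol_continuous[OF G'[OF t]] u])
        fix g :: "'f^'n^'n" assume g: "det g = x"
        have "0 \<le> C1 * (1 + norm g) powr m" "0 \<le> C2 * (1 + norm g) powr m" using C1(1) C2(1) by auto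
        then show "norm (E (u, g) * G t (u, g)) \<le> (C1 + C2) * (1 + norm g) powr m"
          "norm (E (u, g) * G' t (u, g)) \<le> (C1 + C2) * (1 + norm g) powr m"
          using C1(2)[rule_format, OF g] C2(2)[rule_format, OF g] by (simp_all add: distrib_right)
        have "(u, g) \<in> GL2" using u g \<nu>(2) by (simp add: GL2_def GL_iff_det)
        from bspec[OF dG[OF t, unfolded derives_def] this]
        show "((\<lambda>s. E (u, g + s *\<^sub>R (nilX t ** g)) * G t (u, g + s *\<^sub>R (nilX t ** g))) has_vector_derivative
            E (u, g) * G' t (u, g)) (at 0)"
          by (simp add: nil_field_def)
      qed
    qed
    have "osc_integral \<nu> F (x, u) = (LINT g:GL|torsor_measure \<nu> x. E (u, g) * F' (u, g) + (\<Sum>t\<in>?T. E (u, g) * G' t (u, g)))"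
      by (simp add: osc_integral_def eq distrib_left sum_distrib_left)
    also have "\<dots> = (LINT g:GL|torsor_measure \<nu> x. E (u, g) * F' (u, g)) + (LINT g:GL|torsor_measure \<nu> x. (\<Sum>t\<in>?T. E (u, g) * G' t (u, g)))"
      by (rule set_integral_add(2)[OF int[OF F'm] set_integral_sum'(2)[OF finite_nilp_index int[OF G']]])
    also have "(LINT g:GL|torsor_measure \<nu> x. (\<Sum>t\<in>?T. E (u, g) * G' t (u, g))) = 0"
      by (subst set_integral_sum'(1)[OF finite_nilp_index int[OF G']]) (simp_all add: zero)
    finally show ?thesis by (simp add: osc_integral_def)
  qed
  show ?thesis using F' A B by (intro exI[of _ F'] conjI allI impI) auto
qed

end


section \<open>Smoothness of oscillatory integrals\<close>

lemma norm_torsor_point_le: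
  "norm (torsor_point y :: 'f::arch_local_field^'n^'n) \<le> real CARD('n) * real CARD('n) * (1 + norm y)"
proof -
  have "norm (torsor_point y :: 'f^'n^'n) \<le> (\<Sum>i\<in>(UNIV::'n set). \<Sum>j\<in>(UNIV::'n set). norm ((torsor_point y :: 'f^'n^'n) $ i $ j))"
    by (rule norm_matrix_le_sum)
  also have "\<dots> \<le> (\<Sum>i\<in>(UNIV::'n set). \<Sum>j\<in>(UNIV::'n set). 1 + norm y)"
    by (intro sum_mono) (simp add: torsor_point_def)
  finally show ?thesis by simp
qed

lemma torsor_point_inverse:
  assumes "x \<noteq> 0"
  shows "torsor_point (inverse x) ** (torsor_point x ** h) = h"
  using assms by (simp add: vec_eq_iff torsor_point_mult_index)

lemma continuous_on_torsor_point: "continuous_on S (\<lambda>x. torsor_point x :: 'f::arch_local_field^'n^'n)"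
  unfolding torsor_point_def
proof (intro continuous_on_vec_lambda)
  fix i j :: 'n
  show "continuous_on S (\<lambda>x :: 'f. if i = j then if i = (SOME k. True) then x else 1 else 0)"
    by (cases "i = j"; cases "i = (SOME k. True)") (auto intro: continuous_intros)
qed

definition param_domain :: "('f::arch_local_field \<times> ('f^'n^'n)) set" where
  "param_domain = (- {0}) \<times> GL"

lemma open_param_domain: "open (param_domain :: ('f::arch_local_field \<times> ('f^'n^'n)) set)"
  unfolding param_domain_def by (intro open_Times open_GL) auto

text \<open>
  Locally in the parameters the bound is uniform and refers to a fixed variable \<open>h\<close> in \<open>SL\<close>,
  as dominated convergence requires.
\<close>

lemma of_order_param_bound:
  fixes F :: "('f::arch_local_field, 'n::finite) mpair \<Rightarrow> complex"
  assumes F: "of_order m F" "m \<le> 0" and z: "z \<in> param_domain"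
  obtains \<delta> C where "\<delta> > 0" "ball z \<delta> \<subseteq> param_domain"
    "\<forall>y\<in>ball z \<delta>. \<forall>h\<in>SL. norm (F (snd y, torsor_point (fst y) ** h)) \<le> C * (1 + norm h) powr m"
proof -
  obtain x0 u0 where z0: "z = (x0, u0)" by (cases z)
  have nz: "x0 \<noteq> 0" "det u0 \<noteq> 0" using z by (auto simp: z0 param_domain_def GL_iff_det)
  define R where "R = 1 + norm x0 + 1 / norm x0 + norm u0 + 1 / norm (det u0)"
  have pos: "1 / norm x0 > 0" "1 / norm (det u0) > 0" using nz by auto
  have Rp: "R > 0" "norm x0 < R" "norm u0 < R" "1 / norm x0 < R" "1 / norm (det u0) < R"
    using pos norm_ge_zero[of x0] norm_ge_zero[of u0] unfolding R_def by linarith+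
  define W where "W = {y :: 'f \<times> ('f^'n^'n). norm (fst y) < R \<and> 1 / R < norm (fst y) \<and> norm (snd y) < R \<and> 1 / R < norm (det (snd y))}"
  have "open W" unfolding W_def
    by (intro open_Collect_conj open_Collect_less continuous_intros)
  moreover have "z \<in> W" using Rp nz by (auto simp: W_def z0 field_simps)
  ultimately obtain \<delta> where \<delta>: "\<delta> > 0" "ball z \<delta> \<subseteq> W" using open_contains_ball by blast
  have W0: "W \<subseteq> param_domain"
  proof
    fix y assume "y \<in> W"
    moreover have "0 < 1 / R" using Rp by simp
    ultimately have "0 < norm (fst y)" "0 < norm (det (snd y))" by (auto simp: W_def intro: less_trans)
    then show "y \<in> param_domain" by (cases y) (simp add: param_domain_def GL_iff_det)
  qed
  obtain C where C: "C \<ge> 0" "\<And>p. p \<in> bdd_region R \<Longrightarrow> norm (F p) \<le> C * (1 + norm (snd p)) powr m"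
    using of_orderD[OF F(1) Rp(1)] by (metis (no_types))
  obtain K where K: "K \<ge> 1" "\<And>(A :: 'f^'n^'n) (B :: 'f^'n^'n). norm (A ** B) \<le> K * norm A * norm B"
    using norm_matrix_mult_le by metis
  define L where "L = 1 + K * (real CARD('n) * real CARD('n) * (1 + R))"
  have L: "L \<ge> 1" using K(1) Rp(1) by (simp add: L_def)
  have main: "norm (F (snd y, torsor_point (fst y) ** h)) \<le> (C * L powr (- m)) * (1 + norm h) powr m"
    if y: "y \<in> W" and h: "h \<in> SL" for y h
  proof -
    define g where "g = torsor_point (fst y) ** h"
    have x: "fst y \<noteq> 0" using W0 y by (auto simp: param_domain_def)
    have "(snd y, g) \<in> bdd_region R"
      using y h by (simp add: bdd_region_def W_def g_def det_mul det_torsor_point SL_def)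
    then have 1: "norm (F (snd y, g)) \<le> C * (1 + norm g) powr m" using C(2)[of "(snd y, g)"] by simp
    have "norm h = norm (torsor_point (inverse (fst y)) ** g)" by (simp add: g_def torsor_point_inverse[OF x])
    also have "\<dots> \<le> K * norm (torsor_point (inverse (fst y)) :: 'f^'n^'n) * norm g" by (rule K(2))
    also have "\<dots> \<le> L * norm g"
    proof (rule mult_right_mono)
      have "norm (inverse (fst y)) \<le> R"
      proof -
        have "1 / R < norm (fst y)" using y by (simp add: W_def)
        then have "inverse (norm (fst y)) \<le> inverse (1 / R)" using Rp(1) by (intro le_imp_inverse_le) auto
        then show ?thesis by (simp add: norm_inverse)
      qed
      then have "norm (torsor_point (inverse (fst y)) :: 'f^'n^'n) \<le> real CARD('n) * real CARD('n) * (1 + R)"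
        by (intro order_trans[OF norm_torsor_point_le] mult_left_mono) auto
      then have "K * norm (torsor_point (inverse (fst y)) :: 'f^'n^'n) \<le> K * (real CARD('n) * real CARD('n) * (1 + R))"
        using K(1) by (intro mult_left_mono) auto
      then show "K * norm (torsor_point (inverse (fst y)) :: 'f^'n^'n) \<le> L" by (simp add: L_def)
    qed simp
    finally have "(1 + norm g) powr m \<le> L powr (- m) * (1 + norm h) powr m"
      using L F(2) by (intro one_plus_powr_comparable) auto
    then have "C * (1 + norm g) powr m \<le> C * (L powr (- m) * (1 + norm h) powr m)" by (rule mult_left_mono[OF _ C(1)])
    then show ?thesis using 1 by (simp add: g_def mult.assoc)
  qed
  show thesis
    by (rule that[OF \<delta>(1) subset_trans[OF \<delta>(2) W0], of "C * L powr (- m)"]) (use main \<delta>(2) in blast)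
qed

lemma partially_Ck_cong:
  assumes "open S" "\<And>x. x \<in> S \<Longrightarrow> f x = g x" "partially_Ck k S f"
  shows "partially_Ck k S g"
proof (cases k)
  case 0 then show ?thesis using assms by (simp cong: continuous_on_cong)
next
  case (Suc j)
  show ?thesis
    unfolding Suc partially_Ck.simps
  proof (intro conjI allI)
    show "continuous_on S g" using assms Suc by (simp cong: continuous_on_cong)
    fix e
    obtain f' where f': "\<forall>x\<in>S. ((\<lambda>t. f (x + t *\<^sub>R e)) has_vector_derivative f' x) (at 0)" "partially_Ck j S f'"
      using assms(3) unfolding Suc partially_Ck.simps by blast
    have "((\<lambda>t. g (x + t *\<^sub>R e)) has_vector_derivative f' x) (at 0)" if x: "x \<in> S" for x
    proof (subst has_vector_derivative_cong_ev[where g = "\<lambda>t. f (x + t *\<^sub>R e)"])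
      show "\<forall>\<^sub>F t in nhds 0. t \<in> UNIV \<longrightarrow> g (x + t *\<^sub>R e) = f (x + t *\<^sub>R e)"
        using eventually_line_in_open[OF assms(1) x, of e] by eventually_elim (simp add: assms(2))
    qed (use x f'(1) assms(2) in auto)
    then show "\<exists>f'. (\<forall>x\<in>S. ((\<lambda>t. g (x + t *\<^sub>R e)) has_vector_derivative f' x) (at 0)) \<and> partially_Ck j S f'"
      using f'(2) by blast
  qed
qed

lemma partially_Ck_affine:
  assumes "partially_Ck k S f" "linear T" "continuous_on UNIV T" "\<And>y. y \<in> U \<Longrightarrow> a + T y \<in> S"
  shows "partially_Ck k U (\<lambda>y. f (a + T y))"
  using assms(1)
proof (induction k arbitrary: f)
  have c: "continuous_on U (\<lambda>y. f (a + T y))" if "continuous_on S f" for f :: "'a \<Rightarrow> 'b"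
    by (rule continuous_on_compose2[OF that])
       (use assms(4) continuous_on_subset[OF assms(3) subset_UNIV] in \<open>auto intro!: continuous_intros\<close>)
  { case 0 then show ?case using c by simp
  next
    case (Suc k)
    show ?case
      unfolding partially_Ck.simps
    proof (intro conjI allI)
      show "continuous_on U (\<lambda>y. f (a + T y))" using Suc.prems c by simp
      fix e
      obtain f' where f': "\<forall>x\<in>S. ((\<lambda>t. f (x + t *\<^sub>R T e)) has_vector_derivative f' x) (at 0)" "partially_Ck k S f'"
        using Suc.prems unfolding partially_Ck.simps by blast
      have "((\<lambda>t. f (a + T (y + t *\<^sub>R e))) has_vector_derivative f' (a + T y)) (at 0)" if "y \<in> U" for y
        using bspec[OF f'(1) assms(4)[OF that]] by (simp add: linear_add[OF assms(2)] linear_cmul[OF assms(2)] add.assoc)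
      then show "\<exists>g. (\<forall>y\<in>U. ((\<lambda>t. f (a + T (y + t *\<^sub>R e))) has_vector_derivative g y) (at 0)) \<and> partially_Ck k U g"
        using Suc.IH[OF f'(2)] by (intro exI[of _ "\<lambda>y. f' (a + T y)"]) auto
    qed }
qed

context phase
begin

text \<open>
  The integrand transported to \<open>SL\<close>, so that the domain of integration no longer depends on
  the parameter.
\<close>

definition osc_integrand :: "(('f, 'n::finite) mpair \<Rightarrow> complex) \<Rightarrow> 'f \<times> ('f^'n^'n) \<Rightarrow> 'f^'n^'n \<Rightarrow> complex" where
  "osc_integrand F z h = indicator SL h *\<^sub>R (E (snd z, torsor_point (fst z) ** h) * F (snd z, torsor_point (fst z) ** h))"

lemma osc_integrand_measurable:
  fixes F :: "('f, 'n::finite) mpair \<Rightarrow> complex"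
  assumes "continuous_on GL2 F" "z \<in> param_domain"
  shows "osc_integrand F z \<in> borel_measurable borel"
proof -
  have u: "snd z \<in> GL" and x: "fst z \<noteq> 0" using assms(2) by (auto simp: param_domain_def)
  have "(\<lambda>h. indicator GL (torsor_point (fst z) ** h) *\<^sub>R (E (snd z, torsor_point (fst z) ** h) * F (snd z, torsor_point (fst z) ** h)))
      \<in> borel_measurable borel"
    by (rule measurable_compose[OF measurable_left_mult measurable_slice[OF assms(1) u]])
  then have "(\<lambda>h. indicator SL h *\<^sub>R (indicator GL (torsor_point (fst z) ** h) *\<^sub>R (E (snd z, torsor_point (fst z) ** h) * F (snd z, torsor_point (fst z) ** h))))
      \<in> borel_measurable borel"
    by (rule borel_measurable_scaleR[OF borel_measurable_indicator[OF borel_closed[OF closed_SL]]])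
  moreover have "indicator SL h *\<^sub>R (indicator GL (torsor_point (fst z) ** h) *\<^sub>R (E (snd z, torsor_point (fst z) ** h) * F (snd z, torsor_point (fst z) ** h)))
    = osc_integrand F z h" for h
    using x by (simp add: osc_integrand_def indicator_def SL_def GL_iff_det det_mul det_torsor_point)
  ultimately show ?thesis by simp
qed

lemma osc_integral_eq:
  fixes F :: "('f, 'n::finite) mpair \<Rightarrow> complex"
  assumes \<nu>: "SL_haar \<nu>" and "continuous_on GL2 F" "z \<in> param_domain"
  shows "osc_integral \<nu> F z = (\<integral>h. osc_integrand F z h \<partial>\<nu>)"
proof -
  have [measurable_cong]: "sets \<nu> = sets borel" by (rule SL_haarD[OF \<nu>])
  have u: "snd z \<in> GL" and x: "fst z \<noteq> 0" using assms(3) by (auto simp: param_domain_def)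
  have "osc_integral \<nu> F z = (\<integral>h. indicator GL (torsor_point (fst z) ** h) *\<^sub>R
      (E (snd z, torsor_point (fst z) ** h) * F (snd z, torsor_point (fst z) ** h)) \<partial>\<nu>)"
    unfolding osc_integral_def set_lebesgue_integral_def torsor_measure_def
    by (rule integral_distr[OF _ measurable_slice[OF assms(2) u]]) measurable
  also have "\<dots> = (\<integral>h. osc_integrand F z h \<partial>\<nu>)"
  proof (rule integral_cong_AE)
    show "(\<lambda>h. indicator GL (torsor_point (fst z) ** h) *\<^sub>R
      (E (snd z, torsor_point (fst z) ** h) * F (snd z, torsor_point (fst z) ** h))) \<in> borel_measurable \<nu>"
      using measurable_compose[OF measurable_left_mult measurable_slice[OF assms(2) u]] by measurable
    show "osc_integrand F z \<in> borel_measurable \<nu>" using osc_integrand_measurable[OF assms(2,3)] by measurable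
    show "AE h in \<nu>. indicator GL (torsor_point (fst z) ** h) *\<^sub>R
      (E (snd z, torsor_point (fst z) ** h) * F (snd z, torsor_point (fst z) ** h)) = osc_integrand F z h"
      using SL_haarD(2)[OF \<nu>]
      by eventually_elim (use x in \<open>simp add: osc_integrand_def indicator_def SL_def GL_iff_det det_mul det_torsor_point\<close>)
  qed
  finally show ?thesis .
qed

lemma continuous_on_osc_integral:
  fixes F :: "('f, 'n::finite) mpair \<Rightarrow> complex"
  assumes \<nu>: "SL_haar \<nu>" and F: "of_order m F" and m: "m \<le> - growth_exponent \<nu>"
  shows "continuous_on param_domain (osc_integral \<nu> F)"
  unfolding continuous_on_sequentially comp_def
proof (intro allI ballI impI, elim conjE)
  fix X :: "nat \<Rightarrow> 'f \<times> ('f^'n^'n)" and z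
  assume z: "z \<in> param_domain" and X: "\<forall>n. X n \<in> param_domain" "X \<longlonglongrightarrow> z"
  have cF: "continuous_on GL2 F" using F by (simp add: of_order_def)
  have m0: "m \<le> 0" using m growth_exponent(1)[OF \<nu>] by linarith
  have [measurable_cong]: "sets \<nu> = sets borel" by (rule SL_haarD[OF \<nu>])
  obtain \<delta> C where \<delta>: "\<delta> > 0" "ball z \<delta> \<subseteq> param_domain"
    and bd: "\<forall>y\<in>ball z \<delta>. \<forall>h\<in>SL. norm (F (snd y, torsor_point (fst y) ** h)) \<le> C * (1 + norm h) powr m"
    using of_order_param_bound[OF F m0 z] .
  have "\<forall>\<^sub>F n in sequentially. X n \<in> ball z \<delta>"
    by (rule topological_tendstoD[OF X(2) open_ball]) (use \<delta>(1) in simp)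
  then obtain N where N: "\<And>n. n \<ge> N \<Longrightarrow> X n \<in> ball z \<delta>" unfolding eventually_sequentially by blast
  define Y where "Y n = X (n + N)" for n
  have Y: "Y n \<in> ball z \<delta>" "Y n \<in> param_domain" for n using N X(1) by (auto simp: Y_def)
  have Yz: "Y \<longlonglongrightarrow> z" unfolding Y_def using X(2) by (rule LIMSEQ_ignore_initial_segment)
  have "(\<lambda>n. \<integral>h. osc_integrand F (Y n) h \<partial>\<nu>) \<longlonglongrightarrow> (\<integral>h. osc_integrand F z h \<partial>\<nu>)"
  proof (rule integral_dominated_convergence[where w = "\<lambda>h. C * (1 + norm h) powr m"])
    show "osc_integrand F z \<in> borel_measurable \<nu>" using osc_integrand_measurable[OF cF z] by measurable
    show "osc_integrand F (Y n) \<in> borel_measurable \<nu>" for n using osc_integrand_measurable[OF cF Y(2)] by measurable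
    show "integrable \<nu> (\<lambda>h. C * (1 + norm h) powr m)" by (intro integrable_mult_right growth_exponent(2)[OF \<nu> m])
    show "AE h in \<nu>. norm (osc_integrand F (Y n) h) \<le> C * (1 + norm h) powr m" for n
      using SL_haarD(2)[OF \<nu>]
      by eventually_elim (use bd[rule_format, OF Y(1)] in \<open>simp add: osc_integrand_def norm_mult\<close>)
    show "AE h in \<nu>. (\<lambda>n. osc_integrand F (Y n) h) \<longlonglongrightarrow> osc_integrand F z h"
      using SL_haarD(2)[OF \<nu>]
    proof eventually_elim
      case (elim h)
      have c: "continuous_on param_domain (\<lambda>y. (snd y, torsor_point (fst y) ** h))"
        by (intro continuous_on_Pair continuous_on_snd continuous_on_id continuous_on_matrix_mult
            continuous_on_compose2[OF continuous_on_torsor_point[of UNIV]] continuous_on_fst continuous_on_const) auto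
      have im: "(snd y, torsor_point (fst y) ** h) \<in> GL2" if "y \<in> param_domain" for y
        using that elim by (auto simp: param_domain_def GL2_def GL_iff_det det_mul det_torsor_point SL_def)
      have "continuous_on param_domain (\<lambda>y. E (snd y, torsor_point (fst y) ** h) * F (snd y, torsor_point (fst y) ** h))"
        by (rule continuous_on_compose2[OF continuous_on_mult[OF continuous_on_E cF] c]) (use im in auto)
      then have "(\<lambda>n. E (snd (Y n), torsor_point (fst (Y n)) ** h) * F (snd (Y n), torsor_point (fst (Y n)) ** h))
         \<longlonglongrightarrow> E (snd z, torsor_point (fst z) ** h) * F (snd z, torsor_point (fst z) ** h)"
        using Y(2) Yz z unfolding continuous_on_sequentially comp_def by blast
      then show ?case unfolding osc_integrand_def by (intro tendsto_scaleR tendsto_const)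
    qed
  qed
  then have "(\<lambda>n. osc_integral \<nu> F (Y n)) \<longlonglongrightarrow> osc_integral \<nu> F z"
    by (simp add: osc_integral_eq[OF \<nu> cF] Y(2) z)
  then show "(\<lambda>n. osc_integral \<nu> F (X n)) \<longlonglongrightarrow> osc_integral \<nu> F z"
    unfolding Y_def by (rule LIMSEQ_offset)
qed

lemma osc_integral_derivative:
  fixes F :: "('f, 'n::finite) mpair \<Rightarrow> complex"
  assumes \<nu>: "SL_haar \<nu>" and F: "of_order m F" "of_order (m + 1) F1" and m: "m + 1 \<le> - growth_exponent \<nu>"
    and d: "derives (\<lambda>p. E p * F p) (param_field e c) (\<lambda>p. E p * F1 p)" and z: "z \<in> param_domain"
  shows "((\<lambda>s. osc_integral \<nu> F (z + s *\<^sub>R (c, e))) has_vector_derivative osc_integral \<nu> F1 z) (at 0)"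
proof -
  have cF: "continuous_on GL2 F" "continuous_on GL2 F1" using F by (simp_all add: of_order_def)
  have [measurable_cong]: "sets \<nu> = sets borel" by (rule SL_haarD[OF \<nu>])
  have m0: "m + 1 \<le> 0" "m \<le> 0" using m growth_exponent(1)[OF \<nu>] by linarith+
  have mm: "m \<le> - growth_exponent \<nu>" using m by linarith
  obtain \<delta> C where \<delta>: "\<delta> > 0" "ball z \<delta> \<subseteq> param_domain"
    and bd: "\<forall>y\<in>ball z \<delta>. \<forall>h\<in>SL. norm (F1 (snd y, torsor_point (fst y) ** h)) \<le> C * (1 + norm h) powr (m + 1)"
    using of_order_param_bound[OF F(2) m0(1) z] .
  obtain \<delta>0 C0 where \<delta>0: "\<delta>0 > 0" "ball z \<delta>0 \<subseteq> param_domain"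
    and bd0: "\<forall>y\<in>ball z \<delta>0. \<forall>h\<in>SL. norm (F (snd y, torsor_point (fst y) ** h)) \<le> C0 * (1 + norm h) powr m"
    using of_order_param_bound[OF F(1) m0(2) z] .
  define v where "v = (c, e)"
  define \<epsilon> where "\<epsilon> = \<delta> / (1 + norm v)"
  have nv: "1 + norm v > 0" by (simp add: add_pos_nonneg)
  have \<epsilon>: "\<epsilon> > 0" using \<delta>(1) nv by (simp add: \<epsilon>_def)
  have zs: "z + s *\<^sub>R v \<in> ball z \<delta>" if "\<bar>s\<bar> < \<epsilon>" for s
  proof -
    have "\<bar>s\<bar> * (1 + norm v) < \<delta>" using that nv by (simp add: \<epsilon>_def pos_less_divide_eq)
    moreover have "\<bar>s\<bar> * norm v \<le> \<bar>s\<bar> * (1 + norm v)" by (intro mult_left_mono) auto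
    ultimately show ?thesis by (simp add: dist_norm)
  qed
  then have zp: "z + s *\<^sub>R v \<in> param_domain" if "\<bar>s\<bar> < \<epsilon>" for s using \<delta>(2) that by blast
  have "((\<lambda>s. \<integral>h. osc_integrand F (z + s *\<^sub>R v) h \<partial>\<nu>) has_vector_derivative (\<integral>h. osc_integrand F1 (z + 0 *\<^sub>R v) h \<partial>\<nu>)) (at 0)"
  proof (rule has_vector_derivative_integral[OF \<epsilon>, where D = "\<lambda>h. C * (1 + norm h) powr (m + 1)"])
    show "(\<lambda>h. osc_integrand F (z + s *\<^sub>R v) h) \<in> borel_measurable \<nu>" if "\<bar>s\<bar> < \<epsilon>" for s
      using osc_integrand_measurable[OF cF(1) zp[OF that]] by measurable
    show "(\<lambda>h. osc_integrand F1 (z + 0 *\<^sub>R v) h) \<in> borel_measurable \<nu>"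
      using osc_integrand_measurable[OF cF(2) z] by simp
    show "integrable \<nu> (\<lambda>h. C * (1 + norm h) powr (m + 1))" by (intro integrable_mult_right growth_exponent(2)[OF \<nu> m])
    show "integrable \<nu> (\<lambda>h. osc_integrand F (z + 0 *\<^sub>R v) h)"
    proof (rule Bochner_Integration.integrable_bound)
      show "integrable \<nu> (\<lambda>h. C0 * (1 + norm h) powr m)" by (intro integrable_mult_right growth_exponent(2)[OF \<nu> mm])
      show "(\<lambda>h. osc_integrand F (z + 0 *\<^sub>R v) h) \<in> borel_measurable \<nu>"
        using osc_integrand_measurable[OF cF(1) z] by simp
      show "AE h in \<nu>. norm (osc_integrand F (z + 0 *\<^sub>R v) h) \<le> norm (C0 * (1 + norm h) powr m)"
        using SL_haarD(2)[OF \<nu>]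
      proof eventually_elim
        case (elim h)
        then show ?case using bd0[rule_format, of z h] \<delta>0(1) by (simp add: osc_integrand_def norm_mult)
      qed
    qed
    show "AE h in \<nu>. \<forall>s. \<bar>s\<bar> < \<epsilon> \<longrightarrow>
      ((\<lambda>s. osc_integrand F (z + s *\<^sub>R v) h) has_vector_derivative osc_integrand F1 (z + s *\<^sub>R v) h) (at s) \<and>
      norm (osc_integrand F1 (z + s *\<^sub>R v) h) \<le> C * (1 + norm h) powr (m + 1)"
      using SL_haarD(2)[OF \<nu>]
    proof eventually_elim
      case (elim h)
      show ?case
      proof (intro allI impI conjI)
        fix s assume s: "\<bar>s\<bar> < \<epsilon>"
        define y where "y = z + s *\<^sub>R v"
        have y: "fst y \<noteq> 0" "snd y \<in> GL" using zp[OF s] unfolding y_def[symmetric] by (auto simp: param_domain_def)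
        have h1: "det h = 1" using elim by (simp add: SL_def)
        define f where "f r = E (snd (z + r *\<^sub>R v), torsor_point (fst (z + r *\<^sub>R v)) ** h) * F (snd (z + r *\<^sub>R v), torsor_point (fst (z + r *\<^sub>R v)) ** h)" for r
        define p where "p = (snd y, torsor_point (fst y) ** h)"
        have p: "p \<in> GL2" using y h1 by (simp add: p_def GL2_def GL_iff_det det_mul det_torsor_point)
        have line: "p + r *\<^sub>R param_field e c p = (snd (z + (s + r) *\<^sub>R v), torsor_point (fst (z + (s + r) *\<^sub>R v)) ** h)" for r
          using torsor_point_line[OF h1 y(1), of r c]
          by (simp add: p_def param_field_def y_def v_def algebra_simps)
        have "((\<lambda>r. E (p + r *\<^sub>R param_field e c p) * F (p + r *\<^sub>R param_field e c p)) has_vector_derivative E p * F1 p) (at 0)"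
          using d p unfolding derives_def by blast
        then have "((\<lambda>r. f (0 + s *\<^sub>R 1 + r *\<^sub>R 1)) has_vector_derivative E p * F1 p) (at 0)"
          unfolding line f_def by simp
        then have "((\<lambda>r. f (0 + r *\<^sub>R 1)) has_vector_derivative E p * F1 p) (at s)"
          by (rule directional_derivative_line)
        then show "((\<lambda>s. osc_integrand F (z + s *\<^sub>R v) h) has_vector_derivative osc_integrand F1 (z + s *\<^sub>R v) h) (at s)"
          using elim by (simp add: osc_integrand_def f_def p_def y_def)
        show "norm (osc_integrand F1 (z + s *\<^sub>R v) h) \<le> C * (1 + norm h) powr (m + 1)"
          using bd[rule_format, OF zs[OF s] elim] elim by (simp add: osc_integrand_def norm_mult)
      qed
    qed
  qed
  then have "((\<lambda>s. \<integral>h. osc_integrand F (z + s *\<^sub>R v) h \<partial>\<nu>) has_vector_derivative osc_integral \<nu> F1 z) (at 0)"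
    by (simp add: osc_integral_eq[OF \<nu> cF(2) z])
  then show ?thesis unfolding v_def[symmetric]
  proof (rule has_vector_derivative_transform_within_open[where S = "{- \<epsilon><..<\<epsilon>}"])
    show "(\<integral>h. osc_integrand F (z + s *\<^sub>R v) h \<partial>\<nu>) = osc_integral \<nu> F (z + s *\<^sub>R v)" if "s \<in> {- \<epsilon><..<\<epsilon>}" for s
      using osc_integral_eq[OF \<nu> cF(1) zp[of s]] that by auto
  qed (use \<epsilon> in auto)
qed

text \<open>
  A derivative in the parameters falls on the amplitude, whose order it preserves, or on the
  phase, whose derivative is a symbol of order 1. So each derivative costs one order.
\<close>

lemma partially_Ck_osc_integral:
  fixes F :: "('f, 'n::finite) mpair \<Rightarrow> complex"
  assumes \<nu>: "SL_haar \<nu>" and F: "symbol m F" and m: "m + real j \<le> - growth_exponent \<nu>"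
  shows "partially_Ck j param_domain (osc_integral \<nu> F)"
  using F m
proof (induction j arbitrary: m F)
  case 0
  then show ?case using continuous_on_osc_integral[OF \<nu> symbol_of_order] by auto
next
  case (Suc j)
  show ?case
    unfolding partially_Ck.simps
  proof (intro conjI allI)
    show "continuous_on param_domain (osc_integral \<nu> F)"
      by (rule continuous_on_osc_integral[OF \<nu> symbol_of_order[OF Suc.prems(1)]]) (use Suc.prems(2) in linarith)
    fix v :: "'f \<times> ('f^'n^'n)"
    obtain c e where v: "v = (c, e)" by (cases v)
    let ?\<xi> = "param_field e c"
    obtain dF where dF: "derives F ?\<xi> dF" "symbol m dF" using symbol_derives[OF Suc.prems(1) param_field_fields] .
    define F1 where "F1 p = dF p + \<i> * (of_real (phase_derivative ?\<xi> p) * F p)" for p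
    have F1: "symbol (m + 1) F1"
    proof -
      have "symbol (1 + m) (\<lambda>p. of_real (phase_derivative ?\<xi> p) * F p)"
        by (rule symbol_mult[OF symbol_of_real[OF symbol_phase_derivative[OF param_field_fields]] Suc.prems(1)])
      then have "symbol (m + 1) (\<lambda>p. of_real (phase_derivative ?\<xi> p) * F p)" by (simp add: add.commute)
      moreover have "symbol (m + 1) dF" by (rule symbol_weaken[OF dF(2)]) simp
      ultimately show ?thesis unfolding F1_def by (intro symbol_add symbol_mult0[OF symbol_const])
    qed
    have d: "derives (\<lambda>p. E p * F p) ?\<xi> (\<lambda>p. E p * F1 p)"
      by (rule derives_cong[OF derives_mult[OF derives_E dF(1)]]) (simp_all add: F1_def algebra_simps)
    have "((\<lambda>t. osc_integral \<nu> F (z + t *\<^sub>R v)) has_vector_derivative osc_integral \<nu> F1 z) (at 0)" if "z \<in> param_domain" for z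
      unfolding v
      by (rule osc_integral_derivative[OF \<nu> symbol_of_order[OF Suc.prems(1)] symbol_of_order[OF F1] _ d that])
         (use Suc.prems(2) in simp)
    moreover have "partially_Ck j param_domain (osc_integral \<nu> F1)"
      by (rule Suc.IH[OF F1]) (use Suc.prems(2) in simp)
    ultimately show "\<exists>f'. (\<forall>z\<in>param_domain. ((\<lambda>t. osc_integral \<nu> F (z + t *\<^sub>R v)) has_vector_derivative f' z) (at 0)) \<and>
        partially_Ck j param_domain f'" by blast
  qed
qed

end


section \<open>Matrix coefficients as symbols\<close>

context frechet_space
begin

lemma p_zero: "p k 0 = 0"
  using p_scale[of k 0 0] by simp

lemma p_minus: "p k (- v) = p k v"
  using p_scale[of k "- 1" v] by simp

lemma p_nonneg: "0 \<le> p k v"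
  using p_triangle[of k v "- v"] by (simp add: p_zero p_minus)

lemma converges_to_const: "converges_to (\<lambda>_. v) v"
  by (simp add: converges_to_def p_zero)

lemma p_sum_nonneg: "0 \<le> (\<Sum>i\<le>m. p i v)"
  by (intro sum_nonneg p_nonneg)

lemma p_sum_scale: "(\<Sum>i\<le>m. p i (scale a v)) = cmod a * (\<Sum>i\<le>m. p i v)"
  by (simp add: p_scale sum_distrib_left)

end

context contragredient
begin

lemma pairing_zero: "B 0 w = 0" "B v 0 = 0"
  using pairing_add_left[of 0 0 w] pairing_add_right[of v 0 0] by simp_all

lemma pairing_diff_left: "B (u - v) w = B u w - B v w"
  using pairing_add_left[of "u - v" v w] by simp

text \<open>
  Otherwise there are null sequences in both spaces whose pairings stay away from 0, contrary
  to the joint continuity of the pairing.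
\<close>

lemma pairing_small:
  "\<exists>m::nat. \<forall>v w. (\<Sum>i\<le>m. p i v) \<le> 1 / Suc m \<and> (\<Sum>i\<le>m. q i w) \<le> 1 / Suc m \<longrightarrow> cmod (B v w) \<le> 1"
proof (rule ccontr)
  assume "\<not> ?thesis"
  then have "\<forall>m. \<exists>v w. (\<Sum>i\<le>m. p i v) \<le> 1 / Suc m \<and> (\<Sum>i\<le>m. q i w) \<le> 1 / Suc m \<and> cmod (B v w) > 1"
    by (simp add: not_le)
  then obtain v w where vw: "\<And>m. (\<Sum>i\<le>m. p i (v m)) \<le> 1 / Suc m" "\<And>m. (\<Sum>i\<le>m. q i (w m)) \<le> 1 / Suc m"
    "\<And>m. cmod (B (v m) (w m)) > 1" by metis
  have lim: "(\<lambda>m. 1 / real (Suc m)) \<longlonglongrightarrow> 0" using LIMSEQ_inverse_real_of_nat by (simp add: inverse_eq_divide)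
  have "V.converges_to v 0"
    unfolding V.converges_to_def
  proof
    fix k
    show "(\<lambda>i. p k (v i - 0)) \<longlonglongrightarrow> 0"
    proof (rule tendsto_sandwich[OF _ _ tendsto_const lim])
      show "\<forall>\<^sub>F m in sequentially. p k (v m - 0) \<le> 1 / real (Suc m)"
        using eventually_ge_at_top[of k]
      proof eventually_elim
        case (elim m)
        have "p k (v m) \<le> (\<Sum>i\<le>m. p i (v m))" by (rule member_le_sum) (use elim V.p_nonneg in auto)
        then show ?case using vw(1)[of m] by simp
      qed
    qed (simp add: V.p_nonneg)
  qed
  moreover have "W.converges_to w 0"
    unfolding W.converges_to_def
  proof
    fix k
    show "(\<lambda>i. q k (w i - 0)) \<longlonglongrightarrow> 0"
    proof (rule tendsto_sandwich[OF _ _ tendsto_const lim])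
      show "\<forall>\<^sub>F m in sequentially. q k (w m - 0) \<le> 1 / real (Suc m)"
        using eventually_ge_at_top[of k]
      proof eventually_elim
        case (elim m)
        have "q k (w m) \<le> (\<Sum>i\<le>m. q i (w m))" by (rule member_le_sum) (use elim W.p_nonneg in auto)
        then show ?case using vw(2)[of m] by simp
      qed
    qed (simp add: W.p_nonneg)
  qed
  ultimately have "(\<lambda>i. B (v i) (w i)) \<longlonglongrightarrow> B 0 0" by (rule pairing_continuous)
  then have "(\<lambda>i. cmod (B (v i) (w i))) \<longlonglongrightarrow> 0" by (simp add: pairing_zero tendsto_norm_zero)
  then have "\<forall>\<^sub>F i in sequentially. cmod (B (v i) (w i)) < 1" by (rule order_tendstoD) simp
  then obtain i where "cmod (B (v i) (w i)) < 1" by (auto simp: eventually_sequentially)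
  then show False using vw(3)[of i] by simp
qed

text \<open>
  Scaling moves arbitrary vectors into the neighbourhood of \<open>pairing_small\<close>. As the sums of
  seminorms may vanish, they are first enlarged by \<open>e > 0\<close>, which then tends to 0.
\<close>

lemma pairing_bound:
  "\<exists>m C. \<forall>v w. cmod (B v w) \<le> C * (\<Sum>i\<le>m. p i v) * (\<Sum>i\<le>m. q i w)"
proof -
  obtain m where m: "\<And>v w. (\<Sum>i\<le>m. p i v) \<le> 1 / Suc m \<Longrightarrow> (\<Sum>i\<le>m. q i w) \<le> 1 / Suc m \<Longrightarrow> cmod (B v w) \<le> 1"
    using pairing_small by blast
  let ?M = "real (Suc m)"
  have "cmod (B v w) \<le> ?M\<^sup>2 * (\<Sum>i\<le>m. p i v) * (\<Sum>i\<le>m. q i w)" for v w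
  proof -
    define a where "a = (\<Sum>i\<le>m. p i v)"
    define b where "b = (\<Sum>i\<le>m. q i w)"
    have ab: "a \<ge> 0" "b \<ge> 0" by (simp_all add: a_def b_def V.p_sum_nonneg W.p_sum_nonneg)
    have le: "cmod (B v w) \<le> ?M\<^sup>2 * (a + e) * (b + e)" if e: "e > 0" for e
    proof -
      define s where "s = 1 / (?M * (a + e))"
      define t where "t = 1 / (?M * (b + e))"
      have st: "s > 0" "t > 0" using ab e by (simp_all add: s_def t_def add_nonneg_pos)
      have "s * a = 1 / ?M * (a / (a + e))" "t * b = 1 / ?M * (b / (b + e))"
        by (simp_all add: s_def t_def)
      moreover have "1 / ?M * (a / (a + e)) \<le> 1 / ?M * 1" "1 / ?M * (b / (b + e)) \<le> 1 / ?M * 1"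
        using ab e by (intro mult_left_mono; simp)+
      ultimately have "s * a \<le> 1 / ?M" "t * b \<le> 1 / ?M" by simp_all
      then have "cmod (B (scaleV (of_real s) v) (scaleW (of_real t) w)) \<le> 1"
        using st by (intro m) (simp_all add: V.p_sum_scale W.p_sum_scale a_def b_def)
      then have "s * t * cmod (B v w) \<le> 1"
        using st by (simp add: pairing_scale_left pairing_scale_right norm_mult mult_ac)
      then have "cmod (B v w) \<le> 1 / (s * t)" using st by (simp add: pos_le_divide_eq mult.commute)
      also have "1 / (s * t) = ?M\<^sup>2 * (a + e) * (b + e)" by (simp add: s_def t_def power2_eq_square)
      finally show ?thesis .
    qed
    have "((\<lambda>e. ?M\<^sup>2 * (a + e) * (b + e)) \<longlongrightarrow> ?M\<^sup>2 * (a + 0) * (b + 0)) (at_right 0)"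
      by (intro tendsto_intros)
    then have "cmod (B v w) \<le> ?M\<^sup>2 * (a + 0) * (b + 0)"
    proof (rule tendsto_lowerbound)
      show "\<forall>\<^sub>F e in at_right 0. cmod (B v w) \<le> ?M\<^sup>2 * (a + e) * (b + e)"
        using eventually_at_right_less[of "0::real"] by eventually_elim (rule le)
    qed simp
    then show ?thesis by (simp add: a_def b_def)
  qed
  then show ?thesis by blast
qed

text \<open>
  Uniformity of the exponent in \<open>v\<close> matters, because differentiating a matrix coefficient
  changes \<open>v\<close>.
\<close>

lemma coefficient_growth:
  "\<exists>N::nat. \<forall>v. \<exists>C\<ge>0. \<forall>g\<in>GL. cmod (B v (\<pi>' g w)) \<le> C * (1 + group_height g) ^ N"
proof -
  obtain m C where C: "\<And>v w. cmod (B v w) \<le> C * (\<Sum>i\<le>m. p i v) * (\<Sum>i\<le>m. q i w)"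
    using pairing_bound by blast
  have "\<forall>k. \<exists>(N::nat) D. D \<ge> 0 \<and> (\<forall>g\<in>GL. q k (\<pi>' g w) \<le> D * (1 + group_height g) ^ N)"
  proof
    fix k
    obtain N m C where NC: "\<forall>g\<in>GL. \<forall>v. q k (\<pi>' g v) \<le> C * group_height g ^ N * (\<Sum>i\<le>m. q i v)"
      using W.moderate_growth unfolding W.moderate_growth_def by blast
    define D where "D = \<bar>C\<bar> * (\<Sum>i\<le>m. q i w)"
    have "q k (\<pi>' g w) \<le> D * (1 + group_height g) ^ N" if "g \<in> GL" for g
    proof -
      have h: "group_height g \<ge> 0" by (simp add: group_height_def)
      have "q k (\<pi>' g w) \<le> C * group_height g ^ N * (\<Sum>i\<le>m. q i w)" using NC that by blast
      also have "\<dots> \<le> \<bar>C\<bar> * (1 + group_height g) ^ N * (\<Sum>i\<le>m. q i w)"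
        using h by (intro mult_right_mono mult_mono power_mono W.p_sum_nonneg) auto
      finally show ?thesis by (simp add: D_def mult_ac)
    qed
    then show "\<exists>(N::nat) D. D \<ge> 0 \<and> (\<forall>g\<in>GL. q k (\<pi>' g w) \<le> D * (1 + group_height g) ^ N)"
      by (intro exI[of _ N] exI[of _ D]) (simp add: D_def W.p_sum_nonneg)
  qed
  then obtain N D where ND: "\<And>k. D k \<ge> 0" "\<And>k g. g \<in> GL \<Longrightarrow> q k (\<pi>' g w) \<le> D k * (1 + group_height g) ^ (N k :: nat)"
    by metis
  define N0 where "N0 = Max (N ` {..m})"
  have "\<exists>C'\<ge>0. \<forall>g\<in>GL. cmod (B v (\<pi>' g w)) \<le> C' * (1 + group_height g) ^ N0" for v
  proof (intro exI conjI ballI)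
    let ?C' = "\<bar>C\<bar> * (\<Sum>i\<le>m. p i v) * (\<Sum>i\<le>m. D i)"
    show "0 \<le> ?C'" by (intro mult_nonneg_nonneg V.p_sum_nonneg sum_nonneg ND(1)) auto
    fix g :: "'f^'n^'n" assume g: "g \<in> GL"
    have h: "group_height g \<ge> 0" by (simp add: group_height_def)
    have "q i (\<pi>' g w) \<le> D i * (1 + group_height g) ^ N0" if "i \<le> m" for i
    proof -
      have "N i \<le> N0" using that by (simp add: N0_def)
      then have "D i * (1 + group_height g) ^ N i \<le> D i * (1 + group_height g) ^ N0"
        using h ND(1) by (intro mult_left_mono power_increasing) auto
      then show ?thesis using ND(2)[OF g, of i] by linarith
    qed
    then have "(\<Sum>i\<le>m. q i (\<pi>' g w)) \<le> (\<Sum>i\<le>m. D i * (1 + group_height g) ^ N0)" by (intro sum_mono) simp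
    also have "\<dots> = (\<Sum>i\<le>m. D i) * (1 + group_height g) ^ N0" by (simp add: sum_distrib_right)
    finally have s: "(\<Sum>i\<le>m. q i (\<pi>' g w)) \<le> (\<Sum>i\<le>m. D i) * (1 + group_height g) ^ N0" .
    have "cmod (B v (\<pi>' g w)) \<le> C * (\<Sum>i\<le>m. p i v) * (\<Sum>i\<le>m. q i (\<pi>' g w))" by (rule C)
    also have "\<dots> \<le> \<bar>C\<bar> * (\<Sum>i\<le>m. p i v) * ((\<Sum>i\<le>m. D i) * (1 + group_height g) ^ N0)"
      by (intro mult_mono s mult_right_mono V.p_sum_nonneg W.p_sum_nonneg mult_nonneg_nonneg) auto
    finally show "cmod (B v (\<pi>' g w)) \<le> ?C' * (1 + group_height g) ^ N0" by (simp add: mult_ac)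
  qed
  then show ?thesis by blast
qed

lemma coefficient_continuous: "continuous_on GL (\<lambda>g. B v (\<pi>' g w))"
  unfolding continuous_on_sequentially comp_def
proof (intro allI ballI impI, elim conjE)
  fix X :: "nat \<Rightarrow> 'f^'n^'n" and g assume "g \<in> GL" "\<forall>n. X n \<in> GL" "X \<longlonglongrightarrow> g"
  then have "W.converges_to (\<lambda>i. \<pi>' (X i) w) (\<pi>' g w)"
    by (intro W.rep_continuous W.converges_to_const) auto
  then show "(\<lambda>n. B v (\<pi>' (X n) w)) \<longlonglongrightarrow> B v (\<pi>' g w)"
    by (rule pairing_continuous[OF V.converges_to_const])
qed

text \<open>
  The directional derivatives of the orbit map are continuous in the base point. Paired with
  \<open>w\<close> they become continuous partial derivatives of a scalar function, which is therefore
  differentiable; this also makes \<open>B (d e) w\<close> linear in \<open>e\<close>.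
\<close>

lemma orbit_map_derivative:
  "\<exists>d. \<forall>w. ((\<lambda>a. B (\<pi> a v) w) has_derivative (\<lambda>e. B (d e) w)) (at (mat 1))"
proof -
  have "V.map_Ck_on (Suc 0) GL (\<lambda>g. \<pi> g v)"
    using V.smooth unfolding V.map_smooth_on_def by blast
  then have "\<forall>e. \<exists>f'. (\<forall>a\<in>GL. V.has_directional_derivative (\<lambda>g. \<pi> g v) (f' a) a e) \<and> V.map_continuous_on GL f'"
    by simp
  then obtain f where f: "\<And>e a. a \<in> GL \<Longrightarrow> V.has_directional_derivative (\<lambda>g. \<pi> g v) (f e a) a e"
    "\<And>e. V.map_continuous_on GL (f e)" by metis
  have "((\<lambda>a. B (\<pi> a v) w) has_derivative (\<lambda>e. B (f e (mat 1)) w)) (at (mat 1))" for w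
  proof (rule partials_imp_has_derivative[OF open_GL one_GL])
    fix a e :: "'f^'n^'n" assume a: "a \<in> GL"
    show "((\<lambda>t. B (\<pi> (a + t *\<^sub>R e) v) w) has_vector_derivative B (f e a) w) (at 0)"
      unfolding has_vector_derivative_at_0_iff tendsto_at_iff_sequentially comp_def
    proof (intro allI impI)
      fix X :: "nat \<Rightarrow> real" assume X: "\<forall>i. X i \<in> UNIV - {0}" "X \<longlonglongrightarrow> 0"
      have "V.converges_to (\<lambda>i. scaleV (of_real (inverse (X i))) (\<pi> (a + X i *\<^sub>R e) v - \<pi> a v)) (f e a)"
        using f(1)[OF a, of e] X
        unfolding V.has_directional_derivative_def V.converges_to_def tendsto_at_iff_sequentially comp_def by blast
      then have "(\<lambda>i. B (scaleV (of_real (inverse (X i))) (\<pi> (a + X i *\<^sub>R e) v - \<pi> a v)) w) \<longlonglongrightarrow> B (f e a) w"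
        by (rule pairing_continuous[OF _ W.converges_to_const])
      then show "(\<lambda>i. (B (\<pi> (a + X i *\<^sub>R e) v) w - B (\<pi> (a + 0 *\<^sub>R e) v) w) /\<^sub>R X i) \<longlonglongrightarrow> B (f e a) w"
        by (simp add: pairing_scale_left pairing_diff_left scaleR_conv_of_real)
    qed
  next
    fix e :: "'f^'n^'n"
    show "continuous_on GL (\<lambda>a. B (f e a) w)"
      unfolding continuous_on_sequentially comp_def
    proof (intro allI ballI impI, elim conjE)
      fix X :: "nat \<Rightarrow> 'f^'n^'n" and a assume a: "a \<in> GL" "\<forall>n. X n \<in> GL" "X \<longlonglongrightarrow> a"
      have "V.converges_to (\<lambda>i. f e (X i)) (f e a)"
        unfolding V.converges_to_def
      proof
        fix k
        have "((\<lambda>y. p k (f e y - f e a)) \<longlongrightarrow> 0) (at a within GL)"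
          using f(2)[of e] a(1) unfolding V.map_continuous_on_def by blast
        then have "continuous (at a within GL) (\<lambda>y. p k (f e y - f e a))"
          by (simp add: continuous_within V.p_zero)
        then show "(\<lambda>i. p k (f e (X i) - f e a)) \<longlonglongrightarrow> 0"
          using a unfolding continuous_within_sequentially comp_def by (auto simp: V.p_zero)
      qed
      then show "(\<lambda>n. B (f e (X n)) w) \<longlonglongrightarrow> B (f e a) w"
        by (rule pairing_continuous[OF _ W.converges_to_const])
    qed
  qed
  then show ?thesis by (intro exI[of _ "\<lambda>e. f e (mat 1)"]) blast
qed

lemma coefficient_move:
  assumes "a ** b = mat 1" "g \<in> GL"
  shows "B v (\<pi>' (a ** g) w) = B (\<pi> b v) (\<pi>' g w)"
proof -
  have ab: "a \<in> GL" "b \<in> GL" "b ** a = mat 1"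
    using assms(1) matrix_left_right_inverse[of a b] unfolding GL_def invertible_def by blast+
  have "B v (\<pi>' (a ** g) w) = B (\<pi> b v) (\<pi>' b (\<pi>' (a ** g) w))"
    by (rule pairing_invariant[OF ab(2), symmetric])
  also have "\<pi>' b (\<pi>' (a ** g) w) = \<pi>' (b ** (a ** g)) w"
    using ab assms(2) by (intro W.rep_mult[symmetric]) auto
  also have "b ** (a ** g) = g" by (simp add: matrix_mul_assoc ab(3))
  finally show ?thesis .
qed

text \<open>
  Invariance of the pairing turns a motion of \<open>g\<close> by left multiplication into the inverse
  motion of \<open>v\<close>, along which the orbit map is differentiable.
\<close>

lemma coefficient_curve_derivative:
  assumes d: "\<And>w. ((\<lambda>a. B (\<pi> a v) w) has_derivative (\<lambda>e. B (d e) w)) (at (mat 1))"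
    and inv: "\<forall>\<^sub>F s in nhds (0::real). A s ** Ai s = mat 1" and A0: "Ai 0 = mat 1"
    and D: "(Ai has_vector_derivative D) (at 0)" and g: "g \<in> GL"
  shows "((\<lambda>s. B v (\<pi>' (A s ** g) w)) has_vector_derivative B (d D) (\<pi>' g w)) (at 0)"
proof -
  have l: "linear (\<lambda>e. B (d e) (\<pi>' g w))" using has_derivative_linear[OF d] .
  have "(Ai has_derivative (\<lambda>h. h *\<^sub>R D)) (at 0)" using D by (simp add: has_vector_derivative_def)
  moreover have "((\<lambda>a. B (\<pi> a v) (\<pi>' g w)) has_derivative (\<lambda>e. B (d e) (\<pi>' g w))) (at (Ai 0))"
    unfolding A0 by (rule d)
  ultimately have "((\<lambda>s. B (\<pi> (Ai s) v) (\<pi>' g w)) has_derivative (\<lambda>h. B (d (h *\<^sub>R D)) (\<pi>' g w))) (at 0)"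
    by (rule has_derivative_compose)
  then have *: "((\<lambda>s. B (\<pi> (Ai s) v) (\<pi>' g w)) has_vector_derivative B (d D) (\<pi>' g w)) (at 0)"
    by (simp add: has_vector_derivative_def linear_cmul[OF l])
  have ev: "\<forall>\<^sub>F s in nhds 0. s \<in> UNIV \<longrightarrow> B v (\<pi>' (A s ** g) w) = B (\<pi> (Ai s) v) (\<pi>' g w)"
    using inv by eventually_elim (simp add: coefficient_move[OF _ g])
  show ?thesis
    using * by (subst has_vector_derivative_cong_ev[OF ev]) (use eventually_nhds_x_imp_x[OF ev] in auto)
qed

definition coefficient :: "'w \<Rightarrow> 'v \<Rightarrow> ('f, 'n) mpair \<Rightarrow> complex" where
  "coefficient w v z = B v (\<pi>' (snd z) w)"

lemma torsor_point_eq_elem: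
  "torsor_point y = (mat 1 + elem (SOME k. True) (SOME k. True) (y - 1) :: 'f^'n^'n)"
  by (auto simp: vec_eq_iff torsor_point_def mat_def elem_def)

text \<open>
  Both kinds of fields move \<open>g\<close> by left multiplication, \<open>nil_field\<close> by \<open>1 + s X\<close> and
  \<open>param_field\<close> by \<open>torsor_point (1 + s c / det g)\<close>. The latter motion depends on \<open>g\<close> through
  \<open>c / det g\<close>; expanding this number in a real basis separates symbols of order 0 from
  coefficients of fixed vectors.
\<close>

lemma coefficient_derives:
  "\<exists>d. (\<forall>t\<in>nilp_index. derives (coefficient w v) (nil_field t) (coefficient w (d (- nilX t)))) \<and>
     (\<forall>e c. derives (coefficient w v) (param_field e c)
        (\<lambda>z. \<Sum>b\<in>Basis. of_real ((c * inverse (det (snd z))) \<bullet> b) * coefficient w (d (- elem (SOME k. True) (SOME k. True) b)) z))"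
proof -
  obtain d where d: "\<And>w. ((\<lambda>a. B (\<pi> a v) w) has_derivative (\<lambda>e. B (d e) w)) (at (mat 1))"
    using orbit_map_derivative by blast
  let ?k = "SOME k :: 'n. True"
  have nil: "derives (coefficient w v) (nil_field t) (coefficient w (d (- nilX t)))" if t: "t \<in> nilp_index" for t
    unfolding derives_def
  proof
    fix z :: "('f, 'n) mpair" assume z: "z \<in> GL2"
    then have g: "snd z \<in> GL" by (auto simp: GL2_def)
    have "((\<lambda>s. B v (\<pi>' ((mat 1 + s *\<^sub>R nilX t) ** snd z) w)) has_vector_derivative B (d (- nilX t)) (\<pi>' (snd z) w)) (at 0)"
    proof (rule coefficient_curve_derivative[OF d _ _ _ g, where Ai = "\<lambda>s. mat 1 + s *\<^sub>R (- nilX t)"])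
      show "\<forall>\<^sub>F s in nhds 0. (mat 1 + s *\<^sub>R nilX t) ** (mat 1 + s *\<^sub>R - nilX t) = mat 1"
        by (intro always_eventually allI)
           (simp add: matrix_add_ldistrib matrix_add_rdistrib matrix_sub_ldistrib matrix_sub_rdistrib
              scaleR_matrix_mult_left scaleR_matrix_mult_right nilX_sq[OF t])
      show "((\<lambda>s. mat 1 + s *\<^sub>R - nilX t) has_vector_derivative - nilX t) (at 0)"
        by (rule has_vector_derivative_affine)
    qed simp
    then show "((\<lambda>s. coefficient w v (z + s *\<^sub>R nil_field t z)) has_vector_derivative coefficient w (d (- nilX t)) z) (at 0)"
      by (simp add: coefficient_def nil_field_def add_nil_motion)
  qed
  have par: "derives (coefficient w v) (param_field e c)
     (\<lambda>z. \<Sum>b\<in>Basis. of_real ((c * inverse (det (snd z))) \<bullet> b) * coefficient w (d (- elem ?k ?k b)) z)" for e c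
    unfolding derives_def
  proof
    fix z :: "('f, 'n) mpair" assume z: "z \<in> GL2"
    then have g: "snd z \<in> GL" "det (snd z) \<noteq> 0" by (auto simp: GL2_def GL_iff_det)
    define b where "b = c * inverse (det (snd z))"
    have lin_elem: "bounded_linear (elem ?k ?k :: 'f \<Rightarrow> 'f^'n^'n)"
      unfolding linear_conv_bounded_linear[symmetric]
      by (rule linearI) (auto simp: elem_def vec_eq_iff)
    have inv': "((\<lambda>s. inverse (1 + s *\<^sub>R b)) has_vector_derivative - b) (at 0)"
    proof -
      have "((\<lambda>s. 1 + s *\<^sub>R b) has_derivative (\<lambda>h. h *\<^sub>R b)) (at 0)"
        by (auto intro!: derivative_eq_intros)
      then have "((\<lambda>s. inverse (1 + s *\<^sub>R b)) has_derivative
         (\<lambda>h. - (inverse (1 + 0 *\<^sub>R b) * (h *\<^sub>R b) * inverse (1 + 0 *\<^sub>R b)))) (at 0)"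
        by (intro Deriv.has_derivative_inverse) auto
      then show ?thesis by (simp add: has_vector_derivative_def)
    qed
    have "((\<lambda>s. B v (\<pi>' (torsor_point (1 + s *\<^sub>R b) ** snd z) w)) has_vector_derivative B (d (elem ?k ?k (- b))) (\<pi>' (snd z) w)) (at 0)"
    proof (rule coefficient_curve_derivative[OF d _ _ _ g(1), where Ai = "\<lambda>s. torsor_point (inverse (1 + s *\<^sub>R b))"])
      have "\<forall>\<^sub>F s in nhds 0. (1::'f) + s *\<^sub>R b \<in> - {0}"
        by (rule eventually_line_in_open) auto
      then show "\<forall>\<^sub>F s in nhds 0. torsor_point (1 + s *\<^sub>R b) ** torsor_point (inverse (1 + s *\<^sub>R b)) = (mat 1 :: 'f^'n^'n)"
        by eventually_elim (auto simp: vec_eq_iff torsor_point_mult_index, auto simp: torsor_point_def mat_def)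
      show "torsor_point (inverse (1 + 0 *\<^sub>R b)) = (mat 1 :: 'f^'n^'n)"
        by (auto simp: vec_eq_iff torsor_point_def mat_def)
      have "((\<lambda>s. inverse (1 + s *\<^sub>R b) - 1) has_vector_derivative - b) (at 0)"
        using has_vector_derivative_diff[OF inv' has_vector_derivative_const[of 1]] by simp
      then have "((\<lambda>s. elem ?k ?k (inverse (1 + s *\<^sub>R b) - 1) :: 'f^'n^'n) has_vector_derivative elem ?k ?k (- b)) (at 0)"
        by (rule bounded_linear.has_vector_derivative[OF lin_elem])
      from has_vector_derivative_add[OF has_vector_derivative_const[of "mat 1"] this]
      show "((\<lambda>s. torsor_point (inverse (1 + s *\<^sub>R b)) :: 'f^'n^'n) has_vector_derivative elem ?k ?k (- b)) (at 0)"
        unfolding torsor_point_eq_elem by simp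
    qed
    moreover have "snd (z + s *\<^sub>R param_field e c z) = torsor_point (1 + s *\<^sub>R b) ** snd z" for s
      using add_row_motion[OF g(2), of s c] by (simp add: param_field_def b_def divide_inverse)
    moreover have "B (d (elem ?k ?k (- b))) (\<pi>' (snd z) w)
       = (\<Sum>\<beta>\<in>Basis. of_real (b \<bullet> \<beta>) * B (d (- elem ?k ?k \<beta>)) (\<pi>' (snd z) w))"
    proof -
      have l: "linear (\<lambda>e. B (d e) (\<pi>' (snd z) w))" using has_derivative_linear[OF d] .
      have "elem ?k ?k (- b) = (\<Sum>\<beta>\<in>Basis. (b \<bullet> \<beta>) *\<^sub>R (- elem ?k ?k \<beta> :: 'f^'n^'n))"
      proof -
        have "elem ?k ?k (- b) = - (elem ?k ?k (\<Sum>\<beta>\<in>Basis. (b \<bullet> \<beta>) *\<^sub>R \<beta>) :: 'f^'n^'n)"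
          by (simp add: euclidean_representation linear_neg[OF bounded_linear.linear[OF lin_elem]])
        also have "\<dots> = - (\<Sum>\<beta>\<in>Basis. (b \<bullet> \<beta>) *\<^sub>R elem ?k ?k \<beta>)"
          by (simp only: linear_sum[OF bounded_linear.linear[OF lin_elem]] scaleR_elem)
        finally show ?thesis by (simp add: sum_negf)
      qed
      then have "B (d (elem ?k ?k (- b))) (\<pi>' (snd z) w) = (\<Sum>\<beta>\<in>Basis. (b \<bullet> \<beta>) *\<^sub>R B (d (- elem ?k ?k \<beta>)) (\<pi>' (snd z) w))"
        by (simp only: linear_sum[OF l] linear_cmul[OF l])
      then show ?thesis by (simp add: scaleR_conv_of_real)
    qed
    ultimately show "((\<lambda>s. coefficient w v (z + s *\<^sub>R param_field e c z)) has_vector_derivative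
       (\<Sum>b\<in>Basis. of_real ((c * inverse (det (snd z))) \<bullet> b) * coefficient w (d (- elem ?k ?k b)) z)) (at 0)"
      by (simp add: coefficient_def b_def)
  qed
  show ?thesis using nil par by blast
qed

lemma coefficient_of_order:
  "\<exists>m. \<forall>v. of_order m (coefficient w v)"
proof -
  obtain N :: nat where N: "\<And>v. \<exists>C\<ge>0. \<forall>g\<in>GL. cmod (B v (\<pi>' g w)) \<le> C * (1 + group_height g) ^ N"
    using coefficient_growth by blast
  let ?n = "CARD('n)"
  obtain CI where CI: "CI \<ge> 1" "\<And>g :: 'f^'n^'n. det g \<noteq> 0 \<Longrightarrow> norm (matrix_inv g) \<le> CI * (1 + norm g) ^ ?n / norm (det g)"
    using norm_matrix_inv_le by metis
  have "of_order (real (?n * N)) (coefficient w v)" for v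
  proof (rule of_orderI)
    show "continuous_on GL2 (coefficient w v)"
      unfolding coefficient_def[abs_def]
      by (rule continuous_on_compose2[OF coefficient_continuous]) (auto simp: GL2_def intro: continuous_intros)
    fix R :: real assume R: "R > 0"
    obtain C where C: "C \<ge> 0" "\<And>g. g \<in> GL \<Longrightarrow> cmod (B v (\<pi>' g w)) \<le> C * (1 + group_height g) ^ N"
      using N[of v] by blast
    have "norm (coefficient w v z) \<le> (C * (1 + CI * R) ^ N) * (1 + norm (snd z)) powr (real (?n * N))"
      if z: "z \<in> bdd_region R" for z
    proof -
      define g where "g = snd z"
      have gG: "g \<in> GL" using bdd_region_GL2[OF R] z by (auto simp: g_def GL2_def)
      have dg: "1 / R \<le> norm (det g)" using z by (simp add: bdd_region_def g_def)
      have "norm (matrix_inv g) \<le> CI * (1 + norm g) ^ ?n / norm (det g)" using CI(2)[of g] gG by (simp add: GL_iff_det)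
      also have "\<dots> \<le> CI * (1 + norm g) ^ ?n / (1 / R)"
        using dg R CI(1) by (intro divide_left_mono mult_pos_pos) (auto intro: less_le_trans[of 0 "1 / R"])
      also have "\<dots> = CI * R * (1 + norm g) ^ ?n" by simp
      finally have 1: "norm (matrix_inv g) \<le> CI * R * (1 + norm g) ^ ?n" .
      have 2: "1 + norm g \<le> (1 + norm g) ^ ?n" by (rule self_le_power) auto
      have "1 + group_height g \<le> (1 + CI * R) * (1 + norm g) ^ ?n"
        using 1 2 by (simp add: group_height_def distrib_right)
      then have "(1 + group_height g) ^ N \<le> ((1 + CI * R) * (1 + norm g) ^ ?n) ^ N"
        by (intro power_mono) (simp_all add: group_height_def)
      also have "\<dots> = (1 + CI * R) ^ N * (1 + norm g) ^ (?n * N)"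
        by (simp only: power_mult_distrib power_mult)
      finally have "C * (1 + group_height g) ^ N \<le> C * ((1 + CI * R) ^ N * (1 + norm g) ^ (?n * N))"
        using C(1) by (rule mult_left_mono)
      moreover have "(1 + norm g) ^ (?n * N) = (1 + norm g) powr (real (?n * N))"
        by (rule powr_realpow[symmetric]) (simp add: add_pos_nonneg)
      ultimately show ?thesis using C(2)[OF gG] by (simp add: coefficient_def g_def mult.assoc)
    qed
    then show "\<exists>C. \<forall>z\<in>bdd_region R. norm (coefficient w v z) \<le> C * (1 + norm (snd z)) powr (real (?n * N))" by blast
  qed
  then show ?thesis by blast
qed

text \<open>
  The derivatives of a coefficient are combinations of coefficients with the same \<open>w\<close>, all of
  which have the same order.
\<close>

lemma coefficient_symbol: "\<exists>m. \<forall>v. symbol m (coefficient w v)"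
proof -
  obtain m where m: "\<And>v. of_order m (coefficient w v)" using coefficient_of_order by blast
  have "symb k m (coefficient w v)" for k v
  proof (induction k arbitrary: v)
    case 0 then show ?case by (simp add: m)
  next
    case (Suc k)
    obtain d where d: "\<And>t. t \<in> nilp_index \<Longrightarrow> derives (coefficient w v) (nil_field t) (coefficient w (d (- nilX t)))"
      "\<And>e c. derives (coefficient w v) (param_field e c)
        (\<lambda>z. \<Sum>b\<in>Basis. of_real ((c * inverse (det (snd z))) \<bullet> b) * coefficient w (d (- elem (SOME k. True) (SOME k. True) b)) z)"
      using coefficient_derives by blast
    show ?case
    proof (rule symb_SucI[OF m])
      fix \<xi> :: "('f, 'n) mpair \<Rightarrow> ('f, 'n) mpair" assume "\<xi> \<in> fields"
      then show "\<exists>F'. derives (coefficient w v) \<xi> F' \<and> symb k m F'"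
      proof (cases rule: fields_cases)
        case (1 e c)
        have "symb k m (\<lambda>z. \<Sum>b\<in>Basis. complex_of_real ((c * inverse (det (snd z))) \<bullet> b) * coefficient w (d (- elem (SOME k. True) (SOME k. True) b)) z)"
        proof (intro symb_sum symb_mult0 Suc)
          fix b :: 'f
          have "symb k 0 (\<lambda>z :: ('f, 'n) mpair. c * inverse (det (snd z)))"
            by (rule symb_mult0[OF symb_const symb_det_snd(2)])
          then have "symb k 0 (\<lambda>z :: ('f, 'n) mpair. (c * inverse (det (snd z))) \<bullet> b)"
            by (rule symb_bounded_linear[OF bounded_linear_inner_left])
          then show "symb k 0 (\<lambda>z :: ('f, 'n) mpair. complex_of_real ((c * inverse (det (snd z))) \<bullet> b))"
            by (rule symb_bounded_linear[OF bounded_linear_of_real])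
        qed
        then show ?thesis using d(2)[of e c] 1 by blast
      next
        case (2 t)
        then show ?thesis using d(1)[of t] Suc by blast
      qed
    qed
  qed
  then show ?thesis by (auto simp: symbol_def)
qed

end


section \<open>The kernel function\<close>

text \<open>
  The square of the norm is a polynomial in the real coordinates, so that \<open>symb_powr\<close> applies
  to it.
\<close>

lemma symbol_norm_square_powr:
  fixes D :: "('f::arch_local_field, 'n::finite) mpair \<Rightarrow> 'f"
  assumes D: "symbol 0 D" "\<And>z. z \<in> GL2 \<Longrightarrow> D z \<noteq> 0"
    and low: "\<And>R. R > 0 \<Longrightarrow> \<exists>c>0. \<forall>z\<in>bdd_region R. c \<le> norm (D z)"
  shows "symbol 0 (\<lambda>z. complex_of_real ((norm (D z))\<^sup>2 powr s))"
proof -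
  have eq: "(norm (D z))\<^sup>2 = (\<Sum>b\<in>Basis. (D z \<bullet> b) * (D z \<bullet> b))" for z
    unfolding power2_norm_eq_inner by (rule euclidean_inner)
  have "symb k (0 * s) (\<lambda>z. (norm (D z))\<^sup>2 powr s)" for k
  proof (rule symb_powr)
    show "symb k 0 (\<lambda>z. (norm (D z))\<^sup>2)" for k
      unfolding eq using D(1)
      by (intro symb_sum symb_mult0 symb_bounded_linear[OF bounded_linear_inner_left]) (simp_all add: symbol_def)
    show "(norm (D z))\<^sup>2 > 0" if "z \<in> GL2" for z using D(2)[OF that] by simp
    fix R :: real assume "R > 0"
    then obtain c where c: "c > 0" "\<And>z. z \<in> bdd_region R \<Longrightarrow> c \<le> norm (D z)" using low by blast
    have "c\<^sup>2 * (1 + norm (snd z)) powr 0 \<le> (norm (D z))\<^sup>2" if "z \<in> bdd_region R" for z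
    proof -
      have "c\<^sup>2 \<le> (norm (D z))\<^sup>2" using c(1) c(2)[OF that] by (intro power_mono) auto
      moreover have "c\<^sup>2 * (1 + norm (snd z)) powr 0 \<le> c\<^sup>2" by simp
      ultimately show ?thesis by linarith
    qed
    then show "\<exists>c>0. \<forall>z\<in>bdd_region R. c * (1 + norm (snd z)) powr 0 \<le> (norm (D z))\<^sup>2"
      using c(1) by (intro exI[of _ "c\<^sup>2"]) auto
  qed
  then have "symbol 0 (\<lambda>z. (norm (D z))\<^sup>2 powr s)" by (simp add: symbol_def)
  then show ?thesis by (rule symbol_bounded_linear[OF bounded_linear_of_real])
qed

lemma symbol_det_powr:
  "symbol 0 (\<lambda>z :: ('f::arch_local_field, 'n::finite) mpair. complex_of_real ((norm (det (fst z)))\<^sup>2 powr s))"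
  "symbol 0 (\<lambda>z :: ('f::arch_local_field, 'n::finite) mpair. complex_of_real ((norm (det (snd z) * det (fst z)))\<^sup>2 powr s))"
proof -
  have s1: "symbol 0 (\<lambda>z :: ('f, 'n) mpair. det (fst z))"
    unfolding symbol_def by (intro allI symb_det msymb_fst)
  have s2: "symbol 0 (\<lambda>z :: ('f, 'n) mpair. det (snd z) * det (fst z))"
    unfolding symbol_def by (intro allI symb_mult0 symb_det_snd(1) symb_det msymb_fst)
  show "symbol 0 (\<lambda>z :: ('f, 'n) mpair. complex_of_real ((norm (det (fst z)))\<^sup>2 powr s))"
  proof (rule symbol_norm_square_powr[OF s1])
    show "\<exists>c>0. \<forall>z\<in>bdd_region R. c \<le> norm (det (fst (z :: ('f, 'n) mpair)))" if "R > 0" for R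
      using that by (intro exI[of _ "1 / R"]) (auto simp: bdd_region_def)
  qed (simp add: GL2_det)
  show "symbol 0 (\<lambda>z :: ('f, 'n) mpair. complex_of_real ((norm (det (snd z) * det (fst z)))\<^sup>2 powr s))"
  proof (rule symbol_norm_square_powr[OF s2])
    show "\<exists>c>0. \<forall>z\<in>bdd_region R. c \<le> norm (det (snd z) * det (fst (z :: ('f, 'n) mpair)))" if R: "R > 0" for R
    proof (intro exI[of _ "1 / R * (1 / R)"] conjI ballI)
      show "0 < 1 / R * (1 / R)" using R by simp
      fix z :: "('f, 'n) mpair" assume "z \<in> bdd_region R"
      then show "1 / R * (1 / R) \<le> norm (det (snd z) * det (fst z))"
        unfolding norm_mult using R by (intro mult_mono) (auto simp: bdd_region_def)
    qed
  qed (simp add: GL2_det)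
qed

lemma absF_powr: "absF z powr r = (norm z)\<^sup>2 powr (real DIM('f) * r / 2)"
  for z :: "'f::arch_local_field"
proof (cases "z = 0")
  case True then show ?thesis by (simp add: absF_def)
next
  case False
  then have "absF z = norm z powr real DIM('f)" and "(norm z)\<^sup>2 = norm z powr 2"
    by (simp_all add: absF_def powr_realpow)
  then have "(norm z)\<^sup>2 powr (real DIM('f) * r / 2) = norm z powr (2 * (real DIM('f) * r / 2))"
    by (simp only: powr_powr)
  then show ?thesis using \<open>absF z = norm z powr real DIM('f)\<close> by (simp add: powr_powr)
qed

lemma torsor_set_integral_GL:
  fixes \<nu> :: "('f::arch_local_field^'n^'n) measure" and f :: "'f^'n^'n \<Rightarrow> complex"
  assumes \<nu>: "SL_haar \<nu>" "x \<noteq> 0" and m: "(\<lambda>g. indicator GL g *\<^sub>R f g) \<in> borel_measurable borel"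
  shows "(LINT g:{g. det g = x}|torsor_measure \<nu> x. f g) = (LINT g:GL|torsor_measure \<nu> x. f g)"
proof -
  have [measurable_cong]: "sets (torsor_measure \<nu> x) = sets borel" by (rule torsor_measureD[OF \<nu>])
  have S: "{g :: 'f^'n^'n. det g = x} \<in> sets borel"
    by (intro borel_closed closed_Collect_eq continuous_intros)
  have eq: "indicator {g. det g = x} g *\<^sub>R f g = indicator {g. det g = x} g *\<^sub>R (indicator GL g *\<^sub>R f g)" for g
    using \<nu>(2) by (auto simp: indicator_def GL_iff_det)
  show ?thesis
    unfolding set_lebesgue_integral_def
  proof (rule integral_cong_AE)
    show "(\<lambda>g. indicator {g. det g = x} g *\<^sub>R f g) \<in> borel_measurable (torsor_measure \<nu> x)"
      unfolding eq using borel_measurable_scaleR[OF borel_measurable_indicator[OF S] m] by measurable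
    show "(\<lambda>g. indicator GL g *\<^sub>R f g) \<in> borel_measurable (torsor_measure \<nu> x)" using m by measurable
    show "AE g in torsor_measure \<nu> x. indicator {g. det g = x} g *\<^sub>R f g = indicator GL g *\<^sub>R f g"
      using torsor_measureD(2)[OF \<nu>] by eventually_elim (use \<nu>(2) in \<open>auto simp: indicator_def GL_iff_det\<close>)
  qed
qed

context phase
begin

text \<open>
  The sequence of amplitudes does not depend on the measure, the cutoff or the parameters.
  Once the order is low enough for absolute convergence, the integrals without cutoff agree as
  well.
\<close>

lemma oscillatory_iteration:
  fixes F :: "('f, 'n::finite) mpair \<Rightarrow> complex"
  assumes F: "symbol m F"
  shows "\<exists>Fs. (\<forall>k. symbol (m - real k) (Fs k)) \<and>
    (\<forall>(\<nu> :: ('f^'n^'n) measure) x c K k. SL_haar \<nu> \<longrightarrow> x \<noteq> 0 \<longrightarrow> cutoff K c \<longrightarrow>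
       tested_integral \<nu> x c F = tested_integral \<nu> x c (Fs k)) \<and>
    (\<forall>(\<nu> :: ('f^'n^'n) measure) z k j. SL_haar \<nu> \<longrightarrow> z \<in> param_domain \<longrightarrow> m - real k \<le> - growth_exponent \<nu> \<longrightarrow>
       osc_integral \<nu> (Fs (k + j)) z = osc_integral \<nu> (Fs k) z)"
proof -
  define P where "P m F F' \<longleftrightarrow> symbol (m - 1) F' \<and>
    (\<forall>(\<nu> :: ('f^'n^'n) measure) x c K. SL_haar \<nu> \<longrightarrow> x \<noteq> 0 \<longrightarrow> cutoff K c \<longrightarrow>
       tested_integral \<nu> x c F = tested_integral \<nu> x c F') \<and>
    (\<forall>(\<nu> :: ('f^'n^'n) measure) x u. SL_haar \<nu> \<longrightarrow> x \<noteq> 0 \<longrightarrow> u \<in> GL \<longrightarrow> m \<le> - growth_exponent \<nu> \<longrightarrow>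
       osc_integral \<nu> F (x, u) = osc_integral \<nu> F' (x, u))"
    for m and F F' :: "('f, 'n) mpair \<Rightarrow> complex"
  define Fs where "Fs = rec_nat F (\<lambda>k G. SOME G'. P (m - real k) G G')"
  have step: "P (m - real k) (Fs k) (Fs (Suc k))" if "symbol (m - real k) (Fs k)" for k
  proof -
    have "\<exists>G'. P (m - real k) (Fs k) G'" unfolding P_def by (rule oscillatory_reduction[OF that])
    then have "P (m - real k) (Fs k) (SOME G'. P (m - real k) (Fs k) G')" by (rule someI_ex)
    then show ?thesis by (simp add: Fs_def)
  qed
  have F0: "Fs 0 = F" by (simp add: Fs_def)
  have sy: "symbol (m - real k) (Fs k)" for k
  proof (induction k)
    case 0 then show ?case using F by (simp add: F0)
  next
    case (Suc k)
    have "symbol (m - real k - 1) (Fs (Suc k))" using step[OF Suc] by (simp add: P_def)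
    then show ?case by (simp add: algebra_simps)
  qed
  show ?thesis
  proof (intro exI[of _ Fs] conjI allI impI sy)
    fix \<nu> :: "('f^'n^'n) measure" and x :: 'f and c :: "'f^'n^'n \<Rightarrow> complex" and K :: "('f^'n^'n) set" and k :: nat
    assume a: "SL_haar \<nu>" "x \<noteq> 0" "cutoff K c"
    show "tested_integral \<nu> x c F = tested_integral \<nu> x c (Fs k)"
    proof (induction k)
      case 0 then show ?case by (simp add: F0)
    next
      case (Suc k)
      have "tested_integral \<nu> x c (Fs k) = tested_integral \<nu> x c (Fs (Suc k))"
        using step[OF sy[of k]] a unfolding P_def by blast
      then show ?case using Suc by simp
    qed
  next
    fix \<nu> :: "('f^'n^'n) measure" and z :: "'f \<times> ('f^'n^'n)" and k j :: nat
    assume a: "SL_haar \<nu>" "z \<in> param_domain" "m - real k \<le> - growth_exponent \<nu>"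
    obtain x u where z: "z = (x, u)" "x \<noteq> 0" "u \<in> GL" using a(2) by (auto simp: param_domain_def)
    show "osc_integral \<nu> (Fs (k + j)) z = osc_integral \<nu> (Fs k) z"
    proof (induction j)
      case (Suc j)
      have "m - real (k + j) \<le> - growth_exponent \<nu>" using a(3) by simp
      then have "osc_integral \<nu> (Fs (k + j)) (x, u) = osc_integral \<nu> (Fs (Suc (k + j))) (x, u)"
        using step[OF sy[of "k + j"]] a(1) z unfolding P_def by blast
      then show ?case using Suc z by simp
    qed simp
  qed
qed

lemma tested_integral_Fubini:
  fixes F :: "('f, 'n::finite) mpair \<Rightarrow> complex" and c :: "'f^'n^'n \<Rightarrow> complex"
  assumes \<nu>: "SL_haar \<nu>" "x \<noteq> 0" and F: "of_order r F" and r: "r \<le> - growth_exponent \<nu>"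
    and cut: "cutoff K c"
  shows "tested_integral \<nu> x c F = (LINT u:GL|lborel. c u * osc_integral \<nu> F (x, u))"
proof -
  let ?M = "torsor_measure \<nu> x"
  have c: "of_order 0 (\<lambda>p :: ('f, 'n) mpair. c (fst p))" and K: "compact K" "K \<subseteq> GL" "\<forall>u\<in>GL - K. c u = 0"
    using cut by (auto simp: cutoff_def intro: symbol_of_order)
  have sM [measurable_cong]: "sets ?M = sets borel" by (rule torsor_measureD[OF \<nu>])
  interpret pair_sigma_finite "lborel :: ('f^'n^'n) measure" ?M
    using sigma_finite_torsor_measure[OF \<nu>] sigma_finite_lborel by (simp add: pair_sigma_finite_def)
  have cF: "of_order r (\<lambda>p. c (fst p) * F p)" using of_order_mult[OF c F] by simp
  have sup: "supported K (\<lambda>p. c (fst p) * F p)" using K(3) by (auto simp: supported_def GL2_def)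
  define D where "D = {g :: 'f^'n^'n. det g = x}"
  have D: "D \<in> sets borel" unfolding D_def by (intro borel_closed closed_Collect_eq continuous_intros)
  define h where "h u g = indicator GL u *\<^sub>R (indicator D g *\<^sub>R (E (u, g) * (c u * F (u, g))))" for u g
  obtain R0 where R0: "R0 > 0" "\<And>u. u \<in> K \<Longrightarrow> norm u \<le> R0 \<and> 1 / R0 \<le> norm (det u)"
    using compact_GL_bounds[OF K(1,2)] by metis
  obtain Rx where Rx: "Rx > 0" "1 / Rx \<le> norm x" "norm x \<le> Rx" using torsor_region[OF \<nu>(2)] .
  define R where "R = max R0 Rx"
  have R: "R > 0" "1 / R \<le> 1 / R0" "1 / R \<le> 1 / Rx" "R0 \<le> R" "Rx \<le> R"
    using R0(1) Rx(1) by (auto simp: R_def intro!: divide_left_mono)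
  obtain C where C: "C \<ge> 0" "\<And>p. p \<in> bdd_region R \<Longrightarrow> norm (c (fst p) * F p) \<le> C * (1 + norm (snd p)) powr r"
    using of_orderD[OF cF R(1)] by (metis (no_types))
  have bd: "norm (h u g) \<le> (C * indicator K u) * (1 + norm g) powr r" for u g
  proof (cases "u \<in> K \<and> g \<in> D")
    case True
    then have "(u, g) \<in> bdd_region R" using R R0(2)[of u] Rx by (auto simp: bdd_region_def D_def)
    from C(2)[OF this] show ?thesis using True K(2) by (auto simp: h_def norm_mult)
  next
    case False
    have "0 \<le> (C * indicator K u) * (1 + norm g) powr r" using C(1) by simp
    moreover have "h u g = 0" using False K(3) by (auto simp: h_def indicator_def)
    ultimately show ?thesis by simp
  qed
  have hm: "case_prod h \<in> borel_measurable (lborel \<Otimes>\<^sub>M ?M)"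
  proof -
    have "continuous_on GL2 (\<lambda>p. E p * (c (fst p) * F p))"
      using cF by (intro continuous_on_mult[OF continuous_on_E]) (simp add: of_order_def)
    from measurable_GL2[OF this]
    have 1: "(\<lambda>p. indicator GL2 p *\<^sub>R (E p * (c (fst p) * F p))) \<in> borel_measurable (borel \<Otimes>\<^sub>M borel)"
      by (simp add: borel_prod)
    have "(\<lambda>p. indicator D (snd p) :: real) \<in> borel_measurable (borel \<Otimes>\<^sub>M borel)"
      using measurable_compose[OF measurable_snd borel_measurable_indicator[OF D]] .
    from this 1 have "(\<lambda>p. indicator D (snd p) *\<^sub>R (indicator GL2 p *\<^sub>R (E p * (c (fst p) * F p)))) \<in> borel_measurable (borel \<Otimes>\<^sub>M borel)"
      by (rule borel_measurable_scaleR)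
    moreover have "(\<lambda>p. indicator D (snd p) *\<^sub>R (indicator GL2 p *\<^sub>R (E p * (c (fst p) * F p)))) = case_prod h"
      using \<nu>(2) by (auto simp: fun_eq_iff h_def indicator_def GL2_def D_def GL_iff_det)
    moreover have "sets (lborel \<Otimes>\<^sub>M ?M) = sets (borel \<Otimes>\<^sub>M (borel :: ('f^'n^'n) measure))"
      by (rule sets_pair_measure_cong) (simp_all add: sM)
    ultimately show ?thesis by (simp cong: measurable_cong_sets)
  qed
  have int: "integrable (lborel \<Otimes>\<^sub>M ?M) (case_prod h)"
  proof (rule Bochner_Integration.integrable_bound[OF _ hm])
    show "AE p in lborel \<Otimes>\<^sub>M ?M. norm (case_prod h p) \<le> norm ((C * indicator K (fst p)) * (1 + norm (snd p)) powr r)"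
      using bd by (intro AE_I2) (auto simp: case_prod_beta intro: order_trans[OF bd abs_ge_self])
    have iK: "integrable lborel (\<lambda>u. C * indicator K u)"
      by (rule integrable_indicator_compact[OF K(1)])
    have iM: "integrable ?M (\<lambda>g. (1 + norm g) powr r)" by (rule torsor_integrable_powr[OF \<nu> r])
    have Kb: "K \<in> sets borel" using K(1) by (rule borel_compact)
    show "integrable (lborel \<Otimes>\<^sub>M ?M) (\<lambda>p. (C * indicator K (fst p)) * (1 + norm (snd p)) powr r)"
    proof (rule Fubini_integrable)
      show "(\<lambda>p. (C * indicator K (fst p)) * (1 + norm (snd p)) powr r) \<in> borel_measurable (lborel \<Otimes>\<^sub>M ?M)"
        using Kb by measurable
      have "(\<integral>g. norm ((C * indicator K u) * (1 + norm g) powr r) \<partial>?M) = (C * indicator K u) * (\<integral>g. (1 + norm g) powr r \<partial>?M)" for u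
        using C(1) by (simp add: abs_mult)
      then show "integrable lborel (\<lambda>u. \<integral>g. norm ((C * indicator K (fst (u, g))) * (1 + norm (snd (u, g))) powr r) \<partial>?M)"
        using iK by simp
      show "AE u in lborel. integrable ?M (\<lambda>g. (C * indicator K (fst (u, g))) * (1 + norm (snd (u, g))) powr r)"
        using iM by simp
    qed
  qed
  have mU: "(\<lambda>g. indicator GL g *\<^sub>R u_integral (\<lambda>p. c (fst p) * F p) g) \<in> borel_measurable borel"
    using cF by (intro measurable_u_integral) (simp add: of_order_def)
  have "tested_integral \<nu> x c F = (LINT g:D|?M. u_integral (\<lambda>p. c (fst p) * F p) g)"
    unfolding D_def tested_integral_def by (rule torsor_set_integral_GL[OF \<nu> mU, symmetric])
  also have "\<dots> = (\<integral>g. (\<integral>u. h u g \<partial>lborel) \<partial>?M)"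
    unfolding set_lebesgue_integral_def u_integral_def h_def
    by (intro Bochner_Integration.integral_cong refl) (auto simp: indicator_def)
  also have "\<dots> = (\<integral>u. (\<integral>g. h u g \<partial>?M) \<partial>lborel)"
    by (rule Fubini_integral[OF int])
  also have "\<dots> = (LINT u:GL|lborel. c u * osc_integral \<nu> F (x, u))"
    unfolding set_lebesgue_integral_def[where M = lborel]
  proof (intro Bochner_Integration.integral_cong refl)
    fix u :: "'f^'n^'n"
    show "(\<integral>g. h u g \<partial>?M) = indicator GL u *\<^sub>R (c u * osc_integral \<nu> F (x, u))"
    proof (cases "u \<in> GL")
      case True
      have "(LINT g:D|?M. E (u, g) * F (u, g)) = osc_integral \<nu> F (x, u)"
        unfolding D_def osc_integral_def fst_conv snd_conv using F True
        by (intro torsor_set_integral_GL[OF \<nu>] measurable_slice) (simp_all add: of_order_def)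
      moreover have "(\<integral>g. h u g \<partial>?M) = c u * (LINT g:D|?M. E (u, g) * F (u, g))"
      proof -
        have "(\<integral>g. h u g \<partial>?M) = (\<integral>g. c u * (indicator D g *\<^sub>R (E (u, g) * F (u, g))) \<partial>?M)"
          using True by (intro Bochner_Integration.integral_cong refl) (simp add: h_def mult_ac)
        then show ?thesis
          by (simp only: set_lebesgue_integral_def Bochner_Integration.integral_mult_right_zero)
      qed
      ultimately show ?thesis using True by simp
    qed (simp add: h_def)
  qed
  finally show ?thesis .
qed

text \<open>
  Take for \<open>H\<close> the integral of the first amplitude that is integrable. It does not change when
  the order of the amplitude is lowered by \<open>j\<close> more steps, and in that form it is seen to be
  \<open>j\<close> times differentiable.
\<close>

lemma osc_integral_smooth:
  fixes F :: "('f, 'n::finite) mpair \<Rightarrow> complex" and \<nu> :: "('f^'n^'n) measure"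
  assumes \<nu>: "SL_haar \<nu>" and F: "symbol m F"
  obtains H where "\<And>j. partially_Ck j param_domain H"
    "\<And>x c K. x \<noteq> 0 \<Longrightarrow> cutoff K c \<Longrightarrow> tested_integral \<nu> x c F = (LINT u:GL|lborel. c u * H (x, u))"
proof -
  obtain Fs where Fs: "\<forall>k. symbol (m - real k) (Fs k)"
    and A: "\<forall>(\<nu> :: ('f^'n^'n) measure) x c K k. SL_haar \<nu> \<longrightarrow> x \<noteq> 0 \<longrightarrow> cutoff K c \<longrightarrow>
       tested_integral \<nu> x c F = tested_integral \<nu> x c (Fs k)"
    and B: "\<forall>(\<nu> :: ('f^'n^'n) measure) z k j. SL_haar \<nu> \<longrightarrow> z \<in> param_domain \<longrightarrow> m - real k \<le> - growth_exponent \<nu> \<longrightarrow>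
       osc_integral \<nu> (Fs (k + j)) z = osc_integral \<nu> (Fs k) z"
    using oscillatory_iteration[OF F] by (elim exE conjE)
  obtain k0 :: nat where k0: "m + growth_exponent \<nu> \<le> real k0" using real_arch_simple by blast
  have k0': "m - real k0 \<le> - growth_exponent \<nu>" using k0 by simp
  show thesis
  proof (rule that[of "osc_integral \<nu> (Fs k0)"])
    fix j :: nat
    have "partially_Ck j param_domain (osc_integral \<nu> (Fs (k0 + j)))"
      by (rule partially_Ck_osc_integral[OF \<nu> Fs[rule_format]]) (use k0' in simp)
    then show "partially_Ck j param_domain (osc_integral \<nu> (Fs k0))"
      by (rule partially_Ck_cong[OF open_param_domain B[rule_format, OF \<nu> _ k0'], rotated])
  next
    fix x :: 'f and c :: "'f^'n^'n \<Rightarrow> complex" and K :: "('f^'n^'n) set"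
    assume a: "x \<noteq> 0" "cutoff K c"
    have "tested_integral \<nu> x c F = tested_integral \<nu> x c (Fs k0)" by (rule A[rule_format, OF \<nu> a])
    also have "\<dots> = (LINT u:GL|lborel. c u * osc_integral \<nu> (Fs k0) (x, u))"
      by (rule tested_integral_Fubini[OF \<nu> a(1) symbol_of_order[OF Fs[rule_format]] k0' a(2)])
    finally show "tested_integral \<nu> x c F = (LINT u:GL|lborel. c u * osc_integral \<nu> (Fs k0) (x, u))" .
  qed
qed

end

lemma partially_Ck_imp_smooth_on:
  fixes f :: "'a::euclidean_space \<Rightarrow> 'b::real_normed_vector"
  assumes "open S" "\<And>j. partially_Ck j S f"
  shows "smooth_on S f"
  using partially_Ck_imp_Ck_on[OF assms(1,2)] by (simp add: smooth_on_def)

lemma smooth_on_continuous: "smooth_on S f \<Longrightarrow> continuous_on S f"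
  unfolding smooth_on_def using Ck_on.simps(1) by blast

lemma continuous_on_Phi_GJ:
  assumes "continuous_on UNIV \<psi>"
  shows "continuous_on GL (Phi_GJ \<psi> :: 'f::arch_local_field^'n^'n \<Rightarrow> complex)"
  unfolding Phi_GJ_def[abs_def] absF_def trace_def
  by (intro continuous_intros continuous_on_compose2[OF assms]) (auto simp: GL_iff_det)

text \<open>
  The substitution \<open>h = g u\<close>.
\<close>

lemma GL_convolution_vee:
  fixes \<mu> :: "'f::arch_local_field measure" and g :: "'f^'n^'n" and c :: "'f^'n^'n \<Rightarrow> complex"
  assumes \<mu>: "\<mu> = scale_measure (ennreal a) lborel" "a > 0" and g: "g \<in> GL"
    and \<psi>: "continuous_on UNIV \<psi>" and c: "continuous_on GL c"
  shows "GL_convolution \<mu> (Phi_GJ \<psi>) (vee c) g = (LINT u:GL|GL_measure \<mu>. Phi_GJ \<psi> (g ** u) * c u)"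
proof -
  have cc: "continuous_on GL (\<lambda>h. c (matrix_inv g ** h))"
    by (rule continuous_on_compose2[OF c]) (use g in \<open>auto intro!: continuous_intros\<close>)
  have m: "(\<lambda>h. indicator GL h *\<^sub>R (Phi_GJ \<psi> h * c (matrix_inv g ** h))) \<in> borel_measurable borel"
    by (rule borel_measurable_continuous_on_indicator[OF GL_borel continuous_on_mult[OF continuous_on_Phi_GJ[OF \<psi>] cc]])
  have "GL_convolution \<mu> (Phi_GJ \<psi>) (vee c) g = (LINT h:GL|GL_measure \<mu>. Phi_GJ \<psi> h * c (matrix_inv g ** h))"
    unfolding GL_convolution_def vee_def set_lebesgue_integral_def
    by (intro Bochner_Integration.integral_cong refl)
       (use g in \<open>auto simp: indicator_def matrix_inv_mult matrix_inv_inv\<close>)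
  also have "\<dots> = (LINT h:GL|GL_measure \<mu>. Phi_GJ \<psi> (g ** h) * c (matrix_inv g ** (g ** h)))"
    by (rule GL_integral_left_mult[OF \<mu> g m])
  finally show ?thesis by (simp only: GL_cancel_left[OF g])
qed

theorem corollary4p5:
  fixes \<psi> :: "'f::arch_local_field \<Rightarrow> complex"
    and \<mu> :: "'f measure"
    and \<nu> :: "('f^'n^'n) measure"
    and scaleV :: "complex \<Rightarrow> 'v::ab_group_add \<Rightarrow> 'v"
    and p :: "nat \<Rightarrow> 'v \<Rightarrow> real"
    and \<pi> :: "'f^'n^'n \<Rightarrow> 'v \<Rightarrow> 'v"
    and scaleW :: "complex \<Rightarrow> 'w::ab_group_add \<Rightarrow> 'w"
    and q :: "nat \<Rightarrow> 'w \<Rightarrow> real"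
    and \<pi>' :: "'f^'n^'n \<Rightarrow> 'w \<Rightarrow> 'w"
    and B :: "'v \<Rightarrow> 'w \<Rightarrow> complex"
    and \<phi> :: "'f^'n^'n \<Rightarrow> complex"
    and \<cc> :: "nat \<Rightarrow> 'f^'n^'n \<Rightarrow> complex"
  assumes "nontrivial_additive_character \<psi>"
    and "self_dual_haar \<psi> \<mu>"
    and "SL_haar \<nu>"
    and "casselman_wallach scaleV p \<pi>"
    and "frechet_representation.irreducible scaleV p \<pi>"
    and "contragredient scaleV p \<pi> scaleW q \<pi>' B"
    and "matrix_coefficient B \<pi>' \<phi>"
    and "\<phi> (mat 1) = 1"
    and "delta_sequence \<mu> \<cc>"
  shows "(\<forall>x. x \<noteq> 0 \<longrightarrow> convergent (\<lambda>l. kernel_integral \<psi> \<mu> \<nu> \<cc> \<phi> l x)) \<and>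
         smooth_on (- {0}) (kernel_function \<psi> \<mu> \<nu> \<cc> \<phi>)"
proof -
  obtain l w0 where l: "linear l" "l w0 \<noteq> 0" "\<And>x. \<psi> x = exp (\<i> * of_real (l x :: real))"
    using additive_character_exp[OF assms(1)] by blast
  interpret phase l w0 by (rule phase.intro) (rule l)+
  interpret contragredient scaleV p \<pi> scaleW q \<pi>' B by fact
  have \<psi>c: "continuous_on UNIV \<psi>"
    using assms(1) by (simp add: nontrivial_additive_character_def additive_character_def)
  obtain a where a: "\<mu> = scale_measure (ennreal a) lborel" "a > 0"
    using assms(2) unfolding self_dual_haar_def by blast
  note \<nu> = assms(3)
  obtain v w where vw: "\<And>g. g \<in> GL \<Longrightarrow> \<phi> g = B v (\<pi>' g w)"
    using assms(7) unfolding matrix_coefficient_def by blast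
  let ?n = "real CARD('n)" and ?d = "real DIM('f)"
  \<comment> \<open>\<open>A / absF (det u) ^ n\<close> is the density of the measure of \<open>GL\<close>
     with respect to Lebesgue measure.\<close>
  define A where "A = a ^ (CARD('n) * CARD('n))"
  \<comment> \<open>The power of the determinant in \<open>Phi_GJ\<close>, expressed by
     \<open>absF_powr\<close>, times the matrix coefficient.\<close>
  define F where "F z = complex_of_real ((norm (det (snd z) * det (fst z)))\<^sup>2 powr (?d * (?n / 2) / 2)) * coefficient w v z"
    for z :: "('f, 'n) mpair"
  obtain m where m: "symbol m (coefficient w v)" using coefficient_symbol by blast
  have F: "symbol m F" unfolding F_def by (rule symbol_mult0[OF symbol_det_powr(2) m])
  obtain H where H: "\<And>j. partially_Ck j param_domain H"
    and HF: "\<And>x c K. x \<noteq> 0 \<Longrightarrow> cutoff K c \<Longrightarrow> tested_integral \<nu> x c F = (LINT u:GL|lborel. c u * H (x, u))"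
    using osc_integral_smooth[OF \<nu> F] by metis
  have H_u: "smooth_on GL (\<lambda>u. H (x, u))" if "x \<noteq> 0" for x
  proof (rule partially_Ck_imp_smooth_on[OF open_GL])
    fix j
    have "partially_Ck j GL (\<lambda>u :: 'f^'n^'n. H ((x, 0) + (0, u)))"
      by (rule partially_Ck_affine[OF H])
         (use that in \<open>auto simp: param_domain_def intro!: linearI continuous_intros\<close>)
    then show "partially_Ck j GL (\<lambda>u. H (x, u))" by simp
  qed
  have H_x: "smooth_on (- {0}) (\<lambda>x. H (x, mat 1))"
  proof (rule partially_Ck_imp_smooth_on)
    fix j
    have "partially_Ck j (- {0}) (\<lambda>x. H ((0, mat 1) + (x, 0)))"
      by (rule partially_Ck_affine[OF H])
         (auto simp: param_domain_def intro!: linearI continuous_intros)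
    then show "partially_Ck j (- {0}) (\<lambda>x. H (x, mat 1))" by simp
  qed auto
  have kernel: "kernel_integral \<psi> \<mu> \<nu> \<cc> \<phi> k x = (LINT u:GL|GL_measure \<mu>. \<cc> k u * H (x, u))"
    if k: "k \<ge> 1" and x: "x \<noteq> 0" for k x
  proof -
    have tf: "smooth_on GL (\<cc> k)" and "\<exists>C. compact C \<and> C \<subseteq> GL \<and> (\<forall>g\<in>GL - C. \<cc> k g = 0)"
      using assms(9) k by (auto simp: delta_sequence_def test_function_def)
    then obtain K where K: "compact K" "K \<subseteq> GL" "\<forall>u\<in>GL - K. \<cc> k u = 0" by blast
    have cc: "continuous_on GL (\<cc> k)" by (rule smooth_on_continuous[OF tf])
    \<comment> \<open>The test function together with the density of the measure of \<open>GL\<close>.\<close>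
    define c where "c u = complex_of_real (A * (norm (det u))\<^sup>2 powr (?d * (- ?n) / 2)) * \<cc> k u" for u
    have absd: "A / absF (det u) ^ CARD('n) = A * (norm (det u))\<^sup>2 powr (?d * (- ?n) / 2)" if "u \<in> GL" for u :: "'f^'n^'n"
    proof -
      have "absF (det u) > 0" using that by (simp add: absF_pos GL_iff_det)
      then have "absF (det u) powr (- ?n) = 1 / absF (det u) ^ CARD('n)"
        by (simp add: powr_minus powr_realpow divide_inverse)
      then show ?thesis unfolding absF_powr[symmetric] by simp
    qed
    have c_sym: "symbol 0 (\<lambda>z :: ('f, 'n) mpair. c (fst z))"
      unfolding c_def of_real_mult
      by (intro symbol_mult0 symbol_const symbol_det_powr(1) symbol_test tf)
    have cut: "cutoff K c" using c_sym K by (simp add: cutoff_def c_def)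
    have slice: "GL_convolution \<mu> (Phi_GJ \<psi>) (vee (\<cc> k)) g * \<phi> g = u_integral (\<lambda>z. c (fst z) * F z) g"
      if g: "g \<in> GL" for g
    proof -
      have Phi_g: "continuous_on GL (\<lambda>u. Phi_GJ \<psi> (g ** u))"
        by (rule continuous_on_compose2[OF continuous_on_Phi_GJ[OF \<psi>c]]) (use g in \<open>auto intro!: continuous_intros\<close>)
      have "GL_convolution \<mu> (Phi_GJ \<psi>) (vee (\<cc> k)) g = (LINT u:GL|GL_measure \<mu>. Phi_GJ \<psi> (g ** u) * \<cc> k u)"
        by (rule GL_convolution_vee[OF a g \<psi>c cc])
      also have "\<dots> = (LINT u:GL|lborel. (A / absF (det u) ^ CARD('n)) *\<^sub>R (Phi_GJ \<psi> (g ** u) * \<cc> k u))"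
        unfolding A_def
        by (rule GL_integral_lborel[OF a borel_measurable_continuous_on_indicator[OF GL_borel continuous_on_mult[OF Phi_g cc]]])
      finally have "GL_convolution \<mu> (Phi_GJ \<psi>) (vee (\<cc> k)) g * \<phi> g
         = (\<integral>u. indicator GL u *\<^sub>R ((A / absF (det u) ^ CARD('n)) *\<^sub>R (Phi_GJ \<psi> (g ** u) * \<cc> k u)) * \<phi> g \<partial>lborel)"
        by (simp only: set_lebesgue_integral_def Bochner_Integration.integral_mult_left_zero)
      also have "\<dots> = u_integral (\<lambda>z. c (fst z) * F z) g"
        unfolding u_integral_def set_lebesgue_integral_def
      proof (intro Bochner_Integration.integral_cong refl)
        fix u :: "'f^'n^'n"
        show "indicator GL u *\<^sub>R ((A / absF (det u) ^ CARD('n)) *\<^sub>R (Phi_GJ \<psi> (g ** u) * \<cc> k u)) * \<phi> g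
          = indicator GL u *\<^sub>R (E (u, g) * (c (fst (u, g)) * F (u, g)))"
        proof (cases "u \<in> GL")
          case True
          have Phi_u: "Phi_GJ \<psi> (g ** u) = E (u, g) * of_real ((norm (det g * det u))\<^sup>2 powr (?d * (?n / 2) / 2))"
            by (simp only: Phi_GJ_def E_def l(3) absF_powr det_mul fst_conv snd_conv)
          show ?thesis
            unfolding absd[OF True] Phi_u F_def c_def coefficient_def vw[OF g] fst_conv snd_conv
            by (simp add: scaleR_conv_of_real mult_ac)
        qed simp
      qed
      finally show ?thesis .
    qed
    have mU: "(\<lambda>g. indicator GL g *\<^sub>R u_integral (\<lambda>z. c (fst z) * F z) g) \<in> borel_measurable borel"
      by (rule measurable_u_integral[OF symbol_continuous[OF symbol_mult0[OF c_sym F]]])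
    have "kernel_integral \<psi> \<mu> \<nu> \<cc> \<phi> k x = (LINT g:{g. det g = x}|torsor_measure \<nu> x. u_integral (\<lambda>z. c (fst z) * F z) g)"
      unfolding kernel_integral_def set_lebesgue_integral_def
      by (intro Bochner_Integration.integral_cong refl) (use slice x in \<open>auto simp: indicator_def GL_iff_det\<close>)
    also have "\<dots> = tested_integral \<nu> x c F"
      unfolding tested_integral_def by (rule torsor_set_integral_GL[OF \<nu> x mU])
    also have "\<dots> = (LINT u:GL|lborel. c u * H (x, u))"
      by (rule HF[OF x cut])
    also have "\<dots> = (LINT u:GL|lborel. (A / absF (det u) ^ CARD('n)) *\<^sub>R (\<cc> k u * H (x, u)))"
      unfolding set_lebesgue_integral_def
    proof (intro Bochner_Integration.integral_cong refl)
      fix u :: "'f^'n^'n"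
      show "indicator GL u *\<^sub>R (c u * H (x, u)) = indicator GL u *\<^sub>R ((A / absF (det u) ^ CARD('n)) *\<^sub>R (\<cc> k u * H (x, u)))"
        by (cases "u \<in> GL") (simp_all add: absd c_def scaleR_conv_of_real)
    qed
    also have "\<dots> = (LINT u:GL|GL_measure \<mu>. \<cc> k u * H (x, u))"
      unfolding A_def
      by (rule GL_integral_lborel[OF a borel_measurable_continuous_on_indicator[OF GL_borel
              continuous_on_mult[OF cc smooth_on_continuous[OF H_u[OF x]]]], symmetric])
    finally show ?thesis .
  qed
  have lim: "(\<lambda>k. kernel_integral \<psi> \<mu> \<nu> \<cc> \<phi> k x) \<longlonglongrightarrow> H (x, mat 1)" if x: "x \<noteq> 0" for x
  proof -
    have "(\<lambda>k. LINT u:GL|GL_measure \<mu>. \<cc> k u * H (x, u)) \<longlonglongrightarrow> H (x, mat 1)"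
      using assms(9) H_u[OF x] unfolding delta_sequence_def by blast
    moreover have "\<forall>\<^sub>F k in sequentially. (LINT u:GL|GL_measure \<mu>. \<cc> k u * H (x, u)) = kernel_integral \<psi> \<mu> \<nu> \<cc> \<phi> k x"
      using eventually_ge_at_top[of 1] by eventually_elim (simp add: kernel x)
    ultimately show ?thesis by (rule Lim_transform_eventually)
  qed
  have eq: "H (x, mat 1) = kernel_function \<psi> \<mu> \<nu> \<cc> \<phi> x" if "x \<in> - {0}" for x
    unfolding kernel_function_def by (rule limI[OF lim, symmetric]) (use that in simp)
  have "Ck_on j (- {0}) (kernel_function \<psi> \<mu> \<nu> \<cc> \<phi>)" for j
  proof (rule Ck_on_cong[OF _ eq])
    show "Ck_on j (- {0}) (\<lambda>x. H (x, mat 1))" using H_x unfolding smooth_on_def by (rule spec)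
  qed auto
  then have "smooth_on (- {0}) (kernel_function \<psi> \<mu> \<nu> \<cc> \<phi>)" unfolding smooth_on_def by (rule allI)
  moreover have "\<forall>x. x \<noteq> 0 \<longrightarrow> convergent (\<lambda>l. kernel_integral \<psi> \<mu> \<nu> \<cc> \<phi> l x)"
    by (intro allI impI convergentI[OF lim])
  ultimately show ?thesis by (rule conjI[rotated])
qed

end
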